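(* Let $\lambda/\mu$ be a shifted skew shape with $d$ boxes. Then $\mathcal L(\lambda,\mu)\cong H^{\lambda/\mu}$ as $\mathcal H(d)$-modules.
   Context: Conventions: everything is over $\mathbb C$ and $\mathbb Z_2$-graded with the usual sign rule; modules are supermodules, homomorphisms may be even or odd. A simple supermodule is of type M if it stays irreducible when the grading is forgotten, type Q otherwise. For simple supermodules $M,N$, $M\boxtimes N$ is the outer tensor product; it is simple unless both are of type Q, in which case it is a direct sum of two simple modules isomorphic via an odd isomorphism; $M\circledast N$ denotes $M\boxtimes N$ resp. one of these summands (iterated for several factors). $q(a)=a(a+1)$. $\mathcal H(d)$ is the degenerate affine Hecke-Clifford algebra: even generators $s_1,\dots,s_{d-1},x_1,\dots,x_d$, odd generators $c_1,\dots,c_d$; as a vector space $\mathbb C[x_1,\dots,x_d]\otimes\mathcal C\ell(d)\otimes\mathbb CS_d$; the $x_i$ commute, the $s_i$ satisfy the Coxeter relations of $S_d$, $c_i^2=-1$, $c_ic_j=-c_jc_i$ ($i\neq j$), $s_ic_i=c_{i+1}s_i$, $s_ic_{i+1}=c_is_i$, $s_ic_j=c_js_i$ ($j\ne i,i+1$), $c_ix_i=-x_ic_i$, $c_jx_i=x_ic_j$ ($j\neq i$), $s_ix_i=x_{i+1}s_i-1+c_ic_{i+1}$, $s_ix_j=x_js_i$ ($j\ne i,i+1$). $\mathcal A(d)$ is the subalgebra generated by the $x_i$ and $c_i$. Shifted skew shapes: $\lambda=(\lambda_1>\dots>\lambda_r>0)$ and $\mu=(\mu_1\ge\dots\ge\mu_r\ge0)$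 are integer sequences with $\mu_i=\mu_{i+1}\Rightarrow\mu_i=0$ and $\lambda_i\ge\mu_i$ for all $i$. The shape $\lambda/\mu$ has in row $i$ boxes in columns $i+\mu_i,\dots,i+\lambda_i-1$; the content of a box is (column)$-$(row). With $d$ boxes, a standard filling $L$ is a bijective filling by $1,\dots,d$ increasing along rows (left to right) and down columns; $c(L_i)$ is the content of the box labelled $i$; $s_iL$ interchanges $i$ and $i+1$. Put $\kappa_{i,L}=\sqrt{q(c(L_i))}\ge0$ and $\mathcal Y_{i,L}=\sqrt{1-\frac1{(\kappa_{i+1,L}-\kappa_{i,L})^2}-\frac1{(\kappa_{i+1,L}+\kappa_{i,L})^2}}$. $\widehat H^{\lambda/\mu}=\bigoplus_L\mathcal C\ell(d)v_L$ (free over $\mathcal C\ell(d)$, over all standard fillings) is an $\mathcal H(d)$-module via $x_iv_L=\kappa_{i,L}v_L$, $s_iv_L=\frac1{\kappa_{i+1,L}-\kappa_{i,L}}v_L+\frac1{\kappa_{i+1,L}+\kappa_{i,L}}c_ic_{i+1}v_L+\mathcal Y_{i,L}v_{s_iL}$, with $v_{s_iL}=0$ if $s_iL$ is not standard. Let $\phi_i=s_i(x_i^2-x_{i+1}^2)+(x_i+x_{i+1})-c_ic_{i+1}(x_i-x_{i+1})$ and $\phi_w=\phi_{i_1}\cdots\phi_{i_k}$ for a reduced expression $w=s_{i_1}\cdots s_{i_k}$. Fix a standard filling $L$, let $\mathcal L(c(L))$ be an irreducible $\mathcal A(d)$-submodule of $\mathcal C\ell(d)v_L$; $H^{\lambda/\mu}=\sum_{w\in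 S_d}\phi_w\mathcal L(c(L))$, an $\mathcal H(d)$-submodule of $\widehat H^{\lambda/\mu}$. The module $\mathcal L(\lambda,\mu)$: for integers $a\le b$, $m=b-a+1$: $\Phi_a=\mathbb C\langle\varphi\rangle/(\varphi^2-a)$ ($a\ne0$), $\Phi_0=\mathbb C\langle\varphi\rangle/(\varphi)$, $\varphi$ odd; $\mathcal C\ell_m=\mathcal C\ell(m).\mathbf 1$ is the module over $\mathcal C\ell(m)\rtimes S_m$ induced from the trivial $S_m$-module; $\epsilon_i$ acts on $\mathcal C\ell_m$ by the involution $c_j\mapsto(-1)^{\delta_{ij}}c_j$, $\epsilon_i\mathbf 1=\mathbf 1$. $\hat\Phi_{[a,b]}=\Phi_a\boxtimes\mathcal C\ell_m$ is an $\mathcal H(m)$-module with $s_i,c_i$ acting via $1\otimes s_i,1\otimes c_i$ and $x_i$ by $a\otimes\epsilon_i+\sum_{k<i}1\otimes(1-c_kc_i)s_{ki}-\varphi\otimes c_i$ ($s_{ki}$ the transposition). $\Phi_{[0,b]}=\hat\Phi_{[0,b]}$ is simple; for $a\ne0$, $\hat\Phi_{[a,b]}$ is a direct sum of two simple modules isomorphic via an odd isomorphism and $\Phi_{[a,b]}$ denotes one of them; $\Phi_{[a,a-1]}=\mathbb C$. With $d_i=\lambda_i-\mu_i$, $\mathcal M(\lambda,\mu)=\mathcal H(d)\otimes_{\mathcal H(d_1)\otimes\cdots\otimes\mathcal H(d_r)}(\Phi_{[\mu_1,\lambda_1-1]}\circledast\cdots\circledast\Phi_{[\mu_r,\lambda_r-1]})$,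 and $\mathcal L(\lambda,\mu)$ is its unique simple quotient. *)

theory Defs
  imports
    Complex_Main
    "HOL-Library.Poly_Mapping"
    "HOL-Combinatorics.Permutations"
    "HOL-Algebra.Module"
    "HOL-Algebra.QuotRing"
begin

section \<open>Free vector spaces\<close>

text \<open>The complex vector space with basis \<open>'b\<close>.\<close>

type_synonym 'b vec = "('b, complex) poly_mapping"

abbreviation bas :: "'b \<Rightarrow> 'b vec" where
  "bas b \<equiv> Poly_Mapping.single b 1"

definition cscale :: "complex \<Rightarrow> 'b vec \<Rightarrow> 'b vec" where
  "cscale c = Poly_Mapping.map ((*) c)"

lemma lookup_cscale [simp]: "Poly_Mapping.lookup (cscale c v) b = c * Poly_Mapping.lookup v b"
  by (simp add: cscale_def Poly_Mapping.map.rep_eq when_def)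

interpretation cvec: vector_space "cscale :: complex \<Rightarrow> 'b vec \<Rightarrow> 'b vec"
  by unfold_locales (auto intro!: poly_mapping_eqI simp: lookup_add algebra_simps)

text \<open>Linear extension of a map given on the basis.\<close>

definition lin :: "('b \<Rightarrow> 'c vec) \<Rightarrow> 'b vec \<Rightarrow> 'c vec" where
  "lin g v = (\<Sum>b\<in>Poly_Mapping.keys v. cscale (Poly_Mapping.lookup v b) (g b))"

text \<open>The tensor product of two vectors, with the basis element \<open>a \<otimes> b\<close> written \<open>f a b\<close>.\<close>

definition tens :: "('a \<Rightarrow> 'b \<Rightarrow> 'c) \<Rightarrow> 'a vec \<Rightarrow> 'b vec \<Rightarrow> 'c vec" where
  "tens f u v = lin (\<lambda>a. lin (\<lambda>b. bas (f a b)) v) u"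


section \<open>The degenerate affine Hecke-Clifford algebra\<close>

text \<open>Generators \<open>s\<^sub>i\<close>, \<open>x\<^sub>i\<close>, \<open>c\<^sub>i\<close>, numbered from 1. Parities are Booleans, \<open>True\<close> being odd; they
  are added by \<open>\<noteq>\<close>.\<close>

datatype gen = Gs nat | Gx nat | Gc nat

fun gpar :: "gen \<Rightarrow> bool" where
  "gpar (Gs i) = False"
| "gpar (Gx i) = False"
| "gpar (Gc i) = True"

datatype gword = Word (letters: "gen list")

text \<open>With concatenation as the addition of words, the product of \<^typ>\<open>('a, 'b) poly_mapping\<close> makes
  \<open>gword vec\<close> the free associative algebra.\<close>

instantiation gword :: monoid_add
begin

definition zero_gword :: gword where
  "zero_gword = Word []"

definition plus_gword :: "gword \<Rightarrow> gword \<Rightarrow> gword" where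
  "plus_gword v w = Word (letters v @ letters w)"

instance
  by standard (simp_all add: zero_gword_def plus_gword_def)

end

type_synonym falg = "gword vec"

definition gs :: "nat \<Rightarrow> falg" where "gs i = bas (Word [Gs i])"
definition gx :: "nat \<Rightarrow> falg" where "gx i = bas (Word [Gx i])"
definition gc :: "nat \<Rightarrow> falg" where "gc i = bas (Word [Gc i])"

definition gens :: "nat \<Rightarrow> gen set" where
  "gens d = Gs ` {1..<d} \<union> Gx ` {1..d} \<union> Gc ` {1..d}"

text \<open>Generators of the subalgebra \<open>\<A>(d)\<close>.\<close>

definition agens :: "nat \<Rightarrow> gen set" where
  "agens d = Gx ` {1..d} \<union> Gc ` {1..d}"

text \<open>The defining relations, as elements \<open>lhs - rhs\<close> of the free algebra.\<close>

definition rels :: "nat \<Rightarrow> falg set" where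
  "rels d =
     {gs i * gs i - 1 | i. i \<in> {1..<d}}
   \<union> {gs i * gs (i+1) * gs i - gs (i+1) * gs i * gs (i+1) | i. i \<in> {1..<d} \<and> i+1 \<in> {1..<d}}
   \<union> {gs i * gs j - gs j * gs i | i j. i \<in> {1..<d} \<and> j \<in> {1..<d} \<and> (i+1 < j \<or> j+1 < i)}
   \<union> {gx i * gx j - gx j * gx i | i j. i \<in> {1..d} \<and> j \<in> {1..d}}
   \<union> {gc i * gc i + 1 | i. i \<in> {1..d}}
   \<union> {gc i * gc j + gc j * gc i | i j. i \<in> {1..d} \<and> j \<in> {1..d} \<and> i \<noteq> j}
   \<union> {gs i * gc i - gc (i+1) * gs i | i. i \<in> {1..<d}}
   \<union> {gs i * gc (i+1) - gc i * gs i | i. i \<in> {1..<d}}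
   \<union> {gs i * gc j - gc j * gs i | i j. i \<in> {1..<d} \<and> j \<in> {1..d} \<and> j \<noteq> i \<and> j \<noteq> i+1}
   \<union> {gc i * gx i + gx i * gc i | i. i \<in> {1..d}}
   \<union> {gc j * gx i - gx i * gc j | i j. i \<in> {1..d} \<and> j \<in> {1..d} \<and> j \<noteq> i}
   \<union> {gs i * gx i - (gx (i+1) * gs i - 1 + gc i * gc (i+1)) | i. i \<in> {1..<d}}
   \<union> {gs i * gx j - gx j * gs i | i j. i \<in> {1..<d} \<and> j \<in> {1..d} \<and> j \<noteq> i \<and> j \<noteq> i+1}"

definition free_alg :: "nat \<Rightarrow> falg ring" where
  "free_alg d = \<lparr>carrier = {f. \<forall>w\<in>Poly_Mapping.keys f. set (letters w) \<subseteq> gens d},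
                 mult = (*), one = 1, zero = 0, add = (+)\<rparr>"

definition rel_ideal :: "nat \<Rightarrow> falg set" where
  "rel_ideal d = Idl\<^bsub>free_alg d\<^esub> (rels d)"

text \<open>The algebra \<open>\<H>(d)\<close>; its elements are cosets in the free algebra.\<close>

definition HC :: "nat \<Rightarrow> falg set ring" where
  "HC d = free_alg d Quot rel_ideal d"

definition HC_elem :: "nat \<Rightarrow> falg \<Rightarrow> falg set" where
  "HC_elem d f = rel_ideal d +>\<^bsub>free_alg d\<^esub> f"

definition HC_gen :: "nat \<Rightarrow> gen \<Rightarrow> falg set" where
  "HC_gen d g = HC_elem d (bas (Word [g]))"

definition HC_scale :: "nat \<Rightarrow> complex \<Rightarrow> falg set \<Rightarrow> falg set" where
  "HC_scale d c h = HC_elem d (cscale c 1) \<otimes>\<^bsub>HC d\<^esub> h"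

definition HC_homog :: "nat \<Rightarrow> bool \<Rightarrow> falg set set" where
  "HC_homog d p = HC_elem d ` {f \<in> carrier (free_alg d).
     \<forall>w\<in>Poly_Mapping.keys f. odd (length (filter gpar (letters w))) = p}"


section \<open>Supermodules\<close>

definition complex_ring :: "complex ring" where
  "complex_ring = \<lparr>carrier = UNIV, mult = (*), one = 1, zero = 0, add = (+)\<rparr>"

text \<open>A supermodule over an algebra given by generators is recorded as a graded vector space with
  one operator per generator. Only the operators of the generators of the algebra at hand matter,
  so a record is at the same time a module over each subalgebra generated by a subset of
  \<^typ>\<open>gen\<close>; the set \<open>G\<close> below names the subalgebra.\<close>

record 'v smod = "(complex, 'v) module" +
  homog :: "bool \<Rightarrow> 'v set"
  act :: "gen \<Rightarrow> 'v \<Rightarrow> 'v"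

definition superspace :: "'v smod \<Rightarrow> bool" where
  "superspace M \<longleftrightarrow> Module.module complex_ring M
     \<and> (\<forall>p. submodule (homog M p) complex_ring M)
     \<and> (\<forall>v\<in>carrier M. \<exists>!u. fst u \<in> homog M False \<and> snd u \<in> homog M True
                               \<and> v = fst u \<oplus>\<^bsub>M\<^esub> snd u)"

text \<open>Action of an element of the free algebra.\<close>

definition word_act :: "'v smod \<Rightarrow> gword \<Rightarrow> 'v \<Rightarrow> 'v" where
  "word_act M w = foldr (act M) (letters w)"

definition alg_act :: "'v smod \<Rightarrow> falg \<Rightarrow> 'v \<Rightarrow> 'v" where
  "alg_act M f v = (\<Oplus>\<^bsub>M\<^esub>w\<in>Poly_Mapping.keys f. Poly_Mapping.lookup f w \<odot>\<^bsub>M\<^esub> word_act M w v)"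

definition operator :: "bool \<Rightarrow> 'v smod \<Rightarrow> 'w smod \<Rightarrow> ('v \<Rightarrow> 'w) \<Rightarrow> bool" where
  "operator t M N f \<longleftrightarrow> f \<in> carrier M \<rightarrow> carrier N
     \<and> (\<forall>u\<in>carrier M. \<forall>v\<in>carrier M. f (u \<oplus>\<^bsub>M\<^esub> v) = f u \<oplus>\<^bsub>N\<^esub> f v)
     \<and> (\<forall>a. \<forall>v\<in>carrier M. f (a \<odot>\<^bsub>M\<^esub> v) = a \<odot>\<^bsub>N\<^esub> f v)
     \<and> (\<forall>p. \<forall>v\<in>homog M p. f v \<in> homog N (p \<noteq> t))"

definition HC_supermodule :: "nat \<Rightarrow> 'v smod \<Rightarrow> bool" where
  "HC_supermodule d M \<longleftrightarrow> superspace M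
     \<and> (\<forall>g\<in>gens d. operator (gpar g) M M (act M g))
     \<and> (\<forall>f\<in>rels d. \<forall>v\<in>carrier M. alg_act M f v = \<zero>\<^bsub>M\<^esub>)"

text \<open>Homogeneous homomorphisms of parity \<open>t\<close>, with the sign rule
  \<open>f (g v) = (-1)^(t * |g|) g (f v)\<close>.\<close>

definition is_hom :: "gen set \<Rightarrow> bool \<Rightarrow> 'v smod \<Rightarrow> 'w smod \<Rightarrow> ('v \<Rightarrow> 'w) \<Rightarrow> bool" where
  "is_hom G t M N f \<longleftrightarrow> operator t M N f
     \<and> (\<forall>g\<in>G. \<forall>v\<in>carrier M.
          f (act M g v) = (if t \<and> gpar g then -1 else 1) \<odot>\<^bsub>N\<^esub> act N g (f v))"

definition is_iso :: "gen set \<Rightarrow> bool \<Rightarrow> 'v smod \<Rightarrow> 'w smod \<Rightarrow> ('v \<Rightarrow> 'w) \<Rightarrow> bool" where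
  "is_iso G t M N f \<longleftrightarrow> is_hom G t M N f \<and> bij_betw f (carrier M) (carrier N)"

definition HC_isomorphic :: "nat \<Rightarrow> 'v smod \<Rightarrow> 'w smod \<Rightarrow> bool" where
  "HC_isomorphic d M N \<longleftrightarrow> HC_supermodule d M \<and> HC_supermodule d N
     \<and> (\<exists>t f. is_iso (gens d) t M N f)"

definition ungraded_submod :: "gen set \<Rightarrow> 'v smod \<Rightarrow> 'v set \<Rightarrow> bool" where
  "ungraded_submod G M U \<longleftrightarrow> submodule U complex_ring M \<and> (\<forall>g\<in>G. \<forall>v\<in>U. act M g v \<in> U)"

definition submod :: "gen set \<Rightarrow> 'v smod \<Rightarrow> 'v set \<Rightarrow> bool" where
  "submod G M U \<longleftrightarrow> ungraded_submod G M U
     \<and> (\<forall>v\<in>U. \<exists>v0 \<in> U \<inter> homog M False. \<exists>v1 \<in> U \<inter> homog M True. v = v0 \<oplus>\<^bsub>M\<^esub> v1)"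

definition restr :: "'v smod \<Rightarrow> 'v set \<Rightarrow> 'v smod" where
  "restr M U = M\<lparr>carrier := U, homog := \<lambda>p. U \<inter> homog M p\<rparr>"

definition quot :: "'v smod \<Rightarrow> 'v set \<Rightarrow> 'v set smod" where
  "quot M R = \<lparr>carrier = a_rcosets\<^bsub>M\<^esub> R, mult = undefined, one = undefined, zero = R,
     add = set_add M, smult = \<lambda>a A. \<Union>x\<in>A. R +>\<^bsub>M\<^esub> (a \<odot>\<^bsub>M\<^esub> x),
     homog = \<lambda>p. (\<lambda>x. R +>\<^bsub>M\<^esub> x) ` homog M p,
     act = \<lambda>g A. \<Union>x\<in>A. R +>\<^bsub>M\<^esub> act M g x\<rparr>"

definition simple :: "gen set \<Rightarrow> 'v smod \<Rightarrow> bool" where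
  "simple G M \<longleftrightarrow> carrier M \<noteq> {\<zero>\<^bsub>M\<^esub>}
     \<and> (\<forall>U. submod G M U \<longrightarrow> U = {\<zero>\<^bsub>M\<^esub>} \<or> U = carrier M)"

definition ungraded_simple :: "gen set \<Rightarrow> 'v smod \<Rightarrow> bool" where
  "ungraded_simple G M \<longleftrightarrow> carrier M \<noteq> {\<zero>\<^bsub>M\<^esub>}
     \<and> (\<forall>U. ungraded_submod G M U \<longrightarrow> U = {\<zero>\<^bsub>M\<^esub>} \<or> U = carrier M)"

definition type_Q :: "gen set \<Rightarrow> 'v smod \<Rightarrow> bool" where
  "type_Q G M \<longleftrightarrow> simple G M \<and> \<not> ungraded_simple G M"

definition simple_submod :: "gen set \<Rightarrow> 'v smod \<Rightarrow> 'v set \<Rightarrow> bool" where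
  "simple_submod G M U \<longleftrightarrow> submod G M U \<and> simple G (restr M U)"

text \<open>\<open>U\<close> is one of the two summands in a decomposition of \<open>M\<close> into two simple modules that are
  isomorphic via an odd isomorphism.\<close>

definition odd_summand :: "gen set \<Rightarrow> 'v smod \<Rightarrow> 'v set \<Rightarrow> bool" where
  "odd_summand G M U \<longleftrightarrow> simple_submod G M U \<and>
     (\<exists>U'. simple_submod G M U' \<and> U \<inter> U' = {\<zero>\<^bsub>M\<^esub>} \<and> U <+>\<^bsub>M\<^esub> U' = carrier M
        \<and> (\<exists>f. is_iso G True (restr M U) (restr M U') f))"

definition simple_quotient :: "gen set \<Rightarrow> 'v smod \<Rightarrow> 'v set smod" where
  "simple_quotient G M = quot M (THE R. submod G M R \<and> simple G (quot M R))"

text \<open>The module carried by a subspace of a free vector space whose basis is homogeneous.\<close>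

definition vmod :: "'b vec set \<Rightarrow> ('b \<Rightarrow> bool) \<Rightarrow> (gen \<Rightarrow> 'b vec \<Rightarrow> 'b vec) \<Rightarrow> 'b vec smod" where
  "vmod U par a = \<lparr>carrier = U, mult = undefined, one = undefined, zero = 0, add = (+),
     smult = cscale, homog = \<lambda>p. {v \<in> U. \<forall>b\<in>Poly_Mapping.keys v. par b = p}, act = a\<rparr>"


section \<open>Clifford modules and the modules \<open>\<Phi>\<close>\<close>

text \<open>\<open>bas J\<close> stands for \<open>c\<^sub>J = c\<^sub>j\<^sub>1 \<cdots> c\<^sub>j\<^sub>k\<close> (applied to \<open>\<one>\<close>), where \<open>J = {j\<^sub>1 < \<dots> < j\<^sub>k}\<close>;
  the following is \<open>c\<^sub>i c\<^sub>J\<close>.\<close>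

definition cl_c :: "nat \<Rightarrow> nat set \<Rightarrow> nat set vec" where
  "cl_c i J = cscale ((-1) ^ card {j \<in> J. j < i})
     (if i \<in> J then cscale (-1) (bas (J - {i})) else bas (insert i J))"

text \<open>A permutation sends \<open>c\<^sub>J \<one>\<close> to \<open>c\<^bsub>\<sigma>(j\<^sub>1)\<^esub> \<cdots> c\<^bsub>\<sigma>(j\<^sub>k)\<^esub> \<one>\<close>.\<close>

definition cl_perm :: "(nat \<Rightarrow> nat) \<Rightarrow> nat set \<Rightarrow> nat set vec" where
  "cl_perm \<sigma> J = foldr (\<lambda>j. lin (cl_c (\<sigma> j))) (sorted_list_of_set J) (bas {})"

definition cl_eps :: "nat \<Rightarrow> nat set \<Rightarrow> nat set vec" where
  "cl_eps i J = cscale (if i \<in> J then -1 else 1) (bas J)"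

text \<open>Left multiplication by \<open>\<phi>\<close> on \<open>\<Phi>\<^sub>a\<close>, where \<open>bas False\<close>, \<open>bas True\<close> stand for \<open>1\<close>, \<open>\<phi>\<close>. Only
  \<open>bas False\<close> is used for \<open>a = 0\<close>.\<close>

definition phi_mult :: "int \<Rightarrow> bool \<Rightarrow> bool vec" where
  "phi_mult a e = (if a = 0 then 0 else if e then cscale (of_int a) (bas False) else bas True)"

type_synonym rowb = "bool \<times> nat set"

definition rowpar :: "rowb \<Rightarrow> bool" where
  "rowpar b \<longleftrightarrow> fst b \<noteq> odd (card (snd b))"

definition seg_len :: "int \<Rightarrow> int \<Rightarrow> nat" where
  "seg_len a b = nat (b - a + 1)"

fun phi_act :: "int \<Rightarrow> gen \<Rightarrow> rowb \<Rightarrow> rowb vec" where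
  "phi_act a (Gs i) (e, J) = tens Pair (bas e) (cl_perm (transpose i (i+1)) J)"
| "phi_act a (Gc i) (e, J) = cscale (if e then -1 else 1) (tens Pair (bas e) (cl_c i J))"
| "phi_act a (Gx i) (e, J) =
     cscale (of_int a) (tens Pair (bas e) (cl_eps i J))
   + (\<Sum>k\<in>{1..<i}. tens Pair (bas e)
        (cl_perm (transpose k i) J - lin (cl_c k) (lin (cl_c i) (cl_perm (transpose k i) J))))
   - cscale (if e then -1 else 1) (tens Pair (phi_mult a e) (cl_c i J))"

definition hatPhi :: "int \<Rightarrow> int \<Rightarrow> rowb vec smod" where
  "hatPhi a b = vmod
     (cvec.span {bas (e, J) | e J. (a = 0 \<longrightarrow> \<not> e) \<and> J \<subseteq> {1..seg_len a b}})
     rowpar (\<lambda>g. lin (phi_act a g))"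

text \<open>\<open>N\<close> is a choice of the module \<open>\<Phi>\<^bsub>[a,b]\<^esub>\<close>.\<close>

definition is_Phi :: "int \<Rightarrow> int \<Rightarrow> rowb vec smod \<Rightarrow> bool" where
  "is_Phi a b N \<longleftrightarrow>
     (if b < a then N = restr (hatPhi a b) (cvec.span {bas (False, {})})
      else if a = 0 then N = hatPhi a b
      else \<exists>U. odd_summand (gens (seg_len a b)) (hatPhi a b) U \<and> N = restr (hatPhi a b) U)"


section \<open>Outer tensor products\<close>

text \<open>Tensor products of \<open>r\<close> modules have bases indexed by lists of length \<open>r\<close>.\<close>

definition listpar :: "rowb list \<Rightarrow> bool" where
  "listpar bs \<longleftrightarrow> odd (length (filter rowpar bs))"

abbreviation snoc :: "'a list \<Rightarrow> 'a \<Rightarrow> 'a list" where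
  "snoc bs b \<equiv> bs @ [b]"

definition act_left :: "rowb list vec smod \<Rightarrow> gen \<Rightarrow> rowb list \<Rightarrow> rowb list vec" where
  "act_left M g bs = tens snoc (act M g (bas (butlast bs))) (bas (last bs))"

definition act_right :: "rowb vec smod \<Rightarrow> gen \<Rightarrow> rowb list \<Rightarrow> rowb list vec" where
  "act_right N g bs = cscale (if gpar g \<and> listpar (butlast bs) then -1 else 1)
     (tens snoc (bas (butlast bs)) (act N g (bas (last bs))))"

text \<open>For \<open>M\<close> with \<open>e\<close> strands, the generators with larger index act on \<open>N\<close>. The generator \<open>s\<^sub>e\<close> does
  not belong to the subalgebra acting on \<open>M \<boxtimes> N\<close>.\<close>

fun outer_act :: "nat \<Rightarrow> rowb list vec smod \<Rightarrow> rowb vec smod \<Rightarrow> gen \<Rightarrow> rowb list \<Rightarrow> rowb list vec" where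
  "outer_act e M N (Gs i) = (if i < e then act_left M (Gs i) else act_right N (Gs (i - e)))"
| "outer_act e M N (Gx i) = (if i \<le> e then act_left M (Gx i) else act_right N (Gx (i - e)))"
| "outer_act e M N (Gc i) = (if i \<le> e then act_left M (Gc i) else act_right N (Gc (i - e)))"

definition outer :: "nat \<Rightarrow> rowb list vec smod \<Rightarrow> rowb vec smod \<Rightarrow> rowb list vec smod" where
  "outer e M N = vmod
     (cvec.span {tens snoc u v | u v. u \<in> carrier M \<and> v \<in> carrier N})
     listpar (\<lambda>g. lin (outer_act e M N g))"

text \<open>Generators of the image of \<open>\<H>(d\<^sub>1) \<otimes> \<cdots> \<otimes> \<H>(d\<^sub>r)\<close> in \<open>\<H>(d\<^sub>1 + \<cdots> + d\<^sub>r)\<close>.\<close>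

definition block_gens :: "nat list \<Rightarrow> gen set" where
  "block_gens ds = gens (sum_list ds) - {Gs (sum_list (take k ds)) | k. k \<le> length ds}"

text \<open>\<open>P\<close> is a choice of \<open>M \<circledast> N\<close>, for \<open>M\<close> a module over \<open>\<H>(d\<^sub>1) \<otimes> \<cdots> \<otimes> \<H>(d\<^sub>k)\<close> and \<open>N\<close> one over
  \<open>\<H>(m)\<close>.\<close>

definition is_circledast ::
  "nat list \<Rightarrow> nat \<Rightarrow> rowb list vec smod \<Rightarrow> rowb vec smod \<Rightarrow> rowb list vec smod \<Rightarrow> bool" where
  "is_circledast ds m M N P \<longleftrightarrow>
     (let T = outer (sum_list ds) M N in
      if type_Q (block_gens ds) M \<and> type_Q (gens m) N
      then \<exists>U. odd_summand (block_gens (ds @ [m])) T U \<and> P = restr T U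
      else P = T)"

definition unit_mod :: "rowb list vec smod" where
  "unit_mod = vmod (cvec.span {bas []}) listpar (\<lambda>g v. 0)"

text \<open>\<open>N\<close> is a choice of the iterated product \<open>\<Phi>\<^bsub>[a\<^sub>1,b\<^sub>1]\<^esub> \<circledast> \<cdots> \<circledast> \<Phi>\<^bsub>[a\<^sub>r,b\<^sub>r]\<^esub>\<close>, bracketed to the left.\<close>

inductive is_Phi_product :: "(int \<times> int) list \<Rightarrow> rowb list vec smod \<Rightarrow> bool" where
  "is_Phi_product [] unit_mod"
| "is_Phi_product segs M \<Longrightarrow> is_Phi a b N \<Longrightarrow>
   is_circledast (map (\<lambda>(a, b). seg_len a b) segs) (seg_len a b) M N P \<Longrightarrow>
   is_Phi_product (segs @ [(a, b)]) P"


section \<open>Induced modules and \<open>\<L>(\<lambda>,\<mu>)\<close>\<close>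

text \<open>\<open>\<H>(d) \<otimes>\<^sub>B N\<close> is the free vector space on pairs modulo the usual relations; \<open>G\<close> generates \<open>B\<close>,
  which is enough for balancedness.\<close>

definition induced_free :: "nat \<Rightarrow> 'v smod \<Rightarrow> (falg set \<times> 'v) vec smod" where
  "induced_free d N = \<lparr>
     carrier = cvec.span {bas (h, n) | h n. h \<in> carrier (HC d) \<and> n \<in> carrier N},
     mult = undefined, one = undefined, zero = 0, add = (+), smult = cscale,
     homog = \<lambda>t. cvec.span {bas (h, n) | h n p. h \<in> HC_homog d p \<and> n \<in> homog N (p \<noteq> t)},
     act = \<lambda>g. lin (\<lambda>(h, n). bas (HC_gen d g \<otimes>\<^bsub>HC d\<^esub> h, n))\<rparr>"

definition induced_rel :: "nat \<Rightarrow> gen set \<Rightarrow> 'v smod \<Rightarrow> (falg set \<times> 'v) vec set" where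
  "induced_rel d G N = cvec.span (
     {bas (h \<oplus>\<^bsub>HC d\<^esub> h', n) - bas (h, n) - bas (h', n) | h h' n.
        h \<in> carrier (HC d) \<and> h' \<in> carrier (HC d) \<and> n \<in> carrier N}
   \<union> {bas (h, n \<oplus>\<^bsub>N\<^esub> n') - bas (h, n) - bas (h, n') | h n n'.
        h \<in> carrier (HC d) \<and> n \<in> carrier N \<and> n' \<in> carrier N}
   \<union> {bas (HC_scale d a h, n) - cscale a (bas (h, n)) | a h n.
        h \<in> carrier (HC d) \<and> n \<in> carrier N}
   \<union> {bas (h, a \<odot>\<^bsub>N\<^esub> n) - cscale a (bas (h, n)) | a h n.
        h \<in> carrier (HC d) \<and> n \<in> carrier N}
   \<union> {bas (h \<otimes>\<^bsub>HC d\<^esub> HC_gen d g, n) - bas (h, act N g n) | g h n.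
        g \<in> G \<and> h \<in> carrier (HC d) \<and> n \<in> carrier N})"

definition induced :: "nat \<Rightarrow> gen set \<Rightarrow> 'v smod \<Rightarrow> (falg set \<times> 'v) vec set smod" where
  "induced d G N = quot (induced_free d N) (induced_rel d G N)"

definition segments :: "nat list \<Rightarrow> nat list \<Rightarrow> (int \<times> int) list" where
  "segments lam mu = map2 (\<lambda>l m. (int m, int l - 1)) lam mu"

text \<open>\<open>\<M>(\<lambda>,\<mu>)\<close> and \<open>\<L>(\<lambda>,\<mu>)\<close>, depending on the choice \<open>N\<close> of
  \<open>\<Phi>\<^bsub>[\<mu>\<^sub>1,\<lambda>\<^sub>1-1]\<^esub> \<circledast> \<cdots> \<circledast> \<Phi>\<^bsub>[\<mu>\<^sub>r,\<lambda>\<^sub>r-1]\<^esub>\<close>.\<close>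

definition M_module ::
  "nat list \<Rightarrow> nat list \<Rightarrow> rowb list vec smod \<Rightarrow> (falg set \<times> rowb list vec) vec set smod" where
  "M_module lam mu N =
     (let ds = map2 (-) lam mu in induced (sum_list ds) (block_gens ds) N)"

definition L_module ::
  "nat list \<Rightarrow> nat list \<Rightarrow> rowb list vec smod \<Rightarrow> (falg set \<times> rowb list vec) vec set set smod" where
  "L_module lam mu N =
     simple_quotient (gens (sum_list (map2 (-) lam mu))) (M_module lam mu N)"


section \<open>Shifted skew shapes and \<open>H\<^bsup>\<lambda>/\<mu>\<^esup>\<close>\<close>

text \<open>Rows are numbered from 1, while list positions start at 0.\<close>

definition shifted_skew_shape :: "nat list \<Rightarrow> nat list \<Rightarrow> bool" where
  "shifted_skew_shape lam mu \<longleftrightarrow> length lam = length mu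
     \<and> sorted_wrt (>) lam \<and> (\<forall>l\<in>set lam. l > 0) \<and> sorted_wrt (\<ge>) mu
     \<and> (\<forall>i. Suc i < length mu \<longrightarrow> mu ! i = mu ! Suc i \<longrightarrow> mu ! i = 0)
     \<and> (\<forall>i<length lam. mu ! i \<le> lam ! i)"

type_synonym box = "nat \<times> nat"

definition boxes :: "nat list \<Rightarrow> nat list \<Rightarrow> box set" where
  "boxes lam mu = {(i, j). 1 \<le> i \<and> i \<le> length lam
     \<and> i + mu ! (i - 1) \<le> j \<and> j < i + lam ! (i - 1)}"

definition content :: "box \<Rightarrow> int" where
  "content b = int (snd b) - int (fst b)"

text \<open>Fillings take the value 0 outside the shape, so that equal fillings are equal functions.\<close>

type_synonym filling = "box \<Rightarrow> nat"

definition standard :: "nat list \<Rightarrow> nat list \<Rightarrow> filling \<Rightarrow> bool" where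
  "standard lam mu L \<longleftrightarrow> (\<forall>b. b \<notin> boxes lam mu \<longrightarrow> L b = 0)
     \<and> bij_betw L (boxes lam mu) {1..card (boxes lam mu)}
     \<and> (\<forall>i j j'. (i, j) \<in> boxes lam mu \<longrightarrow> (i, j') \<in> boxes lam mu \<longrightarrow> j < j' \<longrightarrow> L (i, j) < L (i, j'))
     \<and> (\<forall>i i' j. (i, j) \<in> boxes lam mu \<longrightarrow> (i', j) \<in> boxes lam mu \<longrightarrow> i < i' \<longrightarrow> L (i, j) < L (i', j))"

definition swap :: "nat \<Rightarrow> filling \<Rightarrow> filling" where
  "swap i L = transpose i (i + 1) \<circ> L"

definition lcontent :: "nat list \<Rightarrow> nat list \<Rightarrow> filling \<Rightarrow> nat \<Rightarrow> int" where
  "lcontent lam mu L i = content (the_inv_into (boxes lam mu) L i)"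

definition q :: "int \<Rightarrow> int" where
  "q a = a * (a + 1)"

definition kappa :: "nat list \<Rightarrow> nat list \<Rightarrow> nat \<Rightarrow> filling \<Rightarrow> real" where
  "kappa lam mu i L = sqrt (real_of_int (q (lcontent lam mu L i)))"

definition Y :: "nat list \<Rightarrow> nat list \<Rightarrow> nat \<Rightarrow> filling \<Rightarrow> real" where
  "Y lam mu i L = sqrt (1 - 1 / (kappa lam mu (i+1) L - kappa lam mu i L)\<^sup>2
                          - 1 / (kappa lam mu (i+1) L + kappa lam mu i L)\<^sup>2)"

text \<open>\<open>bas (J, L)\<close> stands for \<open>c\<^sub>J v\<^sub>L\<close>. The operators on these vectors are the given ones on \<open>v\<^sub>L\<close>,
  moved past \<open>c\<^sub>J\<close> by means of the relations of \<open>\<H>(d)\<close>.\<close>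

type_synonym hatb = "nat set \<times> filling"

definition hat_c :: "nat \<Rightarrow> hatb vec \<Rightarrow> hatb vec" where
  "hat_c i = lin (\<lambda>(J, L). tens Pair (cl_c i J) (bas L))"

definition hat_sv :: "nat list \<Rightarrow> nat list \<Rightarrow> nat \<Rightarrow> filling \<Rightarrow> hatb vec" where
  "hat_sv lam mu i L =
     cscale (of_real (1 / (kappa lam mu (i+1) L - kappa lam mu i L))) (bas ({}, L))
   + cscale (of_real (1 / (kappa lam mu (i+1) L + kappa lam mu i L)))
       (hat_c i (hat_c (i+1) (bas ({}, L))))
   + (if standard lam mu (swap i L)
      then cscale (of_real (Y lam mu i L)) (bas ({}, swap i L)) else 0)"

fun hat_act :: "nat list \<Rightarrow> nat list \<Rightarrow> gen \<Rightarrow> hatb vec \<Rightarrow> hatb vec" where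
  "hat_act lam mu (Gc i) = hat_c i"
| "hat_act lam mu (Gx i) = lin (\<lambda>(J, L).
     cscale ((if i \<in> J then -1 else 1) * of_real (kappa lam mu i L)) (bas (J, L)))"
| "hat_act lam mu (Gs i) = lin (\<lambda>(J, L).
     foldr (\<lambda>j. hat_c (transpose i (i+1) j)) (sorted_list_of_set J) (hat_sv lam mu i L))"

definition hatH :: "nat list \<Rightarrow> nat list \<Rightarrow> hatb vec smod" where
  "hatH lam mu = vmod
     (cvec.span {bas (J, L) | J L. J \<subseteq> {1..card (boxes lam mu)} \<and> standard lam mu L})
     (\<lambda>(J, L). odd (card J)) (hat_act lam mu)"

definition Cl_v :: "nat \<Rightarrow> filling \<Rightarrow> hatb vec set" where
  "Cl_v d L = cvec.span {bas (J, L) | J. J \<subseteq> {1..d}}"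

definition phi :: "nat \<Rightarrow> falg" where
  "phi i = gs i * (gx i * gx i - gx (i+1) * gx (i+1)) + (gx i + gx (i+1))
           - gc i * gc (i+1) * (gx i - gx (i+1))"

definition word_perm :: "nat list \<Rightarrow> nat \<Rightarrow> nat" where
  "word_perm is = foldr (\<lambda>i \<sigma>. transpose i (i+1) \<circ> \<sigma>) is id"

definition reduced_expr :: "nat \<Rightarrow> (nat \<Rightarrow> nat) \<Rightarrow> nat list \<Rightarrow> bool" where
  "reduced_expr d w is \<longleftrightarrow> set is \<subseteq> {1..<d} \<and> word_perm is = w
     \<and> (\<forall>js. set js \<subseteq> {1..<d} \<longrightarrow> word_perm js = w \<longrightarrow> length is \<le> length js)"

text \<open>The sum of all \<open>\<phi>\<^sub>w K\<close>. The product \<open>\<phi>\<^sub>w\<close> does not depend on the reduced expression of \<open>w\<close>; all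
  of them are used instead of choosing one.\<close>

definition H_space :: "nat list \<Rightarrow> nat list \<Rightarrow> hatb vec set \<Rightarrow> hatb vec set" where
  "H_space lam mu K = cvec.span
     {alg_act (hatH lam mu) (prod_list (map phi is)) u | w is u.
        w permutes {1..card (boxes lam mu)} \<and> reduced_expr (card (boxes lam mu)) w is \<and> u \<in> K}"

definition H_module :: "nat list \<Rightarrow> nat list \<Rightarrow> hatb vec set \<Rightarrow> hatb vec smod" where
  "H_module lam mu K = restr (hatH lam mu) (H_space lam mu K)"

end

theory Submission
 imports Defs
begin

abbreviation keys where "keys == Poly_Mapping.keys"

abbreviation subsp where "subsp == cvec.subspace"

lemmas sub_0 = cvec.subspace_0 and sub_add = cvec.subspace_add and sub_scale = cvec.subspace_scale
 and sub_neg = cvec.subspace_neg and sub_diff = cvec.subspace_diff and sub_sum = cvec.subspace_sum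

section \<open>Linear maps between free vector spaces\<close>

abbreviation lk :: "'b vec => 'b => complex" where
 "lk \<equiv> Poly_Mapping.lookup"

definition clin :: "('b vec => 'c vec) => bool" where
 "clin f \<longleftrightarrow> (\<forall>u v. f (u + v) = f u + f v) & (\<forall>a v. f (cscale a v) = cscale a (f v))"

lemma clinI:
 assumes "!!u v. f (u + v) = f u + f v" "!!a v. f (cscale a v) = cscale a (f v)"
 shows "clin f"
 using assms by (simp add: clin_def)

lemma clin_add: "clin f ==> f (u + v) = f u + f v"
 by (simp add: clin_def)

lemma clin_scale: "clin f ==> f (cscale a v) = cscale a (f v)"
 by (simp add: clin_def)

lemma clin_0: "clin f ==> f 0 = 0"
 using clin_scale[of f 0 0] by simp

lemma cscale_m1: "cscale (-1) v = - v"
 by (simp add: cvec.scale_minus_left)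

lemma clin_neg: "clin f ==> f (- v) = - f v"
 using clin_scale[of f "-1" v] by (simp add: cscale_m1)

lemma clin_diff: "clin f ==> f (u - v) = f u - f v"
 using clin_add[of f u "- v"] clin_neg[of f v] by simp

lemma clin_sum: "clin f ==> f (sum g A) = (\<Sum>a\<in>A. f (g a))"
 by (induction A rule: infinite_finite_induct) (auto simp: clin_0 clin_add)

lemmas clin_simps = clin_add clin_scale clin_0 clin_neg clin_diff clin_sum

lemma clin_id [intro!, simp]: "clin (%v. v)"
 by (simp add: clin_def)

lemma clin_zero [intro!, simp]: "clin (%v. 0)"
 by (simp add: clin_def)

lemma clin_comp: "clin f ==> clin g ==> clin (%v. f (g v))"
 by (simp add: clin_def)

lemma clin_plus: "clin f ==> clin g ==> clin (%v. f v + g v)"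
 by (simp add: clin_def cvec.scale_right_distrib algebra_simps)

lemma clin_minus: "clin f ==> clin g ==> clin (%v. f v - g v)"
 by (simp add: clin_def cvec.scale_right_diff_distrib algebra_simps)

lemma clin_uminus: "clin f ==> clin (%v. - f v)"
 by (simp add: clin_def cvec.scale_minus_right)

lemma clin_cscale: "clin f ==> clin (%v. cscale a (f v))"
 by (simp add: clin_def cvec.scale_right_distrib mult.commute)

lemma clin_setsum: "(!!i. i : A ==> clin (f i)) ==> clin (%v. \<Sum>i\<in>A. f i v)"
 by (induction A rule: infinite_finite_induct) (auto intro!: clin_plus)

lemma clin_foldr: "(!!i. i : set js ==> clin (f i)) ==> clin (foldr f js)"
 by (induction js) (auto simp: clin_def)

lemma lin_sup:
 assumes "finite S" "keys v \<subseteq> S"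
 shows "lin g v = (\<Sum>b\<in>S. cscale (lk v b) (g b))"
 unfolding lin_def using assms
 by (intro sum.mono_neutral_left) (auto simp: in_keys_iff)

lemma clin_lin [intro!, simp]: "clin (lin g)"
proof (rule clinI)
 fix u v :: "'a vec" and a
 let ?S = "keys u \<union> keys v"
 have "keys (u + v) \<subseteq> ?S" by (rule keys_add)
 thus "lin g (u + v) = lin g u + lin g v"
  by (simp add: lin_sup[of ?S] lookup_add cvec.scale_left_distrib sum.distrib)
 have "keys (cscale a v) \<subseteq> keys v"
  by (auto simp: in_keys_iff)
 thus "lin g (cscale a v) = cscale a (lin g v)"
  by (simp add: lin_sup[of "keys v"] cvec.scale_sum_right)
qed

lemma clin_lin_comp [intro!]: "clin f ==> clin (%v. lin g (f v))"
 by (rule clin_comp[OF clin_lin])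

lemma lin_bas [simp]: "lin g (bas b) = g b"
 by (simp add: lin_def)

lemma vec_expand: "v = (\<Sum>b\<in>keys v. cscale (lk v b) (bas b))"
proof (rule poly_mapping_eqI)
 fix k
 have "lk (\<Sum>b\<in>keys v. cscale (lk v b) (bas b)) k =
    (\<Sum>b\<in>keys v. if b = k then lk v k else 0)"
  unfolding lookup_sum by (rule sum.cong) (auto simp: lookup_single when_def)
 also have "\<dots> = lk v k" by (simp add: in_keys_iff)
 finally show "lk v k = lk (\<Sum>b\<in>keys v. cscale (lk v b) (bas b)) k" ..
qed

lemma clin_lin_eq:
 assumes "clin f"
 shows "f v = lin (%b. f (bas b)) v"
 by (subst vec_expand[of v]) (simp add: clin_simps[OF assms] lin_def)

lemma clin_eqI:
 assumes "clin f" "clin g" "!!b. b : keys v ==> f (bas b) = g (bas b)"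
 shows "f v = g v"
 unfolding clin_lin_eq[OF assms(1), of v] clin_lin_eq[OF assms(2), of v] lin_def
 by (rule sum.cong) (auto simp: assms(3))

lemma clin_span_eq:
 assumes "v : cvec.span B" "clin f" "clin g" "!!x. x : B ==> f x = g x"
 shows "f v = g v"
 using assms(1)
 by (induction rule: cvec.span_induct_alt)
   (auto simp: clin_simps[OF assms(2)] clin_simps[OF assms(3)] assms(4))

lemma clin_span_mem:
 assumes "v : cvec.span B" "clin f" "subsp W" "!!x. x : B ==> f x : W"
 shows "f v : W"
 using assms(1)
 by (induction rule: cvec.span_induct_alt)
   (auto simp: clin_simps[OF assms(2)] assms(4) sub_0[OF assms(3)]
    intro!: sub_add[OF assms(3)] sub_scale[OF assms(3)])

lemma clin_image_subspace:
 assumes "clin f" "subsp V"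
 shows "subsp (f ` V)"
proof (rule cvec.subspaceI)
 show "0 : f ` V" using clin_0[OF assms(1)] sub_0[OF assms(2)] by force
next
 fix x y assume "x : f ` V" "y : f ` V"
 thus "x + y : f ` V"
  by (auto simp: clin_add[OF assms(1), symmetric] sub_add[OF assms(2)])
next
 fix c x assume "x : f ` V"
 thus "cscale c x : f ` V"
  by (auto simp: clin_scale[OF assms(1), symmetric] sub_scale[OF assms(2)])
qed

lemma clin_vimage_subspace:
 assumes "clin f" "subsp W" "subsp V"
 shows "subsp {v \<in> V. f v : W}"
 by (rule cvec.subspaceI)
   (auto simp: clin_simps[OF assms(1)] sub_0 sub_add sub_scale assms)

lemma span_bas_iff: "v : cvec.span (bas ` S) \<longleftrightarrow> keys v \<subseteq> S"
proof
 assume "v : cvec.span (bas ` S)"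
 thus "keys v \<subseteq> S"
 proof (induction rule: cvec.span_induct_alt)
  case (step c x y)
  have "keys (cscale c x + y) \<subseteq> keys (cscale c x) \<union> keys y"
   by (rule keys_add)
  moreover have "keys (cscale c x) \<subseteq> keys x" by (auto simp: in_keys_iff)
  ultimately show ?case using step by fastforce
 qed simp
next
 assume "keys v \<subseteq> S"
 hence "(\<Sum>b\<in>keys v. cscale (lk v b) (bas b)) : cvec.span (bas ` S)"
  by (intro cvec.span_sum cvec.span_scale cvec.span_base) auto
 thus "v : cvec.span (bas ` S)" using vec_expand[of v] by simp
qed

lemma clin_tens_left: "clin (%u. tens f u v)"
 unfolding tens_def by simp

lemma clin_tens_right: "clin (%v. tens f u v)"
 unfolding tens_def lin_def[of _ u] by (intro clin_setsum clin_cscale clin_lin)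

lemma tens_bas [simp]: "tens f (bas a) (bas b) = bas (f a b)"
 by (simp add: tens_def)

lemmas tens_simps = clin_simps[OF clin_tens_left] clin_simps[OF clin_tens_right]

text \<open>Gradings enter through the parity involution: a subspace is graded iff the involution
  preserves it, and the homogeneous vectors are its eigenvectors.\<close>

definition sgo :: "('b => bool) => 'b vec => 'b vec" where
 "sgo P = lin (%b. cscale (if P b then -1 else 1) (bas b))"

lemma clin_sgo [intro!, simp]: "clin (sgo P)"
 by (simp add: sgo_def)

lemma sgo_bas [simp]: "sgo P (bas b) = cscale (if P b then -1 else 1) (bas b)"
 by (simp add: sgo_def)

lemma lookup_sgo [simp]: "lk (sgo P v) b = (if P b then - lk v b else lk v b)"
proof -
 have "lk (sgo P v) b = (\<Sum>a\<in>keys v. if a = b then (if P b then - lk v b else lk v b) else 0)"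
  unfolding sgo_def lin_def lookup_sum by (rule sum.cong) (auto simp: lookup_single when_def)
 thus ?thesis by (simp add: in_keys_iff)
qed

lemma sgo_sgo [simp]: "sgo P (sgo P v) = v"
 by (rule poly_mapping_eqI) simp

lemma homog_iff_sgo:
 "(\<forall>b\<in>keys v. P b = p) \<longleftrightarrow> sgo P v = (if p then - v else v)"
proof
 assume *: "\<forall>b\<in>keys v. P b = p"
 show "sgo P v = (if p then - v else v)"
 proof (rule poly_mapping_eqI)
  fix b show "lk (sgo P v) b = lk (if p then - v else v) b"
   using * by (cases "lk v b = 0") (auto simp: in_keys_iff)
 qed
next
 assume *: "sgo P v = (if p then - v else v)"
 show "\<forall>b\<in>keys v. P b = p"
 proof
  fix b assume b: "b : keys v"
  have "lk (sgo P v) b = lk (if p then - v else v) b" by (simp add: *)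
  thus "P b = p" using b by (auto simp: in_keys_iff split: if_splits)
 qed
qed

section \<open>Clifford modules\<close>

text \<open>Operators \<open>c\<^sub>i\<close>, \<open>i \<in> I\<close>, on a space \<open>V\<close> that satisfy the Clifford relations.\<close>

locale cliff =
 fixes V :: "'b vec set" and I :: "nat set" and c :: "nat => 'b vec => 'b vec"
 assumes V: "subsp V"
  and c_lin: "clin (c i)"
  and c_mem: "i : I ==> v : V ==> c i v : V"
  and c_sq: "i : I ==> v : V ==> c i (c i v) = - v"
  and c_anti: "i : I ==> j : I ==> i ~= j ==> v : V ==> c i (c j v) = - c j (c i v)"

text \<open>The image of an element of the Clifford algebra, written in the basis \<open>c\<^sub>J\<close>, applied to \<open>u\<close>.\<close>

definition eta :: "(nat => 'b vec => 'b vec) => 'b vec => nat set vec => 'b vec" where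
 "eta c u = lin (%J. foldr c (sorted_list_of_set J) u)"

lemma clin_eta [intro!, simp]: "clin (eta c u)"
 by (simp add: eta_def)

lemma eta_bas: "eta c u (bas J) = foldr c (sorted_list_of_set J) u"
 by (simp add: eta_def)

lemma eta_empty [simp]: "eta c u (bas {}) = u"
 by (simp add: eta_def)

lemma clin_eta_vec:
 assumes "!!i. clin (c i)" shows "clin (%u. eta c u a)"
 unfolding eta_def lin_def by (intro clin_setsum clin_cscale clin_foldr assms)

lemma neg1_pow_vec: "cscale ((-1) ^ n) v = (if even n then v else - v)"
 by (auto simp: cscale_m1)

context cliff
begin

lemma foldr_mem: "set js \<subseteq> I ==> u : V ==> foldr c js u : V"
 by (induction js) (auto intro: c_mem)

lemma c_neg: "c i (- v) = - c i v"
 by (rule clin_neg[OF c_lin])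

lemma c_foldr_notin:
 assumes "sorted js" "distinct js" "set js \<subseteq> I" "i : I" "i \<notin> set js" "u : V"
 shows "c i (foldr c js u) = cscale ((-1) ^ card {j \<in> set js. j < i}) (foldr c (insort i js) u)"
 using assms(1-3,5)
proof (induction js)
 case Nil
 thus ?case by simp
next
 case (Cons k js)
 show ?case
 proof (cases "i \<le> k")
  case True
  have e: "{j \<in> set (k # js). j < i} = {}" using Cons.prems True by auto
  show ?thesis unfolding e using True by simp
 next
  case False
  have e: "{j \<in> set (k # js). j < i} = insert k {j \<in> set js. j < i}" using False by auto
  have mem: "foldr c js u : V" using Cons.prems assms(6) by (intro foldr_mem) auto
  have "c i (foldr c (k # js) u) = - c k (c i (foldr c js u))"
   using Cons.prems assms(4) mem by (auto intro!: c_anti)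
  also have "\<dots> = - c k (cscale ((-1) ^ card {j \<in> set js. j < i}) (foldr c (insort i js) u))"
   using Cons by simp
  finally show ?thesis unfolding e using False Cons.prems
   by (simp add: clin_scale[OF c_lin] cvec.scale_minus_left)
 qed
qed

lemma c_foldr_in:
 assumes "sorted js" "distinct js" "set js \<subseteq> I" "i : I" "i : set js" "u : V"
 shows "c i (foldr c js u) = - cscale ((-1) ^ card {j \<in> set js. j < i}) (foldr c (remove1 i js) u)"
 using assms(1-3,5)
proof (induction js)
 case Nil
 thus ?case by simp
next
 case (Cons k js)
 have mem: "foldr c js u : V" using Cons.prems assms(6) by (intro foldr_mem) auto
 show ?case
 proof (cases "i = k")
  case True
  have e: "{j \<in> set (k # js). j < i} = {}" using Cons.prems True by auto
  show ?thesis unfolding e using True c_sq[OF assms(4) mem] by simp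
 next
  case False
  hence "k < i" using Cons.prems by auto
  have e: "{j \<in> set (k # js). j < i} = insert k {j \<in> set js. j < i}" using \<open>k < i\<close> by auto
  have "c i (foldr c (k # js) u) = - c k (c i (foldr c js u))"
   using Cons.prems assms(4) mem False by (auto intro!: c_anti)
  also have "\<dots> = - c k (- cscale ((-1) ^ card {j \<in> set js. j < i}) (foldr c (remove1 i js) u))"
   using Cons False by simp
  finally show ?thesis unfolding e using False Cons.prems
   by (simp add: clin_scale[OF c_lin] clin_neg[OF c_lin] cvec.scale_minus_left)
 qed
qed

lemma eta_mem_bas: "J \<subseteq> I ==> u : V ==> eta c u (bas J) : V"
 by (cases "finite J") (auto simp: eta_bas intro!: foldr_mem)

lemma eta_mem: "(!!J. J : keys a ==> J \<subseteq> I) ==> u : V ==> eta c u a : V"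
 unfolding eta_def lin_def
 by (intro sub_sum[OF V] sub_scale[OF V])
   (auto simp: eta_bas[symmetric] intro!: eta_mem_bas)

lemma eta_cl_c_bas:
 assumes "finite J" "J \<subseteq> I" "i : I" "u : V"
 shows "eta c u (cl_c i J) = c i (eta c u (bas J))"
proof (cases "i : J")
 case True
 have "eta c u (cl_c i J) = cscale ((-1) ^ card {j \<in> J. j < i}) (- eta c u (bas (J - {i})))"
  using True by (simp add: cl_c_def cscale_m1 clin_simps[OF clin_eta] del: cvec.scale_scale cvec.scale_minus_right)
 thus ?thesis using c_foldr_in[of "sorted_list_of_set J" i u] assms True
  by (simp add: eta_bas sorted_list_of_set_remove)
next
 case False
 thus ?thesis using c_foldr_notin[of "sorted_list_of_set J" i u] assms
  by (simp add: cl_c_def clin_scale[OF clin_eta] eta_bas)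
qed

lemma eta_cl_c:
 assumes "!!J. J : keys a ==> finite J & J \<subseteq> I" "i : I" "u : V"
 shows "eta c u (lin (cl_c i) a) = c i (eta c u a)"
 by (rule clin_eqI[where f="%a. eta c u (lin (cl_c i) a)" and g="%a. c i (eta c u a)"])
   (use assms in "auto intro!: clin_comp[OF clin_eta] clin_comp[OF c_lin] eta_cl_c_bas")

end

lemma cl_c_keys: "keys (cl_c i J) \<subseteq> {J - {i}, insert i J}"
 by (auto simp: cl_c_def in_keys_iff lookup_single when_def split: if_splits)

definition cl_sign :: "nat => nat set => complex" where
 "cl_sign i J = (-1) ^ card {j \<in> J. j < i}"

lemma cl_c_alt: "cl_c i J = (if i : J then cscale (- cl_sign i J) (bas (J - {i}))
  else cscale (cl_sign i J) (bas (insert i J)))"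
 by (simp add: cl_c_def cl_sign_def)

lemma cl_sign_sq [simp]: "cl_sign i J * cl_sign i J = 1" "cl_sign i J * (cl_sign i J * x) = x"
 by (simp_all add: cl_sign_def flip: mult.assoc)

lemma cl_sign_insert: "cl_sign i (insert j J) = cl_sign i J * (if j \<notin> J & j < i then -1 else 1)"
proof (cases "j \<notin> J & j < i")
 case True
 hence "{l \<in> insert j J. l < i} = insert j {l \<in> J. l < i}" by auto
 thus ?thesis using True by (simp add: cl_sign_def)
next
 case False
 hence "{l \<in> insert j J. l < i} = {l \<in> J. l < i}" by auto
 thus ?thesis using False by (auto simp: cl_sign_def)
qed

lemma cl_sign_remove: "cl_sign i (J - {j}) = cl_sign i J * (if j : J & j < i then -1 else 1)"
 using cl_sign_insert[of i j "J - {j}"] by (cases "j : J") (auto simp: insert_absorb split: if_splits)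

lemma cl_c_sq: "lin (cl_c i) (cl_c i J) = - bas J"
 by (simp add: cl_c_alt clin_simps[OF clin_lin] cl_sign_insert cl_sign_remove insert_absorb)

lemma cl_c_anti:
 assumes "i ~= j"
 shows "lin (cl_c i) (cl_c j J) = - lin (cl_c j) (cl_c i J)"
proof -
 have s: "insert i (J - {j}) = insert i J - {j}" "insert j (J - {i}) = insert j J - {i}"
  "insert i (insert j J) = insert j (insert i J)" "J - {i} - {j} = J - {j} - {i}" using assms by auto
 have w: "i < j \<or> j < i" using assms by auto
 show ?thesis using assms w
  by (cases "i : J"; cases "j : J"; elim disjE)
    (simp_all add: cl_c_alt clin_simps[OF clin_lin] cl_sign_insert cl_sign_remove s(1,2,4)
     mult.commute[of "cl_sign i J"] insert_commute)
qed

lemma cliff_cl: "cliff UNIV UNIV (%i. lin (cl_c i))"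
proof
 show "lin (cl_c i) (lin (cl_c i) v) = - v" for i v
  by (rule clin_eqI[where f="%v. lin (cl_c i) (lin (cl_c i) v)"])
    (auto intro!: clin_uminus simp: cl_c_sq)
 show "lin (cl_c i) (lin (cl_c j) v) = - lin (cl_c j) (lin (cl_c i) v)" if "i ~= j" for i j v
  by (rule clin_eqI[where f="%v. lin (cl_c i) (lin (cl_c j) v)"])
    (auto intro!: clin_uminus simp: cl_c_anti[OF that])
qed auto

interpretation cl: cliff UNIV UNIV "%i. lin (cl_c i)"
 by (rule cliff_cl)

lemma foldr_cl_bas: "sorted js ==> distinct js ==> foldr (%j. lin (cl_c j)) js (bas {}) = bas (set js)"
proof (induction js)
 case (Cons j js)
 have e: "{l \<in> set js. l < j} = {}" using Cons.prems by auto
 show ?case using Cons by (simp add: cl_c_def e)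
qed simp

lemma bas_eq_foldr: "finite J ==> bas J = foldr (%j. lin (cl_c j)) (sorted_list_of_set J) (bas {})"
 by (simp add: foldr_cl_bas)

text \<open>A linear map that intertwines the Clifford actions is determined by the image of \<open>\<one>\<close>.\<close>

lemma eta_unique:
 assumes f: "clin f" and c: "!!i J. i : I ==> J \<subseteq> I ==> finite J ==> f (cl_c i J) = c i (f (bas J))"
  and a: "!!J. J : keys a ==> finite J & J \<subseteq> I"
 shows "f a = eta c (f (bas {})) a"
proof (rule clin_eqI[OF f clin_eta])
 fix J assume J: "J : keys a"
 have "f (foldr (%j. lin (cl_c j)) js (bas {})) = foldr c js (f (bas {}))"
  if "sorted js" "distinct js" "set js \<subseteq> I" for js
  using that
 proof (induction js)
  case (Cons j js)
  thus ?case using c[of j "set js"] by (simp add: foldr_cl_bas)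
 qed simp
 from this[of "sorted_list_of_set J"] show "f (bas J) = eta c (f (bas {})) (bas J)"
  using a[OF J] by (simp add: eta_bas bas_eq_foldr[symmetric])
qed

lemma cl_perm_eta: "cl_perm s J = eta (%j. lin (cl_c (s j))) (bas {}) (bas J)"
 by (simp add: cl_perm_def eta_bas)

lemma lin_cl_perm: "lin (cl_perm s) = eta (%j. lin (cl_c (s j))) (bas {})"
 by (simp add: cl_perm_def[abs_def] eta_def)

text \<open>Precomposing the generators with an injection of indices again gives Clifford operators.\<close>

lemma (in cliff) reindex: "inj_on s J ==> s ` J \<subseteq> I ==> cliff V J (%j. c (s j))"
 by unfold_locales (auto simp: V c_lin c_mem c_sq inj_on_def image_subset_iff intro!: c_anti)

lemma cl_perm_c:
 assumes "inj s" "finite J"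
 shows "lin (cl_perm s) (cl_c i J) = lin (cl_c (s i)) (cl_perm s J)"
proof -
 interpret s: cliff UNIV UNIV "%j. lin (cl_c (s j))" by (rule cl.reindex) (use assms in auto)
 show ?thesis using s.eta_cl_c_bas[of J i "bas {}"] assms(2) by (simp add: lin_cl_perm cl_perm_eta)
qed

text \<open>The image of a basis vector under a permutation is, up to sign, a basis vector.\<close>

lemma cl_c_single: "\<exists>a K. cl_c i J = cscale a (bas K) & a ~= 0 & K : {J - {i}, insert i J} &
  (finite J --> odd (card K) ~= odd (card J))"
proof (cases "i : J")
 case True
 thus ?thesis
  by (intro exI[of _ "(-1) ^ card {j \<in> J. j < i} * (-1)"] exI[of _ "J - {i}"])
    (auto simp: cl_c_def card_Diff_singleton_if dest: card_gt_0_iff[THEN iffD2, rotated])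
next
 case False
 thus ?thesis
  by (intro exI[of _ "(-1) ^ card {j \<in> J. j < i}"] exI[of _ "insert i J"])
    (auto simp: cl_c_def)
qed

lemma keys_cl_perm:
 assumes "inj s" "finite J" "K : keys (cl_perm s J)"
 shows "K \<subseteq> s ` J & odd (card K) = odd (card J)"
proof -
 have "keys (foldr (%j. lin (cl_c (s j))) js (bas {})) \<subseteq> {K. K \<subseteq> s ` set js & finite K & odd (card K) = odd (length js)}"
  for js
 proof (induction js)
  case (Cons j js)
  let ?v = "foldr (%j. lin (cl_c (s j))) js (bas {})"
  have "lin (cl_c (s j)) ?v : cvec.span (bas ` {K. K \<subseteq> s ` set (j # js) & finite K & odd (card K) = odd (length (j # js))})"
  proof (rule clin_span_mem[OF _ clin_lin cvec.subspace_span])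
   show "?v : cvec.span (bas ` keys ?v)" by (simp add: span_bas_iff)
   fix x assume "x : bas ` keys ?v"
   then obtain L where L: "x = bas L" "L : keys ?v" by blast
   obtain a M where M: "cl_c (s j) L = cscale a (bas M)" "M : {L - {s j}, insert (s j) L}"
    "finite L --> odd (card M) ~= odd (card L)" using cl_c_single by metis
   have "M : {K. K \<subseteq> s ` set (j # js) & finite K & odd (card K) = odd (length (j # js))}"
    using M L Cons by auto
   thus "lin (cl_c (s j)) x : cvec.span (bas ` {K. K \<subseteq> s ` set (j # js) & finite K & odd (card K) = odd (length (j # js))})"
    unfolding L lin_bas M(1) by (intro cvec.span_scale cvec.span_base) auto
  qed
  thus ?case by (simp add: span_bas_iff)
 qed simp
 from this[of "sorted_list_of_set J"] show ?thesis using assms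
  by (auto simp: cl_perm_def)
qed

lemma cl_perm_id: "finite J ==> cl_perm id J = bas J"
 by (simp add: cl_perm_def foldr_cl_bas)

lemma cl_perm_comp:
 assumes "inj s" "inj t" "finite J"
 shows "lin (cl_perm s) (cl_perm t J) = cl_perm (%j. s (t j)) J"
proof -
 let ?f = "%a. lin (cl_perm s) (lin (cl_perm t) a)"
 have fin: "K : keys (cl_perm t L) ==> finite L ==> finite K" for K L
  using keys_cl_perm[OF assms(2)] by (meson finite_imageI finite_subset)
 have "?f (bas J) = eta (%j. lin (cl_c (s (t j)))) (?f (bas {})) (bas J)"
 proof (rule eta_unique[where I=UNIV])
  fix i and J :: "nat set" assume "finite J"
  have "lin (cl_perm s) (lin (cl_c (t i)) v) = lin (cl_c (s (t i))) (lin (cl_perm s) v)"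
   if "v = cl_perm t J" for v
   by (rule clin_eqI[where f="%v. lin (cl_perm s) (lin (cl_c (t i)) v)"])
     (auto intro!: cl_perm_c assms fin[OF _ \<open>finite J\<close>] simp: that)
  thus "?f (cl_c i J) = lin (cl_c (s (t i))) (?f (bas J))"
   by (simp add: cl_perm_c[OF assms(2) \<open>finite J\<close>])
 qed (use assms in auto)
 thus ?thesis by (simp add: cl_perm_eta)
qed

lemma cl_perm_inv:
 assumes "inj s" "!!j. s (s j) = j" "finite J"
 shows "lin (cl_perm s) (cl_perm s J) = bas J"
 using cl_perm_comp[OF assms(1,1,3)] cl_perm_id[OF assms(3)] by (simp add: assms(2) id_def)

section \<open>Modules over \<open>\<A>(d)\<close> with prescribed weight\<close>

definition clsp :: "nat => nat set vec set" where
 "clsp d = cvec.span (bas ` {J. J \<subseteq> {1..d}})"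

abbreviation clpar :: "nat set => bool" where
 "clpar J \<equiv> odd (card J)"

abbreviation eps :: "nat => nat set vec => nat set vec" where
 "eps i \<equiv> sgo (%J. i : J)"

lemma clsp_iff: "a : clsp d \<longleftrightarrow> (\<forall>J\<in>keys a. J \<subseteq> {1..d})"
 unfolding clsp_def span_bas_iff by auto

lemma subspace_clsp [intro!, simp]: "subsp (clsp d)"
 by (simp add: clsp_def)

lemma bas_clsp [simp]: "bas J : clsp d \<longleftrightarrow> J \<subseteq> {1..d}"
 by (auto simp: clsp_iff)

lemma keys_sgo [simp]: "keys (sgo P v) = keys v"
 by (auto simp: in_keys_iff split: if_splits)

lemma sgo_clsp [simp]: "sgo P a : clsp d \<longleftrightarrow> a : clsp d"
 by (simp add: clsp_iff)

lemma cl_c_clsp: "i : {1..d} ==> a : clsp d ==> lin (cl_c i) a : clsp d"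
proof (rule clin_span_mem[of a "bas ` {J. J \<subseteq> {1..d}}" "lin (cl_c i)" "clsp d"])
 fix x assume "i : {1..d}" "x : bas ` {J. J \<subseteq> {1..d}}"
 thus "lin (cl_c i) x : clsp d" using cl_c_keys[of i] by (fastforce simp: clsp_iff)
qed (auto simp: clsp_def)

lemma clsp_finite: "a : clsp d ==> J : keys a ==> finite J & J \<subseteq> {1..d}"
 unfolding clsp_iff by (meson finite_atLeastAtMost finite_subset)

lemma sgo_cl_c: "finite J ==> sgo clpar (cl_c i J) = - lin (cl_c i) (sgo clpar (bas J))"
 using cl_c_single[of i J] by (auto simp: clin_simps[OF clin_lin] clin_simps[OF clin_sgo] cscale_m1)

lemma sgo_cl_c_vec: "a : clsp d ==> sgo clpar (lin (cl_c i) a) = - lin (cl_c i) (sgo clpar a)"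
 by (rule clin_eqI[where f="%a. sgo clpar (lin (cl_c i) a)"])
   (auto intro!: clin_uminus clin_comp[OF clin_sgo] sgo_cl_c[simplified] dest!: clsp_finite simp del: sgo_bas simp: sgo_cl_c)

lemma eps_cl_c: "eps i (lin (cl_c j) a) = (if i = j then - lin (cl_c j) (eps i a) else lin (cl_c j) (eps i a))"
 by (rule clin_eqI[where f="%a. eps i (lin (cl_c j) a)"]; cases "i = j")
   (auto intro!: clin_uminus clin_comp[OF clin_sgo]
    simp: cl_c_alt clin_simps[OF clin_lin] clin_simps[OF clin_sgo] cscale_m1)

lemma lookup_cl_c:
 assumes "j \<notin> K"
 shows "lk (lin (cl_c j) a) K = - cl_sign j (insert j K) * lk a (insert j K)"
proof -
 have "lk (lin (cl_c j) a) K = (\<Sum>J\<in>keys a. if J = insert j K then - cl_sign j (insert j K) * lk a (insert j K) else 0)"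
  unfolding lin_def lookup_sum
  by (rule sum.cong) (use assms in "auto simp: cl_c_alt lookup_single when_def")
 thus ?thesis by (simp add: in_keys_iff)
qed

locale wmod =
 fixes V :: "'b vec set" and sg :: "'b vec => 'b vec" and x c :: "nat => 'b vec => 'b vec"
  and d :: nat and k :: "nat => complex"
 assumes V: "subsp V"
  and sg_lin: "clin sg" and x_lin: "clin (x i)" and c_lin: "clin (c i)"
  and sg_mem: "v : V ==> sg v : V" and sg_sg: "sg (sg v) = v"
  and x_mem: "i : {1..d} ==> v : V ==> x i v : V"
  and c_mem: "i : {1..d} ==> v : V ==> c i v : V"
  and x_sg: "i : {1..d} ==> v : V ==> x i (sg v) = sg (x i v)"
  and c_sg: "i : {1..d} ==> v : V ==> c i (sg v) = - sg (c i v)"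
  and c_sq: "i : {1..d} ==> v : V ==> c i (c i v) = - v"
  and c_anti: "i : {1..d} ==> j : {1..d} ==> i ~= j ==> v : V ==> c i (c j v) = - c j (c i v)"
  and x_comm: "i : {1..d} ==> j : {1..d} ==> v : V ==> x i (x j v) = x j (x i v)"
  and x_c: "i : {1..d} ==> j : {1..d} ==> v : V ==> x i (c j v) = (if i = j then - c j (x i v) else c j (x i v))"
  and x_sq: "i : {1..d} ==> v : V ==> x i (x i v) = cscale (k i * k i) v"
begin

sublocale cliff V "{1..d}" c
 by unfold_locales (auto simp: V c_lin c_mem c_sq intro!: c_anti)

definition asub :: "'b vec set => bool" where
 "asub U \<longleftrightarrow> subsp U & U \<subseteq> V & (\<forall>i\<in>{1..d}. \<forall>v\<in>U. x i v : U & c i v : U)"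

definition gsub :: "'b vec set => bool" where
 "gsub U \<longleftrightarrow> asub U & (\<forall>v\<in>U. sg v : U)"

definition hw :: "'b vec => bool" where
 "hw u \<longleftrightarrow> u : V & (\<forall>i\<in>{1..d}. x i u = cscale (k i) u)"

definition homo :: "'b vec => bool" where
 "homo u \<longleftrightarrow> sg u = u \<or> sg u = - u"

definition asimple :: bool where
 "asimple \<longleftrightarrow> V ~= {0} & (\<forall>U. gsub U --> U = {0} \<or> U = V)"

lemma gsub_V: "gsub V"
 by (auto simp: gsub_def asub_def V x_mem c_mem sg_mem)

lemma hw_V: "hw u ==> u : V"
 by (simp add: hw_def)

lemma eta_vec_add: "eta c (u + v) a = eta c u a + eta c v a"
 and eta_vec_neg: "eta c (- u) a = - eta c u a"
 using clin_add[OF clin_eta_vec, of c u v a] clin_neg[OF clin_eta_vec, of c u a] c_lin by auto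

lemma gsub_wmod:
 assumes "gsub U" shows "wmod U sg x c d k"
proof -
 have U: "subsp U" "!!v. v : U ==> v : V" "!!i v. i : {1..d} ==> v : U ==> x i v : U"
  "!!i v. i : {1..d} ==> v : U ==> c i v : U" "!!v. v : U ==> sg v : U"
  using assms by (auto simp: gsub_def asub_def)
 show ?thesis
  by (rule wmod.intro; (rule U(1) sg_lin x_lin c_lin U(3) U(4) U(5) sg_sg x_sg c_sg c_sq c_anti x_comm x_c x_sq; (assumption | (rule U(2), assumption))?))
qed

text \<open>If \<open>x\<^sub>i u \<noteq> - \<kappa>\<^sub>i u\<close> then \<open>x\<^sub>i u + \<kappa>\<^sub>i u\<close> is a vector of weight \<open>\<kappa>\<^sub>i\<close>, also when \<open>\<kappa>\<^sub>i = 0\<close> since then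
  \<open>x\<^sub>i\<close> squares to zero; otherwise \<open>c\<^sub>i u\<close> is one.\<close>

lemma hw_exists:
 assumes "gsub U" "U ~= {0}"
 shows "\<exists>u\<in>U. u ~= 0 & homo u & hw u"
proof -
 have U: "subsp U" "U \<subseteq> V" "!!i v. i : {1..d} ==> v : U ==> x i v : U"
  "!!i v. i : {1..d} ==> v : U ==> c i v : U" "!!v. v : U ==> sg v : U"
  using assms by (auto simp: gsub_def asub_def)
 obtain v where v: "v : U" "v ~= 0" using assms(2) sub_0[OF U(1)] by auto
 have ex0: "\<exists>u\<in>U. u ~= 0 & homo u"
 proof (cases "v + sg v = 0")
  case True
  hence "sg v = - v" by (simp add: eq_neg_iff_add_eq_0 add.commute)
  thus ?thesis using v by (auto simp: homo_def)
 next
  case False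
  thus ?thesis using v U sub_add[OF U(1)]
   by (intro bexI[of _ "v + sg v"]) (auto simp: homo_def clin_simps[OF sg_lin] sg_sg add.commute)
 qed
 have "\<exists>u\<in>U. u ~= 0 & homo u & (\<forall>i\<in>{1..n}. x i u = cscale (k i) u)" if "n \<le> d" for n
  using that
 proof (induction n)
  case 0
  thus ?case using ex0 by simp
 next
  case (Suc n)
  then obtain u where u: "u : U" "u ~= 0" "homo u" "!!i. i : {1..n} ==> x i u = cscale (k i) u" by auto
  let ?i = "Suc n"
  have i: "?i : {1..d}" using Suc by auto
  have uV: "u : V" using u U by auto
  define w where "w = x ?i u + cscale (k ?i) u"
  have sgu: "sg (x ?i u) = x ?i (sg u)" using x_sg[OF i uV] by simp
  show ?case
  proof (cases "w = 0")
   case False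
   have xw: "x ?i w = cscale (k ?i) w"
    by (simp add: w_def clin_simps[OF x_lin] x_sq[OF i uV] cvec.scale_right_distrib add.commute)
   have xj: "x j w = cscale (k j) w" if "j : {1..n}" for j
   proof -
    have j: "j : {1..d}" using that Suc by auto
    show ?thesis using u(4)[OF that] x_comm[OF j i uV]
     by (simp add: w_def clin_simps[OF x_lin] cvec.scale_right_distrib mult.commute)
   qed
   have "homo w" using u(3) sgu by (auto simp: w_def homo_def clin_simps[OF sg_lin] clin_simps[OF x_lin])
   moreover have "w : U" using U u i by (auto simp: w_def intro!: sub_add sub_scale)
   moreover have "{1..Suc n} = insert ?i {1..n}" by auto
   ultimately show ?thesis using False xw xj by (intro bexI[of _ w]) auto
  next
   case True
   hence xu: "x ?i u = - cscale (k ?i) u" by (simp add: w_def eq_neg_iff_add_eq_0)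
   let ?w = "c ?i u"
   have "?w ~= 0" using c_sq[OF i uV] u(2) clin_0[OF c_lin] by (metis neg_equal_0_iff_equal)
   moreover have "homo ?w" using u(3) c_sg[OF i uV] clin_neg[OF c_lin, of ?i] clin_neg[OF sg_lin]
    unfolding homo_def by (metis minus_minus)
   moreover have "x ?i ?w = cscale (k ?i) ?w" using xu x_c[OF i i uV]
    by (simp add: clin_simps[OF c_lin])
   moreover have "x j ?w = cscale (k j) ?w" if "j : {1..n}" for j
   proof -
    have j: "j : {1..d}" "j ~= ?i" using that Suc by auto
    show ?thesis using u(4)[OF that] x_c[OF j(1) i uV] j(2) by (simp add: clin_simps[OF c_lin])
   qed
   moreover have "?w : U" using U u i by auto
   moreover have "{1..Suc n} = insert ?i {1..n}" by auto
   ultimately show ?thesis by (intro bexI[of _ ?w]) auto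
  qed
 qed
 from this[of d] show ?thesis using U(2) by (auto simp: hw_def)
qed

lemma x_foldr:
 assumes "set js \<subseteq> {1..d}" "distinct js" "i : {1..d}" "u : V"
 shows "x i (foldr c js u) = cscale (if i : set js then -1 else 1) (foldr c js (x i u))"
 using assms(1,2)
proof (induction js)
 case (Cons j js)
 have "foldr c js u : V" using Cons.prems assms(4) by (intro foldr_mem) auto
 thus ?case using Cons x_c[OF assms(3), of j "foldr c js u"] by (auto simp: clin_simps[OF c_lin] cscale_m1)
qed simp

lemma x_eta:
 assumes "hw u" "a : clsp d" "i : {1..d}"
 shows "x i (eta c u a) = cscale (k i) (eta c u (eps i a))"
proof (rule clin_eqI[where f="%a. x i (eta c u a)"])
 fix J assume J: "J : keys a"
 have l: "clin (foldr c js)" for js by (intro clin_foldr c_lin)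
 show "x i (eta c u (bas J)) = cscale (k i) (eta c u (eps i (bas J)))"
  using clsp_finite[OF assms(2) J] x_foldr[of "sorted_list_of_set J" i u] assms
  by (auto simp: eta_bas hw_def clin_simps[OF l] clin_simps[OF clin_eta] cscale_m1)
qed (auto intro!: clin_comp[OF x_lin] clin_cscale clin_comp[OF clin_eta])

lemma sg_foldr: "set js \<subseteq> {1..d} ==> u : V ==> sg (foldr c js u) = cscale ((-1) ^ length js) (foldr c js (sg u))"
proof (induction js)
 case (Cons j js)
 have m: "foldr c js u : V" using Cons.prems by (intro foldr_mem) auto
 have "sg (c j (foldr c js u)) = - c j (sg (foldr c js u))"
  using c_sg[OF _ m, of j] Cons.prems by simp
 thus ?case using Cons by (simp add: clin_simps[OF c_lin])
qed simp

lemma sg_eta: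
 assumes "u : V" "a : clsp d"
 shows "sg (eta c u a) = eta c (sg u) (sgo clpar a)"
proof (rule clin_eqI[where f="%a. sg (eta c u a)"])
 fix J assume J: "J : keys a"
 show "sg (eta c u (bas J)) = eta c (sg u) (sgo clpar (bas J))"
  using clsp_finite[OF assms(2) J] sg_foldr[of "sorted_list_of_set J" u] assms
  by (auto simp: eta_bas clin_simps[OF clin_eta] cscale_m1)
qed (auto intro!: clin_comp[OF sg_lin] clin_comp[OF clin_eta])

lemma eta_clsp_mem: "u : V ==> a : clsp d ==> eta c u a : V"
 by (rule eta_mem) (auto simp: clsp_iff)

lemma eta_c: "u : V ==> a : clsp d ==> i : {1..d} ==> eta c u (lin (cl_c i) a) = c i (eta c u a)"
 by (rule eta_cl_c) (use clsp_finite in blast)+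

lemma asub_eta:
 assumes "hw u" shows "asub (eta c u ` clsp d)"
 unfolding asub_def
proof (intro conjI ballI)
 show "subsp (eta c u ` clsp d)" by (rule clin_image_subspace) auto
 show "eta c u ` clsp d \<subseteq> V" using eta_clsp_mem[OF hw_V[OF assms]] by auto
next
 fix i v assume i: "i : {1..d}" and "v : eta c u ` clsp d"
 then obtain a where a: "v = eta c u a" "a : clsp d" by auto
 have "x i v = eta c u (cscale (k i) (eps i a))"
  using x_eta[OF assms a(2) i] a by (simp add: clin_scale[OF clin_eta])
 moreover have "cscale (k i) (eps i a) : clsp d" using a by (simp add: sub_scale)
 ultimately show "x i v : eta c u ` clsp d" by (metis imageI)
 have "c i v = eta c u (lin (cl_c i) a)" using eta_c[OF hw_V[OF assms] a(2) i] a by simp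
 thus "c i v : eta c u ` clsp d" using cl_c_clsp[OF i a(2)] by auto
qed

lemma gsub_eta:
 assumes "hw u" "homo u" shows "gsub (eta c u ` clsp d)"
proof -
 have "sg (eta c u a) : eta c u ` clsp d" if "a : clsp d" for a
 proof (cases "sg u = u")
  case True
  thus ?thesis using sg_eta[OF hw_V[OF assms(1)] that] that by auto
 next
  case False
  hence "sg u = - u" using assms(2) by (simp add: homo_def)
  hence "sg (eta c u a) = eta c u (- sgo clpar a)"
   using sg_eta[OF hw_V[OF assms(1)] that] eta_vec_neg[of u "sgo clpar a"]
    clin_neg[OF clin_eta, of c u "sgo clpar a"] by simp
  moreover have "- sgo clpar a : clsp d" using that by (simp add: sub_neg)
  ultimately show ?thesis by (metis imageI)
 qed
 thus ?thesis using asub_eta[OF assms(1)] by (auto simp: gsub_def)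
qed

lemma asimple_eta:
 assumes "asimple" "hw u" "homo u" "u ~= 0"
 shows "eta c u ` clsp d = V"
proof -
 have "u : eta c u ` clsp d" by (rule image_eqI[of _ _ "bas {}"]) auto
 hence "eta c u ` clsp d ~= {0}" using assms(4) by (metis singletonD)
 thus ?thesis using gsub_eta[OF assms(2,3)] assms(1) unfolding asimple_def by metis
qed

text \<open>Moving \<open>c\<^sub>i\<close> through \<open>c\<^sub>J\<close> from the right.\<close>

lemma foldr_c_right:
 assumes "set js \<subseteq> {1..d}" "i : {1..d}" "u : V"
 shows "foldr c js (c i u) = cscale ((-1) ^ length (filter (%j. j ~= i) js)) (c i (foldr c js u))"
 using assms(1)
proof (induction js)
 case (Cons j js)
 have m: "foldr c js u : V" using Cons.prems assms by (intro foldr_mem) auto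
 have "c j (c i (foldr c js u)) = cscale (if j = i then 1 else -1) (c i (c j (foldr c js u)))"
  using c_anti[OF _ _ _ m, of j i] Cons.prems assms(2) by (auto simp: cscale_m1)
 thus ?case using Cons by (auto simp: clin_simps[OF c_lin])
qed simp

lemma eta_c_right:
 assumes "a : clsp d" "!!J. J : keys a ==> even (card J)" "i : {1..d}" "u : V"
 shows "eta c (c i u) a = c i (eta c u (eps i a))"
proof (rule clin_eqI[where f="%a. eta c (c i u) a"])
 fix J assume J: "J : keys a"
 have f: "finite J" "J \<subseteq> {1..d}" "even (card J)" using clsp_finite[OF assms(1) J] assms(2)[OF J] by auto
 have e: "length (filter (%j. j ~= i) (sorted_list_of_set J)) = card (J - {i})"
  using f(1) distinct_card[of "filter (%j. j ~= i) (sorted_list_of_set J)"]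
  by (simp add: set_diff_eq)
 have o: "(-1::complex) ^ (card J - Suc 0) = -1" if "i : J"
 proof -
  have "0 < card J" using f(1) that by (auto simp: card_gt_0_iff)
  thus ?thesis using f(3) by simp
 qed
 show "eta c (c i u) (bas J) = c i (eta c u (eps i (bas J)))"
  using f o foldr_c_right[of "sorted_list_of_set J" i u] assms(3,4)
  by (cases "i : J") (auto simp: eta_bas e clin_simps[OF clin_eta] clin_simps[OF c_lin] cscale_m1
     card_Diff_singleton_if card_gt_0_iff)
qed (auto intro!: clin_comp[OF c_lin] clin_comp[OF clin_eta])

lemma shift_even:
 assumes "a : clsp d" "homog_a = p" "sgo clpar a = (if p then - a else a)" "a ~= 0" "S \<subseteq> V"
  "!!u. u : S ==> eta c u a = 0"
 shows "\<exists>a'\<in>clsp d. sgo clpar a' = a' & lk a' {} ~= 0 & (\<forall>u\<in>S. eta c u a' = 0)"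
proof -
 obtain J where J: "lk a J ~= 0" using assms(4) by (metis poly_mapping_eqI lookup_zero)
 hence "finite J" "J \<subseteq> {1..d}" using clsp_finite[OF assms(1)] by (auto simp: in_keys_iff)
 thus ?thesis using assms(1,3,6) J
 proof (induction J arbitrary: a p rule: finite_induct)
  case empty
  have "lk (sgo clpar a) {} = lk a {}" by simp
  hence "~ p" using empty by (auto split: if_splits)
  thus ?case using empty by (intro bexI[of _ a]) auto
 next
  case (insert j J)
  let ?a = "lin (cl_c j) a"
  have j: "j : {1..d}" using insert by auto
  have "sgo clpar ?a = (if ~ p then - ?a else ?a)"
   using sgo_cl_c_vec[OF insert.prems(2), of j] insert.prems(3) by (auto simp: clin_simps[OF clin_lin])
  moreover have "eta c u ?a = 0" if "u : S" for u
   using insert.prems(4)[OF that] eta_c[of u a j] assms(5) that insert.prems(2) j clin_0[OF c_lin] by auto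
  moreover have "lk ?a J ~= 0" using insert by (auto simp: lookup_cl_c cl_sign_def)
  ultimately show ?case using insert.prems insert.hyps cl_c_clsp[OF j insert.prems(2)]
   by (intro insert.IH[of ?a "~ p"]) auto
 qed
qed

text \<open>Averaging over the sign changes \<open>c\<^sub>i \<mapsto> -c\<^sub>i\<close>, \<open>i \<in> I\<close>, removes all \<open>c\<^sub>J\<close> with \<open>J\<close> meeting \<open>I\<close>.\<close>

lemma average_eps:
 assumes "finite I" "!!i a. i : I ==> a : Z ==> cscale (1/2) (a + eps i a) : Z" "a : Z"
 shows "\<exists>b\<in>Z. \<forall>J. lk b J = (if J \<inter> I = {} then lk a J else 0)"
 using assms(1,2)
proof (induction I rule: finite_induct)
 case empty
 thus ?case using assms(3) by auto
next
 case (insert i I)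
 then obtain b where b: "b : Z" "!!J. lk b J = (if J \<inter> I = {} then lk a J else 0)" by blast
 let ?b = "cscale (1/2) (b + eps i b)"
 have "?b : Z" using b insert.prems by auto
 moreover have "lk ?b J = (if J \<inter> insert i I = {} then lk a J else 0)" for J
  using b(2) by (auto simp: lookup_add)
 ultimately show ?case by blast
qed

lemma even_iff: "sgo clpar a = a \<longleftrightarrow> (\<forall>J\<in>keys a. even (card J))"
 using homog_iff_sgo[of a clpar False] by simp

lemma eps_kill:
 assumes "S \<subseteq> {u. hw u}" "i : {1..d}" "k i ~= 0 \<or> c i ` S \<subseteq> S"
  and a: "a : clsp d" "sgo clpar a = a" "!!u. u : S ==> eta c u a = 0" and u: "u : S"
 shows "eta c u (eps i a) = 0"
proof (cases "k i = 0")
 case False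
 have "cscale (k i) (eta c u (eps i a)) = 0"
  using x_eta[of u a i] a u assms(1,2) clin_0[OF x_lin] by auto
 thus ?thesis using False by simp
next
 case True
 hence "c i u : S" using assms(3) u by auto
 have uV: "u : V" using assms(1) u hw_V by auto
 have z: "c i (eta c u (eps i a)) = 0" using eta_c_right[OF a(1) _ assms(2) uV] a(2) a(3)[OF \<open>c i u : S\<close>]
  by (auto simp: even_iff)
 have "eta c u (eps i a) : V" using uV a(1) by (intro eta_clsp_mem) auto
 from c_sq[OF assms(2) this] show ?thesis using z clin_0[OF c_lin] by simp
qed

lemma kill_all:
 assumes "S \<subseteq> {u. hw u}" "I \<subseteq> {1..d}" "!!i. i : I ==> k i ~= 0 \<or> c i ` S \<subseteq> S"
  and I: "!!J. J \<subseteq> {1..d} ==> J \<inter> I = {} ==> even (card J) ==> J = {}"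
  and a: "a : clsp d" "sgo clpar a = (if p then - a else a)" "a ~= 0" "!!u. u : S ==> eta c u a = 0"
 shows "S \<subseteq> {0}"
proof -
 have SV: "S \<subseteq> V" using assms(1) hw_V by auto
 obtain a' where a': "a' : clsp d" "sgo clpar a' = a'" "lk a' {} ~= 0" "!!u. u : S ==> eta c u a' = 0"
  using shift_even[OF a(1) refl a(2,3) SV a(4)] by blast
 define Z where "Z = {a \<in> clsp d. sgo clpar a = a & (\<forall>u\<in>S. eta c u a = 0)}"
 have Z: "subsp Z" unfolding Z_def
  by (rule cvec.subspaceI)
    (auto simp: sub_0 sub_add sub_scale clin_simps[OF clin_eta] clin_simps[OF clin_sgo])
 have e: "eps i a : Z" if "i : I" "a : Z" for i a
 proof -
  have "sgo clpar (eps i a) = eps i (sgo clpar a)" by (rule poly_mapping_eqI) simp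
  thus ?thesis using that eps_kill[OF assms(1) _ assms(3)] assms(2) by (auto simp: Z_def)
 qed
 have "a' : Z" using a' by (simp add: Z_def)
 then obtain b where b: "b : Z" "!!J. lk b J = (if J \<inter> I = {} then lk a' J else 0)"
  using average_eps[OF finite_subset[OF assms(2)], of Z] e sub_add[OF Z] sub_scale[OF Z]
  by (metis finite_atLeastAtMost)
 have "b = cscale (lk a' {}) (bas {})"
 proof (rule poly_mapping_eqI)
  fix J
  show "lk b J = lk (cscale (lk a' {}) (bas {})) J"
  proof (cases "J = {}")
   case True thus ?thesis using b(2) by simp
  next
   case False
   hence "lk b J = 0" using I[of J] b(2)[of J] a'(1,2) by (auto simp: clsp_iff even_iff in_keys_iff)
   thus ?thesis using False by (simp add: lookup_single when_def)
  qed
 qed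
 thus ?thesis using b(1) a'(3) by (auto simp: Z_def clin_simps[OF clin_eta])
qed

text \<open>A homogeneous element of the Clifford algebra that kills all vectors of weight \<open>\<kappa>\<close> is zero.\<close>

lemma eta_nonzero:
 assumes "V ~= {0}" "a : clsp d" "sgo clpar a = (if p then - a else a)" "a ~= 0"
 shows "\<exists>u. hw u & homo u & eta c u a ~= 0"
proof (rule ccontr)
 assume *: "\<nexists>u. hw u & homo u & eta c u a ~= 0"
 have kz: "hw (c i u)" if "hw u" "i : {1..d}" "k i = 0" for i u
  using that c_mem x_c[OF _ that(2) hw_V[OF that(1)]] by (auto simp: hw_def clin_simps[OF c_lin])
 have "eta c u a = 0" if "hw u" for u
 proof -
  have "hw (u + sg u)" "hw (u - sg u)" "homo (u + sg u)" "homo (u - sg u)"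
   using that sg_mem x_sg sub_add[OF V] sub_diff[OF V]
   by (auto simp: hw_def homo_def clin_simps[OF x_lin] clin_simps[OF sg_lin] sg_sg
      cvec.scale_right_distrib cvec.scale_right_diff_distrib)
  hence "eta c (u + sg u) a = 0" "eta c (u - sg u) a = 0" using * by auto
  hence "(eta c u a + eta c (sg u) a) + (eta c u a - eta c (sg u) a) = 0"
   by (simp add: eta_vec_add eta_vec_neg flip: add_uminus_conv_diff)
  hence "eta c u a + eta c u a = 0" by (simp add: algebra_simps)
  hence "cscale 2 (eta c u a) = 0" by (simp add: cvec.scale_left_distrib[of 1 1, simplified])
  thus ?thesis by simp
 qed
 hence "{u. hw u} \<subseteq> {0}"
  using assms kz by (intro kill_all[of "{u. hw u}" "{1..d}" a p]) auto
 thus False using hw_exists[OF gsub_V assms(1)] by auto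
qed

text \<open>If at most one weight vanishes, already a single vector of weight \<open>\<kappa>\<close> is enough.\<close>

lemma eta_inj:
 assumes "!!i. i : {1..d} ==> k i = 0 ==> i = j" "hw u" "homo u" "u ~= 0" "a : clsp d" "eta c u a = 0"
 shows "a = 0"
proof -
 have *: "b = 0" if "b : clsp d" "sgo clpar b = (if p then - b else b)" "eta c u b = 0" for b p
 proof (rule ccontr)
  assume "b ~= 0"
  have "J = {}" if "J \<subseteq> {1..d}" "J \<inter> ({1..d} - {j}) = {}" "even (card J)" for J
  proof -
   have "J \<subseteq> {j}" using that by auto
   thus ?thesis using that(3) by (auto simp: subset_singleton_iff)
  qed
  hence "{u} \<subseteq> {0}"
   using assms(1,2) that \<open>b ~= 0\<close> by (intro kill_all[of "{u}" "{1..d} - {j}" b p]) auto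
  thus False using assms(4) by simp
 qed
 have s: "eta c u (sgo clpar a) = 0"
 proof -
  have "eta c (sg u) (sgo clpar a) = 0" using sg_eta[OF hw_V[OF assms(2)] assms(5)] assms(6) clin_0[OF sg_lin] by simp
  thus ?thesis using assms(3) eta_vec_neg[of u "sgo clpar a"] by (auto simp: homo_def)
 qed
 have "a + sgo clpar a = 0"
  using assms(5,6) s by (intro *[of _ False]) (auto simp: clin_simps[OF clin_sgo] clin_simps[OF clin_eta] add.commute intro!: sub_add)
 moreover have "a - sgo clpar a = 0"
  using assms(5,6) s by (intro *[of _ True]) (auto simp: clin_simps[OF clin_sgo] clin_simps[OF clin_eta] intro!: sub_diff)
 ultimately have "a + a = 0" by (metis eq_iff_diff_eq_0 )
 hence "cscale 2 a = 0" by (simp add: cvec.scale_left_distrib[of 1 1, simplified])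
 thus ?thesis by simp
qed

text \<open>When exactly one weight vanishes, \<open>u + \<i> c\<^sub>j u\<close> generates a proper submodule that is not graded.\<close>

lemma hw_c_zero: "hw u ==> i : {1..d} ==> k i = 0 ==> hw (c i u)"
 using c_mem x_c[OF _ _ hw_V] by (auto simp: hw_def clin_simps[OF c_lin])

lemma ungraded_asub:
 assumes "asimple" "j : {1..d}" "k j = 0" "!!i. i : {1..d} ==> k i = 0 ==> i = j"
 shows "\<exists>W. asub W & W ~= {0} & W ~= V"
proof -
 obtain u where u: "u ~= 0" "homo u" "hw u"
  using hw_exists[OF gsub_V] assms(1) by (auto simp: asimple_def)
 have uV: "u : V" using u hw_V by auto
 define w where "w = u + cscale \<i> (c j u)"
 have hw: "hw w" using u(3) hw_c_zero[OF u(3) assms(2,3)]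
  by (auto simp: hw_def w_def clin_simps[OF x_lin] cvec.scale_right_distrib mult.commute
    intro!: sub_add[OF V] sub_scale[OF V])
 have cw: "c j w = cscale (- \<i>) w"
  using c_sq[OF assms(2) uV]
  by (simp add: w_def clin_simps[OF c_lin] cvec.scale_right_distrib cscale_m1)
 have no: "u ~= cscale g w" for g
 proof
  assume g: "u = cscale g w"
  have "sg u = u & sg (c j u) = - c j u \<or> sg u = - u & sg (c j u) = c j u"
   using u(2) c_sg[OF assms(2) uV] clin_neg[OF c_lin, of j u] unfolding homo_def by (metis minus_minus)
  hence "u = cscale g (u - cscale \<i> (c j u))"
  proof (elim disjE conjE)
   assume s: "sg u = u" "sg (c j u) = - c j u"
   have "sg u = cscale g (sg u + cscale \<i> (sg (c j u)))"
    by (subst g) (simp add: w_def clin_add[OF sg_lin] clin_scale[OF sg_lin])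
   thus ?thesis by (simp add: s)
  next
   assume s: "sg u = - u" "sg (c j u) = c j u"
   have "sg u = cscale g (sg u + cscale \<i> (sg (c j u)))"
    by (subst g) (simp add: w_def clin_add[OF sg_lin] clin_scale[OF sg_lin])
   hence "- u = - cscale g (u - cscale \<i> (c j u))"
    by (simp add: s cvec.scale_right_distrib cvec.scale_right_diff_distrib)
   thus ?thesis by (simp only: neg_equal_iff_equal)
  qed
  with g[unfolded w_def] have "cscale g (u + cscale \<i> (c j u)) = cscale g (u - cscale \<i> (c j u))"
   by (rule trans[OF sym])
  hence "cscale (g * \<i>) (c j u) + cscale (g * \<i>) (c j u) = 0"
   by (simp add: cvec.scale_right_distrib cvec.scale_right_diff_distrib eq_neg_iff_add_eq_0)
  hence "cscale (g * \<i> + g * \<i>) (c j u) = 0" by (simp only: cvec.scale_left_distrib)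
  moreover have "c j u ~= 0" using c_sq[OF assms(2) uV] u(1) clin_0[OF c_lin] by (metis neg_equal_0_iff_equal)
  ultimately have "g = 0" by simp
  thus False using g u(1) by simp
 qed
 have "u \<notin> eta c w ` clsp d"
 proof
  assume "u : eta c w ` clsp d"
  then obtain a where a: "a : clsp d" "eta c w a = u" by auto
  define Z where "Z = {a \<in> clsp d. eta c w a = u}"
  have "cscale (1/2) (a + eps i a) : Z" if "i : {1..d} - {j}" "a : Z" for i a
  proof -
   have i: "i : {1..d}" "k i ~= 0" using that(1) assms(4) by auto
   have a: "a : clsp d" "eta c w a = u" using that(2) by (auto simp: Z_def)
   have "cscale (k i) (eta c w (eps i a)) = cscale (k i) u"
    using x_eta[OF hw a(1) i(1)] a(2) u(3) i(1) by (auto simp only: hw_def)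
   hence "eta c w (eps i a) = u" using i(2) by simp
   thus ?thesis using a cvec.scale_left_distrib[of "1/2" "1/2" u]
    by (simp add: Z_def clin_simps[OF clin_eta] sub_add sub_scale cvec.scale_right_distrib)
  qed
  then obtain b where b: "b : Z" "!!J. lk b J = (if J \<inter> ({1..d} - {j}) = {} then lk a J else 0)"
   using average_eps[of "{1..d} - {j}" Z a] a by (auto simp: Z_def)
  have "b = cscale (lk b {}) (bas {}) + cscale (lk b {j}) (bas {j})"
  proof (rule poly_mapping_eqI)
   fix J
   have "lk b J = 0" if "J ~= {}" "J ~= {j}"
   proof -
    have 1: "~ J \<subseteq> {j}" using that by auto
    show ?thesis
    proof (rule ccontr)
     assume "lk b J ~= 0"
     hence 2: "lk a J ~= 0" "J \<inter> ({1..d} - {j}) = {}" using b(2)[of J] by (auto split: if_splits)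
     hence "J \<subseteq> {1..d}" using a(1) by (auto simp: clsp_iff in_keys_iff)
     thus False using 1 2(2) by blast
    qed
   qed
   thus "lk b J = lk (cscale (lk b {}) (bas {}) + cscale (lk b {j}) (bas {j})) J"
    by (cases "J = {}"; cases "J = {j}") (auto simp: lookup_add lookup_single when_def)
  qed
  hence "eta c w b = eta c w (cscale (lk b {}) (bas {}) + cscale (lk b {j}) (bas {j}))" by simp
  also have "\<dots> = cscale (lk b {} - \<i> * lk b {j}) w"
   by (simp add: clin_simps[OF clin_eta] eta_bas[of c w "{j}"] cw cvec.scale_left_diff_distrib mult.commute)
  finally show False using b(1) no[of "lk b {} - \<i> * lk b {j}"] unfolding Z_def by simp
 qed
 moreover have "w : eta c w ` clsp d" by (rule image_eqI[of _ _ "bas {}"]) auto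
 moreover have "w ~= 0"
 proof
  assume "w = 0"
  hence "c j w = 0" by (simp add: clin_0[OF c_lin])
  hence cu: "c j u = cscale \<i> u"
   using c_sq[OF assms(2) uV] by (simp add: w_def clin_simps[OF c_lin])
  have cs: "c j (sg u) = - sg (c j u)" by (rule c_sg[OF assms(2) uV])
  from u(2)[unfolded homo_def] have "cscale \<i> u + cscale \<i> u = 0"
  proof
   assume s: "sg u = u"
   have "cscale \<i> u = - cscale \<i> u" using cs s cu by (simp only: clin_scale[OF sg_lin])
   thus ?thesis by (metis add.left_inverse)
  next
   assume s: "sg u = - u"
   have "- cscale \<i> u = cscale \<i> u" using cs s cu by (simp add: clin_simps[OF sg_lin] clin_simps[OF c_lin])
   thus ?thesis by (metis add.left_inverse)
  qed
  hence "cscale (\<i> + \<i>) u = 0" by (simp only: cvec.scale_left_distrib)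
  thus False using u(1) by simp
 qed
 ultimately show ?thesis using asub_eta[OF hw] uV by blast
qed

end

text \<open>The module induced from the character \<open>\<kappa>\<close> of the polynomial algebra.\<close>

definition std_x :: "(nat => complex) => nat => nat set vec => nat set vec" where
 "std_x k i a = cscale (k i) (eps i a)"

lemma clin_std_x: "clin (std_x k i)"
 unfolding std_x_def by (intro clin_cscale clin_sgo)

lemma std_wmod: "wmod (clsp d) (sgo clpar) (std_x k) (%i. lin (cl_c i)) d k"
proof
 interpret cl: cliff UNIV UNIV "%i. lin (cl_c i)" by (rule cliff_cl)
 have ee: "eps i (eps j a) = eps j (eps i a)" for i j a by (rule poly_mapping_eqI) simp
 have es: "eps i (sgo clpar a) = sgo clpar (eps i a)" for i a by (rule poly_mapping_eqI) simp
 show "std_x k i (std_x k j v) = std_x k j (std_x k i v)" for i j v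
  by (simp add: std_x_def clin_scale[OF clin_sgo] ee[of i j] mult.commute)
 show "std_x k i (sgo clpar v) = sgo clpar (std_x k i v)" for i v
  by (simp add: std_x_def clin_scale[OF clin_sgo] es)
 show "std_x k i (lin (cl_c j) v) = (if i = j then - lin (cl_c j) (std_x k i v) else lin (cl_c j) (std_x k i v))" for i j v
  by (simp add: std_x_def clin_scale[OF clin_lin] eps_cl_c)
 show "lin (cl_c i) (lin (cl_c j) v) = - lin (cl_c j) (lin (cl_c i) v)" if "i ~= j" for i j v
  using cl.c_anti[of i j v] that by simp
qed (auto simp: clin_std_x cl_c_clsp sgo_cl_c_vec cliff.c_sq[OF cliff_cl] std_x_def sub_scale clin_scale[OF clin_sgo])

context wmod
begin

text \<open>Every simple module of weight \<open>\<kappa>\<close> is isomorphic to a given simple submodule of the induced one.\<close>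

lemma simple_iso_std:
 assumes V: "asimple" and K: "wmod.asimple K (sgo clpar) (std_x k) (%i. lin (cl_c i)) d"
  and sub: "wmod.gsub (clsp d) (sgo clpar) (std_x k) (%i. lin (cl_c i)) d K"
 shows "\<exists>u. hw u & homo u & bij_betw (eta c u) K V"
proof -
 interpret S: wmod "clsp d" "sgo clpar" "std_x k" "%i. lin (cl_c i)" d k by (rule std_wmod)
 have K0: "subsp K" "K \<subseteq> clsp d" "!!i v. i : {1..d} ==> v : K ==> std_x k i v : K"
  "!!i v. i : {1..d} ==> v : K ==> lin (cl_c i) v : K" "!!v. v : K ==> sgo clpar v : K"
  using sub by (auto simp: S.gsub_def S.asub_def)
 interpret K: wmod K "sgo clpar" "std_x k" "%i. lin (cl_c i)" d k
  by (rule S.gsub_wmod[OF sub])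
 have "K ~= {0}" using K by (simp add: K.asimple_def)
 then obtain a where a: "a : K" "a ~= 0" "K.homo a" using K.hw_exists[OF K.gsub_V] by auto
 then obtain p where p: "sgo clpar a = (if p then - a else a)" by (metis K.homo_def)
 have "V ~= {0}" using V by (simp add: asimple_def)
 then obtain u where u: "hw u" "homo u" "eta c u a ~= 0"
  using eta_nonzero[OF _ _ p a(2)] K0(2) a(1) by blast
 have uV: "u : V" using u hw_V by auto
 have sgu: "eta c (sg u) b = eta c u b \<or> eta c (sg u) b = - eta c u b" for b
  using u(2) eta_vec_neg by (auto simp: homo_def)
 have e: "eta c u (std_x k i b) = x i (eta c u b)" "eta c u (lin (cl_c i) b) = c i (eta c u b)"
  if "i : {1..d}" "b : K" for i b
  using that K0(2) x_eta[OF u(1), of b i] eta_c[OF uV, of b i] by (auto simp: std_x_def clin_scale[OF clin_eta])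
 have es: "\<exists>b'\<in>{sgo clpar b, - sgo clpar b}. sg (eta c u b) = eta c u b'" if "b : K" for b
  using sg_eta[OF uV, of b] sgu[of "sgo clpar b"] that K0(2) by (auto simp: clin_neg[OF clin_eta])
 have es': "eta c u (sgo clpar b) = sg (eta c u b) \<or> eta c u (sgo clpar b) = - sg (eta c u b)" if "b : K" for b
  using es[OF that] by (auto simp: clin_neg[OF clin_eta])
 let ?N = "{b \<in> K. eta c u b = 0}"
 have "K.gsub ?N" unfolding K.gsub_def K.asub_def
 proof (intro conjI ballI)
  show "subsp ?N" using clin_vimage_subspace[OF clin_eta _ K0(1), of "{0}" c u] by simp
  show "?N \<subseteq> K" by auto
 next
  fix b assume b: "b : ?N"
  thus "sgo clpar b : ?N" using K0(5) es'[of b] clin_0[OF sg_lin] by auto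
  fix i assume i: "i : {1..d}"
  show "std_x k i b : ?N" "lin (cl_c i) b : ?N"
   using b K0(3,4)[OF i] e[OF i, of b] clin_0[OF c_lin] clin_0[OF x_lin] by auto
 qed
 hence "?N = {0}" using K a(1) u(3) by (auto simp: K.asimple_def)
 hence inj: "inj_on (eta c u) K"
  by (intro inj_onI) (metis (mono_tags, lifting) CollectI clin_diff[OF clin_eta] sub_diff[OF K0(1)]
    eq_iff_diff_eq_0 singletonD)
 have "gsub (eta c u ` K)" unfolding gsub_def asub_def
 proof (intro conjI ballI)
  show "subsp (eta c u ` K)" by (rule clin_image_subspace[OF clin_eta K0(1)])
  show "eta c u ` K \<subseteq> V" using eta_clsp_mem[OF uV] K0(2) by auto
 next
  fix v assume "v : eta c u ` K"
  then obtain b where b: "v = eta c u b" "b : K" by auto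
  show "sg v : eta c u ` K" using es[OF b(2)] b K0(5) sub_neg[OF K0(1)] by auto
  fix i assume "i : {1..d}"
  thus "x i v : eta c u ` K" "c i v : eta c u ` K" using b K0(3,4) by (auto simp: e[symmetric])
 qed
 moreover have "eta c u ` K ~= {0}" using a u by auto
 ultimately have "eta c u ` K = V" using V by (auto simp: asimple_def)
 thus ?thesis using inj u by (auto simp: bij_betw_def)
qed

end

text \<open>On a module of constant weight the intertwining elements vanish, so that \<open>s\<^sub>i\<close> acts by an
  element of \<open>\<A>(d)\<close>.\<close>

locale bmod = wmod +
 fixes s :: "nat => 'a vec => 'a vec" and B :: "nat set"
 assumes B: "B \<subseteq> {1..<d}" and s_lin: "clin (s i)"
  and s_mem: "i : B ==> v : V ==> s i v : V"
  and s_x: "i : B ==> v : V ==> s i (x i v) = x (i+1) (s i v) - v + c i (c (i+1) v)"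
  and s_sg: "i : B ==> v : V ==> s i (sg v) = sg (s i v)"
  and k_neq: "i : B ==> k i * k i ~= k (i+1) * k (i+1)"
begin

lemma s_formula:
 assumes "i : B" "v : V"
 shows "s i v = cscale (1 / (k (i+1) * k (i+1) - k i * k i))
  (x i v + x (i+1) v - c i (c (i+1) (x i v - x (i+1) v)))"
proof -
 let ?j = "i + 1"
 have i: "i : {1..d}" "?j : {1..d}" "i ~= ?j" using subsetD[OF B assms(1)] by auto
 note m = x_mem[OF i(1) assms(2)] c_mem[OF i(2) assms(2)] s_mem[OF assms]
 have "cscale (k i * k i) (s i v) = s i (x i (x i v))" using x_sq[OF i(1) assms(2)] by (simp add: clin_scale[OF s_lin])
 also have "\<dots> = x ?j (s i (x i v)) - x i v + c i (c ?j (x i v))" by (rule s_x[OF assms(1) m(1)])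
 also have "x ?j (s i (x i v)) = cscale (k ?j * k ?j) (s i v) - x ?j v - c i (c ?j (x ?j v))"
  using s_x[OF assms] x_sq[OF i(2) m(3)] x_c[OF i(2) i(1) m(2)] x_c[OF i(2) i(2) assms(2)] i(3)
  by (simp add: clin_simps[OF x_lin] clin_simps[OF c_lin])
 finally have "cscale (k ?j * k ?j - k i * k i) (s i v) = x i v + x ?j v - c i (c ?j (x i v - x ?j v))"
  by (simp add: clin_simps[OF c_lin] cvec.scale_left_diff_distrib algebra_simps)
 hence "cscale (1 / (k ?j * k ?j - k i * k i)) (cscale (k ?j * k ?j - k i * k i) (s i v)) =
   cscale (1 / (k ?j * k ?j - k i * k i)) (x i v + x ?j v - c i (c ?j (x i v - x ?j v)))" by simp
 thus ?thesis using k_neq[OF assms(1)] by simp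
qed

lemma asub_s:
 assumes "asub U" "i : B" "v : U" shows "s i v : U"
proof -
 have i: "i : {1..d}" "i + 1 : {1..d}" using subsetD[OF B assms(2)] by auto
 have U: "subsp U" "U \<subseteq> V" "!!i v. i : {1..d} ==> v : U ==> x i v : U"
  "!!i v. i : {1..d} ==> v : U ==> c i v : U" using assms(1) by (auto simp: asub_def)
 show ?thesis unfolding s_formula[OF assms(2) subsetD[OF U(2) assms(3)]] using assms(3)
  by (intro sub_scale sub_add sub_diff U(1) U(3,4) i)
qed

lemma restrict:
 assumes "gsub U"
 shows "bmod U sg x c d k s B"
proof -
 interpret U: wmod U sg x c d k by (rule gsub_wmod[OF assms])
 have UV: "v : U ==> v : V" for v using assms by (auto simp: gsub_def asub_def)
 show ?thesis
  by unfold_locales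
   (use B assms k_neq s_x[OF _ UV] s_sg[OF _ UV] asub_s in "auto simp: s_lin gsub_def")
qed

end

section \<open>Submodules of modules of vectors\<close>

lemma vmod_simps [simp]:
 "carrier (vmod V par a) = V" "\<zero>\<^bsub>vmod V par a\<^esub> = 0" "add (vmod V par a) = (+)"
 "smult (vmod V par a) = cscale" "act (vmod V par a) = a"
 "homog (vmod V par a) p = {v \<in> V. sgo par v = (if p then - v else v)}"
 by (simp_all add: vmod_def homog_iff_sgo)

lemma restr_vmod: "U \<subseteq> V ==> restr (vmod V par a) U = vmod U par a"
 by (auto simp: restr_def vmod_def fun_eq_iff)

lemma cring_complex_ring: "cring complex_ring"
proof (rule cringI)
 show "abelian_group complex_ring"
  by (rule abelian_groupI) (auto simp: complex_ring_def algebra_simps intro: exI[of _ "- x" for x] add.right_inverse)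
 show "Group.comm_monoid complex_ring"
  by (rule comm_monoidI) (auto simp: complex_ring_def)
qed (auto simp: complex_ring_def algebra_simps)

lemma complex_ring_carrier [simp]: "carrier complex_ring = UNIV"
 "a \<oplus>\<^bsub>complex_ring\<^esub> b = a + b" "a \<otimes>\<^bsub>complex_ring\<^esub> b = a * b" "\<one>\<^bsub>complex_ring\<^esub> = 1" "\<zero>\<^bsub>complex_ring\<^esub> = 0"
 by (simp_all add: complex_ring_def)

lemma abelian_group_vec:
 assumes "subsp V" "carrier M = V" "\<zero>\<^bsub>M\<^esub> = 0" "add M = (+)"
 shows "abelian_group M"
proof (rule abelian_groupI)
 fix x assume "x : carrier M"
 thus "\<exists>y\<in>carrier M. y \<oplus>\<^bsub>M\<^esub> x = \<zero>\<^bsub>M\<^esub>"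
  using assms by (intro bexI[of _ "- x"]) (auto simp: sub_neg)
qed (use assms in "auto simp: sub_add sub_0 algebra_simps")

lemma module_vec:
 assumes "subsp V" "carrier M = V" "\<zero>\<^bsub>M\<^esub> = 0" "add M = (+)" "smult M = cscale"
 shows "Module.module complex_ring M"
 by (rule moduleI)
   (use assms cring_complex_ring abelian_group_vec[OF assms(1-4)] in
    \<open>auto simp: sub_scale cvec.scale_left_distrib cvec.scale_right_distrib\<close>)

lemma submodule_vec:
 assumes "subsp V" "carrier M = V" "\<zero>\<^bsub>M\<^esub> = 0" "add M = (+)" "smult M = cscale"
 shows "submodule U complex_ring M \<longleftrightarrow> U \<subseteq> V & subsp U"
proof -
 interpret module complex_ring M by (rule module_vec[OF assms])
 show ?thesis
 proof
  assume U: "submodule U complex_ring M"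
  note E = submoduleE[OF U]
  have sc: "cscale b v : U" if "v : U" for b v using E(4)[of b v] that assms by simp
  obtain u where "u : U" using E(2) by auto
  hence "0 : U" using sc[of u 0] by simp
  thus "U \<subseteq> V & subsp U" using E(1,5) sc assms by (auto intro!: cvec.subspaceI)
 next
  assume U: "U \<subseteq> V & subsp U"
  have inv: "\<ominus>\<^bsub>M\<^esub> v = - v" if "v : V" for v
   using that assms minus_equality[of "- v" v] by (simp add: sub_neg)
  show "submodule U complex_ring M"
   by (rule submoduleI) (use U assms inv in "auto simp: sub_0 sub_neg sub_add sub_scale")
 qed
qed

lemma ungraded_submod_vmod:
 "subsp V ==> ungraded_submod G (vmod V par a) U \<longleftrightarrow>
   U \<subseteq> V & subsp U & (\<forall>g\<in>G. \<forall>v\<in>U. a g v : U)"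
 by (auto simp: ungraded_submod_def submodule_vec[of V])

lemma graded_iff_sgo:
 assumes "subsp U"
 shows "(\<forall>v\<in>U. \<exists>v0\<in>U. \<exists>v1\<in>U. sgo par v0 = v0 & sgo par v1 = - v1 & v = v0 + v1) \<longleftrightarrow> (\<forall>v\<in>U. sgo par v : U)"
proof (intro iffI ballI)
 fix v assume *: "\<forall>v\<in>U. \<exists>v0\<in>U. \<exists>v1\<in>U. sgo par v0 = v0 & sgo par v1 = - v1 & v = v0 + v1" "v : U"
 then obtain v0 v1 where "v0 : U" "v1 : U" "sgo par v0 = v0" "sgo par v1 = - v1" "v = v0 + v1" by blast
 thus "sgo par v : U" using sub_diff[OF assms] by (simp add: clin_add[OF clin_sgo])
next
 fix v assume *: "\<forall>v\<in>U. sgo par v : U" "v : U"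
 have "v = cscale (1/2) (v + sgo par v) + cscale (1/2) (v - sgo par v)"
  by (rule poly_mapping_eqI) (simp add: lookup_add lookup_minus field_simps)
 thus "\<exists>v0\<in>U. \<exists>v1\<in>U. sgo par v0 = v0 & sgo par v1 = - v1 & v = v0 + v1"
  using * assms
  by (intro bexI[of _ "cscale (1/2) (v + sgo par v)"] bexI[of _ "cscale (1/2) (v - sgo par v)"])
    (auto simp: clin_simps[OF clin_sgo] sub_scale sub_add sub_diff
     add.commute cvec.scale_right_diff_distrib)
qed

lemma submod_vmod:
 assumes "subsp V"
 shows "submod G (vmod V par a) U \<longleftrightarrow>
   U \<subseteq> V & subsp U & (\<forall>g\<in>G. \<forall>v\<in>U. a g v : U) & (\<forall>v\<in>U. sgo par v : U)"
proof (cases "U \<subseteq> V & subsp U")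
 case True
 have "(\<forall>v\<in>U. \<exists>v0\<in>U \<inter> homog (vmod V par a) False. \<exists>v1\<in>U \<inter> homog (vmod V par a) True. v = v0 + v1)
  \<longleftrightarrow> (\<forall>v\<in>U. \<exists>v0\<in>U. \<exists>v1\<in>U. sgo par v0 = v0 & sgo par v1 = - v1 & v = v0 + v1)"
  using True by (intro ball_cong refl) (simp add: Bex_def, blast)
 thus ?thesis using True graded_iff_sgo[of U par]
  by (auto simp: submod_def ungraded_submod_vmod[OF assms])
qed (auto simp: submod_def ungraded_submod_vmod[OF assms])

lemma superspace_vmod:
 assumes "subsp V" "!!v. v : V ==> sgo par v : V"
 shows "superspace (vmod V par a)"
 unfolding superspace_def
proof (intro conjI allI ballI)
 show "Module.module complex_ring (vmod V par a)" using assms by (intro module_vec) auto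
 fix p
 have "subsp {v \<in> V. sgo par v = (if p then - v else v)}"
  by (rule cvec.subspaceI) (use assms(1) in "auto simp: sub_0 sub_add sub_scale clin_simps[OF clin_sgo]")
 thus "submodule (homog (vmod V par a) p) complex_ring (vmod V par a)"
  using assms(1) by (subst submodule_vec[of V]) auto
next
 fix v assume v: "v : carrier (vmod V par a)"
 then obtain v0 v1 where w: "v0 : V" "v1 : V" "sgo par v0 = v0" "sgo par v1 = - v1" "v = v0 + v1"
  using graded_iff_sgo[OF assms(1)] assms(2) by (metis vmod_simps(1))
 show "\<exists>!u. fst u : homog (vmod V par a) False & snd u : homog (vmod V par a) True & v = fst u \<oplus>\<^bsub>vmod V par a\<^esub> snd u"
 proof (rule ex1I[of _ "(v0, v1)"])
  show "fst (v0, v1) : homog (vmod V par a) False & snd (v0, v1) : homog (vmod V par a) True & v = fst (v0, v1) \<oplus>\<^bsub>vmod V par a\<^esub> snd (v0, v1)"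
   using w by simp
  fix u assume "fst u : homog (vmod V par a) False & snd u : homog (vmod V par a) True & v = fst u \<oplus>\<^bsub>vmod V par a\<^esub> snd u"
  hence u: "sgo par (fst u) = fst u" "sgo par (snd u) = - snd u" "v = fst u + snd u"
   by simp_all
  have half: "a = cscale (1/2) (a + b + sgo par (a + b))" if "sgo par a = a" "sgo par b = - b" for a b
  proof -
   have "a + b + sgo par (a + b) = a + a" using that by (simp add: clin_simps[OF clin_sgo])
   moreover have "cscale (1/2) (a + a) = a" by (rule poly_mapping_eqI) (simp add: lookup_add)
   ultimately show ?thesis by (simp only:)
  qed
  have "fst u = cscale (1/2) (v + sgo par v)" "v0 = cscale (1/2) (v + sgo par v)"
   using half[OF u(1,2)] half[OF w(3,4)] u(3) w(5) by auto
  moreover have "snd u = v - fst u" "v1 = v - v0" unfolding u(3) using u(3) w(5) by (simp_all add: algebra_simps)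
  ultimately show "u = (v0, v1)" by (simp add: prod_eq_iff)
 qed
qed

text \<open>The real square root of \<open>q(z)\<close>, the eigenvalue attached to the content \<open>z\<close>.\<close>

definition kap :: "int => complex" where
 "kap z = complex_of_real (sqrt (real_of_int (q z)))"

lemma q_nonneg: "0 \<le> z ==> 0 \<le> q z"
 by (simp add: q_def)

lemma kap_sq: "0 \<le> z ==> kap z * kap z = of_int (q z)"
proof -
 assume "0 \<le> z"
 hence "kap z * kap z = complex_of_real (sqrt (real_of_int (q z)) * sqrt (real_of_int (q z)))"
  by (simp only: kap_def of_real_mult)
 thus ?thesis using q_nonneg[OF \<open>0 \<le> z\<close>] by simp
qed

lemma q_inj: "0 \<le> z ==> 0 \<le> z' ==> q z = q z' \<longleftrightarrow> z = z'"
proof -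
 assume z: "0 \<le> z" "0 \<le> z'"
 have "q z - q z' = (z - z') * (z + z' + 1)" by (simp add: q_def algebra_simps)
 thus ?thesis using z by (metis add_nonneg_nonneg add_pos_nonneg eq_iff_diff_eq_0 mult_eq_0_iff
   not_less_iff_gr_or_eq zero_less_one add.commute)
qed

lemma kap_zero: "0 \<le> z ==> kap z = 0 \<longleftrightarrow> z = 0"
 using q_inj[of z 0] by (simp add: kap_def q_def)

lemma kap_sq_inj: "0 \<le> z ==> 0 \<le> z' ==> kap z * kap z = kap z' * kap z' \<longleftrightarrow> z = z'"
 by (simp add: kap_sq q_inj)

lemma kap_inj: "0 \<le> z ==> 0 \<le> z' ==> kap z = kap z' \<longleftrightarrow> z = z'"
 using kap_sq_inj by metis

text \<open>A supermodule over the subalgebra with the \<open>s\<^sub>i\<close>, \<open>i \<in> B\<close>, on which \<open>x\<^sub>i\<^sup>2\<close> is \<open>q\<close> of the \<open>i\<close>-th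
  entry of a list of contents.\<close>

definition bmodule :: "nat set => int list => 'b vec set => ('b => bool) => (gen => 'b vec => 'b vec) => bool" where
 "bmodule B zs V par a \<longleftrightarrow> bmod V (sgo par) (%i. a (Gx i)) (%i. a (Gc i)) (length zs)
   (%i. kap (zs ! (i - 1))) (%i. a (Gs i)) B"

definition bgens :: "nat set => nat => gen set" where
 "bgens B d = Gs ` B \<union> agens d"

lemma simple_bmodule:
 assumes "bmodule B zs V par a"
 shows "simple (bgens B (length zs)) (vmod V par a) \<longleftrightarrow>
      wmod.asimple V (sgo par) (%i. a (Gx i)) (%i. a (Gc i)) (length zs)"
  and "ungraded_simple (bgens B (length zs)) (vmod V par a) \<longleftrightarrow> V ~= {0} &
      (\<forall>U. wmod.asub V (%i. a (Gx i)) (%i. a (Gc i)) (length zs) U --> U = {0} \<or> U = V)"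
proof -
 interpret bmod V "sgo par" "%i. a (Gx i)" "%i. a (Gc i)" "length zs"
   "%i. kap (zs ! (i - 1))" "%i. a (Gs i)" B using assms by (simp add: bmodule_def)
 have *: "(U \<subseteq> V & subsp U & (\<forall>g\<in>bgens B (length zs). \<forall>v\<in>U. a g v : U)) \<longleftrightarrow> asub U" for U
  using asub_s[of U] unfolding bgens_def agens_def asub_def by auto
 have **: "submod (bgens B (length zs)) (vmod V par a) U \<longleftrightarrow> gsub U"
  "ungraded_submod (bgens B (length zs)) (vmod V par a) U \<longleftrightarrow> asub U" for U
  unfolding submod_vmod[OF V] ungraded_submod_vmod[OF V] *[symmetric] gsub_def by blast+
 show "simple (bgens B (length zs)) (vmod V par a) \<longleftrightarrow> asimple"
  by (simp add: simple_def asimple_def **)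
 show "ungraded_simple (bgens B (length zs)) (vmod V par a) \<longleftrightarrow> V ~= {0} & (\<forall>U. asub U --> U = {0} \<or> U = V)"
  by (simp add: ungraded_simple_def **)
qed

section \<open>The modules \<open>\<Phi>\<close>\<close>

context
 fixes a :: int
begin

definition pC :: "nat => rowb vec => rowb vec" where
 "pC i = lin (phi_act a (Gc i))"

definition pS :: "(nat => nat) => rowb vec => rowb vec" where
 "pS t = lin (%(e, J). tens Pair (bas e) (cl_perm t J))"

definition pE :: "nat => rowb vec => rowb vec" where
 "pE i = sgo (%(e, J). i : J)"

definition pP :: "rowb vec => rowb vec" where
 "pP = lin (%(e, J). tens Pair (phi_mult a e) (bas J))"

definition pT :: "nat => nat => rowb vec => rowb vec" where
 "pT k i v = pS (transpose k i) v - pC k (pC i (pS (transpose k i) v))"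

definition pX :: "nat => rowb vec => rowb vec" where
 "pX i v = cscale (of_int a) (pE i v) + (\<Sum>k\<in>{1..<i}. pT k i v) - pP (pC i v)"

definition pfin :: "rowb vec set" where
 "pfin = cvec.span (bas ` {(e, J). finite J})"

lemma clin_pC [simp, intro!]: "clin (pC i)" and clin_pS [simp, intro!]: "clin (pS t)"
 and clin_pE [simp, intro!]: "clin (pE i)" and clin_pP [simp, intro!]: "clin pP"
 by (simp_all add: pC_def pS_def pE_def pP_def)

lemma clin_pT [simp, intro!]: "clin (pT k i)"
 unfolding pT_def by (intro clin_minus clin_comp[OF clin_pC] clin_pS)

lemma clin_pX [simp, intro!]: "clin (pX i)"
 unfolding pX_def by (intro clin_minus clin_plus clin_cscale clin_setsum clin_pE clin_pT clin_comp[OF clin_pP] clin_pC)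

lemmas p_simps = clin_simps[OF clin_pC] clin_simps[OF clin_pS] clin_simps[OF clin_pE] clin_simps[OF clin_pP]
  clin_simps[OF clin_pT]

abbreviation rw :: "bool => nat set vec => rowb vec" where
 "rw e w \<equiv> tens Pair (bas e) w"

lemma pC_rw: "pC i (rw e w) = cscale (if e then -1 else 1) (rw e (lin (cl_c i) w))"
proof (rule clin_eqI[where f="%w. pC i (rw e w)"])
qed (auto intro!: clin_comp[OF clin_pC] clin_cscale clin_uminus clin_comp[OF clin_tens_right] clin_tens_right simp: lin_bas[of "phi_act a (Gc i)", folded pC_def])

lemma pS_rw: "pS t (rw e w) = rw e (lin (cl_perm t) w)"
proof (rule clin_eqI[where f="%w. pS t (rw e w)"])
qed (auto intro!: clin_comp[OF clin_pS] clin_comp[OF clin_tens_right] clin_tens_right simp: pS_def)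

lemma pE_bas: "pE i (bas (e, J)) = cscale (if i : J then -1 else 1) (bas (e, J))"
 by (simp add: pE_def)

lemma pE_rw: "pE i (rw e w) = rw e (eps i w)"
proof (rule clin_eqI[where f="%w. pE i (rw e w)"])
qed (auto intro!: clin_comp[OF clin_pE] clin_comp[OF clin_tens_right] clin_tens_right simp: pE_bas tens_simps)

definition pf :: "bool => complex" where
 "pf e = (if a = 0 then 0 else if e then of_int a else 1)"

lemma pf_mult: "pf (~ e) * pf e = of_int a" "pf e * pf (~ e) = of_int a"
 by (auto simp: pf_def)

lemma phi_mult_pf: "phi_mult a e = cscale (pf e) (bas (~ e))"
 by (simp add: phi_mult_def pf_def)

lemma pP_rw: "pP (rw e w) = cscale (pf e) (rw (~ e) w)"
proof -
 have "pP (rw e w) = tens Pair (phi_mult a e) w"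
  by (rule clin_eqI[where f="%w. pP (rw e w)"])
    (auto intro!: clin_comp[OF clin_pP] clin_tens_right simp: pP_def)
 thus ?thesis by (simp add: phi_mult_pf tens_simps)
qed

lemma pX_phi_act: "lin (phi_act a (Gx i)) v = pX i v"
proof (rule clin_eqI[where g="pX i"])
 fix b :: rowb
 obtain e J where b: "b = (e, J)" by force
 have bb: "bas b = rw e (bas J)" by (simp add: b)
 have s: "(\<Sum>k\<in>{1..<i}. rw e (cl_perm (transpose k i) J - lin (cl_c k) (lin (cl_c i) (cl_perm (transpose k i) J))))
   = (\<Sum>k\<in>{1..<i}. pT k i (bas b))"
  unfolding bb pT_def pS_rw pC_rw p_simps by (rule sum.cong) (auto simp: tens_simps)
 have e: "rw e (cl_eps i J) = pE i (bas b)" by (simp add: bb pE_rw cl_eps_def del: tens_bas)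
 have c: "cscale (if e then -1 else 1) (tens Pair (phi_mult a e) (cl_c i J)) = pP (pC i (bas b))"
  unfolding bb pC_rw by (simp add: p_simps pP_rw phi_mult_pf tens_simps)
 show "lin (phi_act a (Gx i)) (bas b) = pX i (bas b)"
  unfolding pX_def s[symmetric] c[symmetric] e[symmetric] by (simp add: b)
qed auto

lemma pS_phi_act: "lin (phi_act a (Gs i)) = pS (transpose i (i+1))"
 unfolding pS_def by (rule arg_cong[where f=lin]) (auto simp: fun_eq_iff)

lemma pfin_subspace [simp, intro!]: "subsp pfin"
 by (simp add: pfin_def)

lemma rw_pfin: "(!!J. J : keys w ==> finite J) ==> rw e w : pfin"
proof -
 assume *: "!!J. J : keys w ==> finite J"
 have "rw e w : pfin"
  by (rule clin_span_mem[of w "bas ` {J. finite J}", OF _ clin_tens_right])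
    (use * in "auto simp: span_bas_iff pfin_def intro!: cvec.span_base")
 thus ?thesis .
qed

text \<open>An identity between linear maps on \<^const>\<open>pfin\<close> can be checked on the vectors \<open>e \<otimes> c\<^sub>J\<close>.\<close>

lemma pfin_eqI:
 assumes "v : pfin" "clin f" "clin g" "!!e J. finite J ==> f (rw e (bas J)) = g (rw e (bas J))"
 shows "f v = g v"
 by (rule clin_span_eq[OF assms(1)[unfolded pfin_def] assms(2,3)]) (use assms(4) in auto)

lemma keys_perm_fin: "inj t ==> finite J ==> K : keys (cl_perm t J) ==> finite K"
 using keys_cl_perm by (meson finite_imageI finite_subset)

lemma keys_clc_fin: "finite J ==> K : keys (cl_c i J) ==> finite K"
 using cl_c_keys[of i J] by auto

lemma pfin_closed [simp]:
 assumes "v : pfin"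
 shows "pC i v : pfin" "pE i v : pfin" "pP v : pfin" "inj t ==> pS t v : pfin"
proof -
 note sp = clin_span_mem[OF assms[unfolded pfin_def] _ pfin_subspace]
 have r: "rw e (bas J) : pfin" if "finite J" for e J by (rule rw_pfin) (use that in simp)
 show "pC i v : pfin"
 proof (rule sp[OF clin_pC])
  fix x assume "x : bas ` {(e::bool, J::nat set). finite J}"
  then obtain e J where "x = rw e (bas J)" "finite J" by auto
  moreover have "rw e (cl_c i J) : pfin" by (rule rw_pfin[OF keys_clc_fin[OF \<open>finite J\<close>]])
  ultimately show "pC i x : pfin" using sub_scale[OF pfin_subspace] by (simp add: pC_rw del: tens_bas)
 qed
 show "pE i v : pfin"
 proof (rule sp[OF clin_pE])
  fix x assume "x : bas ` {(e::bool, J::nat set). finite J}"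
  then obtain e J where "x = rw e (bas J)" "finite J" by auto
  hence "pE i x = (if i : J then - rw e (bas J) else rw e (bas J))"
   by (simp add: pE_rw tens_simps cscale_m1 del: tens_bas)
  thus "pE i x : pfin" using r[OF \<open>finite J\<close>] sub_neg[OF pfin_subspace] by presburger
 qed
 show "pP v : pfin"
 proof (rule sp[OF clin_pP])
  fix x assume "x : bas ` {(e::bool, J::nat set). finite J}"
  then obtain e J where "x = rw e (bas J)" "finite J" by auto
  thus "pP x : pfin" using r[of J]
   by (auto simp: pP_rw sub_0 sub_scale simp del: tens_bas)
 qed
 assume t: "inj t"
 show "pS t v : pfin"
 proof (rule sp[OF clin_pS])
  fix x assume "x : bas ` {(e::bool, J::nat set). finite J}"
  then obtain e J where "x = rw e (bas J)" "finite J" by auto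
  thus "pS t x : pfin" using rw_pfin[OF keys_perm_fin[OF t \<open>finite J\<close>]]
   by (simp add: pS_rw del: tens_bas)
 qed
qed

lemma inj_transpose [simp]: "inj (transpose i j)"
 by (rule bij_is_inj) simp

lemma pT_pfin [simp]: "v : pfin ==> pT k i v : pfin"
 by (simp add: pT_def sub_diff)

lemma pX_pfin [simp]: "v : pfin ==> pX i v : pfin"
 unfolding pX_def
 by (intro sub_diff sub_add sub_scale sub_sum) auto

subsection \<open>Relations between the elementary operators\<close>

lemma rw_eqI: "clin f ==> clin g ==> (!!e J. f (rw e (bas J)) = g (rw e (bas J))) ==> f v = g v"
 by (rule clin_eqI[where f=f]) auto

lemmas p_clin = clin_comp[OF clin_pC] clin_comp[OF clin_pS] clin_comp[OF clin_pE] clin_comp[OF clin_pP]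
 clin_uminus clin_cscale clin_pC clin_pS clin_pE clin_pP clin_id

lemma CC: "pC i (pC i v) = - v"
 by (rule rw_eqI[where f="%v. pC i (pC i v)"]; (intro p_clin)?) (simp add: pC_rw p_simps tens_simps cl_c_sq del: tens_bas)

lemma C_anti: "i ~= j ==> pC i (pC j v) = - pC j (pC i v)"
 by (rule rw_eqI[where f="%v. pC i (pC j v)"]; (intro p_clin)?)
   (simp add: pC_rw p_simps tens_simps cl_c_anti[of i j] del: tens_bas)

lemma EE: "pE i (pE j v) = pE j (pE i v)"
 by (rule poly_mapping_eqI) (simp add: pE_def split: prod.splits)

lemma EC: "pE i (pC j v) = (if i = j then - pC j (pE i v) else pC j (pE i v))"
proof (rule rw_eqI[where f="%v. pE i (pC j v)"])
 show "clin (%v. if i = j then - pC j (pE i v) else pC j (pE i v))" by (cases "i = j") (auto intro!: p_clin)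
 fix e J
 show "pE i (pC j (rw e (bas J))) = (if i = j then - pC j (pE i (rw e (bas J))) else pC j (pE i (rw e (bas J))))"
  using eps_cl_c[of i j "bas J"] by (simp add: pC_rw pE_rw p_simps tens_simps clin_simps[OF clin_lin] del: tens_bas)
qed (intro p_clin)

lemma PP: "pP (pP v) = cscale (of_int a) v"
 by (rule rw_eqI[where f="%v. pP (pP v)"]; (intro p_clin)?) (simp add: pP_rw p_simps pf_mult del: tens_bas)

lemma PC: "pP (pC i v) = - pC i (pP v)"
 by (rule rw_eqI[where f="%v. pP (pC i v)"]; (intro p_clin)?) (simp add: pP_rw pC_rw p_simps cscale_m1 del: tens_bas)

lemma PE: "pP (pE i v) = pE i (pP v)"
 by (rule rw_eqI[where f="%v. pP (pE i v)"]; (intro p_clin)?) (simp add: pP_rw pE_rw p_simps del: tens_bas)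

lemma PS: "pP (pS t v) = pS t (pP v)"
 by (rule rw_eqI[where f="%v. pP (pS t v)"]; (intro p_clin)?) (simp add: pP_rw pS_rw p_simps del: tens_bas)

lemma SC: "inj t ==> v : pfin ==> pS t (pC i v) = pC (t i) (pS t v)"
proof (rule pfin_eqI[where f="%v. pS t (pC i v)"])
 fix e and J :: "nat set" assume "inj t" "finite J"
 thus "pS t (pC i (rw e (bas J))) = pC (t i) (pS t (rw e (bas J)))"
  by (simp add: pC_rw pS_rw p_simps cl_perm_c del: tens_bas)
qed (auto intro!: clin_comp[OF clin_pC] clin_comp[OF clin_pS])

lemma SS: "inj t ==> inj t' ==> v : pfin ==> pS t (pS t' v) = pS (%i. t (t' i)) v"
proof (rule pfin_eqI[where f="%v. pS t (pS t' v)"])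
 fix e and J :: "nat set" assume "inj t" "inj t'" "finite J"
 thus "pS t (pS t' (rw e (bas J))) = pS (%i. t (t' i)) (rw e (bas J))"
  by (simp add: pS_rw cl_perm_comp del: tens_bas)
qed (auto intro!: clin_comp[OF clin_pS])

lemma eps_cl_perm:
 assumes "inj t" "finite J" shows "eps (t i) (cl_perm t J) = lin (cl_perm t) (eps i (bas J))"
proof -
 let ?f = "%b. eps (t i) (lin (cl_perm t) (eps i b))"
 have l: "clin ?f" by (auto intro!: clin_comp[OF clin_sgo])
 have "?f (bas J) = eta (%j. lin (cl_c (t j))) (?f (bas {})) (bas J)"
 proof (rule eta_unique[where I=UNIV, OF l])
  fix j and K :: "nat set" assume K: "finite K"
  have "?f (lin (cl_c j) (bas K)) = lin (cl_c (t j)) (?f (bas K))"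
   by (simp add: eps_cl_c[of i j "bas K", unfolded lin_bas] cl_perm_c[OF assms(1) K]
      eps_cl_c clin_simps[OF clin_lin] clin_simps[OF clin_sgo] inj_eq[OF assms(1)])
  thus "?f (cl_c j K) = lin (cl_c (t j)) (?f (bas K))" by simp
 qed (use assms in auto)
 hence "?f (bas J) = cl_perm t J" by (simp add: cl_perm_eta cl_perm_def[of _ "{}"])
 hence "eps (t i) (?f (bas J)) = eps (t i) (cl_perm t J)" by simp
 thus ?thesis by simp
qed

lemma SE: "inj t ==> v : pfin ==> pS t (pE i v) = pE (t i) (pS t v)"
proof (rule pfin_eqI[where f="%v. pS t (pE i v)"])
 fix e and J :: "nat set" assume "inj t" "finite J"
 thus "pS t (pE i (rw e (bas J))) = pE (t i) (pS t (rw e (bas J)))"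
  by (simp add: pE_rw pS_rw eps_cl_perm del: tens_bas sgo_bas)
qed (auto intro!: clin_comp[OF clin_pE] clin_comp[OF clin_pS])

lemma S_one: "pS t (bas (e, {})) = bas (e, {})" and E_one: "pE i (bas (e, {})) = bas (e, {})"
 by (simp_all add: pS_def pE_def cl_perm_def)

lemma S_id: "v : pfin ==> pS (%i. i) v = v"
proof (rule pfin_eqI[where g="%v. v"])
 fix e and J :: "nat set" assume "finite J"
 thus "pS (%i. i) (rw e (bas J)) = rw e (bas J)"
  using cl_perm_id[of J] by (simp add: pS_rw id_def del: tens_bas)
qed auto

lemma S_trans_sq: "v : pfin ==> pS (transpose i j) (pS (transpose i j) v) = v"
 by (simp add: SS S_id)

text \<open>The space is generated by the two vectors \<open>e \<otimes> \<one>\<close> under the Clifford operators.\<close>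

lemma pfin_generated:
 assumes Z: "subsp Z" and 1: "!!e. bas (e, {}) : Z" and c: "!!j v. v : Z ==> pC j v : Z"
  and v: "v : pfin"
 shows "v : Z"
proof -
 have "rw e (bas J) : Z" if "finite J" for e J
  using that
 proof (induction J rule: finite_induct)
  case empty thus ?case using 1 by simp
 next
  case (insert j J)
  have "pC j (rw e (bas J)) = cscale ((if e then -1 else 1) * cl_sign j J) (rw e (bas (insert j J)))"
   using insert.hyps by (simp add: pC_rw cl_c_alt tens_simps del: tens_bas)
  hence "cscale ((if e then -1 else 1) * cl_sign j J) (pC j (rw e (bas J))) = rw e (bas (insert j J))"
   by simp
  thus ?case using sub_scale[OF Z c[OF insert.IH, of j]] by metis
 qed
 thus ?thesis using v Z
  by (intro clin_span_mem[OF v[unfolded pfin_def] clin_id Z]) auto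
qed

subsection \<open>The relations for \<open>x\<^sub>i\<close>\<close>

lemma TC:
 assumes "v : pfin" "k ~= i"
 shows "pT k i (pC j v) = (if j = i then - pC j (pT k i v) else pC j (pT k i v))"
proof -
 let ?S = "pS (transpose k i)"
 have s: "?S (pC j v) = pC (transpose k i j) (?S v)" using assms by (simp add: SC)
 consider "j = i" | "j = k" "j ~= i" | "j ~= i" "j ~= k" by auto
 thus ?thesis
 proof cases
  case 1
  have "pC i (pC k (pC i (?S v))) = - pC k (pC i (pC i (?S v)))" using assms(2) by (intro C_anti) auto
  hence e: "pC i (pC k (pC i (?S v))) = pC k (?S v)" by (simp add: CC p_simps)
  have "pC i (pC k (?S v)) = - pC k (pC i (?S v))" using assms(2) by (intro C_anti) auto
  hence "pC k (pC i (pC k (?S v))) = pC i (?S v)" by (simp add: p_simps CC)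
  hence "pT k i (pC i v) = pC k (?S v) - pC i (?S v)" using s 1 by (simp add: pT_def)
  moreover have "pC i (pT k i v) = pC i (?S v) - pC k (?S v)"
   unfolding pT_def clin_diff[OF clin_pC] e ..
  ultimately show ?thesis using 1 by simp
 next
  case 2
  thus ?thesis using assms(2) s by (simp add: pT_def p_simps CC)
 next
  case 3
  have "pC k (pC i (pC j (?S v))) = pC j (pC k (pC i (?S v)))"
   using 3 C_anti[of i j "?S v"] C_anti[of k j "pC i (?S v)"] by (simp add: p_simps)
  thus ?thesis using 3 s by (simp add: pT_def p_simps)
 qed
qed

lemma XC:
 assumes "v : pfin"
 shows "pX i (pC j v) = (if j = i then - pC j (pX i v) else pC j (pX i v))"
proof -
 have "(\<Sum>k\<in>{1..<i}. pT k i (pC j v)) = (if j = i then - pC j (\<Sum>k\<in>{1..<i}. pT k i v) else pC j (\<Sum>k\<in>{1..<i}. pT k i v))"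
  using assms by (auto simp: TC p_simps sum_negf)
 moreover have "pP (pC i (pC j v)) = (if j = i then - pC j (pP (pC i v)) else pC j (pP (pC i v)))"
  using PC[of j "pC j v"] PC[of i "pC j v"] PC[of j "pC i v"] C_anti[of i j v] by (auto simp: p_simps)
 ultimately show ?thesis by (auto simp: pX_def p_simps EC)
qed

lemma S_T:
 assumes "inj t" "v : pfin"
 shows "pS t (pT k i v) = pT (t k) (t i) (pS t v)"
proof -
 have e: "(%l. t (transpose k i l)) = (%l. transpose (t k) (t i) (t l))"
  using assms(1) by (auto simp: fun_eq_iff transpose_def inj_eq)
 have "pS t (pS (transpose k i) v) = pS (transpose (t k) (t i)) (pS t v)"
  using assms e by (simp add: SS)
 thus ?thesis using assms by (simp add: pT_def p_simps SC)
qed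

lemma SX:
 assumes "v : pfin" "1 \<le> i"
 shows "pS (transpose i (i+1)) (pX i v) =
  pX (i+1) (pS (transpose i (i+1)) v) - v + pC i (pC (i+1) v)"
proof -
 let ?s = "transpose i (i+1)"
 have "pS ?s (\<Sum>k\<in>{1..<i}. pT k i v) = (\<Sum>k\<in>{1..<i}. pT k (i+1) (pS ?s v))"
  unfolding p_simps by (rule sum.cong) (auto simp: S_T assms)
 moreover have "pT i (i+1) (pS ?s v) = v - pC i (pC (i+1) v)"
  by (simp add: pT_def S_trans_sq[OF assms(1), simplified])
 ultimately show ?thesis using assms
  by (simp add: pX_def p_simps SE SC PS[symmetric] algebra_simps)
qed

lemma X_Suc:
 assumes "v : pfin" "1 \<le> i"
 shows "pX (i+1) v = pS (transpose i (i+1)) (pX i (pS (transpose i (i+1)) v))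
   + pS (transpose i (i+1)) v - pC i (pC (i+1) (pS (transpose i (i+1)) v))"
proof -
 have m: "pS (transpose i (i+1)) v : pfin" using assms(1) by simp
 show ?thesis using SX[OF m assms(2)] S_trans_sq[OF assms(1), of i "i+1"] by simp
qed

lemma SX_far:
 assumes "v : pfin" "j ~= i" "j + 1 ~= i" "1 \<le> j"
 shows "pS (transpose j (j+1)) (pX i v) = pX i (pS (transpose j (j+1)) v)"
proof -
 let ?s = "transpose j (j+1)"
 have si: "?s i = i" using assms by (simp add: transpose_def)
 have "pS ?s (\<Sum>k\<in>{1..<i}. pT k i v) = (\<Sum>k\<in>{1..<i}. pT (?s k) i (pS ?s v))"
  unfolding p_simps
 proof (rule sum.cong[OF refl])
  fix k
  show "pS ?s (pT k i v) = pT (?s k) i (pS ?s v)" using S_T[of ?s v k i] assms(1) unfolding si by simp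
 qed
 also have "\<dots> = (\<Sum>k\<in>{1..<i}. pT k i (pS ?s v))"
  by (rule sum.reindex_bij_witness[of _ ?s ?s]) (use assms in "auto simp: transpose_def split: if_splits")
 finally show ?thesis using assms(1) si by (simp add: pX_def p_simps SE SC PS[symmetric])
qed

text \<open>On \<open>\<one>\<close> the transposition is trivial; this is where the trivial module of the symmetric group
  enters.\<close>

lemma T_E:
 assumes "v : pfin" "i ~= 1"
 shows "pT 1 i (pE 1 v) - pE 1 (pT 1 i v) + cscale 2 (pC 1 (pC i v)) = 0"
proof -
 define Z where "Z = (%v. pT 1 i (pE 1 v) - pE 1 (pT 1 i v) + cscale 2 (pC 1 (pC i v)))"
 have lin: "clin Z" unfolding Z_def
  by (intro clin_plus clin_minus clin_cscale clin_comp[OF clin_pT] clin_comp[OF clin_pE] clin_comp[OF clin_pC] clin_pE clin_pC clin_pT)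
 have "v : {v \<in> pfin. Z v : {0}}"
 proof (rule pfin_generated[OF clin_vimage_subspace[OF lin]])
  fix e
  have m: "bas (e, {}) : pfin" by (auto simp: pfin_def intro!: cvec.span_base)
  show "bas (e, {}) : {v \<in> pfin. Z v : {0}}"
   using assms(2) by (simp add: m Z_def pT_def S_one E_one EC p_simps cvec.scale_left_distrib[of 1 1, simplified])
 next
  fix j v assume "v : {v \<in> pfin. Z v : {0}}"
  hence v: "v : pfin" "Z v = 0" by auto
  have "Z (pC j v) = (if j = 1 \<or> j = i then - pC j (Z v) else pC j (Z v))"
  proof -
   have "pC 1 (pC i (pC j v)) = (if j = 1 \<or> j = i then - pC j (pC 1 (pC i v)) else pC j (pC 1 (pC i v)))"
    using C_anti[of 1 i v] C_anti[of i j v] C_anti[of 1 j "pC i v"] C_anti[of 1 i "pC i v"] assms(2)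
    by (auto simp: CC p_simps)
   thus ?thesis using assms(2) v(1) TC[of v 1 i j] TC[of "pE 1 v" 1 i j]
    by (auto simp: Z_def EC p_simps)
  qed
  thus "pC j v : {v \<in> pfin. Z v : {0}}" using v by (simp add: p_simps)
 qed (use assms in auto)
 thus ?thesis by (simp add: Z_def)
qed

lemma X_X1:
 assumes "v : pfin" "2 \<le> i"
 shows "pX i (pX 1 v) = pX 1 (pX i v)"
proof -
 have i: "i ~= 1" using assms(2) by simp
 have X1: "pX 1 w = cscale (of_int a) (pE 1 w) - pP (pC 1 w)" for w by (simp add: pX_def)
 have PCT: "pT k i (pP (pC 1 w)) = pP (pC 1 (pT k i w))" if "w : pfin" "k ~= i" for w k
 proof -
  have "pT k i (pP u) = pP (pT k i u)" for u
   using PC[of k "pC i (pS (transpose k i) u)"] PC[of i "pS (transpose k i) u"]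
   by (simp add: pT_def p_simps PS)
  thus ?thesis using TC[OF that, of 1] i by simp
 qed
 have TE: "pT k i (pE 1 v) = pE 1 (pT k i v)" if "k : {2..<i}" for k
 proof -
  have "transpose k i 1 = 1" using that by (simp add: transpose_def)
  hence "pS (transpose k i) (pE 1 v) = pE 1 (pS (transpose k i) v)"
   using SE[of "transpose k i" v 1] assms(1) by simp
  thus ?thesis using that i by (simp add: pT_def EC p_simps)
 qed
 have sp: "{1..<i} = insert 1 {2..<i}" using assms(2) by auto
 have s1: "(\<Sum>k\<in>{1..<i}. pT k i (pP (pC 1 v))) = pP (pC 1 (\<Sum>k\<in>{1..<i}. pT k i v))"
  unfolding p_simps
 proof (rule sum.cong[OF refl])
  fix k assume "k : {1..<i}"
  thus "pT k i (pP (pC 1 v)) = pP (pC 1 (pT k i v))" by (intro PCT[OF assms(1)]) auto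
 qed
 have s2: "(\<Sum>k\<in>{1..<i}. pT k i (pE 1 v)) = pE 1 (\<Sum>k\<in>{1..<i}. pT k i v) - cscale 2 (pC 1 (pC i v))"
 proof -
  have "(\<Sum>k\<in>{2..<i}. pT k i (pE 1 v)) = pE 1 (\<Sum>k\<in>{2..<i}. pT k i v)"
   unfolding p_simps by (rule sum.cong[OF refl]) (rule TE)
  moreover have "pT 1 i (pE 1 v) = pE 1 (pT 1 i v) - cscale 2 (pC 1 (pC i v))"
   using T_E[OF assms(1) i] by (simp add: algebra_simps)
  ultimately show ?thesis unfolding sp by (simp add: p_simps)
 qed
 have a1: "pP (pC i (pP (pC 1 v))) = - cscale (of_int a) (pC i (pC 1 v))"
  using PC[of i "pP (pC 1 v)"] by (simp add: PP p_simps)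
 have a2: "pP (pC 1 (pP (pC i v))) = cscale (of_int a) (pC i (pC 1 v))"
  using PC[of 1 "pP (pC i v)"] C_anti[of 1 i v] i by (simp add: PP p_simps)
 have a3: "pP (pC i (pE 1 v)) = pE 1 (pP (pC i v))" "pE i (pP (pC 1 v)) = pP (pC 1 (pE i v))"
  using i by (simp_all add: PE[symmetric] EC)
 have a4: "pC 1 (pC i v) = - pC i (pC 1 v)" using C_anti[of 1 i v] i by simp
 define T where "T w = (\<Sum>k\<in>{1..<i}. pT k i w)" for w
 have T: "clin T" unfolding T_def by (intro clin_setsum clin_pT)
 have X: "pX i w = cscale (of_int a) (pE i w) + T w - pP (pC i w)" for w by (simp add: pX_def T_def)
 show ?thesis
  unfolding X1 X
  by (simp only: p_simps clin_simps[OF T] s1[folded T_def] s2[folded T_def] a1 a2 a3 a4 EE[of i 1])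
    (rule poly_mapping_eqI, simp add: lookup_add lookup_minus algebra_simps)
qed

lemma X_comm:
 assumes "1 \<le> j" "j < i" "v : pfin"
 shows "pX i (pX j v) = pX j (pX i v)"
 using assms
proof (induction j arbitrary: i v rule: dec_induct)
 case base
 thus ?case using X_X1 by simp
next
 case (step j)
 let ?s = "transpose j (j+1)"
 have c: "pC j (pC (j+1) (pX i w)) = pX i (pC j (pC (j+1) w))" if "w : pfin" for w
  using that step by (simp add: XC)
 have s: "pS ?s (pX i w) = pX i (pS ?s w)" if "w : pfin" for w
  using step that by (intro SX_far) auto
 have "pX (j+1) (pX i v) = pS ?s (pX j (pX i (pS ?s v))) + pX i (pS ?s v) - pX i (pC j (pC (j+1) (pS ?s v)))"
  using step by (subst X_Suc) (auto simp: s[simplified] c[simplified])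
 also have "pX j (pX i (pS ?s v)) = pX i (pX j (pS ?s v))" using step by simp
 also have "pS ?s (pX i (pX j (pS ?s v))) = pX i (pS ?s (pX j (pS ?s v)))" using step by (intro s) auto
 finally show ?case using step X_Suc[of v j] by (simp add: clin_simps[OF clin_pX])
qed

lemma X_comm':
 assumes "1 \<le> j" "1 \<le> i" "v : pfin"
 shows "pX i (pX j v) = pX j (pX i v)"
 using assms X_comm[of j i v] X_comm[of i j v] by (cases i j rule: linorder_cases) auto

lemma C_sum_sq: "(\<Sum>k\<in>{1..<i}. pC k (\<Sum>l\<in>{1..<i}. pC l v)) = - cscale (of_nat (i - 1)) v" if "1 \<le> i"
 using that
proof (induction i rule: dec_induct)
 case (step n)
 have e: "{1..<Suc n} = insert n {1..<n}" using step by auto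
 have "(\<Sum>k\<in>{1..<n}. pC k (pC n v)) = - pC n (\<Sum>l\<in>{1..<n}. pC l v)"
  unfolding p_simps sum_negf[symmetric] by (rule sum.cong) (auto intro!: C_anti)
 hence "(\<Sum>k\<in>{1..<Suc n}. pC k (\<Sum>l\<in>{1..<Suc n}. pC l v)) =
   (\<Sum>k\<in>{1..<n}. pC k (\<Sum>l\<in>{1..<n}. pC l v)) - v"
  unfolding e by (simp add: clin_add[OF clin_pC] sum.distrib CC)
 also have "\<dots> = - cscale (of_nat (n - 1) + 1) v" using step.IH by (simp add: cvec.scale_left_distrib)
 also have "of_nat (n - 1) + 1 = (of_nat (Suc n - 1) :: complex)" using step by (simp add: of_nat_diff)
 finally show ?case .
qed simp

lemma X_sq:
 assumes "v : pfin" "1 \<le> i"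
 shows "pX i (pX i v) = cscale (of_int (q (a + int i - 1))) v"
proof -
 define Z where "Z = (%v. pX i (pX i v) - cscale (of_int (q (a + int i - 1))) v)"
 have lin: "clin Z" unfolding Z_def by (intro clin_minus clin_cscale clin_comp[OF clin_pX] clin_pX clin_id)
 have "v : {v \<in> pfin. Z v : {0}}"
 proof (rule pfin_generated[OF clin_vimage_subspace[OF lin]])
  fix e
  define b where "b = (bas (e, {}) :: rowb vec)"
  define A :: complex where "A = of_int (a + int i - 1)"
  define D where "D = (%v. \<Sum>k\<in>{1..<i}. pC k v)"
  have m: "b : pfin" by (auto simp: b_def pfin_def intro!: cvec.span_base)
  have D: "clin D" unfolding D_def by (intro clin_setsum clin_pC)
  have Dm: "D w : pfin" if "w : pfin" for w unfolding D_def using that by (intro sub_sum) auto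
  have XD: "pX i (D w) = D (pX i w)" if "w : pfin" for w
   unfolding D_def clin_simps[OF clin_pX] by (rule sum.cong) (auto simp: XC that)
  have CD: "D (pC i w) = - pC i (D w)" for w
   unfolding D_def p_simps sum_negf[symmetric] by (rule sum.cong) (auto intro!: C_anti)
  have PD: "D (pP w) = - pP (D w)" for w
   unfolding D_def p_simps sum_negf[symmetric] by (rule sum.cong) (auto simp: PC)
  have DD: "D (D w) = - cscale (of_nat (i - 1)) w" for w
   unfolding D_def using C_sum_sq[OF assms(2)] by simp
  have "(\<Sum>k\<in>{1..<i}. pT k i b) = cscale (of_nat (i - 1)) b + pC i (D b)"
  proof -
   have "(\<Sum>k\<in>{1..<i}. pT k i b) = (\<Sum>k\<in>{1..<i}. b + pC i (pC k b))"
   proof (rule sum.cong[OF refl])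
    fix k assume "k : {1..<i}"
    thus "pT k i b = b + pC i (pC k b)" using C_anti[of k i b] by (simp add: pT_def S_one b_def)
   qed
   also have "\<dots> = cscale (of_nat (i - 1)) b + pC i (D b)"
    unfolding D_def p_simps sum.distrib by (simp add: cvec.sum_constant_scale)
   finally show ?thesis .
  qed
  hence X1: "pX i b = cscale A b + pC i (D b) - pP (pC i b)"
  proof -
   have "A = of_int a + of_nat (i - 1)" using assms(2) by (simp add: A_def of_nat_diff)
   thus ?thesis using \<open>(\<Sum>k\<in>{1..<i}. pT k i b) = _\<close> E_one[of i e]
    by (simp add: pX_def b_def cvec.scale_left_distrib)
  qed
  have XP: "pX i (pP w) = pP (pX i w) + cscale (2 * of_int a) (pC i w)" for w
  proof -
   have TP: "pT k i (pP u) = pP (pT k i u)" for u k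
    using PC[of k "pC i (pS (transpose k i) u)"] PC[of i "pS (transpose k i) u"]
    by (simp add: pT_def p_simps PS)
   have 1: "pP (pP (pC i w)) = cscale (of_int a) (pC i w)" by (simp add: PP)
   have "pC i (pP w) = - pP (pC i w)" using PC[of i w] by simp
   hence "pP (pC i (pP w)) = - cscale (of_int a) (pC i w)" using 1 by (simp add: p_simps)
   thus ?thesis using 1 unfolding pX_def
    by (simp add: p_simps TP PE cvec.scale_left_distrib[of "of_int a" "of_int a", simplified])
  qed
  have "pX i (pX i b) = cscale A (pX i b) - pC i (D (pX i b)) + pP (pC i (pX i b)) + cscale (2 * of_int a) b"
  proof -
   have "pX i (pC i (D b)) = - pC i (D (pX i b))" using XC[OF Dm[OF m], of i i] XD[OF m] by simp
   moreover have "pX i (pP (pC i b)) = - pP (pC i (pX i b)) - cscale (2 * of_int a) b"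
    using XP[of "pC i b"] XC[OF m, of i i] by (simp add: p_simps CC)
   ultimately show ?thesis by (subst X1) (simp add: clin_simps[OF clin_pX])
  qed
  also have "\<dots> = cscale (A * A + A) b"
  proof -
   have e1: "pC i (D (pC i (D b))) = - cscale (of_nat (i - 1)) b"
    using CD[of "D b"] by (simp add: p_simps CC DD)
   have e2: "pC i (D (pP (pC i b))) = pP (D b)"
    using CD[of b] PC[of i "pC i (D b)"] by (simp add: PD p_simps clin_simps[OF D] CC)
   have e3: "pP (pC i (pP (pC i b))) = cscale (of_int a) b"
    using PC[of i "pP (pC i b)"] by (simp add: PP p_simps CC)
   have e4: "pP (pC i (pC i (D b))) = - pP (D b)" by (simp add: CC p_simps)
   have Aa: "of_int a + of_nat (i - 1) = A" using assms(2) by (simp add: A_def of_nat_diff)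
   show ?thesis unfolding X1
    by (simp only: p_simps clin_simps[OF D] e1 e2 e3 e4 cvec.scale_right_distrib cvec.scale_right_diff_distrib)
      (rule poly_mapping_eqI, simp add: lookup_add lookup_minus algebra_simps Aa[symmetric])
  qed
  also have "A * A + A = of_int (q (a + int i - 1))" by (simp add: A_def q_def algebra_simps)
  finally show "bas (e, {}) : {v \<in> pfin. Z v : {0}}" using m by (simp add: Z_def b_def)
 next
  fix j v assume "v : {v \<in> pfin. Z v : {0}}"
  hence v: "v : pfin" "Z v = 0" by auto
  have "Z (pC j v) = pC j (Z v)" using v by (auto simp: Z_def XC p_simps clin_simps[OF clin_pX])
  thus "pC j v : {v \<in> pfin. Z v : {0}}" using v by (simp add: p_simps)
 qed (use assms in auto)
 thus ?thesis by (simp add: Z_def)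
qed

end

section \<open>Simplicity of the modules \<open>\<Phi>\<close>\<close>

definition seg_contents :: "int \<times> int => int list" where
 "seg_contents s = map (%j. fst s + int j) [0..<seg_len (fst s) (snd s)]"

lemma length_seg_contents [simp]: "length (seg_contents (a, b)) = seg_len a b"
 by (simp add: seg_contents_def)

lemma nth_seg_contents: "1 \<le> i ==> i \<le> seg_len a b ==> seg_contents (a, b) ! (i - 1) = a + int i - 1"
 by (simp add: seg_contents_def of_nat_diff)

definition hsp :: "int => nat => rowb vec set" where
 "hsp a m = cvec.span (bas ` {(e, J). (a = 0 --> ~ e) & J \<subseteq> {1..m}})"

lemma hatPhi_eq: "hatPhi a b = vmod (hsp a (seg_len a b)) rowpar (%g. lin (phi_act a g))"
proof -
 have "{bas (e, J) | e J. (a = 0 --> ~ e) & J \<subseteq> {1..seg_len a b}} = bas ` {(e, J). (a = 0 --> ~ e) & J \<subseteq> {1..seg_len a b}}"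
  by auto
 thus ?thesis by (simp add: hatPhi_def hsp_def)
qed

lemma hsp_subspace [simp, intro!]: "subsp (hsp a m)"
 by (simp add: hsp_def)

lemma hsp_pfin: "v : hsp a m ==> v : pfin"
proof -
 have "{(e, J). (a = 0 --> ~ e) & J \<subseteq> {1..m}} \<subseteq> {(e, J). finite J}"
  using finite_subset[OF _ finite_atLeastAtMost[of 1 m]] by blast
 thus "v : hsp a m ==> v : pfin" unfolding hsp_def pfin_def span_bas_iff by (rule order_trans[rotated])
qed

lemma rw_hsp: "(!!J. J : keys w ==> J \<subseteq> {1..m}) ==> (a = 0 ==> ~ e) ==> tens Pair (bas e) w : hsp a m"
proof -
 assume *: "!!J. J : keys w ==> J \<subseteq> {1..m}" "a = 0 ==> ~ e"
 show ?thesis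
  by (rule clin_span_mem[of w "bas ` {J. J \<subseteq> {1..m}}", OF _ clin_tens_right])
    (use * in "auto simp: span_bas_iff hsp_def intro!: cvec.span_base")
qed

lemma hsp_closed:
 assumes v: "v : hsp a m"
 shows "i : {1..m} ==> pC a i v : hsp a m" "pE i v : hsp a m" "pP a v : hsp a m"
  "i : {1..m} ==> j : {1..m} ==> pS (transpose i j) v : hsp a m"
  "sgo rowpar v : hsp a m"
proof -
 note sp = clin_span_mem[OF v[unfolded hsp_def] _ hsp_subspace]
 have r: "bas (e, J) : hsp a m" if "a = 0 --> ~ e" "J \<subseteq> {1..m}" for e J
  unfolding hsp_def by (rule cvec.span_base) (use that in auto)
 show "pC a i v : hsp a m" if i: "i : {1..m}"
 proof (rule sp[OF clin_pC])
  fix x assume "x : bas ` {(e, J). (a = 0 --> ~ e) & J \<subseteq> {1..m}}"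
  then obtain e J where x: "x = tens Pair (bas e) (bas J)" "a = 0 --> ~ e" "J \<subseteq> {1..m}" by auto
  have "tens Pair (bas e) (cl_c i J) : hsp a m"
   using x i cl_c_keys[of i J] by (intro rw_hsp) auto
  thus "pC a i x : hsp a m" using sub_scale[OF hsp_subspace]
   by (simp add: x(1) pC_rw del: tens_bas)
 qed
 show "pE i v : hsp a m"
 proof (rule sp[OF clin_pE])
  fix x assume "x : bas ` {(e, J). (a = 0 --> ~ e) & J \<subseteq> {1..m}}"
  thus "pE i x : hsp a m" using r sub_neg[OF hsp_subspace] by (auto simp: pE_bas cscale_m1)
 qed
 show "sgo rowpar v : hsp a m"
 proof (rule sp[OF clin_sgo])
  fix x assume "x : bas ` {(e, J). (a = 0 --> ~ e) & J \<subseteq> {1..m}}"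
  thus "sgo rowpar x : hsp a m" using r sub_neg[OF hsp_subspace] by (auto simp: cscale_m1)
 qed
 show "pP a v : hsp a m"
 proof (rule sp[OF clin_pP])
  fix x assume "x : bas ` {(e, J). (a = 0 --> ~ e) & J \<subseteq> {1..m}}"
  then obtain e J where x: "x = tens Pair (bas e) (bas J)" "J \<subseteq> {1..m}" by auto
  show "pP a x : hsp a m"
  proof (cases "a = 0")
   case True
   thus ?thesis by (simp add: x(1) pP_rw pf_def sub_0 del: tens_bas)
  next
   case False
   thus ?thesis using r[of "~ e" J] x(2) sub_scale[OF hsp_subspace]
    by (simp add: x(1) pP_rw del: tens_bas) simp
  qed
 qed
 show "pS (transpose i j) v : hsp a m" if i: "i : {1..m}" "j : {1..m}"
 proof (rule sp[OF clin_pS])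
  fix x assume "x : bas ` {(e, J). (a = 0 --> ~ e) & J \<subseteq> {1..m}}"
  then obtain e J where x: "x = tens Pair (bas e) (bas J)" "a = 0 --> ~ e" "J \<subseteq> {1..m}" by auto
  have f: "finite J" using x(3) by (rule finite_subset) simp
  have "transpose i j ` J \<subseteq> {1..m}" using x(3) i by (auto simp: transpose_def)
  hence "tens Pair (bas e) (cl_perm (transpose i j) J) : hsp a m"
   using x(2) keys_cl_perm[OF inj_transpose f] by (intro rw_hsp) blast+
  thus "pS (transpose i j) x : hsp a m" by (simp add: x(1) pS_rw del: tens_bas)
 qed
qed

lemma hsp_X:
 assumes "v : hsp a m" "i : {1..m}" shows "pX a i v : hsp a m"
proof -
 have "pT a k i v : hsp a m" if "k : {1..<i}" for k
  unfolding pT_def using assms that by (intro sub_diff hsp_closed hsp_subspace) auto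
 thus ?thesis unfolding pX_def
  using assms by (intro sub_diff sub_add sub_scale sub_sum hsp_subspace hsp_closed) auto
qed

lemma sg_rw: "sgo rowpar (tens Pair (bas e) w) = cscale (if e then -1 else 1) (tens Pair (bas e) (sgo clpar w))"
 by (rule clin_eqI[where f="%w. sgo rowpar (tens Pair (bas e) w)"])
   (auto intro!: clin_comp[OF clin_sgo] clin_cscale clin_uminus clin_tens_right clin_comp[OF clin_tens_right] simp: rowpar_def tens_simps)

lemma sg_p:
 assumes "v : pfin"
 shows "sgo rowpar (pC a i v) = - pC a i (sgo rowpar v)" "sgo rowpar (pE i v) = pE i (sgo rowpar v)"
  "sgo rowpar (pP a v) = - pP a (sgo rowpar v)" "inj t ==> sgo rowpar (pS t v) = pS t (sgo rowpar v)"
proof -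
 show "sgo rowpar (pC a i v) = - pC a i (sgo rowpar v)"
 proof (rule pfin_eqI[OF assms, where f="%v. sgo rowpar (pC a i v)"])
  fix e and J :: "nat set" assume "finite J"
  thus "sgo rowpar (pC a i (rw e (bas J))) = - pC a i (sgo rowpar (rw e (bas J)))"
   unfolding sg_rw pC_rw p_simps clin_simps[OF clin_sgo]
   by (simp add: sg_rw pC_rw sgo_cl_c tens_simps clin_simps[OF clin_lin] p_simps del: tens_bas)
 qed (auto intro!: clin_comp[OF clin_sgo] clin_comp[OF clin_pC] clin_uminus)
 show "sgo rowpar (pE i v) = pE i (sgo rowpar v)"
  by (rule poly_mapping_eqI) (simp add: pE_def)
 show "sgo rowpar (pP a v) = - pP a (sgo rowpar v)"
 proof (rule pfin_eqI[OF assms, where f="%v. sgo rowpar (pP a v)"])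
  fix e and J :: "nat set" assume "finite J"
  thus "sgo rowpar (pP a (rw e (bas J))) = - pP a (sgo rowpar (rw e (bas J)))"
   unfolding sg_rw pP_rw p_simps clin_simps[OF clin_sgo]
   by (simp add: pP_rw tens_simps p_simps sg_rw del: tens_bas)
 qed (auto intro!: clin_comp[OF clin_sgo] clin_comp[OF clin_pP] clin_uminus)
 assume t: "inj t"
 show "sgo rowpar (pS t v) = pS t (sgo rowpar v)"
 proof (rule pfin_eqI[OF assms, where f="%v. sgo rowpar (pS t v)"])
  fix e and J :: "nat set" assume J: "finite J"
  have "sgo clpar (cl_perm t J) = lin (cl_perm t) (sgo clpar (bas J))"
   using homog_iff_sgo[of "cl_perm t J" clpar "clpar J"] keys_cl_perm[OF t J]
   by (auto simp: cscale_m1 clin_simps[OF clin_lin])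
  thus "sgo rowpar (pS t (rw e (bas J))) = pS t (sgo rowpar (rw e (bas J)))"
   unfolding sg_rw pS_rw p_simps clin_simps[OF clin_sgo] by simp
 qed (auto intro!: clin_comp[OF clin_sgo] clin_comp[OF clin_pS] clin_uminus)
qed

lemma sgo_pfin [simp]: "v : pfin ==> sgo rowpar v : pfin"
 unfolding pfin_def span_bas_iff by simp

lemma sg_X:
 assumes "v : pfin" shows "sgo rowpar (pX a i v) = pX a i (sgo rowpar v)"
 unfolding pX_def clin_simps[OF clin_sgo] sum.distrib
 using assms by (simp add: sg_p pT_def p_simps clin_simps[OF clin_sgo])

lemma bmodule_hatPhi:
 assumes "0 \<le> a"
 shows "bmodule {1..<seg_len a b} (seg_contents (a, b)) (hsp a (seg_len a b)) rowpar (%g. lin (phi_act a g))"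
proof -
 let ?m = "seg_len a b"
 have kk: "kap (seg_contents (a, b) ! (i - 1)) * kap (seg_contents (a, b) ! (i - 1)) = of_int (q (a + int i - 1))"
  if "i : {1..?m}" for i using that assms nth_seg_contents[of i a b] kap_sq[of "a + int i - 1"] by simp
 have c: "(%i. lin (phi_act a (Gc i))) = pC a" by (simp add: pC_def fun_eq_iff)
 have x: "(%i. lin (phi_act a (Gx i))) = pX a" using pX_phi_act by (auto simp: fun_eq_iff)
 have s: "(%i. lin (phi_act a (Gs i))) = (%i. pS (transpose i (i+1)))" by (simp add: pS_phi_act)
 show ?thesis
  unfolding bmodule_def x c s length_seg_contents
 proof (unfold_locales, goal_cases)
  case (15 i v)
  have "v : pfin" using 15 hsp_pfin by auto
  thus ?case using X_sq[of v i a] 15 kk[of i] by simp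
 next
  case (16) show ?case by simp
 next
  case (21 i)
  have "q (a + int i - 1) ~= q (a + int (i + 1) - 1)" using assms 21 by (subst q_inj) auto
  thus ?case using 21 kk[of i] kk[of "i + 1"] by auto
 next
  case (12 i j v)
  thus ?case by (intro C_anti)
 next
  case (13 i j v)
  thus ?case using hsp_pfin by (intro X_comm') auto
 next
  case (18 i v)
  thus ?case by (intro hsp_closed) auto
 next
  case (19 i v)
  thus ?case using SX[of v i a] hsp_pfin by auto
 qed (auto simp: hsp_closed hsp_X hsp_pfin sg_p sg_X CC XC)
qed

lemma gens_bgens: "gens m = bgens {1..<m} m"
 by (auto simp: gens_def bgens_def agens_def)

lemma clin_linear: "clin f ==> Vector_Spaces.linear cscale cscale f"
 by unfold_locales (auto simp: clin_simps)

interpretation cpair: vector_space_pair "cscale :: complex => 'b vec => 'b vec" "cscale :: complex => 'c vec => 'c vec"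
 by unfold_locales

lemma independent_bas: "~ cvec.dependent (bas ` S)"
proof
 assume "cvec.dependent (bas ` S)"
 then obtain s where s: "s : S" "bas s : cvec.span (bas ` S - {bas s})" by (auto simp: cvec.dependent_def)
 have "(bas ` S - {bas s} :: 'a vec set) = bas ` (S - {s})"
  by (auto simp: inj_on_def intro!: inj_onI) (metis lookup_single_eq lookup_single_not_eq zero_neq_one)
 thus False using s by (simp add: span_bas_iff)
qed

text \<open>For \<open>a = 0\<close> the weight vectors generate, by comparison of dimensions.\<close>

lemma hatPhi_0_simple:
 assumes "0 \<le> b"
 shows "simple (gens (seg_len 0 b)) (hatPhi 0 b)" "~ ungraded_simple (gens (seg_len 0 b)) (hatPhi 0 b)"
proof -
 let ?m = "seg_len 0 b" and ?a = "%g. lin (phi_act 0 g)"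
 have bm: "bmodule {1..<?m} (seg_contents (0, b)) (hsp 0 ?m) rowpar ?a" by (rule bmodule_hatPhi) simp
 interpret bmod "hsp 0 ?m" "sgo rowpar" "%i. ?a (Gx i)" "%i. ?a (Gc i)" ?m
  "%i. kap (seg_contents (0, b) ! (i - 1))" "%i. ?a (Gs i)" "{1..<?m}"
  using bm by (simp add: bmodule_def)
 have m: "1 \<le> ?m" using assms by (simp add: seg_len_def)
 have z: "kap (seg_contents (0, b) ! (i - 1)) = 0 \<longleftrightarrow> i = 1" if "i : {1..?m}" for i
  using that nth_seg_contents[of i 0 b] kap_zero[of "int i - 1"] by auto
 have gen: "eta (%i. ?a (Gc i)) u ` clsp ?m = hsp 0 ?m" if u: "u ~= 0" "homo u" "hw u" for u
 proof -
  let ?f = "eta (%i. ?a (Gc i)) u" and ?S = "{J. J \<subseteq> {1..?m}}"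
  let ?A = "?f ` bas ` ?S"
  have inj: "inj_on ?f (clsp ?m)"
  proof (rule inj_onI)
   fix x y assume "x : clsp ?m" "y : clsp ?m" "?f x = ?f y"
   hence "x - y = 0" using z u sub_diff[OF subspace_clsp]
    by (intro eta_inj[of 1 u]) (auto simp: clin_diff[OF clin_eta])
   thus "x = y" by simp
  qed
  have injb: "inj_on bas ?S" by (rule inj_onI) (metis lookup_single_eq lookup_single_not_eq zero_neq_one)
  have ind: "~ cvec.dependent ?A"
   by (rule cpair.linear_independent_injective_image[OF clin_linear[OF clin_eta] independent_bas])
     (use inj in "simp add: clsp_def")
  have "card ?A = card ?S"
   using card_image[OF injb] card_image[OF inj_on_subset[OF inj], of "bas ` ?S"] by (auto simp: image_subset_iff)
  also have "\<dots> = 2 ^ ?m" using card_Pow[of "{1..?m}"] by (simp add: Pow_def)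
  finally have cA: "card ?A = 2 ^ ?m" .
  let ?T = "bas ` ((%J. (False, J)) ` ?S)"
  have T: "hsp 0 ?m = cvec.span ?T" unfolding hsp_def by (rule arg_cong[where f=cvec.span]) auto
  have fT: "finite ?T" by simp
  have cT: "card ?T \<le> 2 ^ ?m"
   using card_Pow[of "{1..?m}"] card_image_le[of "?S" "%J. bas (False, J)"] by (simp add: Pow_def image_image)
  have sub: "?f ` clsp ?m \<subseteq> hsp 0 ?m" using eta_clsp_mem[OF hw_V[OF u(3)]] by auto
  have span: "cvec.span ?A = ?f ` clsp ?m"
   using cpair.linear_span_image[OF clin_linear[OF clin_eta]] by (simp add: clsp_def)
  have "v : cvec.span ?A" if v: "v : hsp 0 ?m" for v
  proof (rule ccontr)
   assume n: "v \<notin> cvec.span ?A"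
   have "~ cvec.dependent (insert v ?A)" by (rule cvec.independent_insertI[OF n ind])
   moreover have "insert v ?A \<subseteq> cvec.span ?T" using v sub span cvec.span_superset[of ?A] unfolding T[symmetric] by blast
   ultimately have "card (insert v ?A) \<le> card ?T" using cvec.independent_span_bound[OF fT, of "insert v ?A"] by simp
   moreover have "v \<notin> ?A" using n cvec.span_superset[of ?A] by (rule contra_subsetD[rotated])
   moreover have "finite ?A" by simp
   ultimately show False using cA cT by simp
  qed
  thus ?thesis using sub span by auto
 qed
 have ne: "hsp 0 ?m ~= {0}"
 proof -
  have "bas (False, {}) : hsp 0 ?m" unfolding hsp_def by (rule cvec.span_base) auto
  thus ?thesis by (metis lookup_single_eq lookup_zero singletonD zero_neq_one)
 qed
 have as: "asimple" unfolding asimple_def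
 proof (intro conjI ne allI impI)
  fix U assume U: "gsub U"
  show "U = {0} \<or> U = hsp 0 ?m"
  proof (rule ccontr)
   assume n: "~ (U = {0} \<or> U = hsp 0 ?m)"
   then obtain u where u: "u : U" "u ~= 0" "homo u" "hw u" using hw_exists[OF U] by auto
   have UU: "subsp U" "!!i v. i : {1..?m} ==> v : U ==> ?a (Gc i) v : U" "U \<subseteq> hsp 0 ?m"
    using U by (auto simp: gsub_def asub_def)
   interpret U: cliff U "{1..?m}" "%i. ?a (Gc i)"
    by unfold_locales (use UU(1,2) subsetD[OF UU(3)] c_lin in "auto intro!: c_sq c_anti")
   have "eta (%i. ?a (Gc i)) u ` clsp ?m \<subseteq> U"
   proof
    fix w assume "w : eta (%i. ?a (Gc i)) u ` clsp ?m"
    then obtain b where b: "w = eta (%i. ?a (Gc i)) u b" "b : clsp ?m" by (rule imageE)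
    show "w : U" unfolding b(1) using b(2) by (intro U.eta_mem u(1)) (simp add: clsp_iff)
   qed
   thus False using n gen[OF u(2-4)] UU(3) by auto
  qed
 qed
 have se: "simple (bgens {1..<?m} ?m) (hatPhi 0 b)"
  using simple_bmodule(1)[OF bm] as by (simp add: hatPhi_eq)
 thus "simple (gens ?m) (hatPhi 0 b)" by (simp add: gens_bgens)
 have "\<exists>W. asub W & W ~= {0} & W ~= hsp 0 ?m"
  by (rule ungraded_asub[OF as, of 1]) (use z[of 1] z m in simp_all)
 thus "~ ungraded_simple (gens ?m) (hatPhi 0 b)"
  using simple_bmodule(2)[OF bm] by (auto simp: hatPhi_eq gens_bgens)
qed

lemma is_Phi_bmodule:
 assumes "is_Phi a b N" "0 \<le> a"
 obtains V where "N = vmod V rowpar (%g. lin (phi_act a g))"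
  "bmodule {1..<seg_len a b} (seg_contents (a, b)) V rowpar (%g. lin (phi_act a g))"
  "simple (gens (seg_len a b)) N" "a = 0 & 0 \<le> b --> type_Q (gens (seg_len a b)) N"
proof -
 let ?m = "seg_len a b"
 consider "b < a" | "~ b < a" "a = 0" | "~ b < a" "a ~= 0" by auto
 thus ?thesis
 proof cases
  case 1
  hence m: "?m = 0" by (simp add: seg_len_def)
  have sub: "cvec.span {bas (False, {})} \<subseteq> hsp a ?m"
   unfolding hsp_def by (rule cvec.span_mono) auto
  let ?V = "cvec.span {bas (False, {})} :: rowb vec set"
  have N: "N = vmod ?V rowpar (%g. lin (phi_act a g))"
   using assms(1) 1 restr_vmod[OF sub] by (simp add: is_Phi_def hatPhi_eq)
  have V1: "?V = {cscale z (bas (False, {})) |z. True}"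
   unfolding cvec.span_singleton by auto
  have sg: "sgo rowpar v = v" if "v : ?V" for v using that by (auto simp: V1 clin_scale[OF clin_sgo] rowpar_def)
  have bm: "bmodule {1..<?m} (seg_contents (a, b)) ?V rowpar (%g. lin (phi_act a g))"
   unfolding bmodule_def length_seg_contents m by unfold_locales (auto simp: sg)
  have "U = {0} \<or> U = ?V" if UV: "U \<subseteq> ?V" "subsp U" for U
  proof (cases "U = {0}")
   case False
   then obtain w where w: "w : U" "w ~= 0" using sub_0[OF UV(2)] by auto
   then obtain z where z: "cscale z (bas (False, {})) : U" "z ~= 0"
    using UV(1) V1 by force
   have "cscale y (bas (False, {})) : U" for y
    using sub_scale[OF UV(2) z(1), of "y / z"] z(2) by simp
   thus ?thesis using UV(1) z(2) by (auto simp: V1)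
  qed simp
  moreover have "?V ~= {0}"
  proof -
   have "bas (False, {}) : ?V" by (rule cvec.span_base) auto
   thus ?thesis by (metis lookup_single_eq lookup_zero singletonD zero_neq_one)
  qed
  ultimately have "simple (gens ?m) N" unfolding simple_def N by (auto simp: submod_vmod)
  moreover have "a = 0 & 0 \<le> b --> type_Q (gens ?m) N" using 1 by auto
  ultimately show ?thesis by (rule that[OF N bm])
 next
  case 2
  hence N: "N = hatPhi a b" using assms(1) by (simp add: is_Phi_def)
  show ?thesis using that[OF N[unfolded hatPhi_eq] bmodule_hatPhi[OF assms(2)]] 2 hatPhi_0_simple[of b]
   by (simp add: N type_Q_def)
 next
  case 3
  then obtain U where U: "odd_summand (gens ?m) (hatPhi a b) U" "N = restr (hatPhi a b) U"
   using assms(1) by (auto simp: is_Phi_def)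
  hence s: "submod (gens ?m) (hatPhi a b) U" "simple (gens ?m) (restr (hatPhi a b) U)"
   by (auto simp: odd_summand_def simple_submod_def)
  have UV: "U \<subseteq> hsp a ?m" using s(1) by (simp add: hatPhi_eq submod_vmod)
  have N: "N = vmod U rowpar (%g. lin (phi_act a g))" using U(2) restr_vmod[OF UV] by (simp add: hatPhi_eq)
  interpret bmod "hsp a ?m" "sgo rowpar" "%i. lin (phi_act a (Gx i))" "%i. lin (phi_act a (Gc i))" ?m
   "%i. kap (seg_contents (a, b) ! (i - 1))" "%i. lin (phi_act a (Gs i))" "{1..<?m}"
   using bmodule_hatPhi[OF assms(2), of b] by (simp add: bmodule_def)
  have "gsub U" using s(1) unfolding hatPhi_eq submod_vmod[OF hsp_subspace] gens_bgens bgens_def agens_def gsub_def asub_def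
   by auto
  hence bm: "bmodule {1..<?m} (seg_contents (a, b)) U rowpar (%g. lin (phi_act a g))"
   using restrict by (simp add: bmodule_def)
  have "a = 0 & 0 \<le> b --> type_Q (gens ?m) N" "simple (gens ?m) N" using s(2) 3 U(2) by auto
  thus ?thesis by (rule that[OF N bm, rotated])
 qed
qed

section \<open>Outer tensor products\<close>

lemma listpar_snoc: "listpar (bs @ [b]) \<longleftrightarrow> listpar bs ~= rowpar b"
 by (auto simp: listpar_def)

abbreviation sn :: "rowb list vec => rowb vec => rowb list vec" where
 "sn \<equiv> tens snoc"

lemma tens_eqI:
 assumes "!!a v. clin (%u. f u v)" "!!a v. clin (%u. g u v)" "!!u. clin (f u)" "!!u. clin (g u)"
  "!!a b. f (bas a) (bas b) = g (bas a) (bas b)"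
 shows "f u v = g u v"
proof (rule clin_eqI[where f="%u. f u v" and g="%u. g u v"])
 fix a show "f (bas a) v = g (bas a) v"
  by (rule clin_eqI[OF assms(3,4)]) (rule assms(5))
qed (rule assms(1,2))+

lemma tens_nonzero:
 assumes "u ~= 0" "v ~= 0" shows "sn u v ~= 0"
proof -
 obtain a where a: "lk u a ~= 0" using assms(1) by (metis poly_mapping_eqI lookup_zero)
 obtain b where b: "lk v b ~= 0" using assms(2) by (metis poly_mapping_eqI lookup_zero)
 have "lk (lin (%b. bas (snoc a' b)) v) (snoc a b) = (if a' = a then lk v b else 0)" for a'
 proof -
  have "lk (lin (%b. bas (snoc a' b)) v) (snoc a b) = (\<Sum>b'\<in>keys v. if b' = b then (if a' = a then lk v b else 0) else 0)"
   unfolding lin_def lookup_sum by (rule sum.cong) (auto simp: lookup_single when_def)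
  thus ?thesis by (simp add: in_keys_iff)
 qed
 hence "lk (sn u v) (snoc a b) = (\<Sum>a'\<in>keys u. if a' = a then lk u a * lk v b else 0)"
  unfolding tens_def lin_def[of _ u] lookup_sum by (intro sum.cong) auto
 also have "\<dots> = lk u a * lk v b" by (simp add: in_keys_iff)
 finally show ?thesis using a b by auto
qed

lemma sgo_tens: "sgo listpar (sn u v) = sn (sgo listpar u) (sgo rowpar v)"
 by (rule tens_eqI[where f="%u v. sgo listpar (sn u v)"])
   (auto intro!: clin_comp[OF clin_sgo] clin_tens_left clin_tens_right clin_comp[OF clin_tens_left] clin_comp[OF clin_tens_right]
    simp: tens_simps listpar_snoc cscale_m1)

lemma act_left_tens:
 assumes "clin (aM g)"
 shows "lin (act_left (vmod VM pM aM) g) (sn u v) = sn (aM g u) v"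
 by (rule tens_eqI[where f="%u v. lin (act_left (vmod VM pM aM) g) (sn u v)"])
   (auto intro!: clin_tens_left clin_tens_right clin_comp[OF clin_tens_left assms] simp: act_left_def)

lemma act_right_tens:
 assumes "clin (aN g)"
 shows "lin (act_right (vmod VN pN aN) g) (sn u v) = sn (if gpar g then sgo listpar u else u) (aN g v)"
proof (cases "gpar g")
 case True
 have "lin (act_right (vmod VN pN aN) g) (sn u v) = sn (sgo listpar u) (aN g v)"
  by (rule tens_eqI[where f="%u v. lin (act_right (vmod VN pN aN) g) (sn u v)"])
    (use True in "auto intro!: clin_tens_left clin_tens_right clin_comp[OF clin_tens_left clin_sgo]
     clin_comp[OF clin_tens_right assms] simp: act_right_def tens_simps")
 thus ?thesis using True by simp
next
 case False
 have "lin (act_right (vmod VN pN aN) g) (sn u v) = sn u (aN g v)"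
  by (rule tens_eqI[where f="%u v. lin (act_right (vmod VN pN aN) g) (sn u v)"])
    (use False in "auto intro!: clin_tens_left clin_tens_right
     clin_comp[OF clin_tens_right assms] simp: act_right_def")
 thus ?thesis using False by simp
qed

locale outer_setup =
 M: bmod VM "sgo listpar" "%i. aM (Gx i)" "%i. aM (Gc i)" e "%i. kap (zs1 ! (i - 1))" "%i. aM (Gs i)" B +
 N: bmod VN "sgo rowpar" "%i. aN (Gx i)" "%i. aN (Gc i)" m "%i. kap (zs2 ! (i - 1))" "%i. aN (Gs i)" "{1..<m}"
 for VM :: "rowb list vec set" and aM e zs1 B and VN :: "rowb vec set" and aN m zs2 +
 assumes e: "e = length zs1" and m: "m = length zs2"
begin

definition VT :: "rowb list vec set" where
 "VT = cvec.span {sn u v | u v. u : VM & v : VN}"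

definition aT :: "gen => rowb list vec => rowb list vec" where
 "aT g = lin (outer_act e (vmod VM listpar aM) (vmod VN rowpar aN) g)"

lemma outer_eq: "outer e (vmod VM listpar aM) (vmod VN rowpar aN) = vmod VT listpar aT"
 by (simp add: outer_def VT_def aT_def[abs_def])

lemma clin_aT [simp, intro!]: "clin (aT g)"
 by (simp add: aT_def)

lemma aT_left:
 "i \<le> e ==> aT (Gx i) (sn u v) = sn (aM (Gx i) u) v"
 "i \<le> e ==> aT (Gc i) (sn u v) = sn (aM (Gc i) u) v"
 "i < e ==> aT (Gs i) (sn u v) = sn (aM (Gs i) u) v"
 using act_left_tens[of aM] M.x_lin M.c_lin M.s_lin by (simp_all add: aT_def)

lemma aT_right:
 "~ i \<le> e ==> aT (Gx i) (sn u v) = sn u (aN (Gx (i - e)) v)"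
 "~ i \<le> e ==> aT (Gc i) (sn u v) = sn (sgo listpar u) (aN (Gc (i - e)) v)"
 "~ i < e ==> aT (Gs i) (sn u v) = sn u (aN (Gs (i - e)) v)"
 using act_right_tens[of aN] N.x_lin N.c_lin N.s_lin by (simp_all add: aT_def)

lemma VT_sub [simp, intro!]: "subsp VT"
 by (simp add: VT_def)

lemma sn_VT: "u : VM ==> v : VN ==> sn u v : VT"
 unfolding VT_def by (rule cvec.span_base) auto

lemma VT_mem:
 assumes "v : VT" "clin f" "!!u w. u : VM ==> w : VN ==> f (sn u w) : VT"
 shows "f v : VT"
 by (rule clin_span_mem[OF assms(1)[unfolded VT_def] assms(2) VT_sub]) (use assms(3) in auto)

lemma VT_eq:
 assumes "v : VT" "clin f" "clin g" "!!u w. u : VM ==> w : VN ==> f (sn u w) = g (sn u w)"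
 shows "f v = g v"
 by (rule clin_span_eq[OF assms(1)[unfolded VT_def] assms(2,3)]) (use assms(4) in auto)

definition BT :: "nat set" where
 "BT = B \<union> (%i. i + e) ` {1..<m}"

lemma idx: "i : {1..e + m} ==> i \<le> e & i : {1..e} \<or> ~ i \<le> e & i - e : {1..m}"
 by auto

lemma bmod_outer:
 "bmod VT (sgo listpar) (%i. aT (Gx i)) (%i. aT (Gc i)) (e + m) (%i. kap ((zs1 @ zs2) ! (i - 1))) (%i. aT (Gs i)) BT"
proof -
 have k: "kap ((zs1 @ zs2) ! (i - 1)) = (if i \<le> e then kap (zs1 ! (i - 1)) else kap (zs2 ! (i - e - 1)))" if "i : {1..e + m}" for i
  using that by (auto simp: nth_append e)
 note C = clin_comp[OF clin_aT] clin_comp[OF clin_sgo] clin_plus clin_minus clin_uminus clin_cscale clin_aT clin_sgo clin_id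
 have Bi: "i : BT ==> (i < e & i : B) \<or> (~ i \<le> e & ~ i < e & i - e : {1..<m})" for i
  using M.B by (auto simp: BT_def)
 note sgm = M.sg_mem N.sg_mem
 show ?thesis
 proof (unfold_locales, goal_cases)
  case (5 v) show ?case by (rule VT_mem[OF 5]) (auto simp: sgo_tens intro!: sn_VT sgm)
 next
  case (7 i v) show ?case
   by (rule VT_mem[OF 7(2)]) (use idx[OF 7(1)] in "auto simp: aT_left aT_right intro!: sn_VT M.x_mem N.x_mem")
 next
  case (8 i v) show ?case
   by (rule VT_mem[OF 8(2)]) (use idx[OF 8(1)] in "auto simp: aT_left aT_right intro!: sn_VT M.c_mem N.c_mem sgm")
 next
  case (9 i v) show ?case
   by (rule VT_eq[OF 9(2), where f="%v. aT (Gx i) (sgo listpar v)"]; (intro C)?)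
     (use idx[OF 9(1)] in "auto simp: aT_left aT_right sgo_tens M.x_sg N.x_sg")
 next
  case (10 i v) show ?case
   by (rule VT_eq[OF 10(2), where f="%v. aT (Gc i) (sgo listpar v)"]; (intro C)?)
     (use idx[OF 10(1)] in "auto simp: aT_left aT_right sgo_tens M.c_sg N.c_sg tens_simps")
 next
  case (11 i v) show ?case
   by (rule VT_eq[OF 11(2), where f="%v. aT (Gc i) (aT (Gc i) v)"]; (intro C)?)
     (use idx[OF 11(1)] in "auto simp: aT_left aT_right M.c_sq N.c_sq tens_simps")
 next
  case (12 i j v) show ?case
  proof (rule VT_eq[OF 12(4), where f="%v. aT (Gc i) (aT (Gc j) v)"]; (intro C)?)
   fix u w assume uw: "u : VM" "w : VN"
   show "aT (Gc i) (aT (Gc j) (sn u w)) = - aT (Gc j) (aT (Gc i) (sn u w))"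
    using idx[OF 12(1)] idx[OF 12(2)]
   proof (elim disjE conjE)
    assume a: "i \<le> e" "i : {1..e}" "j \<le> e" "j : {1..e}"
    have "aM (Gc i) (aM (Gc j) u) = - aM (Gc j) (aM (Gc i) u)" using a 12(3) uw by (intro M.c_anti)
    thus ?thesis using a by (simp add: aT_left tens_simps)
   next
    assume a: "~ i \<le> e" "i - e : {1..m}" "~ j \<le> e" "j - e : {1..m}"
    have "aN (Gc (i - e)) (aN (Gc (j - e)) w) = - aN (Gc (j - e)) (aN (Gc (i - e)) w)"
     using a 12(3) uw by (intro N.c_anti) auto
    thus ?thesis using a by (simp add: aT_right tens_simps)
   qed (use uw in "simp_all add: aT_left aT_right tens_simps M.c_sg")
  qed
 next
  case (13 i j v) show ?case
  proof (rule VT_eq[OF 13(3), where f="%v. aT (Gx i) (aT (Gx j) v)"]; (intro C)?)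
   fix u w assume uw: "u : VM" "w : VN"
   show "aT (Gx i) (aT (Gx j) (sn u w)) = aT (Gx j) (aT (Gx i) (sn u w))"
    using idx[OF 13(1)] idx[OF 13(2)]
   proof (elim disjE conjE)
    assume a: "i \<le> e" "i : {1..e}" "j \<le> e" "j : {1..e}"
    thus ?thesis using M.x_comm[of i j u] uw by (simp add: aT_left)
   next
    assume a: "~ i \<le> e" "i - e : {1..m}" "~ j \<le> e" "j - e : {1..m}"
    thus ?thesis using N.x_comm[of "i - e" "j - e" w] uw by (simp add: aT_right)
   qed (simp_all add: aT_left aT_right)
  qed
 next
  case (14 i j v)
  have *: "aT (Gx i) (aT (Gc j) (sn u w)) = (if i = j then - aT (Gc j) (aT (Gx i) (sn u w)) else aT (Gc j) (aT (Gx i) (sn u w)))"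
   if uw: "u : VM" "w : VN" for u w
   using idx[OF 14(1)] idx[OF 14(2)]
  proof (elim disjE conjE)
   assume a: "i \<le> e" "i : {1..e}" "j \<le> e" "j : {1..e}"
   thus ?thesis using M.x_c[of i j u] uw by (simp add: aT_left tens_simps)
  next
   assume a: "~ i \<le> e" "i - e : {1..m}" "~ j \<le> e" "j - e : {1..m}"
   hence "i - e = j - e \<longleftrightarrow> i = j" by auto
   thus ?thesis using a N.x_c[of "i - e" "j - e" w] uw by (simp add: aT_right tens_simps)
  qed (use uw M.x_sg in "auto simp: aT_left aT_right")
  show ?case
  proof (cases "i = j")
   case True
   have "aT (Gx i) (aT (Gc j) v) = - aT (Gc j) (aT (Gx i) v)"
    by (rule VT_eq[OF 14(3), where f="%v. aT (Gx i) (aT (Gc j) v)"]; (intro C)?) (use * True in auto)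
   thus ?thesis using True by simp
  next
   case False
   have "aT (Gx i) (aT (Gc j) v) = aT (Gc j) (aT (Gx i) v)"
    by (rule VT_eq[OF 14(3), where f="%v. aT (Gx i) (aT (Gc j) v)"]; (intro C)?) (use * False in auto)
   thus ?thesis using False by simp
  qed
 next
  case (15 i v) show ?case
   by (rule VT_eq[OF 15(2), where f="%v. aT (Gx i) (aT (Gx i) v)"]; (intro C)?)
     (use idx[OF 15(1)] k[OF 15(1)] in "auto simp: aT_left aT_right M.x_sq N.x_sq tens_simps")
 next
  case 16 show ?case using M.B by (fastforce simp: BT_def)
 next
  case (18 i v) show ?case
   by (rule VT_mem[OF 18(2)]) (use Bi[OF 18(1)] in "auto simp: aT_left aT_right intro!: sn_VT M.s_mem N.s_mem")
 next
  case (19 i v) show ?case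
  proof (rule VT_eq[OF 19(2), where f="%v. aT (Gs i) (aT (Gx i) v)"]; (intro C)?)
   fix u w assume uw: "u : VM" "w : VN"
   show "aT (Gs i) (aT (Gx i) (sn u w)) = aT (Gx (i + 1)) (aT (Gs i) (sn u w)) - sn u w + aT (Gc i) (aT (Gc (i + 1)) (sn u w))"
    using Bi[OF 19(1)]
   proof (elim disjE conjE)
    assume a: "i < e" "i : B"
    thus ?thesis using M.s_x[of i u] uw by (simp add: aT_left tens_simps)
   next
    assume a: "~ i \<le> e" "~ i < e" "i - e : {1..<m}"
    have "i - e + 1 = i + 1 - e" using a by auto
    thus ?thesis using a N.s_x[of "i - e" w] uw by (simp add: aT_right tens_simps)
   qed
  qed
 next
  case (20 i v) show ?case
   by (rule VT_eq[OF 20(2), where f="%v. aT (Gs i) (sgo listpar v)"]; (intro C)?)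
     (use Bi[OF 20(1)] in "auto simp: aT_left aT_right sgo_tens M.s_sg N.s_sg")
 next
  case (21 i)
  from Bi[OF 21] show ?case
  proof (elim disjE conjE)
   assume a: "i < e" "i : B"
   hence "i : {1..e + m}" "i + 1 : {1..e + m}" using M.B by auto
   thus ?thesis using a M.k_neq[of i] by (simp only: k) auto
  next
   assume a: "~ i \<le> e" "~ i < e" "i - e : {1..<m}"
   hence i: "i : {1..e + m}" "i + 1 : {1..e + m}" "i + 1 - e - 1 = i - e + 1 - 1" by auto
   thus ?thesis using a N.k_neq[of "i - e"] by (simp only: k) auto
  qed
 qed auto
qed

sublocale T: bmod VT "sgo listpar" "%i. aT (Gx i)" "%i. aT (Gc i)" "e + m"
 "%i. kap ((zs1 @ zs2) ! (i - 1))" "%i. aT (Gs i)" BT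
 by (rule bmod_outer)

lemma kap_right: "i : {1..m} ==> kap ((zs1 @ zs2) ! (e + i - 1)) = kap (zs2 ! (i - 1))"
 by (auto simp: nth_append e)

lemma gsub_from_left:
 assumes U: "T.gsub U" and n: "n : VN" "n ~= 0" "N.homo n" and M: "M.asimple" and N: "N.asimple"
  and m0: "m0 : VM" "m0 ~= 0" "sn m0 n : U"
 shows "U = VT"
proof -
 have UU: "subsp U" "U \<subseteq> VT" "!!i v. i : {1..e+m} ==> v : U ==> aT (Gx i) v : U"
  "!!i v. i : {1..e+m} ==> v : U ==> aT (Gc i) v : U" "!!v. v : U ==> sgo listpar v : U"
  using U by (auto simp: T.gsub_def T.asub_def)
 let ?M = "{u \<in> VM. sn u n : U}"
 have "M.gsub ?M" unfolding M.gsub_def M.asub_def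
 proof (intro conjI ballI)
  show "subsp ?M" by (rule clin_vimage_subspace[OF clin_tens_left UU(1) M.V])
 next
  fix v assume v: "v : ?M"
  have "sn (sgo listpar v) (sgo rowpar n) : U" using UU(5)[of "sn v n"] v by (simp add: sgo_tens)
  hence "sn (sgo listpar v) n : U"
   using n(3) sub_neg[OF UU(1), of "sn (sgo listpar v) (sgo rowpar n)"] by (auto simp: N.homo_def tens_simps)
  thus "sgo listpar v : ?M" using v by (auto intro: M.sg_mem)
  fix i assume i: "i : {1..e}"
  thus "aM (Gx i) v : ?M" using v UU(3)[of i "sn v n"] M.x_mem by (simp add: aT_left)
  show "aM (Gc i) v : ?M" using i v UU(4)[of i "sn v n"] M.c_mem by (simp add: aT_left)
 qed auto
 moreover have "?M ~= {0}" using m0 by auto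
 ultimately have M': "!!u. u : VM ==> sn u n : U" using M unfolding M.asimple_def by blast
 let ?N = "{v \<in> VN. \<forall>u\<in>VM. sn u v : U}"
 have "N.gsub ?N" unfolding N.gsub_def N.asub_def
 proof (intro conjI ballI)
  show "subsp ?N"
   by (rule cvec.subspaceI)
     (auto simp: tens_simps sub_0[OF UU(1)] sub_0[OF N.V] intro!: sub_add UU N.V sub_scale)
 next
  fix v assume v: "v : ?N"
  have "sn u (sgo rowpar v) : U" if "u : VM" for u
   using UU(5)[of "sn (sgo listpar u) v"] v M.sg_mem[OF that] by (simp add: sgo_tens)
  thus "sgo rowpar v : ?N" using v by (auto intro: N.sg_mem)
  fix i assume i: "i : {1..m}"
  have "sn u (aN (Gx i) v) : U" if "u : VM" for u
   using UU(3)[of "e + i" "sn u v"] v that i by (simp add: aT_right)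
  thus "aN (Gx i) v : ?N" using v i by (auto intro: N.x_mem)
  have "sn u (aN (Gc i) v) : U" if "u : VM" for u
   using UU(4)[of "e + i" "sn (sgo listpar u) v"] v M.sg_mem[OF that] i by (simp add: aT_right)
  thus "aN (Gc i) v : ?N" using v i by (auto intro: N.c_mem)
 qed auto
 moreover have "n : ?N" using n M' by auto
 hence "?N ~= {0}" using n(2) by auto
 ultimately have "?N = VN" using N unfolding N.asimple_def by blast
 hence "VT \<subseteq> U" unfolding VT_def by (intro cvec.span_minimal UU(1)) auto
 thus ?thesis using UU(2) by auto
qed

text \<open>Every vector is a combination of the \<open>\<mu>\<^sub>J \<otimes> c\<^sub>J n\<close>; if it has weight \<open>\<kappa>\<close> then only sets \<open>J\<close> of
  indices with vanishing weight occur.\<close>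

definition expa :: "rowb vec => (nat set => rowb list vec) => rowb list vec" where
 "expa n \<mu> = (\<Sum>J\<in>Pow {1..m}. sn (\<mu> J) (eta (%i. aN (Gc i)) n (bas J)))"

lemma expansion:
 assumes N: "N.asimple" and n: "n ~= 0" "N.homo n" "N.hw n" and t: "t : VT"
 shows "\<exists>\<mu>. (\<forall>J. \<mu> J : VM) & t = expa n \<mu>"
 using t unfolding VT_def
proof (induction rule: cvec.span_induct_alt)
 case base
 thus ?case by (intro exI[of _ "%J. 0"]) (simp add: expa_def tens_simps sub_0[OF M.V])
next
 case (step z x y)
 then obtain u v \<mu> where *: "x = sn u v" "u : VM" "v : VN" "\<forall>J. \<mu> J : VM" "y = expa n \<mu>" by auto
 obtain a where a: "a : clsp m" "v = eta (%i. aN (Gc i)) n a" using N.asimple_eta[OF N n(3,2,1)] *(3) by auto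
 have "v = (\<Sum>J\<in>Pow {1..m}. cscale (lk a J) (eta (%i. aN (Gc i)) n (bas J)))"
  unfolding a(2) eta_bas unfolding eta_def by (rule lin_sup) (use a(1) in "auto simp: clsp_iff")
 hence "x = (\<Sum>J\<in>Pow {1..m}. sn (cscale (lk a J) u) (eta (%i. aN (Gc i)) n (bas J)))"
  by (simp add: *(1) tens_simps)
 hence "cscale z x + y = expa n (%J. cscale z (cscale (lk a J) u) + \<mu> J)"
  by (simp add: *(5) expa_def cvec.scale_sum_right tens_simps sum.distrib)
 moreover have "\<forall>J. cscale z (cscale (lk a J) u) + \<mu> J : VM" using * M.V
  by (auto intro!: sub_add sub_scale)
 ultimately show ?case by (intro exI[of _ "%J. cscale z (cscale (lk a J) u) + \<mu> J"] conjI)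
qed

lemma expansion_hw:
 assumes n: "N.hw n" and t: "t = expa n \<mu>" "!!J. \<mu> J : VM" "T.hw t"
  and I: "finite I" "I \<subseteq> {i \<in> {1..m}. kap (zs2 ! (i - 1)) ~= 0}"
 shows "t = expa n (%J. if J \<inter> I = {} then \<mu> J else 0)"
 using I
proof (induction I rule: finite_induct)
 case empty
 thus ?case using t by simp
next
 case (insert i I)
 let ?\<mu> = "%J. if J \<inter> I = {} then \<mu> J else 0" and ?k = "kap (zs2 ! (i - 1))"
 have i: "i : {1..m}" "?k ~= 0" using insert.prems by auto
 have t1: "t = expa n ?\<mu>" using insert by auto
 have "aT (Gx (e + i)) (expa n \<nu>) = cscale ?k (expa n (%J. cscale (if i : J then -1 else 1) (\<nu> J)))" for \<nu>
  unfolding expa_def clin_simps[OF clin_aT] cvec.scale_sum_right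
 proof (rule sum.cong[OF refl])
  fix J assume J: "J : Pow {1..m}"
  have "aN (Gx i) (eta (%i. aN (Gc i)) n (bas J)) = cscale ?k (eta (%i. aN (Gc i)) n (eps i (bas J)))"
   using N.x_eta[OF n, of "bas J" i] J i by auto
  thus "aT (Gx (e + i)) (sn (\<nu> J) (eta (%i. aN (Gc i)) n (bas J))) =
   cscale ?k (sn (cscale (if i : J then -1 else 1) (\<nu> J)) (eta (%i. aN (Gc i)) n (bas J)))"
   using i by (simp add: aT_right tens_simps clin_simps[OF clin_eta])
 qed
 moreover have "aT (Gx (e + i)) t = cscale ?k t"
  using bspec[OF conjunct2[OF t(3)[unfolded T.hw_def]], of "e + i"] i(1) unfolding kap_right[OF i(1)] by simp
 ultimately have "cscale ?k t = cscale ?k (expa n (%J. cscale (if i : J then -1 else 1) (?\<mu> J)))"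
  using arg_cong[OF t1, of "aT (Gx (e + i))"] by (simp only:)
 hence t2: "t = expa n (%J. cscale (if i : J then -1 else 1) (?\<mu> J))" using i(2) by simp
 have "t = cscale (1/2) (t + t)" by (rule poly_mapping_eqI) (simp add: lookup_add)
 also have "t + t = expa n ?\<mu> + expa n (%J. cscale (if i : J then -1 else 1) (?\<mu> J))" using t1 t2 by simp
 also have "cscale (1/2) \<dots> = expa n (%J. if J \<inter> insert i I = {} then \<mu> J else 0)"
  unfolding expa_def cvec.scale_right_distrib cvec.scale_sum_right sum.distrib[symmetric]
  by (rule sum.cong) (auto simp: tens_simps cvec.scale_left_distrib[of "1/2" "1/2", simplified, symmetric])
 finally show ?case .
qed

lemma asimple_outer_M:
 assumes M: "M.asimple" and N: "N.asimple" and nz: "!!i. i : {1..m} ==> kap (zs2 ! (i - 1)) ~= 0"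
 shows "T.asimple"
proof -
 obtain n where n: "n ~= 0" "N.homo n" "N.hw n" using N.hw_exists[OF N.gsub_V] N by (auto simp: N.asimple_def)
 have main: "U = VT" if U: "T.gsub U" "U ~= {0}" for U
 proof -
  obtain u where u: "u : U" "u ~= 0" "T.homo u" "T.hw u" using T.hw_exists[OF U] by auto
  have "u : VT" using u(4) T.hw_V by auto
  then obtain \<mu> where \<mu>: "!!J. \<mu> J : VM" "u = expa n \<mu>" using expansion[OF N n] by blast
  have "u = expa n (%J. if J \<inter> {1..m} = {} then \<mu> J else 0)"
   by (rule expansion_hw[OF n(3) \<mu>(2,1) u(4)]) (use nz in auto)
  also have "\<dots> = (\<Sum>J\<in>Pow {1..m}. if J = {} then sn (\<mu> {}) n else 0)"
   unfolding expa_def by (rule sum.cong) (auto simp: tens_simps)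
  also have "\<dots> = sn (\<mu> {}) n" by simp
  finally have un: "u = sn (\<mu> {}) n" .
  hence "\<mu> {} ~= 0" using u(2) by (auto simp: tens_simps)
  thus ?thesis using gsub_from_left[OF U(1) N.hw_V[OF n(3)] n(1,2) M N, of "\<mu> {}"] \<mu>(1) u(1) un by simp
 qed
 obtain m0 where m0: "m0 : VM" "m0 ~= 0" using M sub_0[OF M.V] by (auto simp: M.asimple_def)
 have "VT ~= {0}"
 proof
  assume z: "VT = {0}"
  have "sn m0 n = 0" using sn_VT[OF m0(1) N.hw_V[OF n(3)]] z by auto
  thus False using tens_nonzero[of m0 n] m0 n by auto
 qed
 thus ?thesis unfolding T.asimple_def using main by blast
qed

text \<open>If \<open>\<kappa>\<^sub>1 = 0\<close> is the only vanishing weight of the second factor, a vector of weight \<open>\<kappa>\<close> is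
  \<open>\<mu> \<otimes> n + \<mu>' \<otimes> c\<^sub>1 n\<close>. The set of pairs \<open>(\<mu>, \<mu>')\<close> is stable under the swap, by \<open>c\<^sub>1\<close>, so that
  \<open>\<mu> + \<mu>'\<close> runs through an ungraded submodule of the first factor.\<close>

lemma asimple_outer_Q:
 assumes M: "M.asimple" and N: "N.asimple" and m1: "1 \<le> m"
  and z: "!!i. i : {1..m} ==> kap (zs2 ! (i - 1)) = 0 \<longleftrightarrow> i = 1"
  and un: "!!U. M.asub U ==> U = {0} \<or> U = VM"
 shows "T.asimple"
proof -
 obtain n where n: "n ~= 0" "N.homo n" "N.hw n" using N.hw_exists[OF N.gsub_V] N by (auto simp: N.asimple_def)
 have nV: "n : VN" using N.hw_V[OF n(3)] .
 have i1: "1 : {1..m}" using m1 by simp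
 define cn where "cn = aN (Gc 1) n"
 have main: "U = VT" if U: "T.gsub U" "U ~= {0}" for U
 proof -
  have UU: "subsp U" "U \<subseteq> VT" "!!i v. i : {1..e+m} ==> v : U ==> aT (Gx i) v : U"
   "!!i v. i : {1..e+m} ==> v : U ==> aT (Gc i) v : U" "!!v. v : U ==> sgo listpar v : U"
   using U by (auto simp: T.gsub_def T.asub_def)
  obtain u where u: "u : U" "u ~= 0" "T.homo u" "T.hw u" using T.hw_exists[OF U] by auto
  have "u : VT" using u(4) T.hw_V by auto
  then obtain \<mu> where \<mu>: "!!J. \<mu> J : VM" "u = expa n \<mu>" using expansion[OF N n] by blast
  have "u = expa n (%J. if J \<inter> {2..m} = {} then \<mu> J else 0)"
   by (rule expansion_hw[OF n(3) \<mu>(2,1) u(4)]) (use z in auto)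
  also have "\<dots> = (\<Sum>J\<in>{{}, {1}}. sn (\<mu> J) (eta (%i. aN (Gc i)) n (bas J)))"
   unfolding expa_def
  proof (rule sum.mono_neutral_cong_right)
   show "{{}, {1}} \<subseteq> Pow {1..m}" using m1 by auto
   show "\<forall>J\<in>Pow {1..m} - {{}, {1}}. sn (if J \<inter> {2..m} = {} then \<mu> J else 0) (eta (%i. aN (Gc i)) n (bas J)) = 0"
   proof
    fix J assume J: "J : Pow {1..m} - {{}, {1}}"
    have "J \<inter> {2..m} ~= {}"
    proof
     assume "J \<inter> {2..m} = {}"
     hence "J \<subseteq> {1}" using J by force
     thus False using J by auto
    qed
    thus "sn (if J \<inter> {2..m} = {} then \<mu> J else 0) (eta (%i. aN (Gc i)) n (bas J)) = 0"
     by (simp add: tens_simps)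
   qed
  qed auto
  also have "\<dots> = sn (\<mu> {}) n + sn (\<mu> {1}) cn" by (simp add: eta_bas cn_def)
  finally have un': "u = sn (\<mu> {}) n + sn (\<mu> {1}) cn" .
  define F where "F = (%a b. a : VM & b : VM & sn a n + sn b cn : U)"
  have Fu: "F (\<mu> {}) (\<mu> {1})" using \<mu> u(1) un' by (simp add: F_def)
  have ccn: "aN (Gc 1) cn = - n" unfolding cn_def by (rule N.c_sq[OF i1 nV])
  have sgc: "sgo rowpar cn = - aN (Gc 1) (sgo rowpar n)" unfolding cn_def using N.c_sg[OF i1 nV] by simp
  have Fadd: "F (a + a') (b + b')" if "F a b" "F a' b'" for a b a' b'
   using that sub_add[OF UU(1), of "sn a n + sn b cn" "sn a' n + sn b' cn"] sub_add[OF M.V]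
   by (simp add: F_def tens_simps algebra_simps)
  have Fscale: "F (cscale t a) (cscale t b)" if "F a b" for a b t
   using that sub_scale[OF UU(1), of "sn a n + sn b cn" t] sub_scale[OF M.V]
   by (simp add: F_def tens_simps cvec.scale_right_distrib)
  have Fsg: "F (sgo listpar a) (- sgo listpar b)" if "F a b" for a b
  proof -
   have "sgo listpar (sn a n + sn b cn) : U" using that UU(5) by (simp add: F_def)
   hence "sn (sgo listpar a) (sgo rowpar n) - sn (sgo listpar b) (aN (Gc 1) (sgo rowpar n)) : U"
    by (simp add: clin_simps[OF clin_sgo] sgo_tens sgc tens_simps)
   hence "sn (sgo listpar a) n - sn (sgo listpar b) cn : U"
    using n(2) sub_neg[OF UU(1), of "sn (sgo listpar a) (sgo rowpar n) - sn (sgo listpar b) (aN (Gc 1) (sgo rowpar n))"]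
    by (auto simp: N.homo_def tens_simps cn_def clin_simps[OF N.c_lin])
   thus ?thesis using that M.sg_mem sub_neg[OF M.V] by (simp add: F_def tens_simps)
  qed
  have Fc: "F (- sgo listpar b) (sgo listpar a)" if "F a b" for a b
  proof -
   have "aT (Gc (e + 1)) (sn a n + sn b cn) : U" using that UU(4)[of "e + 1"] m1 by (simp add: F_def)
   hence "sn (sgo listpar a) cn - sn (sgo listpar b) n : U"
    using ccn by (simp add: clin_simps[OF clin_aT] aT_right cn_def tens_simps)
   thus ?thesis using that M.sg_mem sub_neg[OF M.V] by (simp add: F_def tens_simps)
  qed
  have Fswap: "F b a" if "F a b" for a b
   using Fscale[OF Fsg[OF Fc[OF that]], of "-1"] by (simp add: clin_simps[OF clin_sgo] cscale_m1)
  define G where "G = {a + b | a b. F a b}"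
  have GM: "a + b : VM" if "F a b" for a b using that by (simp add: F_def sub_add[OF M.V])
  have F0: "F 0 0" by (simp add: F_def tens_simps sub_0[OF UU(1)] sub_0[OF M.V])
  have "M.asub G" unfolding M.asub_def
  proof (intro conjI ballI)
   show "subsp G"
   proof (rule cvec.subspaceI)
    show "0 : G" unfolding G_def using F0 by force
   next
    fix v w assume "v : G" "w : G"
    then obtain a b a' b' where "v = a + b" "F a b" "w = a' + b'" "F a' b'" unfolding G_def by blast
    moreover from this have "v + w = (a + a') + (b + b')" by (simp add: algebra_simps)
    ultimately show "v + w : G" unfolding G_def using Fadd by blast
   next
    fix t v assume "v : G"
    then obtain a b where ab: "v = a + b" "F a b" unfolding G_def by blast
    hence "cscale t v = cscale t a + cscale t b" by (simp add: cvec.scale_right_distrib)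
    thus "cscale t v : G" unfolding G_def using Fscale[OF ab(2)] by blast
   qed
   show "G \<subseteq> VM" using GM by (auto simp: G_def)
  next
   fix i v assume i: "i : {1..e}" and "v : G"
   then obtain a b where ab: "v = a + b" "F a b" unfolding G_def by blast
   have "aT (Gx i) (sn a n + sn b cn) : U" "aT (Gc i) (sn a n + sn b cn) : U"
    using UU(3,4)[of i] i ab(2) by (auto simp: F_def)
   hence "F (aM (Gx i) a) (aM (Gx i) b)" "F (aM (Gc i) a) (aM (Gc i) b)"
    using i ab(2) M.x_mem M.c_mem by (auto simp: F_def aT_left clin_simps[OF clin_aT])
   thus "aM (Gx i) v : G" "aM (Gc i) v : G"
    unfolding G_def ab(1) clin_add[OF M.x_lin] clin_add[OF M.c_lin] by blast+
  qed
  hence "G = {0} \<or> G = VM" by (rule un)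
  thus ?thesis
  proof
   assume G: "G = {0}"
   have neg: "b = - a" if "F a b" for a b
   proof -
    have "a + b : G" using that by (auto simp: G_def)
    thus ?thesis using G by (simp add: eq_neg_iff_add_eq_0 add.commute)
   qed
   let ?a = "\<mu> {}" and ?b = "\<mu> {1}"
   have b: "?b = - ?a" by (rule neg[OF Fu])
   have "- sgo listpar ?b = - sgo listpar ?a" by (rule neg[OF Fsg[OF Fu]])
   hence "sgo listpar ?a = - sgo listpar ?a" using b by (simp add: clin_simps[OF clin_sgo])
   hence "sgo listpar ?a + sgo listpar ?a = 0" by (simp add: eq_neg_iff_add_eq_0)
   hence "cscale (1 + 1) (sgo listpar ?a) = 0" by (simp only: cvec.scale_left_distrib cvec.scale_one)
   hence "sgo listpar (sgo listpar ?a) = 0" by (simp add: clin_0[OF clin_sgo])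
   hence "?a = 0" by simp
   thus ?thesis using u(2) un' b by (simp add: tens_simps)
  next
   assume G: "G = VM"
   have Fgg: "F g g" if "g : VM" for g
   proof -
    have "g : G" using that G by simp
    then obtain a b where ab: "g = a + b" "F a b" unfolding G_def by blast
    show ?thesis using Fadd[OF ab(2) Fswap[OF ab(2)]] ab(1) by (simp add: add.commute)
   qed
   obtain g where g: "g : VM" "g ~= 0" using M sub_0[OF M.V] by (auto simp: M.asimple_def)
   have "F g (- g)" using Fsg[OF Fgg[OF M.sg_mem[OF g(1)]]] by simp
   hence "F (g + g) (g + - g)" by (intro Fadd Fgg g(1))
   hence "F (cscale (1/2) (g + g)) (cscale (1/2) 0)" using Fscale by fastforce
   moreover have "cscale (1/2) (g + g) = g" by (rule poly_mapping_eqI) (simp add: lookup_add)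
   ultimately have "sn g n : U" by (simp add: F_def tens_simps)
   thus ?thesis using gsub_from_left[OF U(1) nV n(1,2) M N g] by simp
  qed
 qed
 obtain m0 where m0: "m0 : VM" "m0 ~= 0" using M sub_0[OF M.V] by (auto simp: M.asimple_def)
 have "sn m0 n ~= 0" using tens_nonzero m0 n by auto
 hence "VT ~= {0}" using sn_VT[OF m0(1) nV] by auto
 thus ?thesis unfolding T.asimple_def using main by blast
qed

end

subsection \<open>Iterated products\<close>

definition block_index :: "nat list => nat set" where
 "block_index ds = {i \<in> {1..<sum_list ds}. \<forall>k\<le>length ds. i ~= sum_list (take k ds)}"

lemma block_gens_eq: "block_gens ds = bgens (block_index ds) (sum_list ds)"
 unfolding block_gens_def gens_def bgens_def agens_def block_index_def by auto

lemma sum_list_take_le: "sum_list (take k ds) \<le> sum_list (ds :: nat list)"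
 by (metis append_take_drop_id le_add1 sum_list_append)

lemma block_index_snoc:
 "block_index (ds @ [m]) = block_index ds \<union> (%i. i + sum_list ds) ` {1..<m}"
proof (intro Set.set_eqI iffI)
 fix i assume i: "i : block_index (ds @ [m])"
 have 1: "i ~= sum_list (take k ds)" if "k \<le> length ds" for k
  using i that by (auto simp: block_index_def dest!: spec[of _ k])
 have 2: "i ~= sum_list ds" using 1[of "length ds"] by simp
 show "i : block_index ds \<union> (%i. i + sum_list ds) ` {1..<m}"
 proof (cases "i < sum_list ds")
  case True
  thus ?thesis using i 1 by (auto simp: block_index_def)
 next
  case False
  hence "i = (i - sum_list ds) + sum_list ds" "i - sum_list ds : {1..<m}" using 2 i by (auto simp: block_index_def)
  thus ?thesis by blast
 qed
next
 fix i assume i: "i : block_index ds \<union> (%i. i + sum_list ds) ` {1..<m}"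
 have "i ~= sum_list (take k (ds @ [m]))" if "k \<le> length (ds @ [m])" for k
 proof (cases "k \<le> length ds")
  case True
  thus ?thesis using i sum_list_take_le[of k ds] by (auto simp: block_index_def)
 next
  case False
  thus ?thesis using i that by (auto simp: block_index_def)
 qed
 thus "i : block_index (ds @ [m])" using i by (auto simp: block_index_def)
qed

definition seg_lens :: "(int \<times> int) list => nat list" where
 "seg_lens segs = map (%(a, b). seg_len a b) segs"

definition contents :: "(int \<times> int) list => int list" where
 "contents segs = concat (map seg_contents segs)"

lemma length_contents: "length (contents segs) = sum_list (seg_lens segs)"
 by (induction segs) (auto simp: contents_def seg_lens_def)

lemma is_Phi_product_bmodule:
 assumes "is_Phi_product segs P" "!!s. s : set segs ==> 0 \<le> fst s"
 shows "\<exists>V a. P = vmod V listpar a & bmodule (block_index (seg_lens segs)) (contents segs) V listpar a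
   & simple (block_gens (seg_lens segs)) P"
 using assms
proof (induction rule: is_Phi_product.induct)
 case 1
 let ?V = "cvec.span {bas []} :: rowb list vec set"
 have V1: "?V = {cscale z (bas []) |z. True}" unfolding cvec.span_singleton by auto
 have sg: "sgo listpar v = v" if "v : ?V" for v using that by (auto simp: V1 clin_scale[OF clin_sgo] listpar_def)
 have "bmodule (block_index (seg_lens [])) (contents []) ?V listpar (%g v. 0)"
  unfolding bmodule_def by unfold_locales (auto simp: sg contents_def seg_lens_def block_index_def)
 moreover have "U = {0} \<or> U = ?V" if UV: "U \<subseteq> ?V" "subsp U" for U
 proof (cases "U = {0}")
  case False
  then obtain w where w: "w : U" "w ~= 0" using sub_0[OF UV(2)] by auto
  then obtain z where z: "cscale z (bas []) : U" "z ~= 0" using UV(1) V1 by force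
  have "cscale y (bas []) : U" for y
   using sub_scale[OF UV(2) z(1), of "y / z"] z(2) by simp
  thus ?thesis using UV(1) z(2) by (auto simp: V1)
 qed simp
 moreover have "?V ~= {0}"
 proof -
  have "bas [] : ?V" by (rule cvec.span_base) auto
  thus ?thesis by (metis lookup_single_eq lookup_zero singletonD zero_neq_one)
 qed
 ultimately show ?case unfolding unit_mod_def by (auto simp: simple_def submod_vmod)
next
 case (2 segs M a b N P)
 let ?ds = "seg_lens segs" and ?m = "seg_len a b"
 let ?e = "sum_list ?ds" and ?z1 = "contents segs" and ?z2 = "seg_contents (a, b)"
 have a: "0 \<le> a" using "2.prems"[of "(a, b)"] by simp
 obtain VM aM where M: "M = vmod VM listpar aM" "bmodule (block_index ?ds) ?z1 VM listpar aM" "simple (block_gens ?ds) M"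
  using "2.IH" "2.prems" by force
 obtain VN where N: "N = vmod VN rowpar (%g. lin (phi_act a g))"
  "bmodule {1..<?m} ?z2 VN rowpar (%g. lin (phi_act a g))" "simple (gens ?m) N"
  "a = 0 & 0 \<le> b --> type_Q (gens ?m) N"
  by (rule is_Phi_bmodule[OF "2.hyps"(2) a])
 let ?aN = "%g. lin (phi_act a g)"
 interpret outer_setup VM aM ?e ?z1 "block_index ?ds" VN ?aN ?m ?z2
  unfolding outer_setup_def outer_setup_axioms_def
  using M(2) N(2) by (simp add: bmodule_def length_contents)
 have BT: "BT = block_index (?ds @ [?m])" unfolding BT_def block_index_snoc by simp
 have lens: "seg_lens (segs @ [(a, b)]) = ?ds @ [?m]" "contents (segs @ [(a, b)]) = ?z1 @ ?z2"
  by (simp_all add: seg_lens_def contents_def)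
 have bT: "bmodule (block_index (?ds @ [?m])) (?z1 @ ?z2) VT listpar aT"
  unfolding bmodule_def using bmod_outer[unfolded BT] by (simp add: length_contents)
 have Ms: "M.asimple" using simple_bmodule(1)[OF M(2)] M(1,3) by (simp add: block_gens_eq length_contents)
 have Ns: "N.asimple" using simple_bmodule(1)[OF N(2)] N(1,3) by (simp add: gens_bgens)
 have bg: "block_gens (?ds @ [?m]) = bgens (block_index (?ds @ [?m])) (length (?z1 @ ?z2))"
  by (simp add: block_gens_eq length_contents)
 have P: "if type_Q (block_gens ?ds) M & type_Q (gens ?m) N
   then \<exists>U. odd_summand (block_gens (?ds @ [?m])) (vmod VT listpar aT) U & P = restr (vmod VT listpar aT) U
   else P = vmod VT listpar aT"
  using "2.hyps"(3) unfolding is_circledast_def Let_def seg_lens_def[symmetric] M(1) N(1) outer_eq by simp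
 show ?case
 proof (cases "type_Q (block_gens ?ds) M & type_Q (gens ?m) N")
  case True
  then obtain U where U: "odd_summand (block_gens (?ds @ [?m])) (vmod VT listpar aT) U" "P = restr (vmod VT listpar aT) U"
   using P by auto
  have s: "submod (block_gens (?ds @ [?m])) (vmod VT listpar aT) U" "simple (block_gens (?ds @ [?m])) (restr (vmod VT listpar aT) U)"
   using U(1) by (auto simp: odd_summand_def simple_submod_def)
  have UV: "U \<subseteq> VT" using s(1) by (simp add: submod_vmod)
  have "T.gsub U" using s(1) unfolding submod_vmod[OF VT_sub] bg bgens_def agens_def T.gsub_def T.asub_def
   by (auto simp: length_contents)
  hence "bmodule (block_index (?ds @ [?m])) (?z1 @ ?z2) U listpar aT"
   using T.restrict[unfolded BT] by (simp add: bmodule_def length_contents)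
  thus ?thesis unfolding lens using U(2) s(2) restr_vmod[OF UV] by metis
 next
  case False
  hence P: "P = vmod VT listpar aT" using P by argo
  have "T.asimple"
  proof (cases "a = 0 & 0 \<le> b")
   case True
   hence "~ type_Q (block_gens ?ds) M" using False N(4) by simp
   hence us: "ungraded_simple (block_gens ?ds) M" using M(3) by (simp add: type_Q_def)
   have un: "U = {0} \<or> U = VM" if "M.asub U" for U
    using us simple_bmodule(2)[OF M(2)] that by (simp add: M(1) block_gens_eq length_contents)
   have m1: "1 \<le> ?m" using True unfolding seg_len_def by linarith
   show ?thesis
   proof (rule asimple_outer_Q[OF Ms Ns m1 _ un])
    fix i assume "i : {1..?m}"
    thus "kap (?z2 ! (i - 1)) = 0 \<longleftrightarrow> i = 1"
     using nth_seg_contents[of i a b] kap_zero[of "int i - 1"] True by auto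
   qed
  next
   case nz: False
   show ?thesis
   proof (rule asimple_outer_M[OF Ms Ns])
    fix i assume i: "i : {1..?m}"
    hence "a ~= 0" using nz by (auto simp: seg_len_def)
    thus "kap (?z2 ! (i - 1)) ~= 0"
     using nth_seg_contents[of i a b] kap_zero[of "a + int i - 1"] i a by auto
   qed
  qed
  hence "simple (block_gens (?ds @ [?m])) P"
   unfolding bg P using simple_bmodule(1)[OF bT] by (simp add: length_contents)
  thus ?thesis unfolding lens using P bT by blast
 qed
qed

section \<open>Standard fillings\<close>

locale skew =
 fixes lam mu :: "nat list"
 assumes shape: "shifted_skew_shape lam mu"
begin

definition bx :: "nat => nat => box" where
 "bx i z = (i, i + z)"

definition row :: "nat => nat => bool" where
 "row i z \<longleftrightarrow> 1 \<le> i & i \<le> length lam & mu ! (i - 1) \<le> z & z < lam ! (i - 1)"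

abbreviation Bx where "Bx \<equiv> boxes lam mu"
abbreviation n where "n \<equiv> card Bx"
abbreviation std where "std \<equiv> standard lam mu"

lemma len: "length mu = length lam"
 using shape by (simp add: shifted_skew_shape_def)

lemma boxes_row: "Bx = {bx i z | i z. row i z}"
proof (intro Set.set_eqI iffI)
 fix b assume b: "b : Bx"
 then obtain i j where "b = (i, j)" "1 \<le> i" "i \<le> length lam" "i + mu ! (i - 1) \<le> j" "j < i + lam ! (i - 1)"
  by (auto simp: boxes_def)
 hence "b = bx i (j - i)" "row i (j - i)" by (auto simp: bx_def row_def)
 thus "b : {bx i z | i z. row i z}" by blast
qed (auto simp: boxes_def bx_def row_def)

lemma bx_Bx [simp]: "bx i z : Bx \<longleftrightarrow> row i z"
 unfolding boxes_row by (auto simp: bx_def)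

lemma bx_eq [simp]: "bx i z = bx i' z' \<longleftrightarrow> i = i' & z = z'"
 by (auto simp: bx_def)

lemma content_bx [simp]: "content (bx i z) = int z"
 by (simp add: content_def bx_def)

lemma finite_Bx [simp, intro!]: "finite Bx"
proof -
 have "Bx \<subseteq> (\<Union>i\<in>{1..length lam}. (%z. bx i z) ` {..<lam ! (i - 1)})"
  unfolding boxes_row row_def by auto
 thus ?thesis by (rule finite_subset) auto
qed

lemma Bx_cases: "b : Bx ==> (!!i z. b = bx i z ==> row i z ==> P) ==> P"
 unfolding boxes_row by blast

lemma content_nonneg: "b : Bx ==> 0 \<le> content b"
 by (elim Bx_cases) auto

lemma lam_less:
 assumes "1 \<le> i" "i < i'" "i' \<le> length lam"
 shows "lam ! (i' - 1) + (i' - i) \<le> lam ! (i - 1)"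
proof -
 have s: "sorted_wrt (>) lam" using shape by (simp add: shifted_skew_shape_def)
 have "lam ! (l - 1) + (l - i) \<le> lam ! (i - 1)" if "i + 1 \<le> l" "l \<le> i'" for l
  using that
 proof (induction l rule: dec_induct)
  case base
  thus ?case using sorted_wrt_nth_less[OF s, of "i - 1" i] assms by auto
 next
  case (step l)
  have "lam ! l < lam ! (l - 1)" using sorted_wrt_nth_less[OF s, of "l - 1" l] step assms by auto
  thus ?case using step by (simp add: Suc_diff_le)
 qed
 thus ?thesis using assms by simp
qed

lemma lam_less': "1 \<le> i ==> i < i' ==> i' \<le> length lam ==> lam ! (i' - 1) < lam ! (i - 1)"
 using lam_less[of i i'] by linarith

lemma std_zero: "standard lam mu L ==> b \<notin> boxes lam mu ==> L b = 0"
 unfolding standard_def by blast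

lemma mu_le: "1 \<le> i ==> i < i' ==> i' \<le> length lam ==> mu ! (i' - 1) \<le> mu ! (i - 1)"
proof -
 assume *: "1 \<le> i" "i < i'" "i' \<le> length lam"
 have s: "sorted_wrt (\<ge>) mu" using shape by (simp add: shifted_skew_shape_def)
 show ?thesis using sorted_wrt_nth_less[OF s, of "i - 1" "i' - 1"] * len by auto
qed

lemma mu_Suc: "1 \<le> i ==> i < length lam ==> mu ! i < mu ! (i - 1) \<or> mu ! i = 0"
proof -
 assume *: "1 \<le> i" "i < length lam"
 have "mu ! (i - 1) = mu ! Suc (i - 1) --> mu ! (i - 1) = 0"
  using shape * len unfolding shifted_skew_shape_def by (metis Suc_diff_1 Suc_le_eq One_nat_def zero_less_one order_less_le_trans)
 thus ?thesis using mu_le[of i "i + 1"] * by auto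
qed

text \<open>Convexity of the shape, in terms of rows and contents.\<close>

lemma row_up: "row i z ==> row i' z ==> i < i' ==> row i (z + 1)"
 using lam_less[of i i'] by (auto simp: row_def)

lemma row_between: "row i z ==> row i' z ==> i < l ==> l < i' ==> row l z"
 using lam_less'[of l i'] mu_le[of i l] by (auto simp: row_def)

lemma row_diag_down: "row i z ==> row (i + 1) z ==> 1 \<le> z ==> row (i + 1) (z - 1)"
 using mu_Suc[of i] by (auto simp: row_def)

lemma row_col:
 assumes "row i z" "row i' z'" "i + z = i' + z'" "i + 1 < i'"
 shows "row (i + 1) (z - 1)"
proof -
 have "lam ! (i' - 1) + (i' - (i + 1)) \<le> lam ! i" using lam_less[of "i + 1" i'] assms by (auto simp: row_def)
 thus ?thesis using assms mu_Suc[of i] by (auto simp: row_def)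
qed

definition lbl :: "filling => nat => box" where
 "lbl L i = the_inv_into Bx L i"

lemma lcontent_lbl: "lcontent lam mu L i = content (lbl L i)"
 by (simp add: lcontent_def lbl_def)

lemma std_row_raw:
 assumes "std L" "row i z" "row i z'" "z < z'" shows "L (bx i z) < L (bx i z')"
proof -
 have *: "\<forall>i j j'. (i, j) : Bx --> (i, j') : Bx --> j < j' --> L (i, j) < L (i, j')"
  using assms(1) unfolding standard_def by (elim conjE)
 show ?thesis using *[rule_format, of i "i + z" "i + z'"] assms bx_Bx[of i z] bx_Bx[of i z'] by (simp add: bx_def)
qed

lemma std_col_raw:
 assumes "std L" "row i z" "row i' z'" "i < i'" "i + z = i' + z'" shows "L (bx i z) < L (bx i' z')"
proof -
 have *: "\<forall>i i' j. (i, j) : Bx --> (i', j) : Bx --> i < i' --> L (i, j) < L (i', j)"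
  using assms(1) unfolding standard_def by (elim conjE)
 show ?thesis using *[rule_format, of i "i + z" i'] assms bx_Bx[of i z] bx_Bx[of i' z'] by (simp add: bx_def)
qed

lemma bij_swap: "bij_betw L Bx {1..n} ==> i : {1..<n} ==> bij_betw (swap i L) Bx {1..n}"
 unfolding swap_def
 by (erule bij_betw_trans) (auto intro!: bij_betw_byWitness[where f'="transpose i (i+1)"] simp: transpose_def)

context
 fixes L assumes L: "std L"
begin

lemma std_bij: "bij_betw L Bx {1..n}"
 using L by (simp add: standard_def)

lemma std_inj: "b : Bx ==> b' : Bx ==> L b = L b' \<longleftrightarrow> b = b'"
 using std_bij by (auto simp: bij_betw_def inj_on_def)

lemma std_range: "b : Bx ==> L b : {1..n}"
 using std_bij by (auto simp: bij_betw_def)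

lemma lbl_Bx: "i : {1..n} ==> lbl L i : Bx"
 unfolding lbl_def using std_bij by (intro the_inv_into_into) (auto simp: bij_betw_def)

lemma L_lbl: "i : {1..n} ==> L (lbl L i) = i"
 unfolding lbl_def using std_bij by (intro f_the_inv_into_f) (auto simp: bij_betw_def)

lemma lbl_L: "b : Bx ==> lbl L (L b) = b"
 unfolding lbl_def using std_bij by (intro the_inv_into_f_f) (auto simp: bij_betw_def)

lemmas std_row = std_row_raw[OF L] and std_col = std_col_raw[OF L]

lemma std_diag_step:
 assumes "row i z" "row (i + 1) z"
 shows "L (bx i z) < L (bx i (z + 1))" "L (bx i (z + 1)) < L (bx (i + 1) z)"
proof -
 have u: "row i (z + 1)" using row_up[OF assms] by simp
 show "L (bx i z) < L (bx i (z + 1))" by (rule std_row[OF assms(1) u]) simp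
 show "L (bx i (z + 1)) < L (bx (i + 1) z)" by (rule std_col[OF u assms(2)]) auto
qed

lemma std_diag:
 assumes "row i z" "row i' z" "i < i'"
 shows "L (bx i z) + 2 \<le> L (bx i' z)"
proof -
 have "row l z ==> L (bx i z) + 2 \<le> L (bx l z)" if "i + 1 \<le> l" "l \<le> i'" for l
  using that
 proof (induction l rule: dec_induct)
  case base
  thus ?case using std_diag_step[OF assms(1) base(1)] by linarith
 next
  case (step l)
  have r: "row l z" using step assms by (intro row_between[of i z i' l]) auto
  have "L (bx i z) + 2 \<le> L (bx l z)" using step r by auto
  thus ?case using std_diag_step[of l z] r step.prems by simp
 qed
 thus ?thesis using assms by simp
qed

lemma consec_content_neq:
 assumes "i : {1..<n}"
 shows "content (lbl L i) ~= content (lbl L (i + 1))"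
proof
 assume eq: "content (lbl L i) = content (lbl L (i + 1))"
 obtain a z where a: "lbl L i = bx a z" "row a z" using lbl_Bx[of i] assms by (auto elim: Bx_cases)
 obtain a' z' where a': "lbl L (i + 1) = bx a' z'" "row a' z'" using lbl_Bx[of "i + 1"] assms by (auto elim: Bx_cases)
 have l: "L (bx a z) = i" "L (bx a' z') = i + 1" using L_lbl[of i] L_lbl[of "i + 1"] a a' assms by auto
 have "z = z'" using eq a a' by simp
 thus False using std_diag[of a z a'] std_diag[of a' z a] a a' l by (cases a a' rule: linorder_cases) auto
qed

text \<open>Consecutive labels in boxes of adjacent contents sit in boxes that are neighbours in a row or in
  a column.\<close>

lemma consec_adjacent:
 assumes i: "i : {1..<n}" and a: "lbl L j = bx a z" "row a z" and b: "lbl L j' = bx b (z + 1)" "row b (z + 1)"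
  and j: "j = i & j' = i + 1 \<or> j = i + 1 & j' = i"
 shows "b = a \<or> b + 1 = a"
proof -
 have l: "L (bx a z) = j" "L (bx b (z + 1)) = j'" using L_lbl[of j] L_lbl[of j'] a b i j by auto
 show ?thesis
 proof (rule ccontr)
  assume n: "~ ?thesis"
  then consider "a < b" | "b + 1 < a" by linarith
  thus False
  proof cases
   case 1
   have r: "row a (z + 1)" using a(2) b(2) lam_less[of a b] 1 by (auto simp: row_def)
   have "L (bx a z) < L (bx a (z + 1))" using std_row[OF a(2) r] by simp
   moreover have "L (bx a (z + 1)) + 2 \<le> L (bx b (z + 1))" using std_diag[OF r b(2) 1] .
   ultimately show False using l j by auto
  next
   case 2
   have "mu ! (a - 1 - 1) \<le> mu ! (b - 1)" using mu_le[of b "a - 1"] 2 a(2) b(2) by (auto simp: row_def)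
   moreover have "lam ! (a - 1) + (a - (a - 1)) \<le> lam ! (a - 1 - 1)" using lam_less[of "a - 1" a] 2 a(2) b(2) by (auto simp: row_def)
   ultimately have r: "row (a - 1) (z + 1)" using a(2) b(2) 2 by (auto simp: row_def)
   have "L (bx b (z + 1)) + 2 \<le> L (bx (a - 1) (z + 1))" using std_diag[OF b(2) r] 2 by simp
   moreover have "L (bx (a - 1) (z + 1)) < L (bx a z)" using std_col[OF r a(2)] 2 by simp
   ultimately show False using l j by auto
  qed
 qed
qed

lemmas swap_range = bij_swap[OF std_bij]

lemma swap_less:
 assumes "i : {1..<n}" "b : Bx" "b' : Bx" "L b < L b'" "~ (b = lbl L i & b' = lbl L (i + 1))"
 shows "swap i L b < swap i L b'"
proof -
 have "~ (L b = i & L b' = i + 1)" using assms lbl_L[of b] lbl_L[of b'] by metis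
 thus ?thesis using assms(4) by (auto simp: swap_def transpose_def)
qed

text \<open>The exchange of \<open>i\<close> and \<open>i + 1\<close> leads to a standard filling iff their contents are not adjacent.\<close>

lemma swap_std_iff:
 assumes i: "i : {1..<n}"
 shows "std (swap i L) \<longleftrightarrow> \<bar>content (lbl L i) - content (lbl L (i + 1))\<bar> ~= 1"
proof -
 have ii: "i : {1..n}" "i + 1 : {1..n}" using i by auto
 obtain a z where a: "lbl L i = bx a z" "row a z" using lbl_Bx[OF ii(1)] by (auto elim: Bx_cases)
 obtain b w where b: "lbl L (i + 1) = bx b w" "row b w" using lbl_Bx[OF ii(2)] by (auto elim: Bx_cases)
 have l: "L (bx a z) = i" "L (bx b w) = i + 1" using L_lbl[OF ii(1)] L_lbl[OF ii(2)] a b by auto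
 have sw: "swap i L (bx a z) = i + 1" "swap i L (bx b w) = i" using l by (auto simp: swap_def)
 show ?thesis
 proof
  assume st: "std (swap i L)"
  show "\<bar>content (lbl L i) - content (lbl L (i + 1))\<bar> ~= 1"
  proof
   assume "\<bar>content (lbl L i) - content (lbl L (i + 1))\<bar> = 1"
   then consider "w = z + 1" | "z = w + 1" using a b by force
   thus False
   proof cases
    case 1
    hence "b = a \<or> b + 1 = a" using consec_adjacent[OF i, of i a z "i + 1" b] a b by auto
    thus False
    proof
     assume "b = a"
     hence "swap i L (bx a z) < swap i L (bx b w)"
      using std_row_raw[OF st, of a z "z + 1"] a b 1 by simp
     thus False using sw by simp
    next
     assume "b + 1 = a"
     hence "L (bx b w) < L (bx a z)" using a b 1 by (intro std_col) auto
     thus False using l by simp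
    qed
   next
    case 2
    hence "a = b \<or> a + 1 = b" using consec_adjacent[OF i, of "i + 1" b w i a] a b by auto
    thus False
    proof
     assume "a = b"
     hence "L (bx b w) < L (bx a z)" using std_row[of b w z] a b 2 by auto
     thus False using l by simp
    next
     assume ab: "a + 1 = b"
     hence "a < b" "a + z = b + w" using 2 by auto
     hence "swap i L (bx a z) < swap i L (bx b w)"
      using std_col_raw[OF st a(2) b(2)] by simp
     thus False using sw by simp
    qed
   qed
  qed
 next
  assume n: "\<bar>content (lbl L i) - content (lbl L (i + 1))\<bar> ~= 1"
  have m: "w = z + 1 --> False" "z = w + 1 --> False" using n a b by auto
  show "std (swap i L)" unfolding standard_def
  proof (intro conjI allI impI)
   fix c assume "c \<notin> Bx"
   thus "swap i L c = 0" using std_zero[OF L] i by (simp add: swap_def transpose_def)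
  next
   show "bij_betw (swap i L) Bx {1..n}" by (rule swap_range[OF i])
  next
   fix r j j' assume j: "(r, j) : Bx" "(r, j') : Bx" "j < j'"
   obtain y y' where y: "(r, j) = bx r y" "row r y" "(r, j') = bx r y'" "row r y'" "y < y'"
    using that[of "j - r" "j' - r"] j by (auto simp: boxes_row bx_def)
   have less: "L (bx r y) < L (bx r y')" using y by (intro std_row) auto
   have "~ (bx r y = lbl L i & bx r y' = lbl L (i + 1))"
   proof
    assume e: "bx r y = lbl L i & bx r y' = lbl L (i + 1)"
    hence "y' ~= y + 1" using m a b by auto
    hence "y + 1 < y'" using y by simp
    moreover from this have "row r (y + 1)" using y by (auto simp: row_def)
    ultimately have "L (bx r y) < L (bx r (y + 1))" "L (bx r (y + 1)) < L (bx r y')" using y by (auto intro!: std_row)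
    thus False using e l a b by auto
   qed
   thus "swap i L (r, j) < swap i L (r, j')" unfolding y using less y j by (intro swap_less[OF i]) auto
  next
   fix r r' j assume j: "(r, j) : Bx" "(r', j) : Bx" "r < r'"
   obtain y y' where y: "(r, j) = bx r y" "row r y" "(r', j) = bx r' y'" "row r' y'" "r + y = r' + y'"
    using that[of "j - r" "j - r'"] j by (auto simp: boxes_row bx_def)
   have less: "L (bx r y) < L (bx r' y')" using y j by (intro std_col) auto
   have "~ (bx r y = lbl L i & bx r' y' = lbl L (i + 1))"
   proof
    assume e: "bx r y = lbl L i & bx r' y' = lbl L (i + 1)"
    hence "y ~= y' + 1" using m a b by auto
    hence rr: "r + 1 < r'" using y j by auto
    have r1: "row (r + 1) (y - 1)" using row_col[OF y(2,4,5) rr] .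
    have "L (bx r y) < L (bx (r + 1) (y - 1))" "L (bx (r + 1) (y - 1)) < L (bx r' y')"
     using y r1 rr by (auto intro!: std_col)
    thus False using e l a b by auto
   qed
   thus "swap i L (r, j) < swap i L (r', j)" unfolding y using less y j by (intro swap_less[OF i]) auto
  qed
 qed
qed

text \<open>Contents \<open>a, b, a\<close> at consecutive labels force \<open>a = 0\<close>: otherwise two boxes would have to lie
  between the boxes of content \<open>a\<close>.\<close>

lemma consec_aba:
 assumes i: "1 \<le> i" "i + 2 \<le> n" and eq: "content (lbl L i) = content (lbl L (i + 2))"
 shows "content (lbl L i) = 0"
proof -
 have ii: "i : {1..n}" "i + 2 : {1..n}" using i by auto
 obtain a z where a: "lbl L i = bx a z" "row a z" using lbl_Bx[OF ii(1)] by (auto elim: Bx_cases)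
 obtain b w where b: "lbl L (i + 2) = bx b w" "row b w" using lbl_Bx[OF ii(2)] by (auto elim: Bx_cases)
 have l: "L (bx a z) = i" "L (bx b z) = i + 2" "w = z" using L_lbl[OF ii(1)] L_lbl[OF ii(2)] a b eq by auto
 have ab: "a < b"
 proof (rule ccontr)
  assume "~ a < b"
  moreover have "a ~= b" using l by auto
  ultimately show False using std_diag[of b z a] a b l by auto
 qed
 have "b = a + 1"
 proof (rule ccontr)
  assume "b ~= a + 1"
  hence r: "row (a + 1) z" using row_between[of a z b "a + 1"] a b l ab by auto
  hence "L (bx a z) + 2 \<le> L (bx (a + 1) z)" using a by (intro std_diag) auto
  moreover have "L (bx (a + 1) z) + 2 \<le> L (bx b z)"
   using r b l ab \<open>b ~= a + 1\<close> by (intro std_diag) auto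
  ultimately show False using l by simp
 qed
 have rb: "row (a + 1) z" using b l \<open>b = a + 1\<close> by simp
 have "z = 0"
 proof (rule ccontr)
  assume "z ~= 0"
  hence d: "row (a + 1) (z - 1)" using row_diag_down[OF a(2) rb] by simp
  have u: "row a (z + 1)" using row_up[OF a(2) rb] by simp
  have "L (bx a z) < L (bx (a + 1) (z - 1))" using \<open>z ~= 0\<close> a d by (intro std_col) auto
  moreover have "L (bx (a + 1) (z - 1)) < L (bx (a + 1) z)" using \<open>z ~= 0\<close> d rb by (intro std_row) auto
  moreover note std_diag_step[OF a(2) rb]
  ultimately have "L (bx (a + 1) (z - 1)) = L (bx a (z + 1))" using l \<open>b = a + 1\<close> by simp
  thus False using std_inj[of "bx (a + 1) (z - 1)" "bx a (z + 1)"] d u by simp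
 qed
 thus ?thesis using a by simp
qed

end

text \<open>A standard filling is determined by its sequence of contents, since the labels increase along
  each diagonal.\<close>

lemma contents_inj:
 assumes L: "std L" and L': "std L'" and eq: "!!i. i : {1..n} ==> content (lbl L i) = content (lbl L' i)"
 shows "L = L'"
proof -
 have "lbl L i = lbl L' i" if "i : {1..n}" for i
  using that
 proof (induction i rule: less_induct)
  case (less i)
  have key: False
   if A: "std A" and A': "std A'" and IH: "!!j. j < i ==> j : {1..n} ==> lbl A j = lbl A' j"
    and a: "lbl A i = bx a z" "row a z" and b: "lbl A' i = bx b z" "row b z" and ab: "a < b" for A A' a b z
  proof -
   have m: "A' (bx a z) : {1..n}" using std_range[OF A'] a by simp
   have lt: "A' (bx a z) < i" using std_diag[OF A' a(2) b(2) ab] L_lbl[OF A' less.prems] b by simp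
   have "lbl A (A' (bx a z)) = bx a z" using IH[OF lt m] lbl_L[OF A', of "bx a z"] a by simp
   hence "A (bx a z) = A' (bx a z)" using L_lbl[OF A m] by simp
   moreover have "A (bx a z) = i" using L_lbl[OF A less.prems] a by simp
   ultimately show False using lt by simp
  qed
  obtain a z where a: "lbl L i = bx a z" "row a z" using lbl_Bx[OF L less.prems] by (auto elim: Bx_cases)
  obtain b w where b: "lbl L' i = bx b w" "row b w" using lbl_Bx[OF L' less.prems] by (auto elim: Bx_cases)
  have w: "w = z" using eq[OF less.prems] a b by simp
  have "a = b"
   using key[OF L L', of a z b] key[OF L' L, of b z a] a b w less.IH by (cases a b rule: linorder_cases) auto
  thus ?case using a b w by simp
 qed
 hence e: "L b = L' b" if "b : Bx" for b
  using lbl_L[OF L that] L_lbl[OF L', of "L b"] std_range[OF L that] by metis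
 show ?thesis
 proof
  fix b show "L b = L' b" using e[of b] std_zero[OF L] std_zero[OF L'] by (cases "b : Bx") auto
 qed
qed

abbreviation kp where "kp \<equiv> kappa lam mu"

lemma kp_sq: "std L ==> i : {1..n} ==> kp i L * kp i L = real_of_int (q (content (lbl L i)))"
 using q_nonneg[OF content_nonneg[OF lbl_Bx]] by (simp add: kappa_def lcontent_lbl)

lemma kp_nonneg: "0 \<le> kp i L \<or> ~ std L \<or> i \<notin> {1..n}"
 using q_nonneg[OF content_nonneg[OF lbl_Bx]] by (auto simp: kappa_def lcontent_lbl)

lemma kp_kap: "complex_of_real (kp i L) = kap (content (lbl L i))"
 by (simp add: kappa_def kap_def lcontent_lbl)

lemma kp_eq_iff:
 assumes "std L" "std L'" "i : {1..n}" "j : {1..n}"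
 shows "kp i L = kp j L' \<longleftrightarrow> content (lbl L i) = content (lbl L' j)"
 using kap_inj[OF content_nonneg[OF lbl_Bx[OF assms(1,3)]] content_nonneg[OF lbl_Bx[OF assms(2,4)]]]
 unfolding kp_kap[symmetric] by simp

lemma kp_ne:
 assumes "std L" "i : {1..<n}"
 shows "kp i L ~= kp (i+1) L" "kp i L + kp (i+1) L ~= 0"
proof -
 have ii: "i : {1..n}" "i + 1 : {1..n}" using assms by auto
 show ne: "kp i L ~= kp (i+1) L" using consec_content_neq[OF assms] kp_eq_iff[OF assms(1,1) ii] by simp
 show "kp i L + kp (i+1) L ~= 0" using ne kp_nonneg[of i L] kp_nonneg[of "i+1" L] assms(1) ii by auto
qed

text \<open>With \<open>m = a - b\<close> and \<open>s = a + b + 1\<close> the quantity under the root is \<open>(m\<^sup>2 - 1)(s\<^sup>2 - 1) / (m s)\<^sup>2\<close>.\<close>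

lemma Y_radicand:
 assumes "std L" "i : {1..<n}"
 defines "a \<equiv> content (lbl L i)" and "b \<equiv> content (lbl L (i+1))"
 shows "1 - 1 / (kp (i+1) L - kp i L)\<^sup>2 - 1 / (kp (i+1) L + kp i L)\<^sup>2 =
  of_int (((a - b)\<^sup>2 - 1) * ((a + b + 1)\<^sup>2 - 1)) / (of_int ((a - b) * (a + b + 1)))\<^sup>2"
proof -
 have ii: "i : {1..n}" "i + 1 : {1..n}" using assms by auto
 let ?x = "kp i L" and ?y = "kp (i+1) L"
 let ?A = "real_of_int a" and ?B = "real_of_int b"
 have ne: "?y - ?x ~= 0" "?y + ?x ~= 0" using kp_ne[OF assms(1,2)] by auto
 have sq: "?x\<^sup>2 = ?A * (?A + 1)" "?y\<^sup>2 = ?B * (?B + 1)"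
  using kp_sq[OF assms(1) ii(1)] kp_sq[OF assms(1) ii(2)] unfolding a_def b_def q_def by (simp_all add: power2_eq_square)
 have "(?y - ?x) * (?y + ?x) = ?y\<^sup>2 - ?x\<^sup>2" by (simp add: algebra_simps power2_eq_square)
 also have "\<dots> = (?B - ?A) * (?A + ?B + 1)" unfolding sq by (simp add: algebra_simps)
 finally have pr: "(?y - ?x) * (?y + ?x) = (?B - ?A) * (?A + ?B + 1)" .
 have nz: "(?B - ?A) * (?A + ?B + 1) ~= 0" using ne pr by (metis mult_eq_0_iff)
 have "1 / (?y - ?x)\<^sup>2 + 1 / (?y + ?x)\<^sup>2 = (2 * (?x\<^sup>2 + ?y\<^sup>2)) / ((?y - ?x) * (?y + ?x))\<^sup>2"
 proof -
  have "1 / u\<^sup>2 + 1 / v\<^sup>2 = (u\<^sup>2 + v\<^sup>2) / (u * v)\<^sup>2" if "u ~= 0" "v ~= 0" for u v :: real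
   using that by (simp add: field_simps)
  moreover have "(?y - ?x)\<^sup>2 + (?y + ?x)\<^sup>2 = 2 * (?x\<^sup>2 + ?y\<^sup>2)" by (simp add: power2_eq_square algebra_simps)
  ultimately show ?thesis using ne by simp
 qed
 also have "\<dots> = (2 * (?A * (?A + 1) + ?B * (?B + 1))) / ((?B - ?A) * (?A + ?B + 1))\<^sup>2" unfolding pr sq ..
 finally have "1 - 1 / (?y - ?x)\<^sup>2 - 1 / (?y + ?x)\<^sup>2 =
  1 - (2 * (?A * (?A + 1) + ?B * (?B + 1))) / ((?B - ?A) * (?A + ?B + 1))\<^sup>2" by simp
 also have "\<dots> = (((?B - ?A) * (?A + ?B + 1))\<^sup>2 - 2 * (?A * (?A + 1) + ?B * (?B + 1))) / ((?B - ?A) * (?A + ?B + 1))\<^sup>2"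
  using nz by (simp add: diff_divide_distrib)
 also have "((?B - ?A) * (?A + ?B + 1))\<^sup>2 - 2 * (?A * (?A + 1) + ?B * (?B + 1)) = ((?A - ?B)\<^sup>2 - 1) * ((?A + ?B + 1)\<^sup>2 - 1)"
  by (simp add: power2_eq_square algebra_simps)
 also have "((?B - ?A) * (?A + ?B + 1))\<^sup>2 = ((?A - ?B) * (?A + ?B + 1))\<^sup>2"
  by (simp add: power2_eq_square algebra_simps)
 finally show ?thesis by simp
qed

lemma Y_facts:
 assumes "std L" "i : {1..<n}"
 shows "1 / (kp (i+1) L - kp i L)\<^sup>2 + 1 / (kp (i+1) L + kp i L)\<^sup>2 + (Y lam mu i L)\<^sup>2 = 1"
  and "std (swap i L) \<longleftrightarrow> Y lam mu i L ~= 0"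
proof -
 let ?a = "content (lbl L i)" and ?b = "content (lbl L (i+1))"
 have ii: "i : {1..n}" "i + 1 : {1..n}" using assms by auto
 have ab: "?a ~= ?b" "0 \<le> ?a" "0 \<le> ?b" using consec_content_neq[OF assms] content_nonneg lbl_Bx assms(1) ii by auto
 have m: "1 \<le> (?a - ?b)\<^sup>2" using ab(1) by (simp add: int_one_le_iff_zero_less)
 have s: "4 \<le> (?a + ?b + 1)\<^sup>2" using ab power_mono[of 2 "?a + ?b + 1" 2] by simp
 have nn: "0 \<le> ((?a - ?b)\<^sup>2 - 1) * ((?a + ?b + 1)\<^sup>2 - 1)" using m s by (intro mult_nonneg_nonneg) auto
 have d: "(?a - ?b) * (?a + ?b + 1) ~= 0" using ab by auto
 let ?r = "1 - 1 / (kp (i+1) L - kp i L)\<^sup>2 - 1 / (kp (i+1) L + kp i L)\<^sup>2"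
 have r: "?r = of_int (((?a - ?b)\<^sup>2 - 1) * ((?a + ?b + 1)\<^sup>2 - 1)) / (of_int ((?a - ?b) * (?a + ?b + 1)))\<^sup>2"
  by (rule Y_radicand[OF assms])
 have "0 \<le> ?r" unfolding r using nn by (intro divide_nonneg_nonneg) (auto simp only: of_int_0_le_iff zero_le_power2)
 thus "1 / (kp (i+1) L - kp i L)\<^sup>2 + 1 / (kp (i+1) L + kp i L)\<^sup>2 + (Y lam mu i L)\<^sup>2 = 1"
  by (simp add: Y_def)
 have "Y lam mu i L = 0 \<longleftrightarrow> ?r = 0" by (simp add: Y_def)
 also have "\<dots> \<longleftrightarrow> ((?a - ?b)\<^sup>2 - 1) * ((?a + ?b + 1)\<^sup>2 - 1) = 0"
  unfolding r using d by (simp only: divide_eq_0_iff of_int_eq_0_iff power_eq_0_iff) auto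
 also have "\<dots> \<longleftrightarrow> (?a - ?b)\<^sup>2 = 1" using s by auto
 also have "\<dots> \<longleftrightarrow> \<bar>?a - ?b\<bar> = 1" by (simp add: power2_eq_1_iff abs_if) linarith
 finally show "std (swap i L) \<longleftrightarrow> Y lam mu i L ~= 0" using swap_std_iff[OF assms] by simp
qed

lemma lbl_swap:
 assumes "bij_betw L Bx {1..n}" "i : {1..<n}" "j : {1..n}"
 shows "lbl (swap i L) j = lbl L (transpose i (i+1) j)"
proof -
 have j: "transpose i (i+1) j : {1..n}" using assms by (auto simp: transpose_def)
 have "L (lbl L (transpose i (i+1) j)) = transpose i (i+1) j"
  unfolding lbl_def using assms(1) j by (intro f_the_inv_into_f) (auto simp: bij_betw_def)
 hence "swap i L (lbl L (transpose i (i+1) j)) = j" by (simp add: swap_def)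
 moreover have "lbl L (transpose i (i+1) j) : Bx"
  unfolding lbl_def using assms(1) j by (intro the_inv_into_into) (auto simp: bij_betw_def)
 ultimately show ?thesis using the_inv_into_f_f[of "swap i L" Bx "lbl L (transpose i (i+1) j)"]
   bij_swap[OF assms(1,2)] by (auto simp: lbl_def[of "swap i L"] bij_betw_def)
qed

lemma kp_swap: "bij_betw L Bx {1..n} ==> i : {1..<n} ==> j : {1..n} ==> kp j (swap i L) = kp (transpose i (i+1) j) L"
 by (simp add: kappa_def lcontent_lbl lbl_swap)

lemma swap_swap [simp]: "swap i (swap i L) = L"
 by (auto simp: swap_def fun_eq_iff)

end

section \<open>The module \<open>\<hat>H\<close>\<close>

abbreviation em :: "filling => nat set vec => hatb vec" where
 "em L a \<equiv> tens Pair a (bas L)"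

lemma clin_hat_c [simp, intro!]: "clin (hat_c i)"
 by (simp add: hat_c_def)

lemma hat_c_em: "hat_c i (em L a) = em L (lin (cl_c i) a)"
 by (rule clin_eqI[where f="%a. hat_c i (em L a)"])
   (auto intro!: clin_comp[OF clin_hat_c] clin_comp[OF clin_tens_left] clin_tens_left simp: hat_c_def)

lemma em_bas: "bas (J, L) = em L (bas J)"
 by simp

lemma hat_eqI:
 assumes "clin f" "clin g" "!!L J. f (em L (bas J)) = g (em L (bas J))"
 shows "f v = g v"
 by (rule clin_eqI[OF assms(1,2)]) (metis assms(3) em_bas prod.exhaust)

lemma hat_c_sq: "hat_c i (hat_c i v) = - v"
 by (rule hat_eqI[where f="%v. hat_c i (hat_c i v)"])
   (auto intro!: clin_comp[OF clin_hat_c] clin_uminus simp: hat_c_em cl_c_sq tens_simps simp del: tens_bas)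

lemma hat_c_anti: "i ~= j ==> hat_c i (hat_c j v) = - hat_c j (hat_c i v)"
 by (rule hat_eqI[where f="%v. hat_c i (hat_c j v)"])
   (auto intro!: clin_comp[OF clin_hat_c] clin_uminus simp: hat_c_em cl_c_anti[of i j] tens_simps simp del: tens_bas)

lemma hat_cliff: "cliff UNIV UNIV hat_c"
 by unfold_locales (auto simp: hat_c_sq intro: hat_c_anti)

lemma hat_cliff_perm: "inj s ==> cliff UNIV UNIV (%j. hat_c (s j))"
 by (rule cliff.reindex[OF hat_cliff]) auto

lemma sgo_em: "sgo (%(J, L). clpar J) (em L a) = em L (sgo clpar a)"
 by (rule clin_eqI[where f="%a. sgo (%(J, L). clpar J) (em L a)"])
   (auto intro!: clin_comp[OF clin_sgo] clin_comp[OF clin_tens_left] clin_tens_left simp: tens_simps cscale_m1)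

lemma cscale_diff_eq: "u - v = w ==> cscale a u = cscale a v + cscale a w"
 by (auto simp: cvec.scale_right_diff_distrib)

context skew
begin

abbreviation "hx i \<equiv> hat_act lam mu (Gx i)"
abbreviation "hs i \<equiv> hat_act lam mu (Gs i)"
abbreviation hpar :: "hatb => bool" where "hpar \<equiv> (%(J, L). clpar J)"
abbreviation kc :: "nat => filling => complex" where "kc i L \<equiv> complex_of_real (kp i L)"
abbreviation one :: "filling => hatb vec" where "one L \<equiv> em L (bas {})"
abbreviation "tr i \<equiv> transpose i (i+1)"

definition V0 :: "hatb vec set" where
 "V0 = cvec.span (bas ` {(J, L). J \<subseteq> {1..n} & std L})"

lemma hatH_eq: "hatH lam mu = vmod V0 hpar (hat_act lam mu)"
proof -
 have "{bas (J, L) | J L. J \<subseteq> {1..n} & std L} = bas ` {(J, L). J \<subseteq> {1..n} & std L}" by auto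
 thus ?thesis by (simp add: hatH_def V0_def)
qed

lemma V0_sub [simp, intro!]: "subsp V0"
 by (simp add: V0_def)

lemma clin_hat_act [simp, intro!]: "clin (hat_act lam mu g)"
 by (cases g) auto

lemma hx_em: "hx i (em L a) = cscale (kc i L) (em L (eps i a))"
 by (rule clin_eqI[where f="%a. hx i (em L a)"])
   (auto intro!: clin_comp[OF clin_hat_act] clin_cscale clin_comp[OF clin_tens_left] clin_tens_left simp: tens_simps cscale_m1
    simp del: hat_act.simps, auto)

lemma hs_em: "hs i (em L a) = eta (%j. hat_c (tr i j)) (hat_sv lam mu i L) a"
 by (rule clin_eqI[where f="%a. hs i (em L a)"])
   (auto intro!: clin_comp[OF clin_hat_act] clin_tens_left simp del: hat_act.simps, auto simp: eta_bas)

lemma em_V0: "a : clsp n ==> std L ==> em L a : V0"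
 by (rule clin_span_mem[of a "bas ` {J. J \<subseteq> {1..n}}", OF _ clin_tens_left])
   (auto simp: clsp_def V0_def intro!: cvec.span_base)

lemma one_V0: "std L ==> one L : V0"
 by (rule em_V0) auto

lemma V0_mem:
 assumes "v : V0" "clin f" "subsp W" "!!L J. std L ==> J \<subseteq> {1..n} ==> f (em L (bas J)) : W"
 shows "f v : W"
 by (rule clin_span_mem[OF assms(1)[unfolded V0_def] assms(2,3)]) (use assms(4) in auto)

lemma V0_eqI:
 assumes "v : V0" "clin f" "clin g" "!!L a. std L ==> a : clsp n ==> f (em L a) = g (em L a)"
 shows "f v = g v"
 by (rule clin_span_eq[OF assms(1)[unfolded V0_def] assms(2,3)]) (use assms(4)[of _ "bas _"] in auto)

lemma hc_V0: "i : {1..n} ==> v : V0 ==> hat_c i v : V0"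
 by (rule V0_mem[OF _ clin_hat_c V0_sub]) (auto simp: hat_c_em simp del: tens_bas intro!: em_V0 cl_c_clsp[where a="bas _", simplified lin_bas])

lemma hx_V0: "v : V0 ==> hx i v : V0"
proof (rule V0_mem[OF _ clin_hat_act V0_sub])
 fix L J assume "std L" "J \<subseteq> {1..n}"
 thus "hx i (em L (bas J)) : V0" unfolding hx_em
  by (intro sub_scale V0_sub em_V0) (simp_all del: sgo_bas)
qed

lemma V0_generated:
 assumes Z: "subsp Z" and 1: "!!L. std L ==> one L : Z"
  and c: "!!j v. j : {1..n} ==> v : Z ==> hat_c j v : Z" and v: "v : V0"
 shows "v : Z"
proof -
 have "em L (bas J) : Z" if "finite J" "J \<subseteq> {1..n}" "std L" for J L
  using that
 proof (induction J rule: finite_induct)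
  case empty thus ?case using 1 by simp
 next
  case (insert j J)
  have "hat_c j (em L (bas J)) = cscale (cl_sign j J) (em L (bas (insert j J)))"
   using insert.hyps by (simp add: hat_c_em cl_c_alt tens_simps del: tens_bas)
  hence "cscale (cl_sign j J) (hat_c j (em L (bas J))) = em L (bas (insert j J))" by simp
  moreover have "hat_c j (em L (bas J)) : Z" using insert by (intro c) auto
  ultimately show ?case using sub_scale[OF Z, of "hat_c j (em L (bas J))" "cl_sign j J"] by simp
 qed
 thus ?thesis using V0_mem[OF v clin_id Z] finite_subset[OF _ finite_atLeastAtMost] by blast
qed

lemma hx_c: "hx i (hat_c j v) = (if i = j then - hat_c j (hx i v) else hat_c j (hx i v))"
proof (cases "i = j")
 case True
 have "hx i (hat_c i v) = - hat_c i (hx i v)"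
  by (rule hat_eqI[where f="%v. hx i (hat_c i v)"])
    (auto intro!: clin_comp[OF clin_hat_act] clin_comp[OF clin_hat_c] clin_uminus
     simp: hat_c_em hx_em clin_simps[OF clin_hat_c] eps_cl_c[of i i "bas _", simplified lin_bas] tens_simps clin_simps[OF clin_lin]
     simp del: tens_bas hat_act.simps)
 thus ?thesis using True by simp
next
 case False
 have "hx i (hat_c j v) = hat_c j (hx i v)"
  by (rule hat_eqI[where f="%v. hx i (hat_c j v)"])
    (use False in \<open>auto intro!: clin_comp[OF clin_hat_act] clin_comp[OF clin_hat_c]
     simp: hat_c_em hx_em clin_simps[OF clin_hat_c] eps_cl_c[of i j "bas _", simplified lin_bas] tens_simps clin_simps[OF clin_lin]
     simp del: tens_bas hat_act.simps\<close>)
 thus ?thesis using False by simp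
qed

lemma hx_comm: "hx i (hx j v) = hx j (hx i v)"
proof -
 have e: "eps i (eps j a) = eps j (eps i a)" for a by (rule poly_mapping_eqI) simp
 show ?thesis
  by (rule hat_eqI[where f="%v. hx i (hx j v)"])
    (auto intro!: clin_comp[OF clin_hat_act] simp: hx_em clin_simps[OF clin_hat_act] e[of "bas _"] mult.commute
    simp del: tens_bas hat_act.simps sgo_bas)
qed

lemma hs_c:
 assumes "v : V0" shows "hs i (hat_c j v) = hat_c (tr i j) (hs i v)"
proof (rule V0_eqI[OF assms])
 fix L a assume "std L" "a : clsp n"
 interpret cliff UNIV UNIV "%j. hat_c (tr i j)" by (rule hat_cliff_perm) simp
 show "hs i (hat_c j (em L a)) = hat_c (tr i j) (hs i (em L a))"
  unfolding hat_c_em hs_em using clsp_finite[OF \<open>a : clsp n\<close>] by (intro eta_cl_c) auto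
qed (auto intro!: clin_comp[OF clin_hat_act] clin_comp[OF clin_hat_c] simp del: hat_act.simps)

definition al :: "nat => filling => complex" where "al i L = 1 / (kc (i+1) L - kc i L)"
definition be :: "nat => filling => complex" where "be i L = 1 / (kc (i+1) L + kc i L)"
definition yy :: "nat => filling => complex" where "yy i L = complex_of_real (Y lam mu i L)"

lemma yy_std: "std L ==> i : {1..<n} ==> std (swap i L) \<longleftrightarrow> yy i L ~= 0"
 using Y_facts(2) by (simp add: yy_def)

lemma yy_sq:
 assumes "std L" "i : {1..<n}" shows "al i L * al i L + be i L * be i L + yy i L * yy i L = 1"
proof -
 have "al i L * al i L + be i L * be i L + yy i L * yy i L =
  complex_of_real (1 / (kp (i+1) L - kp i L)\<^sup>2 + 1 / (kp (i+1) L + kp i L)\<^sup>2 + (Y lam mu i L)\<^sup>2)"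
  by (simp add: al_def be_def yy_def power2_eq_square)
 thus ?thesis unfolding Y_facts(1)[OF assms] by simp
qed

lemma hs_one:
 assumes "std L" "i : {1..<n}"
 shows "hs i (one L) = cscale (al i L) (one L) + cscale (be i L) (hat_c i (hat_c (i+1) (one L))) + cscale (yy i L) (one (swap i L))"
 unfolding hs_em eta_empty hat_sv_def using yy_std[OF assms] by (auto simp: al_def be_def yy_def)

lemma hs_V0:
 assumes "i : {1..<n}" "v : V0" shows "hs i v : V0"
proof -
 have "v : {v \<in> V0. hs i v : V0}"
 proof (rule V0_generated[OF clin_vimage_subspace[OF clin_hat_act V0_sub V0_sub] _ _ assms(2)])
  fix L assume L: "std L"
  have "cscale (yy i L) (one (swap i L)) : V0"
  proof (cases "yy i L = 0")
   case True
   thus ?thesis by (simp add: sub_0)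
  next
   case False
   hence "std (swap i L)" using yy_std[OF L assms(1)] by simp
   thus ?thesis by (intro sub_scale V0_sub one_V0)
  qed
  moreover have "cscale (al i L) (one L) + cscale (be i L) (hat_c i (hat_c (i+1) (one L))) : V0"
   using one_V0[OF L] assms(1) by (intro sub_add V0_sub sub_scale hc_V0) auto
  ultimately have "hs i (one L) : V0" unfolding hs_one[OF L assms(1)] by (rule sub_add[OF V0_sub, rotated])
  thus "one L : {v \<in> V0. hs i v : V0}" using one_V0[OF L] by simp
 next
  fix j v assume j: "j : {1..n}" and "v : {v \<in> V0. hs i v : V0}"
  moreover have "tr i j : {1..n}" using j assms(1) by (auto simp: transpose_def)
  ultimately show "hat_c j v : {v \<in> V0. hs i v : V0}" using hs_c[of v i j] hc_V0 by (auto simp del: hat_act.simps)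
 qed
 thus ?thesis by simp
qed

text \<open>The operator that permutes the Clifford generators and the labels, and the part of \<open>s\<^sub>i\<close> that keeps
  the filling.\<close>

definition tau :: "(nat => nat) => hatb vec => hatb vec" where
 "tau s = lin (%(J, L). em (%x. s (L x)) (cl_perm s J))"

lemma clin_tau [simp, intro!]: "clin (tau s)"
 by (simp add: tau_def)

lemma tau_em: "tau s (em L a) = em (%x. s (L x)) (lin (cl_perm s) a)"
 by (rule clin_eqI[where f="%a. tau s (em L a)"])
   (auto intro!: clin_comp[OF clin_tau] clin_comp[OF clin_tens_left] clin_tens_left, auto simp: tau_def)

lemma swap_tr: "(%x. transpose i (Suc i) (L x)) = swap i L" "(%x. tr i (L x)) = swap i L"
 by (simp_all add: swap_def comp_def)

definition Bo :: "nat => hatb vec => hatb vec" where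
 "Bo i v = hx i v + hx (i+1) v - hat_c i (hat_c (i+1) (hx i v - hx (i+1) v))"

lemma clin_Bo [simp, intro!]: "clin (Bo i)"
 unfolding Bo_def
 by (intro clin_minus clin_plus clin_comp[OF clin_hat_c] clin_hat_act)

lemma Bo_c: "Bo i (hat_c j v) = hat_c (tr i j) (Bo i v)"
proof -
 consider "j = i" | "j = i + 1" | "j ~= i" "j ~= i + 1" by auto
 thus ?thesis
 proof cases
  case 1
  have "hat_c i (hat_c (i+1) (hat_c i w)) = hat_c (i+1) w" for w
   using hat_c_anti[of "i+1" i w] by (simp add: clin_simps[OF clin_hat_c] hat_c_sq)
  moreover have "hat_c (i+1) (hat_c i (hat_c (i+1) w)) = hat_c i w" for w
   using hat_c_anti[of i "i+1" w] by (simp add: clin_simps[OF clin_hat_c] hat_c_sq)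
  ultimately show ?thesis using 1
   by (simp add: Bo_def hx_c clin_simps[OF clin_hat_c] hat_c_sq del: hat_act.simps)
 next
  case 2
  thus ?thesis
   by (simp add: Bo_def hx_c clin_simps[OF clin_hat_c] hat_c_sq del: hat_act.simps)
 next
  case 3
  have "hat_c i (hat_c (i+1) (hat_c j w)) = hat_c j (hat_c i (hat_c (i+1) w))" for w
   using hat_c_anti[of "i+1" j w] hat_c_anti[of i j "hat_c (i+1) w"] 3 by (simp add: clin_simps[OF clin_hat_c])
  thus ?thesis using 3
   by (simp add: Bo_def hx_c clin_simps[OF clin_hat_c] del: hat_act.simps)
 qed
qed

lemma tau_c:
 assumes "inj s" "a : clsp d"
 shows "tau s (hat_c j (em L a)) = hat_c (s j) (tau s (em L a))"
proof -
 have "lin (cl_perm s) (lin (cl_c j) a) = lin (cl_c (s j)) (lin (cl_perm s) a)"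
  by (rule clin_eqI[where f="%a. lin (cl_perm s) (lin (cl_c j) a)"])
    (use assms clsp_finite[OF assms(2)] in "auto simp: cl_perm_c")
 thus ?thesis by (simp add: hat_c_em tau_em)
qed

lemma hs_formula:
 assumes L: "std L" and i: "i : {1..<n}" and a: "a : clsp n"
 shows "hs i (em L a) = cscale (1 / (kc (i+1) L * kc (i+1) L - kc i L * kc i L)) (Bo i (em L a))
   + cscale (yy i L) (tau (tr i) (em L a))"
proof -
 let ?g = "1 / (kc (i+1) L * kc (i+1) L - kc i L * kc i L)"
 let ?f = "%a. cscale ?g (Bo i (em L a)) + cscale (yy i L) (tau (tr i) (em L a))"
 have ne: "kc (i+1) L - kc i L ~= 0" "kc (i+1) L + kc i L ~= 0"
  using kp_ne[OF L i] by (auto simp flip: of_real_add of_real_diff)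
 have pr: "kc (i+1) L * kc (i+1) L - kc i L * kc i L = (kc (i+1) L - kc i L) * (kc (i+1) L + kc i L)"
  by (simp add: algebra_simps)
 have g: "?g * (kc i L + kc (i+1) L) = al i L" "?g * (kc (i+1) L - kc i L) = be i L"
  unfolding pr al_def be_def using ne by (simp_all add: add.commute)
 have "?f a = eta (%j. hat_c (tr i j)) (?f (bas {})) a"
 proof (rule eta_unique[where I="{1..n}"])
  show "clin ?f" by (intro clin_plus clin_cscale clin_comp[OF clin_Bo] clin_comp[OF clin_tau] clin_tens_left)
  fix j J assume J: "j : {1..n}" "J \<subseteq> {1..n}" "finite J"
  have "?f (cl_c j J) = cscale ?g (Bo i (hat_c j (em L (bas J)))) + cscale (yy i L) (tau (tr i) (hat_c j (em L (bas J))))"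
   by (simp add: hat_c_em del: tens_bas)
  also have "\<dots> = hat_c (tr i j) (?f (bas J))"
   using tau_c[of "tr i" "bas J" n j L] J by (simp add: Bo_c clin_simps[OF clin_hat_c] del: tens_bas)
  finally show "?f (cl_c j J) = hat_c (tr i j) (?f (bas J))" .
 next
  show "!!J. J : keys a ==> finite J & J \<subseteq> {1..n}" using clsp_finite[OF a] by blast
 qed
 moreover have "?f (bas {}) = hat_sv lam mu i L"
 proof -
  have "Bo i (one L) = cscale (kc i L + kc (i+1) L) (one L) + cscale (kc (i+1) L - kc i L) (hat_c i (hat_c (i+1) (one L)))"
   by (simp add: Bo_def hx_em clin_simps[OF clin_hat_c] cvec.scale_left_distrib cvec.scale_left_diff_distrib del: tens_bas hat_act.simps)
  moreover have "tau (tr i) (one L) = one (swap i L)"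
   unfolding tau_em swap_tr by (simp add: cl_perm_def)
  ultimately have "?f (bas {}) = cscale (al i L) (one L) + cscale (be i L) (hat_c i (hat_c (i+1) (one L))) + cscale (yy i L) (one (swap i L))"
   by (simp only: cvec.scale_right_distrib cvec.scale_scale g)
  thus ?thesis using hs_one[OF L i] by (simp only: hs_em eta_empty)
 qed
 ultimately show ?thesis unfolding hs_em by simp
qed

lemma hx_tau:
 assumes "std L" "i : {1..<n}" "j : {1..n}" "a : clsp n"
 shows "hx (tr i j) (tau (tr i) (em L a)) = tau (tr i) (hx j (em L a))"
proof -
 have tj: "tr i j : {1..n}" using assms by (auto simp: transpose_def)
 have "eps (tr i j) (lin (cl_perm (tr i)) a) = lin (cl_perm (tr i)) (eps j a)"
 proof (rule clin_eqI[where f="%a. eps (tr i j) (lin (cl_perm (tr i)) a)"])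
  fix J assume "J : keys a"
  thus "eps (tr i j) (lin (cl_perm (tr i)) (bas J)) = lin (cl_perm (tr i)) (eps j (bas J))"
   using eps_cl_perm[of "tr i" J j] clsp_finite[OF assms(4)] by simp
 qed (auto intro!: clin_comp[OF clin_sgo])
 moreover have "kp (tr i j) (swap i L) = kp j L"
  using kp_swap[OF std_bij[OF assms(1)] assms(2) tj] by simp
 ultimately show ?thesis
  by (simp only: hx_em tau_em swap_tr clin_scale[OF clin_tau])
qed

lemma hx_clsp: "std L ==> a : clsp n ==> \<exists>b\<in>clsp n. hx j (em L a) = em L b"
 by (intro bexI[of _ "cscale (kc j L) (eps j a)"]) (auto simp: hx_em tens_simps sub_scale simp del: hat_act.simps)

lemma hs_x:
 assumes i: "i : {1..<n}" and v: "v : V0"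
 shows "hs i (hx i v) = hx (i+1) (hs i v) - v + hat_c i (hat_c (i+1) v)"
proof (rule V0_eqI[OF v, where f="%v. hs i (hx i v)"])
 fix L a assume L: "std L" and a: "a : clsp n"
 let ?v = "em L a" and ?j = "i + 1"
 define D where "D = kc ?j L * kc ?j L - kc i L * kc i L"
 have d: "D ~= 0" unfolding D_def
  using kp_ne[OF L i] by (auto simp flip: of_real_mult of_real_diff simp: square_eq_iff eq_neg_iff_add_eq_0 add.commute)
 obtain b where b: "b : clsp n" "hx i ?v = em L b" using hx_clsp[OF L a] by blast
 have t: "hx ?j (tau (tr i) ?v) = tau (tr i) (hx i ?v)"
  using hx_tau[OF L i _ a, of i] i by (simp add: transpose_def del: hat_act.simps)
 have sq: "hx k (hx k ?v) = cscale (kc k L * kc k L) ?v" for k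
  by (simp add: hx_em clin_simps[OF clin_hat_act] del: hat_act.simps)
 have "hs i (hx i ?v) = cscale (1 / D) (Bo i (hx i ?v)) + cscale (yy i L) (tau (tr i) (hx i ?v))"
  unfolding b(2) D_def by (rule hs_formula[OF L i b(1)])
 moreover have "hx ?j (hs i ?v) = cscale (1 / D) (hx ?j (Bo i ?v)) + cscale (yy i L) (tau (tr i) (hx i ?v))"
  unfolding hs_formula[OF L i a] D_def by (simp only: clin_add[OF clin_hat_act] clin_scale[OF clin_hat_act] t)
 moreover have "Bo i (hx i ?v) - hx ?j (Bo i ?v) = cscale (- D) ?v + cscale D (hat_c i (hat_c ?j ?v))"
  unfolding Bo_def clin_simps[OF clin_hat_act] clin_simps[OF clin_hat_c] hx_c
  using hx_comm[of ?j i ?v]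
  by (simp add: clin_simps[OF clin_hat_c] sq cvec.scale_left_diff_distrib D_def del: hat_act.simps)
 hence "cscale (1 / D) (Bo i (hx i ?v)) = cscale (1 / D) (hx ?j (Bo i ?v)) + cscale (1 / D) (cscale (- D) ?v + cscale D (hat_c i (hat_c ?j ?v)))"
  by (rule cscale_diff_eq)
 ultimately show "hs i (hx i ?v) = hx ?j (hs i ?v) - ?v + hat_c i (hat_c ?j ?v)"
  using d by (simp add: cvec.scale_right_distrib cvec.scale_right_diff_distrib del: hat_act.simps)
qed (intro clin_comp[OF clin_hat_act] clin_hat_act clin_plus clin_minus clin_comp[OF clin_hat_c] clin_hat_c clin_id)+

lemma hs_x_far:
 assumes i: "i : {1..<n}" and j: "j : {1..n}" "j ~= i" "j ~= i + 1" and v: "v : V0"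
 shows "hs i (hx j v) = hx j (hs i v)"
proof (rule V0_eqI[OF v, where f="%v. hs i (hx j v)"])
 fix L a assume L: "std L" and a: "a : clsp n"
 obtain b where b: "b : clsp n" "hx j (em L a) = em L b" using hx_clsp[OF L a] by blast
 have t: "hx j (tau (tr i) (em L a)) = tau (tr i) (hx j (em L a))"
  using hx_tau[OF L i j(1) a] j by (simp add: transpose_def del: hat_act.simps)
 have B: "Bo i (hx j w) = hx j (Bo i w)" for w
  unfolding Bo_def clin_simps[OF clin_hat_act] hx_comm[of j] hx_c using j
  by (simp add: hx_c clin_simps[OF clin_hat_c] clin_simps[OF clin_hat_act] hx_comm[of j] del: hat_act.simps)
 show "hs i (hx j (em L a)) = hx j (hs i (em L a))"
  unfolding hs_formula[OF L i a] clin_add[OF clin_hat_act] clin_scale[OF clin_hat_act] t B[symmetric]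
  unfolding b(2) by (rule hs_formula[OF L i b(1)])
qed (intro clin_comp[OF clin_hat_act] clin_hat_act)+

end

context skew
begin

lemma kc_swap:
 assumes "bij_betw L Bx {1..n}" "i : {1..<n}"
 shows "kc i (swap i L) = kc (i+1) L" "kc (i+1) (swap i L) = kc i L"
  "j : {1..n} ==> j ~= i ==> j ~= i + 1 ==> kc j (swap i L) = kc j L"
 using kp_swap[OF assms, of i] kp_swap[OF assms, of "i+1"] kp_swap[OF assms, of j] assms(2)
 by (auto simp: transpose_def)

definition yf :: "real => real => complex" where
 "yf x y = complex_of_real (sqrt (1 - 1 / (y - x)\<^sup>2 - 1 / (y + x)\<^sup>2))"

lemma yf_sym: "yf x y = yf y x"
 by (simp add: yf_def power2_commute add.commute)

lemma yy_yf: "yy i L = yf (kp i L) (kp (i+1) L)"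
 by (simp add: yy_def Y_def yf_def)

lemma swap_vals:
 assumes "bij_betw L Bx {1..n}" "i : {1..<n}"
 shows "al i (swap i L) = - al i L" "be i (swap i L) = be i L" "yy i (swap i L) = yy i L"
proof -
 have k: "kp i (swap i L) = kp (i+1) L" "kp (i+1) (swap i L) = kp i L"
  using kc_swap(1,2)[OF assms] by (simp_all only: of_real_eq_iff)
 show "yy i (swap i L) = yy i L" unfolding yy_yf k by (rule yf_sym)
 show "al i (swap i L) = - al i L" unfolding al_def k by (metis minus_diff_eq minus_divide_right)
 show "be i (swap i L) = be i L" unfolding be_def k by (simp add: add.commute)
qed

lemma scale_yy_hs_one:
 assumes "std L" "j : {1..<n}" "i : {1..<n}"
 shows "cscale (yy j L) (hs i (one (swap j L))) = cscale (yy j L) (cscale (al i (swap j L)) (one (swap j L)) +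
  cscale (be i (swap j L)) (hat_c i (hat_c (i+1) (one (swap j L)))) + cscale (yy i (swap j L)) (one (swap i (swap j L))))"
proof (cases "yy j L = 0")
 case False
 hence "std (swap j L)" using yy_std[OF assms(1,2)] by simp
 thus ?thesis by (simp only: hs_one[OF _ assms(3)])
qed (simp del: hat_act.simps)

lemma hs_cc: "v : V0 ==> i : {1..<n} ==> hs i (hat_c i (hat_c (i+1) v)) = - hat_c i (hat_c (i+1) (hs i v))"
 using hs_c[of "hat_c (i+1) v" i i] hs_c[of v i "i+1"] hat_c_anti[of "i+1" i "hs i v"] hc_V0[of "i+1" v]
 by (simp del: hat_act.simps)

lemma clin_hs_hs: "clin (%v. hs i (hs j v))"
 by (rule clin_comp[OF clin_hat_act clin_hat_act])

lemma V0_eq_one: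
 assumes f: "clin f" and g: "clin g" and one: "!!L. std L ==> f (one L) = g (one L)"
  and c: "!!j v. j : {1..n} ==> v : V0 ==> \<exists>j'. f (hat_c j v) = hat_c j' (f v) & g (hat_c j v) = hat_c j' (g v)"
  and v: "v : V0"
 shows "f v = g v"
proof -
 let ?Z = "{v \<in> V0. f v - g v : {0}}"
 have "v : ?Z"
 proof (rule V0_generated[OF clin_vimage_subspace[OF clin_minus[OF f g]] _ _ v])
  fix j v assume j: "j : {1..n}" "v : ?Z"
  then obtain j' where "f (hat_c j v) = hat_c j' (f v)" "g (hat_c j v) = hat_c j' (g v)" using c by blast
  thus "hat_c j v : ?Z" using j hc_V0 by simp
 qed (use one one_V0 in auto)
 thus ?thesis by simp
qed

lemma hs_sq:
 assumes "v : V0" "i : {1..<n}" shows "hs i (hs i v) = v"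
proof (rule V0_eq_one[OF clin_hs_hs clin_id _ _ assms(1)])
 fix L assume L: "std L"
 note b = std_bij[OF L]
 have oV: "one L : V0" by (rule one_V0[OF L])
 note ho = hs_one[OF L assms(2)]
 have "hs i (hs i (one L)) = cscale (al i L) (hs i (one L)) + cscale (be i L) (hs i (hat_c i (hat_c (i+1) (one L))))
   + cscale (yy i L) (hs i (one (swap i L)))"
  using arg_cong[OF ho, of "hs i"] by (simp only: clin_add[OF clin_hat_act] clin_scale[OF clin_hat_act])
 also have "\<dots> = cscale (al i L * al i L + be i L * be i L + yy i L * yy i L) (one L)"
 proof -
  have e: "hat_c i (hat_c (i+1) (hat_c i (hat_c (i+1) w))) = - w" for w
   using hat_c_anti[of "i+1" i "hat_c (i+1) w"] by (simp add: hat_c_sq clin_neg[OF clin_hat_c])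
  show ?thesis
   unfolding hs_cc[OF oV assms(2)] scale_yy_hs_one[OF L assms(2,2)] ho swap_vals[OF b assms(2)] swap_swap
    clin_add[OF clin_hat_c] clin_scale[OF clin_hat_c] e
   by (rule poly_mapping_eqI) (simp add: lookup_add algebra_simps del: tens_bas)
 qed
 finally show "hs i (hs i (one L)) = one L" unfolding yy_sq[OF L assms(2)] by simp
next
 fix j v assume "j : {1..n}" "v : V0"
 hence "hs i (hs i (hat_c j v)) = hat_c j (hs i (hs i v))"
  using hs_c[of v i j] hs_c[of "hs i v" i "tr i j"] hs_V0[OF assms(2)] by (simp del: hat_act.simps)
 thus "\<exists>j'. hs i (hs i (hat_c j v)) = hat_c j' (hs i (hs i v)) & hat_c j v = hat_c j' v" by blast
qed

lemma hs_far:
 assumes "v : V0" "i : {1..<n}" "j : {1..<n}" "i + 1 < j"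
 shows "hs i (hs j v) = hs j (hs i v)"
proof (rule V0_eq_one[OF clin_hs_hs clin_hs_hs _ _ assms(1)])
 fix L assume L: "std L"
 note b = std_bij[OF L]
 have oV: "one L : V0" by (rule one_V0[OF L])
 have ij: "i ~= j" "i + 1 ~= j" "j + 1 ~= i" "j + 1 ~= i + 1" using assms(4) by auto
 have vi: "al i (swap j L) = al i L" "be i (swap j L) = be i L" "yy i (swap j L) = yy i L"
  using kc_swap(3)[OF b assms(3), of i] kc_swap(3)[OF b assms(3), of "i+1"] assms
  by (auto simp: al_def be_def yy_yf)
 have vj: "al j (swap i L) = al j L" "be j (swap i L) = be j L" "yy j (swap i L) = yy j L"
  using kc_swap(3)[OF b assms(2), of j] kc_swap(3)[OF b assms(2), of "j+1"] assms
  by (auto simp: al_def be_def yy_yf)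
 have c1: "hs i (hat_c j (hat_c (j+1) (one L))) = hat_c j (hat_c (j+1) (hs i (one L)))"
  using hs_c[of "hat_c (j+1) (one L)" i j] hs_c[OF oV, of i "j+1"] hc_V0[OF _ oV, of "j+1"] assms
  by (simp add: transpose_def del: hat_act.simps tens_bas)
 have c2: "hs j (hat_c i (hat_c (i+1) (one L))) = hat_c i (hat_c (i+1) (hs j (one L)))"
  using hs_c[of "hat_c (i+1) (one L)" j i] hs_c[OF oV, of j "i+1"] hc_V0[OF _ oV, of "i+1"] assms
  by (simp add: transpose_def del: hat_act.simps tens_bas)
 have cc: "hat_c j (hat_c (j+1) (hat_c i (hat_c (i+1) w))) = hat_c i (hat_c (i+1) (hat_c j (hat_c (j+1) w)))" for w
  using ij hat_c_anti[of "j+1" i "hat_c (i+1) w"] hat_c_anti[of "j" i "hat_c (j+1) (hat_c (i+1) w)"]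
   hat_c_anti[of "j+1" "i+1" w] hat_c_anti[of "j" "i+1" "hat_c (j+1) w"]
  by (simp add: clin_simps[OF clin_hat_c])
 have sw: "swap j (swap i L) = swap i (swap j L)"
  using ij by (auto simp: swap_def fun_eq_iff transpose_def)
 show "hs i (hs j (one L)) = hs j (hs i (one L))"
  unfolding hs_one[OF L assms(2)] hs_one[OF L assms(3)] clin_add[OF clin_hat_act] clin_scale[OF clin_hat_act]
   c1 c2 scale_yy_hs_one[OF L assms(2,3)] scale_yy_hs_one[OF L assms(3,2)] vi vj sw
   clin_add[OF clin_hat_c] clin_scale[OF clin_hat_c] cc
  by (rule poly_mapping_eqI) (simp add: lookup_add algebra_simps del: tens_bas)
next
 fix k v assume k: "k : {1..n}" "v : V0"
 have "tr i (tr j k) = tr j (tr i k)" using assms(4) by (auto simp: transpose_def)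
 thus "\<exists>j'. hs i (hs j (hat_c k v)) = hat_c j' (hs i (hs j v)) & hs j (hs i (hat_c k v)) = hat_c j' (hs j (hs i v))"
  using hs_c[OF k(2)] hs_c[of "hs j v" i "tr j k"] hs_c[of "hs i v" j "tr i k"] hs_V0[OF _ k(2)] assms(2,3)
  by (intro exI[of _ "tr i (tr j k)"]) (simp del: hat_act.simps)
qed

subsection \<open>The braid relation\<close>

definition Q :: "nat => filling => complex => complex => complex => complex => hatb vec" where
 "Q i M a b c e = cscale a (one M) + cscale b (hat_c i (hat_c (i+1) (one M)))
   + cscale c (hat_c (i+1) (hat_c (i+2) (one M))) + cscale e (hat_c i (hat_c (i+2) (one M)))"

lemma Q_add: "Q i M a b c e + Q i M a' b' c' e' = Q i M (a + a') (b + b') (c + c') (e + e')"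
 by (simp add: Q_def cvec.scale_left_distrib algebra_simps del: tens_bas)

lemma Q_zero: "Q i M 0 0 0 0 = 0"
 by (simp add: Q_def)

lemma c_sort: "hat_c (i+1) (hat_c i v) = - hat_c i (hat_c (i+1) v)"
 "hat_c (i+2) (hat_c i v) = - hat_c i (hat_c (i+2) v)"
 "hat_c (i+2) (hat_c (i+1) v) = - hat_c (i+1) (hat_c (i+2) v)"
 by (rule hat_c_anti, simp)+

lemma hs_Q1:
 assumes "std M \<or> a = 0 & b = 0 & c = 0 & e = 0" "i : {1..<n}" "i + 1 : {1..<n}"
 shows "hs i (Q i M a b c e) =
   Q i M (a * al i M + b * be i M) (a * be i M - b * al i M) (e * al i M - c * be i M) (c * al i M + e * be i M)
  + Q i (swap i M) (yy i M * a) (yy i M * (- b)) (yy i M * e) (yy i M * c)"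
proof (cases "std M")
 case False
 thus ?thesis using assms by (simp add: Q_zero clin_0[OF clin_hat_act] del: hat_act.simps)
next
 case M: True
 let ?v = "one M"
 have oV: "?v : V0" by (rule one_V0[OF M])
 have cV: "hat_c (i+1) ?v : V0" "hat_c (i+2) ?v : V0" using assms oV by (auto intro!: hc_V0 simp del: tens_bas)
 have t: "tr i i = i+1" "tr i (i+1) = i" "tr i (i+2) = i+2" by (auto simp: transpose_def)
 have c: "hs i (hat_c i (hat_c (i+1) ?v)) = hat_c (i+1) (hat_c i (hs i ?v))"
  "hs i (hat_c (i+1) (hat_c (i+2) ?v)) = hat_c i (hat_c (i+2) (hs i ?v))"
  "hs i (hat_c i (hat_c (i+2) ?v)) = hat_c (i+1) (hat_c (i+2) (hs i ?v))"
  by (simp_all only: hs_c[OF cV(1)] hs_c[OF cV(2)] hs_c[OF oV] t)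
 show ?thesis
  unfolding Q_def clin_add[OF clin_hat_act] clin_scale[OF clin_hat_act] c hs_one[OF M assms(2)]
  by (rule poly_mapping_eqI)
    (simp only: clin_add[OF clin_hat_c] clin_scale[OF clin_hat_c] clin_neg[OF clin_hat_c] c_sort hat_c_sq minus_minus
      cvec.scale_minus_right lookup_add lookup_minus lookup_uminus lookup_cscale, simp add: algebra_simps del: tens_bas)
qed

lemma hs_Q2:
 assumes "std M \<or> a = 0 & b = 0 & c = 0 & e = 0" "i : {1..<n}" "i + 1 : {1..<n}"
 shows "hs (i+1) (Q i M a b c e) =
   Q i M (a * al (i+1) M + c * be (i+1) M) (e * al (i+1) M + b * be (i+1) M)
      (a * be (i+1) M - c * al (i+1) M) (b * al (i+1) M - e * be (i+1) M)
  + Q i (swap (i+1) M) (yy (i+1) M * a) (yy (i+1) M * e) (yy (i+1) M * (- c)) (yy (i+1) M * b)"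
proof (cases "std M")
 case False
 thus ?thesis using assms by (simp add: Q_zero clin_0[OF clin_hat_act] del: hat_act.simps)
next
 case M: True
 let ?v = "one M"
 have oV: "?v : V0" by (rule one_V0[OF M])
 have cV: "hat_c (i+1) ?v : V0" "hat_c (i+2) ?v : V0" using assms oV by (auto intro!: hc_V0 simp del: tens_bas)
 have t: "tr (i+1) i = i" "tr (i+1) (i+1) = i+2" "tr (i+1) (i+2) = i+1" by (auto simp: transpose_def)
 have c: "hs (i+1) (hat_c i (hat_c (i+1) ?v)) = hat_c i (hat_c (i+2) (hs (i+1) ?v))"
  "hs (i+1) (hat_c (i+1) (hat_c (i+2) ?v)) = hat_c (i+2) (hat_c (i+1) (hs (i+1) ?v))"
  "hs (i+1) (hat_c i (hat_c (i+2) ?v)) = hat_c i (hat_c (i+1) (hs (i+1) ?v))"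
  by (simp_all only: hs_c[OF cV(1)] hs_c[OF cV(2)] hs_c[OF oV] t)
 have e: "i + 1 + 1 = i + 2" by simp
 show ?thesis
  unfolding Q_def clin_add[OF clin_hat_act] clin_scale[OF clin_hat_act] c hs_one[OF M assms(3)] e
  by (rule poly_mapping_eqI)
    (simp only: clin_add[OF clin_hat_c] clin_scale[OF clin_hat_c] clin_neg[OF clin_hat_c] c_sort hat_c_sq minus_minus
      cvec.scale_minus_right lookup_add lookup_minus lookup_uminus lookup_cscale, simp add: algebra_simps del: tens_bas)
qed

text \<open>The partial fraction identities behind the braid relation.\<close>

lemma braid_fractions:
 fixes p q r :: complex
 assumes "q - p ~= 0" "q + p ~= 0" "r - q ~= 0" "r + q ~= 0" "r - p ~= 0" "r + p ~= 0"
 defines "A \<equiv> 1 / (q - p)" and "B \<equiv> 1 / (q + p)" and "A' \<equiv> 1 / (r - q)" and "B' \<equiv> 1 / (r + q)"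
  and "A'' \<equiv> 1 / (r - p)" and "B'' \<equiv> 1 / (r + p)"
 shows "A * (A' - A'') = A' * A''" "B * (A'' - B') = B' * A''" "B * (A' - B'') = A' * B''" "A * (B' - B'') = - (B' * B'')"
  and "A * B * (A' - B') = A' * B' * (A + B)"
 unfolding A_def B_def A'_def B'_def A''_def B''_def using assms
 by (simp_all add: divide_simps; algebra)+

lemma braid_coeffs:
 fixes A B A' B' A'' B'' y y' :: complex
 assumes e: "A * (A' - A'') = A' * A''" "B * (A'' - B') = B' * A''" "B * (A' - B'') = A' * B''" "A * (B' - B'') = - (B' * B'')"
  and y: "A * A + B * B + y * y = 1" "A' * A' + B' * B' + y' * y' = 1"
 shows "A * A * A' + B * B * B' + y * y * A'' = A' * A' * A - B' * B' * B + y' * y' * A''"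
  "A * A * B' + B * B * A' + y * y * B'' = A' * A' * B - B' * B' * A + y' * y' * B''"
proof -
 have yy: "y * y = 1 - A * A - B * B" "y' * y' = 1 - A' * A' - B' * B'" using y by (auto simp: algebra_simps)
 have s: "y * y * z = z - A * A * z - B * B * z" "y' * y' * z = z - A' * A' * z - B' * B' * z" for z
  by (simp_all only: yy left_diff_distrib mult_1)
 have "A * (A * (A' - A'')) + B * (B * (B' - A'')) = A' * (A' * A - A' * A'') - B' * (B' * B + B' * A'')"
 proof -
  have "A' * A - A' * A'' = A * A''" "B' * B + B' * A'' = B * A''" "B * (B' - A'') = - (B' * A'')"
   using e(1,2) by (simp_all add: algebra_simps)
  thus ?thesis by (simp add: e(1) mult_ac)
 qed
 thus "A * A * A' + B * B * B' + y * y * A'' = A' * A' * A - B' * B' * B + y' * y' * A''"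
  unfolding s by (simp add: algebra_simps)
 have "A * (A * (B' - B'')) + B * (B * (A' - B'')) = A' * (A' * B - A' * B'') - B' * (B' * A + B' * B'')"
 proof -
  have "A' * B - A' * B'' = B * B''" "B' * A + B' * B'' = A * B''"
   using e(3,4) by (simp_all add: algebra_simps)
  thus ?thesis by (simp add: e(3,4) mult_ac)
 qed
 thus "A * A * B' + B * B * A' + y * y * B'' = A' * A' * B - B' * B' * A + y' * y' * B''"
  unfolding s by (simp add: algebra_simps)
qed

lemma hs_braid_one:
 assumes L: "std L" and i: "i : {1..<n}" "i + 1 : {1..<n}"
 shows "hs i (hs (i+1) (hs i (one L))) = hs (i+1) (hs i (hs (i+1) (one L)))"
proof -
 define M1 M2 where "M1 = swap i L" and "M2 = swap (i+1) L"
 define M12 M21 where "M12 = swap (i+1) M1" and "M21 = swap i M2"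
 define p q r where "p = kc i L" and "q = kc (i+1) L" and "r = kc (i+2) L"
 define A B y where "A = 1 / (q - p)" and "B = 1 / (q + p)" and "y = yf (kp i L) (kp (i+1) L)"
 define A' B' y' where "A' = 1 / (r - q)" and "B' = 1 / (r + q)" and "y' = yf (kp (i+1) L) (kp (i+2) L)"
 define A'' B'' y'' where "A'' = 1 / (r - p)" and "B'' = 1 / (r + p)" and "y'' = yf (kp i L) (kp (i+2) L)"
 note bL = std_bij[OF L]
 have b: "bij_betw M1 Bx {1..n}" "bij_betw M2 Bx {1..n}" unfolding M1_def M2_def by (intro bij_swap bL i)+
 have b2: "bij_betw M12 Bx {1..n}" "bij_betw M21 Bx {1..n}" unfolding M12_def M21_def by (intro bij_swap b i)+
 have W: "swap i M12 = swap (i+1) M21"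
  unfolding M12_def M21_def M1_def M2_def by (auto simp: swap_def fun_eq_iff transpose_def)
 have i2: "i + 1 + 1 = i + 2" "i + 2 : {1..n}" "i : {1..n}" "i + 1 : {1..n}" using i by auto
 have kM1: "kp i M1 = kp (i+1) L" "kp (i+1) M1 = kp i L" "kp (i+2) M1 = kp (i+2) L"
  unfolding M1_def using kp_swap[OF bL i(1)] i2 by (simp_all add: transpose_def)
 have kM2: "kp i M2 = kp i L" "kp (i+1) M2 = kp (i+2) L" "kp (i+2) M2 = kp (i+1) L"
  unfolding M2_def using kp_swap[OF bL i(2)] i2 by (simp_all add: transpose_def)
 have kM12: "kp i M12 = kp (i+1) L" "kp (i+1) M12 = kp (i+2) L"
  unfolding M12_def using kp_swap[OF b(1) i(2)] i2 kM1 by (simp_all add: transpose_def)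
 have kM21: "kp (i+1) M21 = kp i L" "kp (i+2) M21 = kp (i+1) L"
  unfolding M21_def using kp_swap[OF b(2) i(1)] i2 kM2 by (simp_all add: transpose_def)
 have vL: "al i L = A" "be i L = B" "yy i L = y" "al (i+1) L = A'" "be (i+1) L = B'" "yy (i+1) L = y'"
  by (simp_all only: al_def be_def yy_yf A_def B_def y_def A'_def B'_def y'_def p_def q_def r_def i2)
 have vM1: "al i M1 = - A" "be i M1 = B" "yy i M1 = y" "al (i+1) M1 = A''" "be (i+1) M1 = B''" "yy (i+1) M1 = y''"
  using swap_vals[OF bL i(1)] by (simp_all only: M1_def[symmetric] vL)
   (simp_all only: al_def be_def yy_yf A''_def B''_def y''_def kM1 p_def r_def i2)
 have vM2: "al i M2 = A''" "be i M2 = B''" "yy i M2 = y''" "al (i+1) M2 = - A'" "be (i+1) M2 = B'" "yy (i+1) M2 = y'"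
  using swap_vals[OF bL i(2)] by (simp_all only: M2_def[symmetric] vL)
   (simp_all only: al_def be_def yy_yf A''_def B''_def y''_def kM2 p_def r_def i2)
 have vM12: "al i M12 = A'" "be i M12 = B'" "yy i M12 = y'"
  by (simp_all only: al_def be_def yy_yf A'_def B'_def y'_def kM12 q_def r_def)
 have vM21: "al (i+1) M21 = A" "be (i+1) M21 = B" "yy (i+1) M21 = y"
  by (simp_all only: al_def be_def yy_yf A_def B_def y_def kM21 p_def q_def i2)
 have sM1: "std M1 \<or> y = 0" using yy_std[OF L i(1)] vL by (auto simp: M1_def)
 have sM2: "std M2 \<or> y' = 0" using yy_std[OF L i(2)] vL by (auto simp: M2_def)
 have sM12: "std M12 \<or> y * y'' = 0" using sM1 yy_std[OF _ i(2), of M1] vM1 by (auto simp: M12_def)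
 have sM21: "std M21 \<or> y' * y'' = 0" using sM2 yy_std[OF _ i(1), of M2] vM2 by (auto simp: M21_def)
 have one: "one L = Q i L 1 0 0 0" by (simp add: Q_def)
 have ys: "A * A + B * B + y * y = 1" "A' * A' + B' * B' + y' * y' = 1"
  using yy_sq[OF L i(1)] yy_sq[OF L i(2)] unfolding vL by auto
 have l1: "hs i (one L) = Q i L A B 0 0 + Q i M1 y 0 0 0"
  unfolding one using hs_Q1[of L 1 0 0 0 i] L i unfolding vL M1_def[symmetric] by simp
 have l2: "hs (i+1) (hs i (one L)) = Q i L (A*A') (B*B') (A*B') (B*A') + Q i M2 (y'*A) 0 0 (y'*B)
   + Q i M1 (y*A'') 0 (y*B'') 0 + Q i M12 (y''*y) 0 0 0"
  unfolding l1 clin_add[OF clin_hat_act]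
  using hs_Q2[of L A B 0 0 i] hs_Q2[of M1 y 0 0 0 i] L sM1 i unfolding vL vM1 M2_def[symmetric] M12_def[symmetric]
  by (auto simp: add.assoc simp del: hat_act.simps)
 have l3: "hs i (hs (i+1) (hs i (one L))) =
   Q i L (A*A'*A + B*B'*B) (A*A'*B - B*B'*A) (B*A'*A - A*B'*B) (A*B'*A + B*A'*B)
  + Q i M1 (y*(A*A')) (y*(-(B*B'))) (y*(B*A')) (y*(A*B'))
  + (Q i M2 (y'*A*A'') (y'*A*B'') (y'*B*A'') (y'*B*B'') + Q i M21 (y''*(y'*A)) 0 (y''*(y'*B)) 0)
  + (Q i M1 (y*A''*(-A)) (y*A''*B) (-(y*B''*B)) (y*B''*(-A)) + Q i L (y*(y*A'')) 0 0 (y*(y*B'')))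
  + (Q i M12 (y''*y*A') (y''*y*B') 0 0 + Q i (swap i M12) (y'*(y''*y)) 0 0 0)"
 proof -
  have "M1 = swap i L" "swap i M1 = L" "swap i M2 = M21" by (simp_all add: M1_def M21_def)
  thus ?thesis
   unfolding l2 clin_add[OF clin_hat_act]
   using hs_Q1[of L "A*A'" "B*B'" "A*B'" "B*A'" i] hs_Q1[of M2 "y'*A" 0 0 "y'*B" i]
    hs_Q1[of M1 "y*A''" 0 "y*B''" 0 i] hs_Q1[of M12 "y''*y" 0 0 0 i] L sM1 sM2 sM12 i
   unfolding vL vM1 vM2 vM12 by (auto simp del: hat_act.simps)
 qed
 have r1: "hs (i+1) (one L) = Q i L A' 0 B' 0 + Q i M2 y' 0 0 0"
  unfolding one using hs_Q2[of L 1 0 0 0 i] L i unfolding vL M2_def[symmetric] by simp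
 have r2: "hs i (hs (i+1) (one L)) = Q i L (A'*A) (A'*B) (-(B'*B)) (B'*A) + Q i M1 (y*A') 0 0 (y*B')
   + Q i M2 (y'*A'') (y'*B'') 0 0 + Q i M21 (y''*y') 0 0 0"
  unfolding r1 clin_add[OF clin_hat_act]
  using hs_Q1[of L A' 0 B' 0 i] hs_Q1[of M2 y' 0 0 0 i] L sM2 i unfolding vL vM2 M1_def[symmetric] M21_def[symmetric]
  by (auto simp: add.assoc simp del: hat_act.simps)
 have r3: "hs (i+1) (hs i (hs (i+1) (one L))) =
   Q i L (A'*A*A' + -(B'*B)*B') (B'*A*A' + A'*B*B') (A'*A*B' - -(B'*B)*A') (A'*B*A' - B'*A*B')
  + Q i M2 (y'*(A'*A)) (y'*(B'*A)) (y'*(B'*B)) (y'*(A'*B))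
  + (Q i M1 (y*A'*A'') (y*B'*A'') (y*A'*B'') (-(y*B'*B'')) + Q i M12 (y''*(y*A')) (y''*(y*B')) 0 0)
  + (Q i M2 (y'*A''*(-A')) (y'*B''*B') (y'*A''*B') (y'*B''*(-A')) + Q i L (y'*(y'*A'')) 0 0 (y'*(y'*B'')))
  + (Q i M21 (y''*y'*A) 0 (y''*y'*B) 0 + Q i (swap (i+1) M21) (y*(y''*y')) 0 0 0)"
 proof -
  have "M2 = swap (i+1) L" "swap (i+1) M2 = L" "swap (i+1) M1 = M12" by (simp_all add: M2_def M12_def)
  thus ?thesis
   unfolding r2 clin_add[OF clin_hat_act]
   using hs_Q2[of L "A'*A" "A'*B" "-(B'*B)" "B'*A" i] hs_Q2[of M1 "y*A'" 0 0 "y*B'" i]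
    hs_Q2[of M2 "y'*A''" "y'*B''" 0 0 i] hs_Q2[of M21 "y''*y'" 0 0 0 i] L sM1 sM2 sM21 i
   unfolding vL vM1 vM2 vM21 by (auto simp del: hat_act.simps)
 qed
 have main: "hs i (hs (i+1) (hs i (one L))) = hs (i+1) (hs i (hs (i+1) (one L)))" if
   eL: "A * A * A' + B * B * B' + y * y * A'' = A' * A' * A - B' * B' * B + y' * y' * A''"
  "A * A * B' + B * B * A' + y * y * B'' = A' * A' * B - B' * B' * A + y' * y' * B''"
  "A * B * (A' - B') = A' * B' * (A + B)"
  and e1: "y * (A * (A' - A'')) = y * (A' * A'')" "y * (B * (A'' - B')) = y * (B' * A'')"
   "y * (B * (A' - B'')) = y * (A' * B'')" "y * (A * (B' - B'')) = y * (- (B' * B''))"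
  and e2: "y' * (A * (A' - A'')) = y' * (A' * A'')" "y' * (B * (A'' - B')) = y' * (B' * A'')"
   "y' * (B * (A' - B'')) = y' * (A' * B'')" "y' * (A * (B' - B'')) = y' * (- (B' * B''))"
 proof -
  have "hs i (hs (i+1) (hs i (one L))) =
    Q i L (A*A'*A + B*B'*B + y*(y*A'')) (A*A'*B - B*B'*A + 0) (B*A'*A - A*B'*B + 0) (A*B'*A + B*A'*B + y*(y*B''))
   + Q i M1 (y*(A*A') + y*A''*(-A)) (y*(-(B*B')) + y*A''*B) (y*(B*A') + -(y*B''*B)) (y*(A*B') + y*B''*(-A))
   + Q i M2 (y'*A*A'') (y'*A*B'') (y'*B*A'') (y'*B*B'')
   + Q i M21 (y''*(y'*A)) 0 (y''*(y'*B)) 0 + Q i M12 (y''*y*A') (y''*y*B') 0 0 + Q i (swap i M12) (y'*(y''*y)) 0 0 0"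
   unfolding l3 Q_add[symmetric] by (simp only: ac_simps)
  moreover have "hs (i+1) (hs i (hs (i+1) (one L))) =
    Q i L (A'*A*A' + -(B'*B)*B' + y'*(y'*A'')) (B'*A*A' + A'*B*B' + 0) (A'*A*B' - -(B'*B)*A' + 0) (A'*B*A' - B'*A*B' + y'*(y'*B''))
   + Q i M1 (y*A'*A'') (y*B'*A'') (y*A'*B'') (-(y*B'*B''))
   + Q i M2 (y'*(A'*A) + y'*A''*(-A')) (y'*(B'*A) + y'*B''*B') (y'*(B'*B) + y'*A''*B') (y'*(A'*B) + y'*B''*(-A'))
   + Q i M21 (y''*y'*A) 0 (y''*y'*B) 0 + Q i M12 (y''*(y*A')) (y''*(y*B')) 0 0 + Q i (swap (i+1) M21) (y*(y''*y')) 0 0 0"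
   unfolding r3 Q_add[symmetric] by (simp only: ac_simps)
  moreover have "A*A'*A + B*B'*B + y*(y*A'') = A'*A*A' + -(B'*B)*B' + y'*(y'*A'')"
   "A*A'*B - B*B'*A + 0 = B'*A*A' + A'*B*B' + 0" "B*A'*A - A*B'*B + 0 = A'*A*B' - -(B'*B)*A' + 0"
   "A*B'*A + B*A'*B + y*(y*B'') = A'*B*A' - B'*A*B' + y'*(y'*B'')"
   using eL by (simp_all add: algebra_simps)
  moreover have "y*(A*A') + y*A''*(-A) = y*A'*A''" "y*(-(B*B')) + y*A''*B = y*B'*A''"
   "y*(B*A') + -(y*B''*B) = y*A'*B''" "y*(A*B') + y*B''*(-A) = -(y*B'*B'')"
   using e1 by (simp_all add: algebra_simps)
  moreover have "y'*A*A'' = y'*(A'*A) + y'*A''*(-A')" "y'*A*B'' = y'*(B'*A) + y'*B''*B'"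
   "y'*B*A'' = y'*(B'*B) + y'*A''*B'" "y'*B*B'' = y'*(A'*B) + y'*B''*(-A')"
   using e2 by (simp_all add: algebra_simps)
  moreover have "y''*(y'*A) = y''*y'*A" "y''*(y'*B) = y''*y'*B" "y''*y*A' = y''*(y*A')" "y''*y*B' = y''*(y*B')"
   "y'*(y''*y) = y*(y''*y')" by (simp_all only: ac_simps)
  ultimately show ?thesis unfolding W by (simp only:)
 qed
 have ne: "q - p ~= 0" "q + p ~= 0" "r - q ~= 0" "r + q ~= 0"
  using kp_ne[OF L i(1)] kp_ne[OF L i(2)] unfolding p_def q_def r_def i2(1)
  by (auto simp flip: of_real_add of_real_diff simp: add.commute)
 show ?thesis
 proof (cases "content (lbl L i) = content (lbl L (i+2))")
  case False
  have ne2: "kp i L ~= kp (i+2) L" using False kp_eq_iff[OF L L i2(3,2)] by simp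
  hence "r - p ~= 0" "r + p ~= 0"
   using kp_nonneg[of i L] kp_nonneg[of "i+2" L] L i2 unfolding p_def r_def
   by (auto simp flip: of_real_add of_real_diff simp: add_nonneg_eq_0_iff)
  note f = braid_fractions[OF ne this, folded A_def B_def A'_def B'_def A''_def B''_def]
  show ?thesis by (rule main[OF braid_coeffs[OF f(1-4) ys] f(5)]) (simp_all only: f(1-4))
 next
  case True
  have z: "content (lbl L i) = 0" using consec_aba[OF L _ _ True] i by auto
  hence pr: "p = 0" "r = 0" using True unfolding p_def r_def kp_kap kap_def Defs.q_def by simp_all
  have "~ std M1"
  proof
   assume s: "std M1"
   have "content (lbl M1 (i+1)) = content (lbl L i)" "content (lbl M1 (i+1+1)) = content (lbl L (i+2))"
    unfolding M1_def using lbl_swap[OF bL i(1), of "i+1"] lbl_swap[OF bL i(1), of "i+2"] i2 by (simp_all add: transpose_def)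
   thus False using consec_content_neq[OF s i(2)] True by simp
  qed
  hence y: "y = 0" using sM1 by simp
  have "~ std M2"
  proof
   assume s: "std M2"
   have "content (lbl M2 i) = content (lbl L i)" "content (lbl M2 (i+1)) = content (lbl L (i+2))"
    unfolding M2_def using lbl_swap[OF bL i(2), of "i"] lbl_swap[OF bL i(2), of "i+1"] i2 by (simp_all add: transpose_def)
   thus False using consec_content_neq[OF s i(1)] True by simp
  qed
  hence y': "y' = 0" using sM2 by simp
  have AB: "A = 1 / q" "B = 1 / q" "A' = - (1 / q)" "B' = 1 / q"
   unfolding A_def B_def A'_def B'_def pr by simp_all
  show ?thesis by (rule main) (simp_all add: y y' AB)
 qed
qed

lemma hs_braid:
 assumes "v : V0" "i : {1..<n}" "i + 1 : {1..<n}"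
 shows "hs i (hs (i+1) (hs i v)) = hs (i+1) (hs i (hs (i+1) v))"
proof (rule V0_eq_one[where f="%v. hs i (hs (i+1) (hs i v))" and g="%v. hs (i+1) (hs i (hs (i+1) v))",
   OF _ _ hs_braid_one[OF _ assms(2,3)] _ assms(1)])
 show "clin (%v. hs i (hs (i+1) (hs i v)))" "clin (%v. hs (i+1) (hs i (hs (i+1) v)))"
  by (intro clin_comp[OF clin_hat_act clin_hs_hs])+
 fix k v assume k: "k : {1..n}" "v : V0"
 have t: "tr i (tr (i+1) (tr i k)) = tr (i+1) (tr i (tr (i+1) k))" by (auto simp: transpose_def)
 note m = hs_V0[OF assms(2)] hs_V0[OF assms(3)]
 show "\<exists>j'. hs i (hs (i+1) (hs i (hat_c k v))) = hat_c j' (hs i (hs (i+1) (hs i v))) &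
   hs (i+1) (hs i (hs (i+1) (hat_c k v))) = hat_c j' (hs (i+1) (hs i (hs (i+1) v)))"
  by (intro exI[of _ "tr i (tr (i+1) (tr i k))"] conjI)
    (simp_all only: hs_c[OF k(2)] hs_c[OF m(1)[OF k(2)]] hs_c[OF m(2)[OF k(2)]]
     hs_c[OF m(2)[OF m(1)[OF k(2)]]] hs_c[OF m(1)[OF m(2)[OF k(2)]]] t)
qed

end

section \<open>The action of the free algebra\<close>

lemma sgo_comm: "sgo P (sgo P' v) = sgo P' (sgo P v)"
 by (rule poly_mapping_eqI) simp

definition vact :: "(gen => 'b vec => 'b vec) => falg => 'b vec => 'b vec" where
 "vact a f v = lin (%w. foldr a (letters w) v) f"

lemma cscale_single: "cscale c (Poly_Mapping.single b x) = Poly_Mapping.single b (c * x)"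
 by (rule poly_mapping_eqI) (simp add: lookup_single when_def)

lemma cscale_times: "cscale c f = Poly_Mapping.single 0 c * f" "cscale c f = f * Poly_Mapping.single 0 c" for f :: falg
proof -
 have f: "f = (\<Sum>b\<in>keys f. Poly_Mapping.single b (lk f b))"
  using vec_expand[of f] by (simp add: cscale_single)
 have l: "cscale c f = (\<Sum>b\<in>keys f. Poly_Mapping.single b (c * lk f b))"
  by (subst f) (simp add: cvec.scale_sum_right cscale_single)
 show "cscale c f = Poly_Mapping.single 0 c * f"
  unfolding l by (subst (3) f) (simp add: sum_distrib_left mult_single)
 show "cscale c f = f * Poly_Mapping.single 0 c"
  unfolding l by (subst (3) f) (simp add: sum_distrib_right mult_single mult.commute)
qed

lemma cscale_mult_left: "cscale c f * g = cscale c (f * g)" for f g :: falg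
 by (simp add: cscale_times(1) mult.assoc)

lemma cscale_mult_right: "f * cscale c g = cscale c (f * g)" for f g :: falg
 by (simp add: cscale_times(2) mult.assoc)

lemma clin_times_left: "clin (%f. f * g)" for g :: falg
 by (rule clinI) (simp_all add: distrib_right cscale_mult_left)

lemma clin_times_right: "clin (%g. f * g)" for f :: falg
 by (rule clinI) (simp_all add: distrib_left cscale_mult_right)

lemma clin_vact_alg: "clin (%f. vact a f v)"
 unfolding vact_def by simp

lemma clin_vact: "(!!g. clin (a g)) ==> clin (vact a f)"
 unfolding vact_def lin_def by (intro clin_setsum clin_cscale clin_foldr)

lemma vact_bas: "vact a (bas w) v = foldr a (letters w) v"
 by (simp add: vact_def)

lemma vact_mult:
 assumes a: "!!g. clin (a g)"
 shows "vact a (f * g) v = vact a f (vact a g v)"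
proof -
 have b: "vact a (bas w * g) v = vact a (bas w) (vact a g v)" for w
 proof (rule clin_eqI[where f="%g. vact a (bas w * g) v" and g="%g. vact a (bas w) (vact a g v)"])
  show "clin (%g. vact a (bas w * g) v)" by (rule clin_comp[OF clin_vact_alg clin_times_right])
  show "clin (%g. vact a (bas w) (vact a g v))" by (rule clin_comp[OF clin_vact[OF a] clin_vact_alg])
  fix w' show "vact a (bas w * bas w') v = vact a (bas w) (vact a (bas w') v)"
   by (simp add: mult_single vact_bas plus_gword_def)
 qed
 show ?thesis
 proof (rule clin_eqI[where f="%f. vact a (f * g) v" and g="%f. vact a f (vact a g v)"])
  show "clin (%f. vact a (f * g) v)" by (rule clin_comp[OF clin_vact_alg clin_times_left])
 qed (use b clin_vact_alg in auto)
qed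

lemma vact_one: "vact a 1 v = v"
proof -
 have e: "(1 :: falg) = bas (Word [])" by (metis single_one zero_gword_def)
 show ?thesis unfolding e vact_bas by simp
qed

lemmas vact_lin = clin_simps[OF clin_vact_alg]

lemma vact_gens: "vact a (gs i) v = a (Gs i) v" "vact a (gx i) v = a (Gx i) v" "vact a (gc i) v = a (Gc i) v"
 by (simp_all add: gs_def gx_def gc_def vact_bas)

abbreviation fal :: "nat => falg set" where
 "fal d \<equiv> carrier (free_alg d)"

lemma fal_iff: "f : fal d \<longleftrightarrow> (\<forall>w\<in>keys f. set (letters w) \<subseteq> gens d)"
 by (simp add: free_alg_def)

lemma free_alg_ops [simp]: "mult (free_alg d) = (*)" "one (free_alg d) = 1" "zero (free_alg d) = 0" "add (free_alg d) = (+)"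
 by (simp_all add: free_alg_def)

lemma fal_span: "fal d = cvec.span (bas ` {w. set (letters w) \<subseteq> gens d})"
 by (auto simp: set_eq_iff fal_iff span_bas_iff subset_iff)

lemma fal_sub: "subsp (fal d)"
 by (simp add: fal_span)

lemma fal_one: "1 : fal d"
 by (simp add: fal_iff zero_gword_def)

lemma fal_mult: "f : fal d ==> g : fal d ==> f * g : fal d"
 using keys_mult[of f g] by (fastforce simp: fal_iff plus_gword_def)

lemma fal_gens: "bas (Word [g]) : fal d \<longleftrightarrow> g : gens d"
 by (simp add: fal_iff)

lemma fal_closed: "f : fal d ==> g : fal d ==> f + g : fal d" "f : fal d ==> g : fal d ==> f - g : fal d"
 "f : fal d ==> - f : fal d" "0 : fal d" "f : fal d ==> cscale c f : fal d"
 using fal_sub by (auto intro: sub_add sub_diff sub_neg sub_0 sub_scale)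

lemma ring_free_alg: "ring (free_alg d)"
proof (rule ringI)
 show "abelian_group (free_alg d)" by (rule abelian_group_vec[OF fal_sub]) simp_all
 show "Group.monoid (free_alg d)"
  by (rule monoidI) (auto simp: fal_mult fal_one mult.assoc)
qed (simp_all add: algebra_simps)

lemma gs_fal: "i : {1..<d} ==> gs i : fal d" and gx_fal: "i : {1..d} ==> gx i : fal d"
 and gc_fal: "i : {1..d} ==> gc i : fal d"
 by (simp_all add: gs_def gx_def gc_def fal_gens gens_def)

lemma rels_fal: "rels d \<subseteq> fal d"
 unfolding rels_def
 by (auto intro!: fal_closed fal_mult fal_one gs_fal gx_fal gc_fal simp del: One_nat_def)

lemma finsum_vmod:
 assumes V: "subsp V" and "finite A" "!!x. x : A ==> f x : V"
 shows "finsum (vmod V par a) f A = sum f A"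
proof -
 interpret abelian_group "vmod V par a" by (rule abelian_group_vec[OF V]) simp_all
 show ?thesis using assms(2,3)
 proof (induction A rule: finite_induct)
  case (insert x A)
  thus ?case by (subst finsum_insert) auto
 qed simp
qed

lemma foldr_stable: "(!!g v. g : G ==> v : V ==> a g v : V) ==> set gl \<subseteq> G ==> v : V ==> foldr a gl v : V"
 by (induction gl) auto

lemma alg_act_vmod:
 assumes V: "subsp V" and st: "!!g v. g : gens d ==> v : V ==> a g v : V" and f: "f : fal d" and v: "v : V"
 shows "alg_act (vmod V par a) f v = vact a f v"
 unfolding alg_act_def vact_def lin_def word_act_def vmod_simps
 by (rule finsum_vmod[OF V]) (use f v in \<open>auto simp: fal_iff intro!: sub_scale[OF V] foldr_stable[of "gens d", OF st]\<close>)

lemma vact_stable: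
 assumes V: "subsp V" and st: "!!g v. g : gens d ==> v : V ==> a g v : V" and f: "f : fal d" and v: "v : V"
 shows "vact a f v : V"
 unfolding vact_def lin_def
 by (intro sub_sum[OF V] sub_scale[OF V] foldr_stable[of "gens d", OF st]) (use f v in "auto simp: fal_iff")

text \<open>The defining relations, for operators on a space of vectors.\<close>

locale HC_ops =
 fixes d :: nat and V :: "'b vec set" and par :: "'b => bool" and a :: "gen => 'b vec => 'b vec"
 assumes V: "subsp V" and a_lin: "!!g. clin (a g)" and a_mem: "!!g v. g : gens d ==> v : V ==> a g v : V"
  and sg_mem: "!!v. v : V ==> sgo par v : V"
  and a_sg: "!!g v. g : gens d ==> v : V ==> sgo par (a g v) = (if gpar g then - a g (sgo par v) else a g (sgo par v))"
  and rels: "!!f v. f : rels d ==> v : V ==> vact a f v = 0"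
begin

lemma HC_supermodule: "HC_supermodule d (vmod V par a)"
 unfolding HC_supermodule_def
proof (intro conjI ballI)
 show "superspace (vmod V par a)" by (rule superspace_vmod[OF V sg_mem])
 fix g assume g: "g : gens d"
 show "operator (gpar g) (vmod V par a) (vmod V par a) (act (vmod V par a) g)"
  unfolding operator_def
 proof (intro conjI allI ballI)
  fix p v assume "v : homog (vmod V par a) p"
  thus "act (vmod V par a) g v : homog (vmod V par a) (p ~= gpar g)"
   using a_mem[OF g] a_sg[OF g] clin_neg[OF a_lin] by auto
 qed (use a_mem[OF g] clin_add[OF a_lin] clin_scale[OF a_lin] in auto)
next
 fix f v assume "f : rels d" "v : carrier (vmod V par a)"
 thus "alg_act (vmod V par a) f v = \<zero>\<^bsub>vmod V par a\<^esub>"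
  using alg_act_vmod[OF V a_mem] rels_fal rels by fastforce
qed

lemma restrict:
 assumes "submod (gens d) (vmod V par a) U"
 shows "HC_ops d U par a"
proof -
 have U: "U \<subseteq> V" "subsp U" "!!g v. g : gens d ==> v : U ==> a g v : U" "!!v. v : U ==> sgo par v : U"
  using assms V by (auto simp: submod_vmod)
 show ?thesis by unfold_locales (use U a_lin a_sg rels in "auto dest!: subsetD[OF U(1)]")
qed

end

context skew
begin

lemma sgo_tau:
 assumes "inj s" "a : clsp n" shows "sgo hpar (tau s (em L a)) = tau s (sgo hpar (em L a))"
proof -
 have "sgo clpar (lin (cl_perm s) a) = lin (cl_perm s) (sgo clpar a)"
 proof (rule clin_eqI[where f="%a. sgo clpar (lin (cl_perm s) a)"])
  fix J assume J: "J : keys a"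
  have "sgo clpar (cl_perm s J) = (if clpar J then - cl_perm s J else cl_perm s J)"
   using homog_iff_sgo[of "cl_perm s J" clpar "clpar J"] keys_cl_perm[OF assms(1), of J] clsp_finite[OF assms(2) J] by auto
  thus "sgo clpar (lin (cl_perm s) (bas J)) = lin (cl_perm s) (sgo clpar (bas J))"
   by (auto simp: clin_simps[OF clin_lin] cscale_m1)
 qed (auto intro!: clin_comp[OF clin_sgo])
 thus ?thesis by (simp only: tau_em sgo_em)
qed

lemma hs_sg: "v : V0 ==> i : {1..<n} ==> sgo hpar (hs i v) = hs i (sgo hpar v)"
proof (rule V0_eqI[where f="%v. sgo hpar (hs i v)"])
 fix L a assume L: "std L" and a: "a : clsp n" and i: "i : {1..<n}"
 have x: "sgo hpar (hx j (em M b)) = hx j (sgo hpar (em M b))" for j M b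
  by (simp only: hx_em sgo_em clin_scale[OF clin_sgo] sgo_comm[of clpar])
 have c: "sgo hpar (hat_c j (em M b)) = - hat_c j (sgo hpar (em M b))" if "b : clsp n" for j M b
  by (simp add: hat_c_em sgo_em sgo_cl_c_vec[OF that] tens_simps)
 have xb: "hx j (em L b) = em L (cscale (kc j L) (eps j b))" for j b by (simp only: hx_em tens_simps)
 have bb: "sgo hpar (hat_c i (hat_c (i+1) (em L b))) = hat_c i (hat_c (i+1) (sgo hpar (em L b)))" if "b : clsp n" for b
 proof -
  have "lin (cl_c (i+1)) b : clsp n" using that i by (intro cl_c_clsp) auto
  hence "sgo hpar (hat_c i (hat_c (i+1) (em L b))) = - hat_c i (sgo hpar (hat_c (i+1) (em L b)))"
   unfolding hat_c_em[of "i+1"] by (rule c)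
  thus ?thesis using c[OF that, of "i+1" L] by (simp add: clin_simps[OF clin_hat_c])
 qed
 have B: "sgo hpar (Bo i (em L a)) = Bo i (sgo hpar (em L a))"
 proof -
  have m: "cscale (kc j L) (eps j a) : clsp n" for j using a by (simp add: sub_scale)
  show ?thesis
   unfolding Bo_def clin_simps[OF clin_sgo] clin_simps[OF clin_hat_c] x xb bb[OF m] sgo_em sgo_comm[of clpar] ..
 qed
 have t: "sgo hpar (tau (tr i) (em L a)) = tau (tr i) (sgo hpar (em L a))" by (rule sgo_tau[OF inj_transpose a])
 have sa: "sgo clpar a : clsp n" using a by simp
 show "sgo hpar (hs i (em L a)) = hs i (sgo hpar (em L a))"
  unfolding hs_formula[OF L i a] sgo_em hs_formula[OF L i sa] clin_add[OF clin_sgo] clin_scale[OF clin_sgo] B t ..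
qed (auto intro!: clin_comp[OF clin_sgo] clin_comp[OF clin_hat_act] simp del: hat_act.simps)

lemma hat_HC_ops: "HC_ops n V0 hpar (hat_act lam mu)"
proof
 show "clin (hat_act lam mu g)" for g by simp
 have hc: "hat_act lam mu (Gc i) = hat_c i" for i by simp
 show "hat_act lam mu g v : V0" if "g : gens n" "v : V0" for g v
  using that hc_V0 hx_V0 hs_V0 by (auto simp: gens_def simp del: hat_act.simps(2,3))
 show "sgo hpar v : V0" if "v : V0" for v
  using that unfolding V0_def span_bas_iff by simp
 show "sgo hpar (hat_act lam mu g v) = (if gpar g then - hat_act lam mu g (sgo hpar v) else hat_act lam mu g (sgo hpar v))"
  if "g : gens n" "v : V0" for g v
 proof -
  have x: "sgo hpar (hx i v) = hx i (sgo hpar v)" for i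
  proof (rule hat_eqI[where f="%v. sgo hpar (hx i v)"])
   fix L J
   show "sgo hpar (hx i (em L (bas J))) = hx i (sgo hpar (em L (bas J)))"
    by (simp only: hx_em sgo_em clin_scale[OF clin_sgo] sgo_comm[of clpar])
  qed (auto intro!: clin_comp[OF clin_sgo] clin_comp[OF clin_hat_act] simp del: hat_act.simps)
  have c: "sgo hpar (hat_c i v) = - hat_c i (sgo hpar v)" for i
  proof (rule V0_eqI[OF that(2), where f="%v. sgo hpar (hat_c i v)"])
   fix L a assume "a : clsp n"
   thus "sgo hpar (hat_c i (em L a)) = - hat_c i (sgo hpar (em L a))"
    by (simp add: hat_c_em sgo_em sgo_cl_c_vec tens_simps)
  qed (auto intro!: clin_comp[OF clin_sgo] clin_comp[OF clin_hat_c] clin_uminus)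
  show ?thesis using that x c hs_sg unfolding gens_def by (auto simp del: hat_act.simps(2,3))
 qed
 fix f v assume f: "f : rels n" and v: "v : V0"
 note ev = vact_lin vact_mult[OF clin_hat_act] vact_gens vact_one hc
 have t: "tr i i = i + 1" "tr i (i+1) = i" "j ~= i ==> j ~= i + 1 ==> tr i j = j" for i j :: nat
  by (auto simp: transpose_def)
 from f show "vact (hat_act lam mu) f v = 0"
  unfolding rels_def
 proof (elim UnE CollectE exE conjE)
  fix i assume "f = gs i * gs i - 1" "i : {1..<n}"
  thus ?thesis using hs_sq[OF v] by (simp only: ev right_minus_eq)
 next
  fix i assume "f = gs i * gs (i + 1) * gs i - gs (i + 1) * gs i * gs (i + 1)" "i : {1..<n}" "i + 1 : {1..<n}"
  thus ?thesis using hs_braid[OF v] by (simp only: ev right_minus_eq)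
 next
  fix i j assume "f = gs i * gs j - gs j * gs i" "i : {1..<n}" "j : {1..<n}" "i + 1 < j \<or> j + 1 < i"
  thus ?thesis using hs_far[OF v, of i j] hs_far[OF v, of j i] by (auto simp only: ev right_minus_eq)
 next
  fix i j assume "f = gx i * gx j - gx j * gx i"
  thus ?thesis using hx_comm by (simp only: ev right_minus_eq)
 next
  fix i assume "f = gc i * gc i + 1"
  thus ?thesis using hat_c_sq by (simp only: ev) simp
 next
  fix i j :: nat assume "f = gc i * gc j + gc j * gc i" "i ~= j"
  thus ?thesis using hat_c_anti[of i j v] by (simp only: ev) simp
 next
  fix i assume "f = gs i * gc i - gc (i + 1) * gs i"
  thus ?thesis using hs_c[OF v, of i i] t by (simp only: ev right_minus_eq)
 next
  fix i assume "f = gs i * gc (i + 1) - gc i * gs i"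
  thus ?thesis using hs_c[OF v, of i "i+1"] t by (simp only: ev right_minus_eq)
 next
  fix i j assume "f = gs i * gc j - gc j * gs i" "j ~= i" "j ~= i + 1"
  thus ?thesis using hs_c[OF v, of i j] t(3)[of j i] by (simp only: ev right_minus_eq) simp
 next
  fix i assume "f = gc i * gx i + gx i * gc i"
  thus ?thesis using hx_c[of i i v] by (simp only: ev) simp
 next
  fix i j assume "f = gc j * gx i - gx i * gc j" "j ~= i"
  thus ?thesis using hx_c[of i j v] by (simp only: ev right_minus_eq) simp
 next
  fix i assume "f = gs i * gx i - (gx (i + 1) * gs i - 1 + gc i * gc (i + 1))" "i : {1..<n}"
  thus ?thesis using hs_x[OF _ v, of i] by (simp only: ev right_minus_eq)
 next
  fix i j assume f: "f = gs i * gx j - gx j * gs i" and ij: "i : {1..<n}" "j : {1..n}" "j ~= i" "j ~= i + 1"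
  show ?thesis using hs_x_far[OF ij v] unfolding f by (simp only: ev right_minus_eq)
 qed
qed simp

end

section \<open>Inversions\<close>

definition Inv :: "nat => (nat => nat) => (nat \<times> nat) set" where
 "Inv d w = {(a, b). 1 \<le> a & a < b & b \<le> d & w a > w b}"

lemma finite_Inv [simp, intro!]: "finite (Inv d w)"
 by (rule finite_subset[of _ "{1..d} \<times> {1..d}"]) (auto simp: Inv_def)

lemma Inv_tr_le:
 assumes w: "w permutes {1..d}"
 shows "card (Inv d (%j. transpose i (i+1) (w j))) \<le> card (Inv d w) + 1"
proof -
 have "Inv d (%j. transpose i (i+1) (w j)) \<subseteq> insert (inv_into UNIV w i, inv_into UNIV w (i+1)) (Inv d w)"
 proof clarify
  fix a b assume ab: "(a, b) : Inv d (%j. transpose i (i+1) (w j))" "(a, b) \<notin> Inv d w"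
  have "w a ~= w b" using ab(1) permutes_inj[OF w] by (auto simp: Inv_def dest: injD)
  hence "w a = i & w b = i + 1" using ab by (auto simp: Inv_def transpose_def split: if_splits)
  thus "a = inv_into UNIV w i & b = inv_into UNIV w (i+1)" using permutes_inj[OF w] by (auto simp: inv_f_eq)
 qed
 hence "card (Inv d (%j. transpose i (i+1) (w j))) \<le> card (insert (inv_into UNIV w i, inv_into UNIV w (i+1)) (Inv d w))"
  by (intro card_mono) auto
 also have "\<dots> \<le> card (Inv d w) + 1" by (simp add: card_insert_if)
 finally show ?thesis .
qed

lemma Inv_tr_less:
 assumes w: "w permutes {1..d}" and ab: "1 \<le> a" "a < b" "b \<le> d" "w a = i + 1" "w b = i"
 shows "card (Inv d (%j. transpose i (i+1) (w j))) < card (Inv d w)"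
proof (rule psubset_card_mono)
 have "(a, b) : Inv d w" using ab by (auto simp: Inv_def)
 moreover have "(a, b) \<notin> Inv d (%j. transpose i (i+1) (w j))" using ab by (auto simp: Inv_def)
 moreover have "Inv d (%j. transpose i (i+1) (w j)) \<subseteq> Inv d w"
 proof clarify
  fix a' b' assume ab': "(a', b') : Inv d (%j. transpose i (i+1) (w j))"
  have "w a' ~= w b'" using ab' permutes_inj[OF w] by (auto simp: Inv_def dest: injD)
  hence "w a' > w b' \<or> w a' = i & w b' = i + 1" using ab' by (auto simp: Inv_def transpose_def split: if_splits)
  moreover have "~ (w a' = i & w b' = i + 1)"
  proof
   assume "w a' = i & w b' = i + 1"
   hence "a' = b" "b' = a" using ab(4,5) injD[OF permutes_inj[OF w], of a' b] injD[OF permutes_inj[OF w], of b' a] by auto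
   thus False using ab ab' by (auto simp: Inv_def)
  qed
  ultimately show "(a', b') : Inv d w" using ab' by (auto simp: Inv_def)
 qed
 ultimately show "Inv d (%j. transpose i (i+1) (w j)) \<subset> Inv d w" by blast
qed simp

lemma word_perm_Cons: "word_perm (i # is) = (%j. transpose i (i+1) (word_perm is j))"
 by (simp add: word_perm_def comp_def)

lemma word_perm_props: "set is \<subseteq> {1..<d} ==> word_perm is permutes {1..d} & card (Inv d (word_perm is)) \<le> length is"
proof (induction "is")
 case Nil
 have "Inv d id = {}" by (auto simp: Inv_def)
 hence "card (Inv d id) \<le> 0" by (simp only: card.empty)
 moreover have "word_perm [] = id" by (simp add: word_perm_def fun_eq_iff)
 ultimately show ?case using permutes_id by (metis list.size(3))
next
 case (Cons i "is")
 hence w: "word_perm is permutes {1..d}" "card (Inv d (word_perm is)) \<le> length is" by auto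
 have "transpose i (i+1) permutes {1..d}" using Cons.prems by (intro permutes_swap_id) auto
 hence "transpose i (i+1) \<circ> word_perm is permutes {1..d}" by (rule permutes_compose[OF w(1)])
 thus ?case using Inv_tr_le[OF w(1), of i] w(2) by (simp add: word_perm_Cons comp_def)
qed

section \<open>The module \<open>H\<close>\<close>

context skew
begin

definition pm :: "filling => filling => nat => nat" where
 "pm L M j = (if j : {1..n} then M (lbl L j) else j)"

lemma pm_permutes:
 assumes L: "std L" and M: "std M" shows "pm L M permutes {1..n}"
proof (rule bij_imp_permutes)
 have "bij_betw (lbl L) {1..n} Bx" unfolding lbl_def[abs_def]
  using bij_betw_the_inv_into[OF std_bij[OF L]] by simp
 hence "bij_betw (M \<circ> lbl L) {1..n} {1..n}" by (rule bij_betw_trans) (rule std_bij[OF M])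
 thus "bij_betw (pm L M) {1..n} {1..n}" by (rule bij_betw_cong[THEN iffD1, rotated]) (auto simp: pm_def)
qed (simp only: pm_def if_False)

lemma pm_L:
 assumes L: "std L" and M: "std M" shows "(%x. pm L M (L x)) = M"
proof
 fix x show "pm L M (L x) = M x"
 proof (cases "x : Bx")
  case True
  thus ?thesis using std_range[OF L True] lbl_L[OF L True] by (simp add: pm_def)
 next
  case False
  thus ?thesis using std_zero[OF L False] std_zero[OF M False] by (simp add: pm_def)
 qed
qed

lemma pm_unique:
 assumes L: "std L" and M: "std M" and s: "s permutes {1..n}" "(%x. s (L x)) = M"
 shows "s = pm L M"
proof
 fix j show "s j = pm L M j"
 proof (cases "j : {1..n}")
  case True
  thus ?thesis using fun_cong[OF s(2), of "lbl L j"] L_lbl[OF L True] by (simp add: pm_def)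
 next
  case False
  thus ?thesis using permutes_not_in[OF s(1) False] by (simp only: pm_def) simp
 qed
qed

lemma pm_swap: "i : {1..<n} ==> (%j. tr i (pm L M j)) = pm L (swap i M)"
 by (auto simp: fun_eq_iff pm_def swap_def transpose_def)

text \<open>If two standard fillings differ, some exchange of consecutive labels brings one closer to the other
  and stays standard.\<close>

lemma step_towards:
 assumes L: "std L" and M: "std M" and ne: "M ~= L"
 shows "\<exists>i\<in>{1..<n}. std (swap i M) & card (Inv n (pm L (swap i M))) < card (Inv n (pm L M))"
proof -
 have "\<exists>i\<in>{1..<n}. L (lbl M i) > L (lbl M (i+1))"
 proof (rule ccontr)
  assume "~ ?thesis"
  hence le: "!!i. i : {1..<n} ==> L (lbl M i) \<le> L (lbl M (i+1))" by force
  have lt: "L (lbl M i) < L (lbl M (i+1))" if "i : {1..<n}" for i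
  proof -
   have ii: "i : {1..n}" "i + 1 : {1..n}" using that by auto
   have "lbl M i ~= lbl M (i+1)" using L_lbl[OF M ii(1)] L_lbl[OF M ii(2)] by auto
   thus ?thesis using le[OF that] std_inj[OF L lbl_Bx[OF M ii(1)] lbl_Bx[OF M ii(2)]] by linarith
  qed
  have ge: "i \<le> L (lbl M i)" if "1 \<le> i" "i \<le> n" for i
   using that
  proof (induction i rule: dec_induct)
   case base thus ?case using std_range[OF L lbl_Bx[OF M, of 1]] by auto
  next
   case (step i) thus ?case using lt[of i] by auto
  qed
  have eq: "L (lbl M i) = i" if "1 \<le> i" "i \<le> n" for i
  proof -
   have "L (lbl M i) + (l - i) \<le> L (lbl M l)" if "i \<le> l" "l \<le> n" for l
    using that
   proof (induction l rule: dec_induct)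
    case (step l) thus ?case using lt[of l] \<open>1 \<le> i\<close> by auto
   qed simp
   from this[of n] have "L (lbl M i) + (n - i) \<le> n" using std_range[OF L lbl_Bx[OF M, of n]] that by auto
   thus ?thesis using ge[OF that] that by linarith
  qed
  have "M = L"
  proof
   fix b show "M b = L b"
   proof (cases "b : Bx")
    case True
    thus ?thesis using eq[of "M b"] std_range[OF M True] lbl_L[OF M True] by auto
   qed (simp add: std_zero[OF L] std_zero[OF M])
  qed
  thus False using ne by simp
 qed
 then obtain i where i: "i : {1..<n}" "L (lbl M (i+1)) < L (lbl M i)" by auto
 have ii: "i : {1..n}" "i + 1 : {1..n}" using i(1) by auto
 have st: "std (swap i M)"
 proof (rule ccontr)
  assume "~ std (swap i M)"
  hence c: "\<bar>content (lbl M i) - content (lbl M (i + 1))\<bar> = 1" using swap_std_iff[OF M i(1)] by simp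
  obtain a z where a: "lbl M i = bx a z" "row a z" using lbl_Bx[OF M ii(1)] by (auto elim: Bx_cases)
  obtain b w where b: "lbl M (i + 1) = bx b w" "row b w" using lbl_Bx[OF M ii(2)] by (auto elim: Bx_cases)
  have l: "M (bx a z) = i" "M (bx b w) = i + 1" using L_lbl[OF M ii(1)] L_lbl[OF M ii(2)] a b by auto
  consider "w = z + 1" | "z = w + 1" using c a b by force
  thus False
  proof cases
   case 1
   hence "b = a \<or> b + 1 = a" using consec_adjacent[OF M i(1), of i a z "i + 1" b] a b by auto
   thus False
   proof
    assume "b = a"
    hence "L (bx a z) < L (bx b w)" using std_row_raw[OF L, of a z w] a b 1 by auto
    thus False using i(2) a b by simp
   next
    assume "b + 1 = a"
    hence "M (bx b w) < M (bx a z)" using a b 1 by (intro std_col_raw[OF M]) auto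
    thus False using l by simp
   qed
  next
   case 2
   hence "a = b \<or> a + 1 = b" using consec_adjacent[OF M i(1), of "i + 1" b w i a] a b by auto
   thus False
   proof
    assume "a = b"
    hence "M (bx b w) < M (bx a z)" using std_row_raw[OF M, of b w z] a b 2 by auto
    thus False using l by simp
   next
    assume "a + 1 = b"
    hence "L (bx a z) < L (bx b w)" using a b 2 by (intro std_col_raw[OF L]) auto
    thus False using i(2) a b by simp
   qed
  qed
 qed
 let ?a = "L (lbl M (i+1))" and ?b = "L (lbl M i)"
 have r: "?a : {1..n}" "?b : {1..n}" using std_range[OF L] lbl_Bx[OF M] ii by auto
 have "pm L M ?a = i + 1" "pm L M ?b = i"
  using r lbl_L[OF L lbl_Bx[OF M ii(1)]] lbl_L[OF L lbl_Bx[OF M ii(2)]] L_lbl[OF M] ii by (auto simp: pm_def)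
 hence "card (Inv n (%j. tr i (pm L M j))) < card (Inv n (pm L M))"
  using r i(2) by (intro Inv_tr_less[OF pm_permutes[OF L M], of ?a ?b]) auto
 thus ?thesis using st i(1) unfolding pm_swap[OF i(1)] by blast
qed

lemma tau_tau: "inj s ==> inj t ==> a : clsp n ==> tau s (tau t (em L a)) = tau (%j. s (t j)) (em L a)"
proof -
 assume *: "inj s" "inj t" "a : clsp n"
 have "lin (cl_perm s) (lin (cl_perm t) a) = lin (cl_perm (%j. s (t j))) a"
  by (rule clin_eqI[where f="%a. lin (cl_perm s) (lin (cl_perm t) a)"])
    (use * clsp_finite[OF *(3)] in "auto simp: cl_perm_comp")
 thus ?thesis by (simp add: tau_em)
qed

lemma tau_id: "a : clsp n ==> tau id (em L a) = em L a"
proof -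
 assume *: "a : clsp n"
 have "lin (cl_perm id) a = a"
  by (rule clin_eqI[where f="lin (cl_perm id)" and g="%a. a"]) (use clsp_finite[OF *] in "auto simp: cl_perm_id")
 thus ?thesis by (simp add: tau_em)
qed

lemma cl_perm_clsp:
 assumes "s permutes {1..n}" "a : clsp n" shows "lin (cl_perm s) a : clsp n"
proof (rule clin_span_mem[OF assms(2)[unfolded clsp_def] clin_lin subspace_clsp])
 fix x assume "x : bas ` {J. J \<subseteq> {1..n}}"
 then obtain J where J: "x = bas J" "J \<subseteq> {1..n}" by auto
 have sJ: "s ` J \<subseteq> {1..n}" using permutes_image[OF assms(1)] J(2) by blast
 have "K \<subseteq> {1..n}" if "K : keys (cl_perm s J)" for K
  using keys_cl_perm[OF permutes_inj[OF assms(1)] finite_subset[OF J(2)]] that sJ by blast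
 thus "lin (cl_perm s) x : clsp n"
  using J by (auto simp: clsp_iff)
qed

lemma hx_tau_gen:
 assumes L: "std L" and M: "std M" and j: "j : {1..n}" and a: "a : clsp n"
 shows "hx (pm L M j) (tau (pm L M) (em L a)) = tau (pm L M) (hx j (em L a))"
proof -
 have inj: "inj (pm L M)" using permutes_inj[OF pm_permutes[OF L M]] .
 have "eps (pm L M j) (lin (cl_perm (pm L M)) a) = lin (cl_perm (pm L M)) (eps j a)"
 proof (rule clin_eqI[where f="%a. eps (pm L M j) (lin (cl_perm (pm L M)) a)"])
  fix J assume "J : keys a"
  thus "eps (pm L M j) (lin (cl_perm (pm L M)) (bas J)) = lin (cl_perm (pm L M)) (eps j (bas J))"
   using eps_cl_perm[OF inj, of J j] clsp_finite[OF a] by simp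
 qed (auto intro!: clin_comp[OF clin_sgo])
 moreover have "kp (pm L M j) M = kp j L"
 proof -
  have "lbl M (pm L M j) = lbl L j" using lbl_L[OF M lbl_Bx[OF L j]] j by (simp add: pm_def)
  thus ?thesis by (simp add: kappa_def lcontent_lbl)
 qed
 ultimately show ?thesis by (simp only: hx_em tau_em pm_L[OF L M] clin_scale[OF clin_tau])
qed

definition phiop :: "nat => hatb vec => hatb vec" where
 "phiop i v = vact (hat_act lam mu) (phi i) v"

lemma phiop_em:
 assumes M: "std M" and i: "i : {1..<n}" and a: "a : clsp n"
 shows "phiop i (em M a) = cscale ((kc i M * kc i M - kc (i+1) M * kc (i+1) M) * yy i M) (tau (tr i) (em M a))"
proof -
 have hc: "hat_act lam mu (Gc i) = hat_c i" for i by simp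
 define D where "D = kc (i+1) M * kc (i+1) M - kc i M * kc i M"
 have d: "D ~= 0" unfolding D_def
  using kp_ne[OF M i] by (auto simp flip: of_real_mult of_real_diff simp: square_eq_iff eq_neg_iff_add_eq_0 add.commute)
 have sq: "hx j (hx j (em M a)) = cscale (kc j M * kc j M) (em M a)" for j
  by (simp add: hx_em clin_simps[OF clin_hat_act] del: hat_act.simps)
 have "phiop i (em M a) = hs i (hx i (hx i (em M a)) - hx (i+1) (hx (i+1) (em M a))) + Bo i (em M a)"
  unfolding phiop_def phi_def Bo_def
  by (simp only: vact_lin vact_mult[OF clin_hat_act] vact_gens hc) (simp add: algebra_simps clin_simps[OF clin_hat_c] clin_simps[OF clin_hat_act] del: hat_act.simps)
 also have "hx i (hx i (em M a)) - hx (i+1) (hx (i+1) (em M a)) = cscale (- D) (em M a)"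
  unfolding sq D_def by (simp add: cvec.scale_left_diff_distrib)
 also have "hs i (cscale (- D) (em M a)) + Bo i (em M a) = cscale (- D * yy i M) (tau (tr i) (em M a))"
  unfolding clin_scale[OF clin_hat_act] hs_formula[OF M i a] D_def[symmetric] using d
  by (simp add: cvec.scale_right_distrib del: hat_act.simps)
 also have "- D = kc i M * kc i M - kc (i+1) M * kc (i+1) M" by (simp add: D_def)
 finally show ?thesis .
qed

lemma vact_phi_Cons: "vact (hat_act lam mu) (prod_list (map phi (i # is))) v = phiop i (vact (hat_act lam mu) (prod_list (map phi is)) v)"
 by (simp add: phiop_def vact_mult[OF clin_hat_act])

lemma phi_fal: "set is \<subseteq> {1..<d} ==> prod_list (map phi is) : fal d"
proof (induction "is")
 case (Cons i "is")
 have "phi i : fal d" using Cons.prems unfolding phi_def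
  by (intro fal_closed fal_mult gs_fal gx_fal gc_fal) auto
 thus ?case using Cons by (simp add: fal_mult)
qed (simp add: fal_one)

end

locale skewK = skew +
 fixes L :: filling and K :: "hatb vec set"
 assumes L: "standard lam mu L" and K: "simple_submod (agens (card (boxes lam mu))) (hatH lam mu) K"
  and KL: "K \<subseteq> Cl_v (card (boxes lam mu)) L"
begin

lemma Cl_v_eq: "Cl_v n L = em L ` clsp n"
proof -
 have "{bas (J, L) |J. J \<subseteq> {1..n}} = em L ` bas ` {J. J \<subseteq> {1..n}}" by force
 hence "Cl_v n L = cvec.span (em L ` bas ` {J. J \<subseteq> {1..n}})" by (simp add: Cl_v_def)
 also have "\<dots> = em L ` clsp n"
  unfolding clsp_def by (rule cpair.linear_span_image[OF clin_linear[OF clin_tens_left]])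
 finally show ?thesis .
qed

lemma K_em: "v : K ==> \<exists>a\<in>clsp n. v = em L a"
 using KL Cl_v_eq by auto

lemma K_props: "subsp K" "K \<subseteq> V0" "j : {1..n} ==> v : K ==> hat_c j v : K"
 "j : {1..n} ==> v : K ==> hx j v : K" "v : K ==> sgo hpar v : K" "K ~= {0}"
proof -
 have s: "submod (agens n) (vmod V0 hpar (hat_act lam mu)) K" "simple (agens n) (restr (vmod V0 hpar (hat_act lam mu)) K)"
  using K unfolding hatH_eq simple_submod_def by auto
 have s': "K \<subseteq> V0" "subsp K" "!!g v. g : agens n ==> v : K ==> hat_act lam mu g v : K" "!!v. v : K ==> sgo hpar v : K"
  using s(1) unfolding submod_vmod[OF V0_sub] by auto
 show "subsp K" "K \<subseteq> V0" by (rule s')+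
 show "hat_c j v : K" if "j : {1..n}" "v : K" using s'(3)[of "Gc j" v] that by (simp add: agens_def)
 show "hx j v : K" if "j : {1..n}" "v : K" using s'(3)[of "Gx j" v] that by (simp add: agens_def del: hat_act.simps)
 show "sgo hpar v : K" if "v : K" using s'(4) that .
 show "K ~= {0}" using s(2) unfolding restr_vmod[OF s'(1)] simple_def by simp
qed

lemma K_simple:
 assumes "subsp U" "U \<subseteq> K" "!!j v. j : {1..n} ==> v : U ==> hat_c j v : U"
  "!!j v. j : {1..n} ==> v : U ==> hx j v : U" "!!v. v : U ==> sgo hpar v : U"
 shows "U = {0} \<or> U = K"
proof -
 have "simple (agens n) (restr (vmod V0 hpar (hat_act lam mu)) K)" using K unfolding hatH_eq simple_submod_def by auto
 hence "submod (agens n) (vmod K hpar (hat_act lam mu)) U ==> U = {0} \<or> U = K"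
  unfolding restr_vmod[OF K_props(2)] simple_def by auto
 moreover have "submod (agens n) (vmod K hpar (hat_act lam mu)) U"
  unfolding submod_vmod[OF K_props(1)] using assms by (auto simp: agens_def simp del: hat_act.simps(2,3))
 ultimately show ?thesis by blast
qed

definition KM :: "filling => hatb vec set" where
 "KM M = tau (pm L M) ` K"

lemma KM_em: "std M ==> v : KM M ==> \<exists>a\<in>clsp n. v = em M a"
proof -
 assume M: "std M" and "v : KM M"
 then obtain u where "u : K" "v = tau (pm L M) u" by (auto simp: KM_def)
 then obtain a where a: "a : clsp n" "v = tau (pm L M) (em L a)" using K_em by blast
 hence "v = em M (lin (cl_perm (pm L M)) a)" by (simp only: tau_em pm_L[OF L M])
 thus ?thesis using cl_perm_clsp[OF pm_permutes[OF L M] a(1)] by blast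
qed

lemma KM_sub: "subsp (KM M)"
 unfolding KM_def by (rule clin_image_subspace[OF clin_tau K_props(1)])

lemma KM_V0: "std M ==> KM M \<subseteq> V0"
 using KM_em em_V0 by blast

lemma pm_surj:
 assumes "std M" "j : {1..n}" obtains j' where "j' : {1..n}" "pm L M j' = j"
 using permutes_image[OF pm_permutes[OF L assms(1)]] assms(2) by (metis imageE)

lemma tau_pm_act:
 assumes M: "std M" and j: "j : {1..n}" and v: "v : K"
 shows "tau (pm L M) (hat_c j v) = hat_c (pm L M j) (tau (pm L M) v)"
  "tau (pm L M) (hx j v) = hx (pm L M j) (tau (pm L M) v)"
proof -
 obtain a where a: "a : clsp n" "v = em L a" using K_em[OF v] by auto
 have inj: "inj (pm L M)" using permutes_inj[OF pm_permutes[OF L M]] .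
 show "tau (pm L M) (hat_c j v) = hat_c (pm L M j) (tau (pm L M) v)" unfolding a(2) by (rule tau_c[OF inj a(1)])
 show "tau (pm L M) (hx j v) = hx (pm L M j) (tau (pm L M) v)" unfolding a(2) by (rule hx_tau_gen[OF L M j a(1), symmetric])
qed

lemma tau_sg:
 assumes M: "std M" and v: "v : K" shows "tau (pm L M) (sgo hpar v) = sgo hpar (tau (pm L M) v)"
proof -
 obtain a where a: "a : clsp n" "v = em L a" using K_em[OF v] by auto
 show ?thesis unfolding a(2) by (rule sgo_tau[OF permutes_inj[OF pm_permutes[OF L M]] a(1), symmetric])
qed

lemma KM_closed:
 assumes M: "std M" and v: "v : KM M"
 shows "j : {1..n} ==> hat_c j v : KM M" "j : {1..n} ==> hx j v : KM M" "sgo hpar v : KM M"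
proof -
 obtain u where u: "u : K" "v = tau (pm L M) u" using v by (auto simp: KM_def)
 show "hat_c j v : KM M" if "j : {1..n}"
 proof -
  from M that obtain j' where j: "j' : {1..n}" "pm L M j' = j" by (rule pm_surj)
  show ?thesis using tau_pm_act(1)[OF M j(1) u(1)] K_props(3)[OF j(1) u(1)] j(2) unfolding KM_def u(2) by (metis imageI)
 qed
 show "hx j v : KM M" if "j : {1..n}"
 proof -
  from M that obtain j' where j: "j' : {1..n}" "pm L M j' = j" by (rule pm_surj)
  show ?thesis using tau_pm_act(2)[OF M j(1) u(1)] K_props(4)[OF j(1) u(1)] j(2) unfolding KM_def u(2) by (metis imageI)
 qed
 show "sgo hpar v : KM M" using tau_sg[OF M u(1)] K_props(5)[OF u(1)] unfolding KM_def u(2) by (metis imageI)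
qed

lemma tau_inj:
 assumes M: "std M" and v: "v : K" "tau (pm L M) v = 0" shows "v = 0"
proof -
 obtain a where a: "a : clsp n" "v = em L a" using K_em[OF v(1)] by auto
 have p: "pm L M permutes {1..n}" by (rule pm_permutes[OF L M])
 have "tau (inv_into UNIV (pm L M)) (tau (pm L M) v) = tau (%j. inv_into UNIV (pm L M) (pm L M j)) v"
  unfolding a(2) by (rule tau_tau[OF _ _ a(1)]) (use permutes_inj[OF p] permutes_inj[OF permutes_inv[OF p]] in auto)
 also have "(%j. inv_into UNIV (pm L M) (pm L M j)) = id" using permutes_inverses(2)[OF p] by auto
 also have "tau id v = v" unfolding a(2) by (rule tau_id[OF a(1)])
 finally show ?thesis using v(2) by (simp add: clin_0[OF clin_tau])
qed

lemma KM_simple: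
 assumes M: "std M" and U: "subsp U" "U \<subseteq> KM M" "!!j v. j : {1..n} ==> v : U ==> hat_c j v : U"
  "!!j v. j : {1..n} ==> v : U ==> hx j v : U" "!!v. v : U ==> sgo hpar v : U"
 shows "U = {0} \<or> U = KM M"
proof -
 let ?W = "{v \<in> K. tau (pm L M) v : U}"
 have r: "pm L M j : {1..n}" if "j : {1..n}" for j using permutes_in_image[OF pm_permutes[OF L M]] that by blast
 have "?W = {0} \<or> ?W = K"
 proof (rule K_simple)
  show "subsp ?W" by (rule clin_vimage_subspace[OF clin_tau U(1) K_props(1)])
 qed (use U(3-5) r tau_pm_act[OF M] tau_sg[OF M] K_props(3-5) in "auto simp del: hat_act.simps")
 moreover have "U = tau (pm L M) ` ?W" using U(2) by (auto simp: KM_def)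
 ultimately show ?thesis unfolding KM_def by (metis (no_types, lifting) clin_0[OF clin_tau] image_empty image_insert)
qed

lemma KM_swap:
 assumes M: "std M" and i: "i : {1..<n}" and s: "std (swap i M)"
 shows "KM (swap i M) = tau (tr i) ` KM M"
proof -
 have "tau (pm L (swap i M)) v = tau (tr i) (tau (pm L M) v)" if vK: "v : K" for v
 proof -
  obtain a where a: "a : clsp n" "v = em L a" using K_em[OF vK] by auto
  show ?thesis unfolding a(2) pm_swap[OF i, symmetric]
   by (rule tau_tau[symmetric, OF _ permutes_inj[OF pm_permutes[OF L M]] a(1)]) simp
 qed
 thus ?thesis unfolding KM_def image_image by (intro image_cong) auto
qed

definition S :: "hatb vec set" where
 "S = cvec.span (\<Union>M\<in>{M. std M}. KM M)"

lemma S_sub [simp, intro!]: "subsp S"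
 by (simp add: S_def)

lemma KM_S: "std M ==> KM M \<subseteq> S"
 unfolding S_def by (auto intro: cvec.span_base)

lemma S_mem:
 assumes "v : S" "clin f" "subsp W" "!!M v. std M ==> v : KM M ==> f v : W"
 shows "f v : W"
 by (rule clin_span_mem[OF assms(1)[unfolded S_def] assms(2,3)]) (use assms(4) in auto)

lemma hs_KM:
 assumes M: "std M" and v: "v : KM M" and i: "i : {1..<n}"
 shows "hs i v = cscale (1 / (kc (i+1) M * kc (i+1) M - kc i M * kc i M)) (Bo i v) + cscale (yy i M) (tau (tr i) v)"
  and "Bo i v : KM M"
proof -
 obtain a where a: "a : clsp n" "v = em M a" using KM_em[OF M v] by auto
 show "hs i v = cscale (1 / (kc (i+1) M * kc (i+1) M - kc i M * kc i M)) (Bo i v) + cscale (yy i M) (tau (tr i) v)"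
  unfolding a(2) by (rule hs_formula[OF M i a(1)])
 have ii: "i : {1..n}" "i + 1 : {1..n}" using i by auto
 show "Bo i v : KM M" unfolding Bo_def
  by (intro sub_add[OF KM_sub] sub_diff[OF KM_sub] KM_closed[OF M] v ii)
qed

lemma S_submod: "submod (gens n) (vmod V0 hpar (hat_act lam mu)) S"
proof -
 have hc: "hat_act lam mu (Gc i) = hat_c i" for i by simp
 have s: "hs i v : S" if "i : {1..<n}" "v : S" for i v
 proof (rule S_mem[OF that(2) clin_hat_act S_sub])
  fix M u assume M: "std M" and u: "u : KM M"
  have "cscale (yy i M) (tau (tr i) u) : S"
  proof (cases "yy i M = 0")
   case False
   hence "std (swap i M)" using yy_std[OF M that(1)] by simp
   hence "tau (tr i) u : S" using KM_swap[OF M that(1)] u KM_S by blast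
   thus ?thesis by (rule sub_scale[OF S_sub])
  qed (simp add: sub_0)
  moreover have "Bo i u : S" using hs_KM(2)[OF M u that(1)] KM_S[OF M] by blast
  ultimately show "hs i u : S" unfolding hs_KM(1)[OF M u that(1)]
   by (intro sub_add[OF S_sub] sub_scale[OF S_sub, of "Bo i u"])
 qed
 have c: "hat_c i v : S" if "i : {1..n}" "v : S" for i v
  by (rule S_mem[OF that(2) clin_hat_c S_sub]) (use KM_closed(1) KM_S that(1) in blast)
 have x: "hx i v : S" if "i : {1..n}" "v : S" for i v
  by (rule S_mem[OF that(2) clin_hat_act S_sub]) (use KM_closed(2) KM_S that(1) in blast)
 have g: "sgo hpar v : S" if "v : S" for v
  by (rule S_mem[OF that clin_sgo S_sub]) (use KM_closed(3) KM_S in blast)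
 have "S \<subseteq> V0" using S_mem[OF _ clin_id V0_sub] KM_V0 by blast
 thus ?thesis unfolding submod_vmod[OF V0_sub] gens_def using s c x g
  by (auto simp del: hat_act.simps(2,3))
qed

lemma S_HC_ops: "HC_ops n S hpar (hat_act lam mu)"
 by (rule HC_ops.restrict[OF hat_HC_ops S_submod])

lemma phi_word:
 assumes "set is \<subseteq> {1..<n}" "u : K"
 shows "\<exists>a. vact (hat_act lam mu) (prod_list (map phi is)) u = cscale a (tau (word_perm is) u)
  & (std (%x. word_perm is (L x)) \<or> a = 0)"
 using assms(1)
proof (induction "is")
 case Nil
 obtain b where b: "b : clsp n" "u = em L b" using K_em[OF assms(2)] by auto
 show ?case using tau_id[OF b(1), of L] L b(2) by (intro exI[of _ 1]) (simp add: vact_one word_perm_def id_def)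
next
 case (Cons i "is")
 then obtain a where a: "vact (hat_act lam mu) (prod_list (map phi is)) u = cscale a (tau (word_perm is) u)"
  "std (%x. word_perm is (L x)) \<or> a = 0" by auto
 have i: "i : {1..<n}" using Cons.prems by auto
 have p: "word_perm is permutes {1..n}" using word_perm_props[of "is" n] Cons.prems by auto
 obtain b where b: "b : clsp n" "u = em L b" using K_em[OF assms(2)] by auto
 show ?case
 proof (cases "a = 0")
  case True
  thus ?thesis unfolding vact_phi_Cons a(1) phiop_def
   by (intro exI[of _ 0]) (simp add: clin_0[OF clin_vact[OF clin_hat_act]])
 next
  case False
  let ?M = "%x. word_perm is (L x)"
  have M: "std ?M" using a(2) False by simp
  have m: "lin (cl_perm (word_perm is)) b : clsp n" by (rule cl_perm_clsp[OF p b(1)])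
  have t: "tau (tr i) (tau (word_perm is) u) = tau (word_perm (i # is)) u"
   unfolding b(2) word_perm_Cons by (rule tau_tau[OF _ permutes_inj[OF p] b(1)]) simp
  let ?z = "(kc i ?M * kc i ?M - kc (i+1) ?M * kc (i+1) ?M) * yy i ?M"
  have "phiop i (tau (word_perm is) u) = cscale ?z (tau (tr i) (tau (word_perm is) u))"
   using phiop_em[OF M i m] by (simp only: b(2) tau_em)
  hence "phiop i (cscale a (tau (word_perm is) u)) = cscale (a * ?z) (tau (word_perm (i # is)) u)"
   unfolding phiop_def clin_scale[OF clin_vact[OF clin_hat_act]] t by simp
  moreover have "std (%x. word_perm (i # is) (L x)) \<or> a * ?z = 0"
   using yy_std[OF M i] unfolding word_perm_Cons swap_tr by auto
  ultimately show ?thesis unfolding vact_phi_Cons a(1) by blast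
 qed
qed

text \<open>Towards a given standard filling there is a path of standard fillings along a reduced expression.\<close>

lemma reduced_path:
 assumes "std M"
 shows "\<exists>is. set is \<subseteq> {1..<n} & word_perm is = pm L M & length is \<le> card (Inv n (pm L M)) &
  (\<forall>u\<in>K. \<exists>a. a ~= 0 & vact (hat_act lam mu) (prod_list (map phi is)) u = cscale a (tau (pm L M) u))"
 using assms
proof (induction "card (Inv n (pm L M))" arbitrary: M rule: less_induct)
 case less
 show ?case
 proof (cases "M = L")
  case True
  have "pm L L = id" using pm_unique[OF L L, of id] by (auto simp: permutes_id)
  moreover have "vact (hat_act lam mu) (prod_list (map phi [])) u = cscale 1 (tau id u)" if "u : K" for u
   using K_em[OF that] tau_id by (auto simp: vact_one)
  ultimately show ?thesis using True by (intro exI[of _ "[]"]) (auto simp: word_perm_def id_def intro!: exI[of _ 1])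
 next
  case False
  obtain i where i: "i : {1..<n}" "std (swap i M)" "card (Inv n (pm L (swap i M))) < card (Inv n (pm L M))"
   using step_towards[OF L less.prems False] by blast
  obtain "is" where w: "set is \<subseteq> {1..<n}" "word_perm is = pm L (swap i M)" "length is \<le> card (Inv n (pm L (swap i M)))"
   and act: "\<forall>u\<in>K. \<exists>a. a ~= 0 & vact (hat_act lam mu) (prod_list (map phi is)) u = cscale a (tau (pm L (swap i M)) u)"
   using less.hyps[OF i(3,2)] by blast
  have wp: "word_perm (i # is) = pm L M"
   unfolding word_perm_Cons w(2) using pm_swap[OF i(1), of L "swap i M"] by simp
  have "\<exists>a. a ~= 0 & vact (hat_act lam mu) (prod_list (map phi (i # is))) u = cscale a (tau (pm L M) u)" if u: "u : K" for u
  proof -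
   obtain a where a: "a ~= 0" "vact (hat_act lam mu) (prod_list (map phi is)) u = cscale a (tau (pm L (swap i M)) u)"
    using act u by blast
   obtain b where b: "b : clsp n" "u = em L b" using K_em[OF u] by auto
   have m: "lin (cl_perm (pm L (swap i M))) b : clsp n" by (rule cl_perm_clsp[OF pm_permutes[OF L i(2)] b(1)])
   have t: "tau (tr i) (tau (pm L (swap i M)) u) = tau (pm L M) u"
    unfolding b(2) wp[symmetric] word_perm_Cons w(2)
    by (rule tau_tau[OF _ permutes_inj[OF pm_permutes[OF L i(2)]] b(1)]) simp
   let ?N = "swap i M"
   let ?z = "(kc i ?N * kc i ?N - kc (i+1) ?N * kc (i+1) ?N) * yy i ?N"
   have "phiop i (tau (pm L ?N) u) = cscale ?z (tau (tr i) (tau (pm L ?N) u))"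
    using phiop_em[OF i(2,1) m] by (simp only: b(2) tau_em pm_L[OF L i(2)])
   hence "phiop i (cscale a (tau (pm L ?N) u)) = cscale (a * ?z) (tau (pm L M) u)"
    unfolding phiop_def clin_scale[OF clin_vact[OF clin_hat_act]] t by simp
   moreover have "a * ?z ~= 0"
   proof -
    have "kc i ?N * kc i ?N - kc (i+1) ?N * kc (i+1) ?N ~= 0"
     using kp_ne[OF i(2,1)] by (auto simp flip: of_real_mult of_real_diff simp: square_eq_iff eq_neg_iff_add_eq_0 add.commute)
    moreover have "yy i ?N ~= 0" using yy_std[OF i(2,1)] less.prems by simp
    ultimately show ?thesis using a(1) by simp
   qed
   ultimately show ?thesis unfolding vact_phi_Cons a(2) by blast
  qed
  thus ?thesis using w i(1,3) wp by (intro exI[of _ "i # is"]) auto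
 qed
qed

lemma H_space_eq: "H_space lam mu K = S"
proof
 have st: "hat_act lam mu g v : V0" if "g : gens n" "v : V0" for g v
  using HC_ops.a_mem[OF hat_HC_ops] that by blast
 have aa: "alg_act (hatH lam mu) (prod_list (map phi is)) u = vact (hat_act lam mu) (prod_list (map phi is)) u"
  if "set is \<subseteq> {1..<n}" "u : K" for "is" u
  unfolding hatH_eq by (rule alg_act_vmod[OF V0_sub _ phi_fal[OF that(1)]]) (use st K_props(2) that(2) in "auto simp del: hat_act.simps")
 show "H_space lam mu K \<subseteq> S"
  unfolding H_space_def
 proof (rule cvec.span_minimal[OF _ S_sub], clarify)
  fix w "is" u assume r: "reduced_expr n w is" and u: "u : K"
  hence iss: "set is \<subseteq> {1..<n}" by (simp add: reduced_expr_def)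
  obtain a where a: "vact (hat_act lam mu) (prod_list (map phi is)) u = cscale a (tau (word_perm is) u)"
   "std (%x. word_perm is (L x)) \<or> a = 0" using phi_word[OF iss u] by blast
  show "alg_act (hatH lam mu) (prod_list (map phi is)) u : S"
  proof (cases "a = 0")
   case True
   thus ?thesis unfolding aa[OF iss u] a(1) by (simp add: sub_0)
  next
   case False
   let ?M = "%x. word_perm is (L x)"
   have M: "std ?M" using a(2) False by simp
   have "word_perm is = pm L ?M" using word_perm_props[OF iss] by (intro pm_unique[OF L M]) auto
   hence "tau (word_perm is) u : KM ?M" using u unfolding KM_def by (metis imageI)
   thus ?thesis unfolding aa[OF iss u] a(1) using KM_S[OF M] by (intro sub_scale[OF S_sub]) auto
  qed
 qed
 show "S \<subseteq> H_space lam mu K"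
  unfolding S_def
 proof (rule cvec.span_minimal, clarify)
  fix M v assume M: "std M" and "v : KM M"
  then obtain u where u: "u : K" "v = tau (pm L M) u" by (auto simp: KM_def)
  obtain "is" where w: "set is \<subseteq> {1..<n}" "word_perm is = pm L M" "length is \<le> card (Inv n (pm L M))"
   and act: "\<forall>u\<in>K. \<exists>a. a ~= 0 & vact (hat_act lam mu) (prod_list (map phi is)) u = cscale a (tau (pm L M) u)"
   using reduced_path[OF M] by blast
  have red: "reduced_expr n (pm L M) is"
   unfolding reduced_expr_def using w word_perm_props by (metis order_trans)
  obtain a where a: "a ~= 0" "vact (hat_act lam mu) (prod_list (map phi is)) u = cscale a (tau (pm L M) u)" using act u(1) by blast
  have "alg_act (hatH lam mu) (prod_list (map phi is)) u : H_space lam mu K"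
   unfolding H_space_def using red pm_permutes[OF L M] u(1) by (intro cvec.span_base) blast
  hence "cscale (1 / a) (cscale a v) : H_space lam mu K"
   unfolding aa[OF w(1) u(1)] a(2) u(2)[symmetric] H_space_def by (rule cvec.span_scale)
  thus "v : H_space lam mu K" using a(1) by simp
 qed (simp add: H_space_def)
qed

lemma H_module_eq: "H_module lam mu K = vmod S hpar (hat_act lam mu)"
proof -
 have "S \<subseteq> V0" using S_submod by (simp add: submod_vmod)
 thus ?thesis unfolding H_module_def H_space_eq hatH_eq by (rule restr_vmod)
qed

definition pr :: "filling => hatb vec => hatb vec" where
 "pr M = lin (%(J, M'). if M' = M then bas (J, M) else 0)"

lemma clin_pr: "clin (pr M)" by (simp add: pr_def)

lemma pr_em: "pr M (em M' a) = (if M' = M then em M a else 0)"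
proof (cases "M' = M")
 case True
 have "pr M (em M a) = em M a"
  by (rule clin_eqI[where f="%a. pr M (em M a)"]) (auto intro!: clin_comp[OF clin_pr] clin_tens_left simp: pr_def)
 thus ?thesis using True by simp
next
 case False
 have "pr M (em M' a) = 0"
  by (rule clin_eqI[where f="%a. pr M (em M' a)" and g="%a. 0"])
    (use False in "auto intro!: clin_comp[OF clin_pr] clin_tens_left simp: pr_def")
 thus ?thesis using False by simp
qed

lemma pr_S: "v : S ==> std M ==> pr M v : KM M"
proof (rule S_mem[OF _ clin_pr KM_sub])
 fix M' u assume "std M'" "u : KM M'"
 then obtain a where a: "u = em M' a" using KM_em by blast
 show "pr M u : KM M" using \<open>u : KM M'\<close> unfolding a pr_em by (auto simp: sub_0[OF KM_sub])
qed

lemma hx_lookup: "lk (hx p v) (J, M) = (if p : J then -1 else 1) * kc p M * lk v (J, M)"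
proof -
 have "lk (hx p v) (J, M) = (\<Sum>b\<in>keys v. if b = (J, M) then (if p : J then -1 else 1) * kc p M * lk v (J, M) else 0)"
  unfolding hat_act.simps lin_def lookup_sum
  by (rule sum.cong) (auto simp: lookup_single when_def split: prod.splits)
 thus ?thesis by (simp add: in_keys_iff)
qed

text \<open>Vectors of different fillings are separated by the eigenvalues of the \<open>x\<^sub>p\<^sup>2\<close>.\<close>

lemma S_simple:
 assumes U: "submod (gens n) (vmod S hpar (hat_act lam mu)) U" "U ~= {0}"
 shows "U = S"
proof -
 have US: "U \<subseteq> S" "subsp U" "!!g v. g : gens n ==> v : U ==> hat_act lam mu g v : U" "!!v. v : U ==> sgo hpar v : U"
  using U(1) by (auto simp: submod_vmod)
 have Uc: "hat_c j v : U" if "j : {1..n}" "v : U" for j v using US(3)[of "Gc j" v] that by (simp add: gens_def)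
 have Ux: "hx j v : U" if "j : {1..n}" "v : U" for j v using US(3)[of "Gx j" v] that by (simp add: gens_def del: hat_act.simps)
 have Us: "hs j v : U" if "j : {1..<n}" "v : U" for j v using US(3)[of "Gs j" v] that by (simp add: gens_def del: hat_act.simps)
 have SV: "S \<subseteq> V0" using S_submod by (simp add: submod_vmod)
 define supp where "supp v = snd ` keys v" for v :: "hatb vec"
 have fs: "finite (supp v)" for v by (simp add: supp_def)
 have ss: "std M" if "v : U" "M : supp v" for v M
  using that US(1) SV unfolding supp_def V0_def by (fastforce simp: span_bas_iff dest!: subsetD)
 have sk: "M : supp v \<longleftrightarrow> (\<exists>J. lk v (J, M) ~= 0)" for v M by (force simp: supp_def in_keys_iff)
 obtain u where u: "u : U" "u ~= 0" and min: "!!v. v : U ==> v ~= 0 ==> card (supp u) \<le> card (supp v)"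
 proof -
  obtain v where "v : U" "v ~= 0" using U(2) sub_0[OF US(2)] by auto
  hence "\<exists>u. (u : U & u ~= 0) & (\<forall>v. v : U & v ~= 0 --> card (supp u) \<le> card (supp v))"
   by (intro ex_has_least_nat[of "%u. u : U & u ~= 0" v "%u. card (supp u)"]) auto
  thus ?thesis using that by blast
 qed
 obtain b where "lk u b ~= 0" using u(2) by (metis poly_mapping_eqI lookup_zero)
 then obtain M where M: "M : supp u" using sk by (metis prod.exhaust)
 have Ms: "std M" by (rule ss[OF u(1) M])
 have one: "M' = M" if M': "M' : supp u" for M'
 proof (rule ccontr)
  assume "M' ~= M"
  have Ms': "std M'" by (rule ss[OF u(1) M'])
  obtain p where p: "p : {1..n}" "content (lbl M p) ~= content (lbl M' p)"
   using contents_inj[OF Ms Ms'] \<open>M' ~= M\<close> by metis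
  have kne: "kc p M' * kc p M' ~= kc p M * kc p M"
   using p kap_sq_inj[OF content_nonneg[OF lbl_Bx[OF Ms' p(1)]] content_nonneg[OF lbl_Bx[OF Ms p(1)]]]
   unfolding kp_kap by simp
  define v where "v = hx p (hx p u) - cscale (kc p M * kc p M) u"
  have lkv: "lk v (J, N) = (kc p N * kc p N - kc p M * kc p M) * lk u (J, N)" for J N
   by (simp add: v_def lookup_minus hx_lookup algebra_simps del: hat_act.simps)
  have "v : U" unfolding v_def
   using Ux[OF p(1) Ux[OF p(1) u(1)]] sub_scale[OF US(2) u(1)] by (rule sub_diff[OF US(2)])
  moreover obtain J where "lk u (J, M') ~= 0" using M' sk by blast
  hence "lk v (J, M') ~= 0" using kne by (simp add: lkv)
  hence "v ~= 0" by auto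
  moreover have "supp v \<subseteq> supp u - {M}" using sk lkv by auto
  hence "card (supp v) < card (supp u)" using M fs by (intro psubset_card_mono) auto
  ultimately show False using min by fastforce
 qed
 have "pr M u = u"
 proof -
  have "pr M u = (%v. v) u"
  proof (rule clin_eqI[OF clin_pr clin_id])
   fix b assume b: "b : keys u"
   hence "snd b = M" using one unfolding supp_def by blast
   thus "pr M (bas b) = bas b" by (cases b) (simp add: pr_def)
  qed
  thus ?thesis .
 qed
 hence uK: "u : KM M" using pr_S[OF _ Ms, of u] u(1) US(1) by auto
 have "U \<inter> KM M = {0} \<or> U \<inter> KM M = KM M"
  by (rule KM_simple[OF Ms]) (use US Uc Ux KM_closed[OF Ms] KM_sub in "auto intro!: cvec.subspace_inter simp del: hat_act.simps")
 hence KU: "KM M \<subseteq> U" using uK u by auto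
 have "KM N \<subseteq> U" if N: "std N" for N
 proof -
  have "!!M. std M ==> KM M \<subseteq> U ==> KM N \<subseteq> U"
  proof -
   fix M assume "std M" "KM M \<subseteq> U"
   thus "KM N \<subseteq> U"
   proof (induction "card (Inv n (pm N M))" arbitrary: M rule: less_induct)
    case less
    show ?case
    proof (cases "M = N")
     case False
     obtain i where i: "i : {1..<n}" "std (swap i M)" "card (Inv n (pm N (swap i M))) < card (Inv n (pm N M))"
      using step_towards[OF N less.prems(1) False] by blast
     have y: "yy i M ~= 0" using yy_std[OF less.prems(1) i(1)] i(2) by simp
     have "tau (tr i) v : U" if v: "v : KM M" for v
     proof -
      note f = hs_KM[OF less.prems(1) v i(1)]
      have "cscale (yy i M) (tau (tr i) v) = hs i v - cscale (1 / (kc (i+1) M * kc (i+1) M - kc i M * kc i M)) (Bo i v)"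
       using f(1) by (simp del: hat_act.simps)
      also have "\<dots> : U" using f(2) less.prems(2) v Us[OF i(1)]
       by (intro sub_diff[OF US(2)] sub_scale[OF US(2)]) auto
      finally have "cscale (1 / yy i M) (cscale (yy i M) (tau (tr i) v)) : U" by (rule sub_scale[OF US(2)])
      thus ?thesis using y by simp
     qed
     hence "KM (swap i M) \<subseteq> U" unfolding KM_swap[OF less.prems(1) i(1,2)] by auto
     thus ?thesis by (rule less.hyps[OF i(3,2)])
    qed (use less in simp)
   qed
  qed
  thus ?thesis using Ms KU by blast
 qed
 hence "S \<subseteq> U" unfolding S_def by (intro cvec.span_minimal US(2)) auto
 thus ?thesis using US(1) by auto
qed

end

section \<open>The row reading filling\<close>

lemma row_order_rigid:
 fixes \<pi> r :: "nat => nat" and z :: "nat => 'c"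
 assumes \<pi>: "\<pi> permutes {1..d}"
  and mono: "!!p p'. 1 \<le> p ==> p \<le> p' ==> p' \<le> d ==> r p \<le> r p'"
  and inj: "!!p p'. p : {1..d} ==> p' : {1..d} ==> r p = r p' ==> z p = z p' ==> p = p'"
  and last: "!!p. p : {1..d} ==> \<exists>e\<in>{p..d}. r e = r p & (\<forall>p'\<in>{p..d}. z p' = z e --> p' = e)"
  and order: "!!p p'. 1 \<le> p ==> p < p' ==> p' \<le> d ==> r (\<pi> p) = r (\<pi> p') ==> \<pi> p < \<pi> p'"
  and z: "!!p. p : {1..d} ==> z (\<pi> p) = z p"
 shows "\<pi> = id"
proof (rule ccontr)
 assume "\<pi> ~= id"
 then obtain p' where "\<pi> p' ~= p'" by (auto simp: fun_eq_iff)
 then obtain p where p: "\<pi> p ~= p" and least: "!!i. i < p ==> \<pi> i = i"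
  using exists_least_iff[of "%p. \<pi> p ~= p"] by blast
 have pd: "p : {1..d}" using p permutes_not_in[OF \<pi>] by blast
 have ge: "p \<le> \<pi> i" if "p \<le> i" for i
 proof (rule ccontr)
  assume "~ p \<le> \<pi> i"
  hence "\<pi> (\<pi> i) = \<pi> i" using least by simp
  hence "\<pi> i = i" using permutes_inj[OF \<pi>] by (auto dest: injD)
  thus False using \<open>~ p \<le> \<pi> i\<close> that by simp
 qed
 obtain e where e: "e : {p..d}" "r e = r p" and u: "!!p'. p' : {p..d} ==> z p' = z e ==> p' = e" using last[OF pd] by auto
 have in_d: "\<pi> i : {1..d}" if "i : {1..d}" for i using permutes_in_image[OF \<pi>] that by blast
 have \<pi>e: "\<pi> e = e" using u[of "\<pi> e"] ge[of e] in_d[of e] z[of e] e(1) pd by auto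
 obtain p0 where p0: "p0 : {1..d}" "\<pi> p0 = p" using permutes_image[OF \<pi>] pd by (metis imageE)
 have gt: "p < p0" using p0(2) p least[of p0] by (cases p0 p rule: linorder_cases) auto
 have "p0 < e"
 proof (rule ccontr)
  assume "~ p0 < e"
  hence "e < p0" using \<pi>e p0(2) p by (cases p0 e rule: linorder_cases) auto
  hence "\<pi> e < \<pi> p0" using order[of e p0] e p0 \<pi>e pd by auto
  thus False using e(1) \<pi>e p0 by auto
 qed
 hence "r p0 = r p" using mono[of p p0] mono[of p0 e] gt e pd by auto
 hence "p0 = p" using inj[OF p0(1) pd] z[OF p0(1)] p0(2) by auto
 thus False using gt by simp
qed

context skew
begin

definition segs :: "(int \<times> int) list" where "segs = segments lam mu"

definition blens :: "nat list" where "blens = map2 (-) lam mu"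

fun rd :: "nat => box list" where
 "rd 0 = []"
| "rd (Suc r) = rd r @ map (bx (Suc r)) [mu ! r..<lam ! r]"

lemma mu_lam: "r < length lam ==> mu ! r \<le> lam ! r"
 using shape by (simp add: shifted_skew_shape_def)

lemma length_segs [simp]: "length segs = length lam" "length blens = length lam"
 using len by (simp_all add: segs_def segments_def blens_def)

lemma segs_nth: "r < length lam ==> segs ! r = (int (mu ! r), int (lam ! r) - 1)"
 using len by (simp add: segs_def segments_def)

lemma seg_lens_segs: "seg_lens segs = blens"
proof (rule nth_equalityI)
 fix r assume "r < length (seg_lens segs)"
 hence "r < length lam" by (simp add: seg_lens_def)
 thus "seg_lens segs ! r = blens ! r"
  using segs_nth[of r] mu_lam[of r] len by (simp add: seg_lens_def seg_len_def blens_def nat_diff_distrib')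
qed (simp add: seg_lens_def)

lemma set_rd: "r \<le> length lam ==> set (rd r) = {bx i z | i z. row i z & i \<le> r}"
 by (induction r) (auto simp: row_def le_Suc_eq)

definition lex :: "box => box => bool" where
 "lex b b' \<longleftrightarrow> fst b < fst b' \<or> fst b = fst b' & snd b < snd b'"

lemma fst_bx [simp]: "fst (bx a z) = a"
 by (simp add: bx_def)

lemma sorted_rd: "r \<le> length lam ==> sorted_wrt lex (rd r)"
proof (induction r)
 case (Suc r)
 have *: "lex b b'" if "b : set (rd r)" "b' : set (map (bx (Suc r)) [mu ! r..<lam ! r])" for b b'
  using that Suc.prems by (auto simp: set_rd lex_def)
 have "sorted_wrt lex (map (bx (Suc r)) [mu ! r..<lam ! r])"
  by (simp add: sorted_wrt_map lex_def bx_def sorted_wrt_iff_nth_less)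
 thus ?case using Suc by (simp add: sorted_wrt_append *)
qed simp

lemma contents_rd: "r \<le> length lam ==> map content (rd r) = contents (take r segs)"
proof (induction r)
 case (Suc r)
 have "map content (map (bx (Suc r)) [mu ! r..<lam ! r]) = seg_contents (segs ! r)"
  using Suc.prems mu_lam[of r] by (intro nth_equalityI) (auto simp: segs_nth seg_contents_def seg_len_def)
 thus ?case using Suc by (simp add: take_Suc_conv_app_nth contents_def)
qed (simp add: contents_def)

lemma length_rd: "r \<le> length lam ==> length (rd r) = sum_list (take r blens)"
 using contents_rd[of r] length_contents[of "take r segs"] unfolding seg_lens_segs[symmetric]
 by (metis length_map seg_lens_def take_map)

lemma block_rd:
 "r \<le> length lam ==> i : block_index (take r blens) \<longleftrightarrow> i : {1..<length (rd r)} & fst (rd r ! (i - 1)) = fst (rd r ! i)"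
proof (induction r)
 case (Suc r)
 let ?l = "length (rd r)" and ?m = "lam ! r - mu ! r"
 have r: "r < length lam" using Suc.prems by simp
 have m: "take (Suc r) blens = take r blens @ [?m]"
  using r len by (simp add: take_Suc_conv_app_nth blens_def)
 have nth: "rd (Suc r) ! j = (if j < ?l then rd r ! j else bx (Suc r) (mu ! r + (j - ?l)))" if "j < ?l + ?m" for j
  using that by (auto simp: nth_append)
 have le: "fst (rd r ! j) \<le> r" if "j < ?l" for j using nth_mem[OF that] set_rd[of r] r by (auto simp: bx_def)
 consider "i < 1" | "1 \<le> i" "i < ?l" | "1 \<le> i" "i = ?l" | "1 \<le> i" "?l < i" by linarith
 thus ?case
 proof cases
  case 1 thus ?thesis by (simp add: m block_index_def)
 next
  case 2
  thus ?thesis unfolding m block_index_snoc using Suc.IH r length_rd[of r] by (auto simp: nth_append)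
 next
  case 3
  have "i \<notin> block_index (take r blens @ [?m])" unfolding block_index_snoc using 3 length_rd[of r] r
   by (auto simp: block_index_def)
  moreover have "fst (rd (Suc r) ! (i - 1)) ~= fst (rd (Suc r) ! i)" if "i < ?l + ?m"

  proof -
   have "i - 1 < ?l" using 3 by simp
   hence "fst (rd (Suc r) ! (i - 1)) \<le> r" using le[of "i - 1"] by (simp add: nth_append)
   moreover have "fst (rd (Suc r) ! i) = Suc r" using nth[OF that] 3 by (simp)
   ultimately show ?thesis by simp
  qed
  ultimately show ?thesis using 3 unfolding m by auto
 next
  case 4
  have "i : block_index (take r blens @ [?m]) \<longleftrightarrow> i - ?l : {1..<?m}" unfolding block_index_snoc using 4 length_rd[of r] r
   by (auto simp: block_index_def image_iff intro!: bexI[of _ "i - ?l"])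
  moreover have "fst (rd (Suc r) ! (i - 1)) = fst (rd (Suc r) ! i)" if "i < ?l + ?m"
  proof -
   have "~ i - 1 < ?l" "~ i < ?l" "i - 1 < ?l + ?m" using 4 that by auto
   thus ?thesis using nth[of "i - 1"] nth[OF that] by (simp only: if_False fst_bx)
  qed
  ultimately show ?thesis using 4 unfolding m by auto
 qed
qed (simp add: block_index_def)

definition bl :: "box list" where "bl = rd (length lam)"

lemma set_bl: "set bl = Bx"
 unfolding bl_def set_rd[OF le_refl] boxes_row by (auto simp: row_def)

lemma lex_bl: "p < p' ==> p' < length bl ==> lex (bl ! p) (bl ! p')"
 using sorted_rd[of "length lam"] unfolding bl_def sorted_wrt_iff_nth_less by blast

lemma distinct_bl: "distinct bl"
 unfolding distinct_conv_nth using lex_bl by (metis lex_def less_irrefl linorder_neqE_nat)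

lemma length_bl: "length bl = n"
 using distinct_card[OF distinct_bl] by (simp add: set_bl)

lemma n_blens: "n = sum_list blens"
 using length_rd[of "length lam"] unfolding bl_def[symmetric] length_bl by simp

lemma contents_bl: "contents segs = map content bl"
 using contents_rd[of "length lam"] by (simp add: bl_def)

definition L0 :: filling where
 "L0 b = (if b : Bx then Suc (THE p. p < n & bl ! p = b) else 0)"

lemma L0_bl: "p < n ==> L0 (bl ! p) = Suc p"
proof -
 assume p: "p < n"
 have "(THE p'. p' < n & bl ! p' = bl ! p) = p"
  using p distinct_bl by (intro the_equality) (auto simp: nth_eq_iff_index_eq length_bl)
 thus ?thesis using p set_bl nth_mem[of p bl] by (simp add: L0_def length_bl)
qed

lemma bl_Bx: "p : {1..n} ==> bl ! (p - 1) : Bx"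
 using nth_mem[of "p - 1" bl, unfolded set_bl length_bl] by auto

lemma bl_L0: "b : Bx ==> \<exists>p<n. b = bl ! p & L0 b = Suc p"
 using set_bl L0_bl length_bl by (metis in_set_conv_nth)

lemma L0_lex: "b : Bx ==> b' : Bx ==> lex b b' ==> L0 b < L0 b'"
proof -
 assume "b : Bx" "b' : Bx" "lex b b'"
 then obtain p p' where "p < n" "b = bl ! p" "L0 b = Suc p" "p' < n" "b' = bl ! p'" "L0 b' = Suc p'" using bl_L0 by metis
 thus ?thesis using lex_bl[of p' p] \<open>lex b b'\<close> length_bl by (cases p p' rule: linorder_cases) (auto simp: lex_def)
qed

lemma std_L0: "std L0"
 unfolding standard_def
proof (intro conjI allI impI)
 show "L0 b = 0" if "b \<notin> Bx" for b using that by (simp add: L0_def)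
 show "bij_betw L0 Bx {1..n}"
 proof (rule bij_betw_imageI)
  show "inj_on L0 Bx"
  proof (rule inj_onI)
   fix b b' assume *: "b : Bx" "b' : Bx" "L0 b = L0 b'"
   obtain p p' where "b = bl ! p" "L0 b = Suc p" "b' = bl ! p'" "L0 b' = Suc p'"
    using bl_L0[OF *(1)] bl_L0[OF *(2)] by blast
   thus "b = b'" using *(3) by simp
  qed
  show "L0 ` Bx = {1..n}"
  proof
   show "L0 ` Bx \<subseteq> {1..n}"
   proof
    fix y assume "y : L0 ` Bx"
    then obtain b where "b : Bx" "y = L0 b" by blast
    thus "y : {1..n}" using bl_L0[of b] by auto
   qed
   show "{1..n} \<subseteq> L0 ` Bx"
   proof
    fix i assume i: "i : {1..n}"
    hence "i - 1 < n" "i = Suc (i - 1)" by auto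
    hence "i = L0 (bl ! (i - 1))" "bl ! (i - 1) : Bx" using L0_bl[of "i - 1"] bl_Bx[OF i] by simp_all
    thus "i : L0 ` Bx" by blast
   qed
  qed
 qed
qed (auto intro!: L0_lex simp: lex_def)

lemma lbl_L0: "p : {1..n} ==> lbl L0 p = bl ! (p - 1)"
 using lbl_L[OF std_L0, of "bl ! (p - 1)"] L0_bl[of "p - 1"] bl_Bx[of p] by fastforce

definition rw :: "nat => nat" where "rw p = fst (bl ! (p - 1))"
definition cn :: "nat => int" where "cn p = contents segs ! (p - 1)"

lemma cn_lbl: "p : {1..n} ==> cn p = content (lbl L0 p)"
proof -
 assume p: "p : {1..n}"
 have "p - 1 < length bl" using p length_bl by auto
 thus ?thesis by (simp add: cn_def contents_bl lbl_L0[OF p])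
qed

lemma rw_mono: "1 \<le> p ==> p \<le> p' ==> p' \<le> n ==> rw p \<le> rw p'"

proof (cases "p = p'")
 case False
 assume p: "1 \<le> p" "p \<le> p'" "p' \<le> n"
 hence "lex (bl ! (p - 1)) (bl ! (p' - 1))" using False length_bl by (intro lex_bl) auto
 thus ?thesis by (auto simp: rw_def lex_def)
qed simp

lemma block_rw: "i : block_index blens \<longleftrightarrow> i : {1..<n} & rw i = rw (i + 1)"
 using block_rd[of "length lam" i] unfolding bl_def[symmetric] length_bl by (simp add: rw_def)

lemma row_bl: "p : {1..n} ==> \<exists>z. bl ! (p - 1) = bx (rw p) z & row (rw p) z & cn p = int z"
proof -
 assume p: "p : {1..n}"
 from bl_Bx[OF p] obtain i z where "bl ! (p - 1) = bx i z" "row i z" by (elim Bx_cases)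
 thus ?thesis using cn_lbl[OF p] lbl_L0[OF p] by (auto simp: rw_def bx_def content_def)
qed

lemma rw_cn_inj: "p : {1..n} ==> p' : {1..n} ==> rw p = rw p' ==> cn p = cn p' ==> p = p'"
proof -
 assume p: "p : {1..n}" "p' : {1..n}" "rw p = rw p'" "cn p = cn p'"
 hence "bl ! (p - 1) = bl ! (p' - 1)" using row_bl[OF p(1)] row_bl[OF p(2)] by auto
 moreover have "p - 1 < length bl" "p' - 1 < length bl" using p length_bl by auto
 ultimately have "p - 1 = p' - 1" using distinct_bl by (simp only: nth_eq_iff_index_eq)
 thus "p = p'" using p by auto
qed

lemma row_end:
 assumes p: "p : {1..n}"
 shows "\<exists>e\<in>{p..n}. rw e = rw p & (\<forall>p'\<in>{p..n}. cn p' = cn e --> p' = e)"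
proof -
 obtain z where z: "bl ! (p - 1) = bx (rw p) z" "row (rw p) z" "cn p = int z" using row_bl[OF p] by auto
 let ?z = "lam ! (rw p - 1) - 1"
 have re: "row (rw p) ?z" "z \<le> ?z" using z(2) by (auto simp: row_def)
 then obtain e' where e': "e' < n" "bl ! e' = bx (rw p) ?z" using bl_L0[of "bx (rw p) ?z"] by auto
 let ?e = "Suc e'"
 have e: "?e : {1..n}" "rw ?e = rw p" "cn ?e = int ?z"
  using e' length_bl by (auto simp: rw_def cn_def contents_bl bx_def content_def)
 have pe: "p \<le> ?e"
 proof (rule ccontr)
  assume "~ p \<le> ?e"
  hence "lex (bl ! e') (bl ! (p - 1))" using lex_bl[of e' "p - 1"] p length_bl by auto
  thus False using e' z re(2) by (simp add: lex_def bx_def)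
 qed
 have "p' = ?e" if p': "p' : {p..n}" "cn p' = cn ?e" for p'
 proof -
  have p1: "p' : {1..n}" using p' p by auto
  obtain z' where z': "row (rw p') z'" "cn p' = int z'" using row_bl[OF p1] by auto
  have "rw p \<le> rw p'" using rw_mono[of p p'] p' p by auto
  moreover have "~ rw p < rw p'" using lam_less'[of "rw p" "rw p'"] z' re(1) p'(2) e(3) by (simp add: row_def) linarith
  ultimately show ?thesis using rw_cn_inj[OF p1 e(1)] e(2) p'(2) by auto
 qed
 moreover have "?e : {p..n}" using e(1) pe by simp
 ultimately show ?thesis using e(2) by blast
qed

end

section \<open>Proper submodules of the induced module\<close>

locale ind = HN: bmod VN "sgo par" "%i. aN (Gx i)" "%i. aN (Gc i)" d "%i. kap (zs ! (i - 1))" "%i. aN (Gs i)" B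
 for VN :: "'b vec set" and par aN d zs B +
 fixes U :: "'a vec set" and sg :: "'a vec => 'a vec" and b :: "gen => 'a vec => 'a vec"
  and emb :: "'b vec => 'a vec" and r :: "nat => nat"
 assumes U: "subsp U" and b_lin: "!!g. clin (b g)" and b_mem: "!!g v. g : gens d ==> v : U ==> b g v : U"
  and sg_lin: "clin sg"
  and b_rels: "!!f v. f : rels d ==> v : U ==> vact b f v = 0"
  and emb_mem: "!!n. n : VN ==> emb n : U"
  and emb_add: "!!m n. m : VN ==> n : VN ==> emb (m + n) = emb m + emb n"
  and emb_scale: "!!n z. n : VN ==> emb (cscale z n) = cscale z (emb n)"
  and emb_act: "!!g n. g : bgens B d ==> n : VN ==> b g (emb n) = emb (aN g n)"
  and emb_sg: "!!n. n : VN ==> sg (emb n) = emb (sgo par n)"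
  and gen: "!!W. subsp W ==> W \<subseteq> U ==> emb ` VN \<subseteq> W ==> (!!g v. g : gens d ==> v : W ==> b g v : W) ==> W = U"
  and VN_simple: "HN.asimple"
  and nonneg: "!!p. p : {1..d} ==> 0 \<le> zs ! (p - 1)" and len_zs: "length zs = d"
  and r_mono: "!!p p'. 1 \<le> p ==> p \<le> p' ==> p' \<le> d ==> r p \<le> r p'"
  and r_B: "!!i. i : {1..<d} ==> r i = r (i + 1) ==> i : B"
  and r_inj: "!!p p'. p : {1..d} ==> p' : {1..d} ==> r p = r p' ==> zs ! (p - 1) = zs ! (p' - 1) ==> p = p'"
  and r_last: "!!p. p : {1..d} ==>
    \<exists>e\<in>{p..d}. r e = r p & (\<forall>p'\<in>{p..d}. zs ! (p' - 1) = zs ! (e - 1) --> p' = e)"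
begin

abbreviation A where "A i \<equiv> b (Gs i)"
abbreviation bx where "bx i \<equiv> b (Gx i)"
abbreviation bc where "bc i \<equiv> b (Gc i)"
abbreviation tr where "tr i \<equiv> transpose i (i + 1)"

lemma gen_mem: "i : {1..<d} ==> v : U ==> A i v : U" "i : {1..d} ==> v : U ==> bx i v : U"
 "i : {1..d} ==> v : U ==> bc i v : U"
 by (auto intro!: b_mem simp: gens_def)

lemmas ev = vact_lin vact_mult[OF b_lin] vact_gens vact_one

lemma b_rel: "g - h : rels d ==> v : U ==> vact b g v = vact b h v"
 using b_rels[of "g - h" v] by (simp add: vact_lin)

lemma s_rels:
 "i : {1..<d} ==> gs i * gs i - 1 : rels d"
 "i : {1..<d} ==> i + 1 : {1..<d} ==> gs i * gs (i+1) * gs i - gs (i+1) * gs i * gs (i+1) : rels d"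
 "i : {1..<d} ==> j : {1..<d} ==> i + 1 < j \<or> j + 1 < i ==> gs i * gs j - gs j * gs i : rels d"
 "i : {1..<d} ==> gs i * gc i - gc (i+1) * gs i : rels d"
 "i : {1..<d} ==> gs i * gc (i+1) - gc i * gs i : rels d"
 "i : {1..<d} ==> j : {1..d} ==> j ~= i ==> j ~= i+1 ==> gs i * gc j - gc j * gs i : rels d"
 "i : {1..<d} ==> gs i * gx i - (gx (i+1) * gs i - 1 + gc i * gc (i+1)) : rels d"
 "i : {1..<d} ==> j : {1..d} ==> j ~= i ==> j ~= i+1 ==> gs i * gx j - gx j * gs i : rels d"
 unfolding rels_def
 by ((((rule UnI2)?, intro CollectI exI conjI, rule refl, assumption+) | rule UnI1)+)

lemma A_sq: "i : {1..<d} ==> v : U ==> A i (A i v) = v"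
 using b_rel[OF s_rels(1)] by (simp only: ev)

lemma A_braid: "i : {1..<d} ==> i + 1 : {1..<d} ==> v : U ==> A i (A (i+1) (A i v)) = A (i+1) (A i (A (i+1) v))"
 using b_rel[OF s_rels(2)] by (simp only: ev)

lemma A_far: "i : {1..<d} ==> j : {1..<d} ==> i + 1 < j \<or> j + 1 < i ==> v : U ==> A i (A j v) = A j (A i v)"
 using b_rel[OF s_rels(3), of i j v] by (simp only: ev)

lemma A_c:
 assumes i: "i : {1..<d}" and j: "j : {1..d}" and v: "v : U"
 shows "bc j (A i v) = A i (bc (tr i j) v)"
proof -
 have 1: "A i (bc i v) = bc (i+1) (A i v)" using b_rel[OF s_rels(4)[OF i] v] by (simp only: ev)
 have 2: "A i (bc (i+1) v) = bc i (A i v)" using b_rel[OF s_rels(5)[OF i] v] by (simp only: ev)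
 have 3: "A i (bc j v) = bc j (A i v)" if "j ~= i" "j ~= i+1"
  using b_rel[OF s_rels(6)[OF i j that] v] by (simp only: ev)
 consider "j = i" | "j = i + 1" | "j ~= i" "j ~= i + 1" by blast
 thus ?thesis
 proof cases
  case 1
  thus ?thesis using 2 by (simp add: transpose_def)
 next
  case 2
  thus ?thesis using 1 by (simp add: transpose_def)
 next
  case 3
  thus ?thesis using \<open>j ~= i ==> j ~= i + 1 ==> A i (bc j v) = bc j (A i v)\<close> by (simp add: transpose_def)
 qed
qed

lemma A_x:
 assumes i: "i : {1..<d}" and v: "v : U"
 shows "A i (bx i v) = bx (i+1) (A i v) - v + bc i (bc (i+1) v)"
 using b_rel[OF s_rels(7)[OF i] v] by (simp only: ev)

lemma A_x_far:
 assumes "i : {1..<d}" "j : {1..d}" "j ~= i" "j ~= i+1" "v : U"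
 shows "A i (bx j v) = bx j (A i v)"
 using b_rel[OF s_rels(8)[OF assms(1-4)] assms(5)] by (simp only: ev)

fun pw :: "nat list => nat => nat" where
 "pw [] p = p"
| "pw (i # w) p = pw w (tr i p)"

fun good :: "nat list => bool" where
 "good [] = True"
| "good (i # w) \<longleftrightarrow> i : {1..<d} & r (pw w i) < r (pw w (i + 1)) & good w"

definition op :: "nat list => 'a vec => 'a vec" where
 "op w = foldr A w"

definition XX :: "nat list => 'a vec set" where
 "XX w = (%n. op w (emb n)) ` VN"

lemma op_simps [simp]: "op [] v = v" "op (i # w) v = A i (op w v)"
 by (simp_all add: op_def)

lemma XX_Cons: "XX (i # w) = A i ` XX w"
 by (simp add: XX_def image_image)

lemma good_set: "good w ==> set w \<subseteq> {1..<d}"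
 by (induction w) auto

lemma op_U: "set w \<subseteq> {1..<d} ==> v : U ==> op w v : U"
 by (induction w) (auto intro: gen_mem)

lemma XX_U: "good w ==> XX w \<subseteq> U"
 using op_U[OF good_set] emb_mem by (auto simp: XX_def)

lemma pw_permutes: "good w ==> pw w permutes {1..d}"
proof (induction w)
 case Nil thus ?case using permutes_id by (simp add: id_def)
next
 case (Cons i w)
 have "tr i permutes {1..d}" using Cons.prems by (intro permutes_swap_id) auto
 hence "pw w \<circ> tr i permutes {1..d}" by (rule permutes_compose) (use Cons in auto)
 moreover have "pw (i # w) = pw w \<circ> tr i" by auto
 ultimately show ?case by (simp only:)
qed

lemma A_img_img: "good w ==> i : {1..<d} ==> A i ` A i ` XX w = XX w"
 unfolding image_image using A_sq XX_U[of w] by (subst image_cong[where g="%v. v"]) auto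

lemma A_img_braid:
 "good w ==> i : {1..<d} ==> i + 1 : {1..<d} ==> A i ` A (i+1) ` A i ` XX w = A (i+1) ` A i ` A (i+1) ` XX w"
 unfolding image_image using A_braid XX_U by (intro image_cong) auto

lemma A_img_far:
 "good w ==> i : {1..<d} ==> j : {1..<d} ==> i + 1 < j \<or> j + 1 < i ==> A i ` A j ` XX w = A j ` A i ` XX w"
 unfolding image_image by (intro image_cong refl A_far) (use XX_U in blast)+

lemma pw_Cons_at: "pw (i # w) i = pw w (i+1)" "pw (i # w) (i+1) = pw w i" "j ~= i ==> j ~= i + 1 ==> pw (i # w) j = pw w j"
 by (auto simp: transpose_def)

definition rr :: "nat list => nat => nat" where "rr w p = r (pw w p)"

lemma rr_Cons: "rr (i # w) p = (if p = i then rr w (i+1) else if p = i + 1 then rr w i else rr w p)"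
 by (auto simp: rr_def transpose_def)

lemma good_Cons: "good (i # w) \<longleftrightarrow> i : {1..<d} & rr w i < rr w (i + 1) & good w"
 by (simp add: rr_def)

lemma XX_Nil_A: "i : B ==> A i ` XX [] = XX []"
proof -
 assume i: "i : B"
 have "A i ` XX [] = (%n. emb (aN (Gs i) n)) ` VN"
  unfolding XX_def image_image using emb_act[of "Gs i"] i by (intro image_cong) (auto simp: bgens_def)
 also have "\<dots> \<subseteq> XX []" unfolding XX_def using HN.s_mem[OF i] by auto
 finally have *: "A i ` XX [] \<subseteq> XX []" .
 have "i : {1..<d}" using i HN.B by blast
 hence "XX [] = A i ` A i ` XX []" using A_img_img[of "[]" i] by simp
 also have "\<dots> \<subseteq> A i ` XX []" using * by blast
 finally show ?thesis using * by blast
qed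

text \<open>\<open>\<rr> w\<close> lists the rows of the strands after \<open>w\<close>; a good word only interchanges strands in increasing
  order.\<close>

lemma XX_reduce:
 assumes "good h" "i : {1..<d}"
 shows "(rr h i = rr h (i+1) --> A i ` XX h = XX h) &
  (rr h i > rr h (i+1) --> (\<exists>h'. good h' & Suc (length h') = length h & rr h' = rr (i # h) & A i ` XX h = XX h'))"
 using assms
proof (induction "length h" arbitrary: h i rule: less_induct)
 case less
 show ?case
 proof (cases h)
  case Nil
  have "r i \<le> r (i+1)" using r_mono[of i "i+1"] less.prems by auto
  thus ?thesis using XX_Nil_A r_B[OF less.prems(2)] unfolding Nil by (auto simp: rr_def)
 next
  case (Cons k h1)
  have g1: "good h1" and k: "k : {1..<d}" and lt: "rr h1 k < rr h1 (k+1)" using less.prems(1) unfolding Cons good_Cons by auto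
  note i = less.prems(2)
  have IH: "length g < length h ==> good g ==> j : {1..<d} ==> rr g j = rr g (j+1) ==> A j ` XX g = XX g"
   "length g < length h ==> good g ==> j : {1..<d} ==> rr g j > rr g (j+1) ==>
    \<exists>h'. good h' & Suc (length h') = length g & rr h' = rr (j # g) & A j ` XX g = XX h'" for g j
   using less.hyps by blast+
  have l1: "length h1 < length h" by (simp add: Cons)
  consider "k = i" | "i + 1 < k \<or> k + 1 < i" | "k = i + 1 \<or> i = k + 1" by linarith
  thus ?thesis
  proof cases
   case 1
   have "A i ` XX h = XX h1" unfolding Cons 1 XX_Cons by (rule A_img_img[OF g1 i])
   moreover have "rr h1 = rr (i # h)" by (auto simp: Cons 1 rr_Cons fun_eq_iff)
   moreover have "rr h i < rr h (i+1) \<or> rr h i > rr h (i+1)" "Suc (length h1) = length h" "~ rr h i = rr h (i+1)"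
    using lt by (auto simp: Cons 1 rr_Cons)
   ultimately show ?thesis using g1 by blast
  next
   case 2
   have e: "A i ` XX h = A k ` A i ` XX h1" unfolding Cons XX_Cons by (rule A_img_far[OF g1 i k 2])
   have ri: "rr h i = rr h1 i" "rr h (i+1) = rr h1 (i+1)" using 2 by (auto simp: Cons rr_Cons)
   show ?thesis
   proof (intro conjI impI)
    assume "rr h i = rr h (i+1)"
    thus "A i ` XX h = XX h" unfolding e using IH(1)[OF l1 g1 i] ri by (simp add: Cons XX_Cons)
   next
    assume "rr h (i+1) < rr h i"
    then obtain h' where h': "good h'" "Suc (length h') = length h1" "rr h' = rr (i # h1)" "A i ` XX h1 = XX h'"
     using IH(2)[OF l1 g1 i] ri by auto
    have "good (k # h')" unfolding good_Cons using h'(1) k lt 2 by (auto simp: rr_Cons h'(3))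
    moreover have "rr (k # h') = rr (i # h)" using 2 h'(3) by (auto simp: Cons rr_Cons fun_eq_iff)
    moreover have "A i ` XX h = XX (k # h')" unfolding e h'(4) XX_Cons ..
    ultimately show "\<exists>h'. good h' & Suc (length h') = length h & rr h' = rr (i # h) & A i ` XX h = XX h'"
     using h'(2) by (intro exI[of _ "k # h'"]) (simp add: Cons)
   qed
  next
   case 3
   have braid: "A i ` A k ` A i ` XX w = A k ` A i ` A k ` XX w" if "good w" for w
    using 3
   proof
    assume 3: "k = i + 1"
    show ?thesis using A_img_braid[OF that i] k unfolding 3 by blast
   next
    assume 3: "i = k + 1"
    show ?thesis using A_img_braid[OF that k] i unfolding 3 by blast
   qed
   have inv: "rr h1 (i+1) < rr h1 i" if "rr h (i+1) \<le> rr h i"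
    using that lt 3 by (auto simp: Cons rr_Cons split: if_splits)
   show ?thesis
   proof (cases "rr h (i+1) \<le> rr h i")
    case le: True
    obtain h2 where h2: "good h2" "Suc (length h2) = length h1" "rr h2 = rr (i # h1)" "A i ` XX h1 = XX h2"
     using IH(2)[OF l1 g1 i inv[OF le]] by auto
    have l2: "length h2 < length h" using h2(2) Cons by simp
    have h1: "XX h1 = A i ` XX h2" using A_img_img[OF g1 i] h2(4) by simp
    have e: "A i ` XX h = A k ` A i ` A k ` XX h2" unfolding Cons XX_Cons h1 by (rule braid[OF h2(1)])
    have r2: "rr h2 k = rr h2 (k+1) \<longleftrightarrow> rr h i = rr h (i+1)" "rr h2 (k+1) < rr h2 k \<longleftrightarrow> rr h (i+1) < rr h i"
     using 3 by (auto simp: Cons rr_Cons h2(3))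
    show ?thesis
    proof (intro conjI impI)
     assume "rr h i = rr h (i+1)"
     hence "A k ` XX h2 = XX h2" using IH(1)[OF l2 h2(1) k] r2 by simp
     thus "A i ` XX h = XX h" unfolding e using h1 by (simp add: Cons XX_Cons)
    next
     assume gt: "rr h (i+1) < rr h i"
     then obtain h3 where h3: "good h3" "Suc (length h3) = length h2" "rr h3 = rr (k # h2)" "A k ` XX h2 = XX h3"
      using IH(2)[OF l2 h2(1) k] r2 by auto
     have g: "good (i # h3)" unfolding good_Cons using h3(1,3) i 3 lt by (auto simp: rr_Cons h2(3))
     have "good (k # i # h3)" unfolding good_Cons[of k] using g k 3 gt inv[OF le] h3(3) h2(3) by (auto simp: rr_Cons Cons)
     moreover have "rr (k # i # h3) = rr (i # h)" using 3 by (auto simp: Cons rr_Cons fun_eq_iff h3(3) h2(3))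
     moreover have "A i ` XX h = XX (k # i # h3)" unfolding e h3(4) XX_Cons ..
     ultimately show "\<exists>h'. good h' & Suc (length h') = length h & rr h' = rr (i # h) & A i ` XX h = XX h'"
      using h2(2) h3(2) by (intro exI[of _ "k # i # h3"]) (simp add: Cons)
    qed
   qed auto
  qed
 qed
qed

definition D :: "nat => 'a vec set" where
 "D l = cvec.span (\<Union>w\<in>{w. good w & length w < l}. XX w)"

lemma D_sub [simp, intro!]: "subsp (D l)"
 by (simp add: D_def)

lemma XX_D: "good w ==> length w < l ==> XX w \<subseteq> D l"
 unfolding D_def by (auto intro!: cvec.span_base)

lemma D_into:
 assumes "v : D l" "clin f" "subsp W" "!!w n. good w ==> length w < l ==> n : VN ==> f (op w (emb n)) : W"
 shows "f v : W"
 by (rule clin_span_mem[OF assms(1)[unfolded D_def] assms(2,3)]) (use assms(4) in "auto simp: XX_def")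

lemma D_mono: "l \<le> l' ==> D l \<subseteq> D l'"
 unfolding D_def by (intro cvec.span_mono) auto

lemma D_U: "D l \<subseteq> U"
 using D_into[OF _ clin_id U] op_U[OF good_set] emb_mem by blast

lemma op_D: "good w ==> n : VN ==> length w < l ==> op w (emb n) : D l"
 using XX_D by (auto simp: XX_def)

lemma A_D: "v : D l ==> i : {1..<d} ==> A i v : D (Suc l)"
proof (rule D_into[OF _ b_lin D_sub])
 fix w n assume i: "i : {1..<d}" and w: "good w" "length w < l" and n: "n : VN"
 have x: "A i (op w (emb n)) : A i ` XX w" using n by (auto simp: XX_def)
 consider "rr w i < rr w (i+1)" | "rr w i = rr w (i+1)" | "rr w i > rr w (i+1)" by linarith
 thus "A i (op w (emb n)) : D (Suc l)"
 proof cases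
  case 1
  hence "good (i # w)" unfolding good_Cons using w i by blast
  thus ?thesis using op_D[of "i # w" n "Suc l"] n w by simp
 next
  case 2
  thus ?thesis using XX_reduce[OF w(1) i] x XX_D[OF w(1), of "Suc l"] w(2) by auto
 next
  case 3
  then obtain h' where "good h'" "Suc (length h') = length w" "A i ` XX w = XX h'" using XX_reduce[OF w(1) i] by auto
  thus ?thesis using x XX_D[of h' "Suc l"] w(2) by auto
 qed
qed

lemma c_op: "good w ==> j : {1..d} ==> n : VN ==> bc j (op w (emb n)) = op w (emb (aN (Gc (pw w j)) n))"
proof (induction w arbitrary: j)
 case Nil thus ?case using emb_act[of "Gc j"] by (auto simp: bgens_def agens_def)
next
 case (Cons i w)
 have i: "i : {1..<d}" and w: "good w" using Cons.prems by auto
 have "tr i j : {1..d}" using i Cons.prems by (auto simp: transpose_def)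
 thus ?case using Cons.IH[OF w _ Cons.prems(3)] A_c[OF i Cons.prems(2) op_U[OF good_set[OF w] emb_mem[OF Cons.prems(3)]]] by simp
qed

lemma pw_in: "good w ==> j : {1..d} ==> pw w j : {1..d}"
 using permutes_in_image[OF pw_permutes] by blast

lemma c_D: "v : D l ==> j : {1..d} ==> bc j v : D l"
 by (erule D_into[OF _ b_lin D_sub]) (simp only: c_op, intro op_D HN.c_mem pw_in)

lemma x_op: "good w ==> j : {1..d} ==> n : VN ==> bx j (op w (emb n)) - op w (emb (aN (Gx (pw w j)) n)) : D (length w)"
proof (induction w arbitrary: j)
 case Nil
 thus ?case using emb_act[of "Gx j" n] by (auto simp: bgens_def agens_def sub_0)
next
 case (Cons i w)
 have i: "i : {1..<d}" and w: "good w" using Cons.prems by auto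
 have ii: "i : {1..d}" "i + 1 : {1..d}" "tr i j : {1..d}" using i Cons.prems by (auto simp: transpose_def)
 note n = Cons.prems(3) and j = Cons.prems(2)
 let ?v = "op w (emb n)"
 have v: "?v : U" by (rule op_U[OF good_set[OF w] emb_mem[OF n]])
 have vD: "?v : D (length (i # w))" by (rule op_D[OF w n]) simp
 have "bx j (A i ?v) - A i (bx (tr i j) ?v) : D (length (i # w))"
 proof -
  consider "j = i + 1" | "j = i" | "j ~= i" "j ~= i + 1" by blast
  thus ?thesis
  proof cases
   case 1
   have "bx j (A i ?v) - A i (bx (tr i j) ?v) = ?v - bc i (bc (i+1) ?v)"
    using A_x[OF i v] 1 by (simp add: transpose_def)
   thus ?thesis using vD ii c_D by (simp only: sub_diff[OF D_sub])
  next
   case 2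
   have "bx i (A i ?v) = A i (A i (bx i (A i ?v)))" by (rule A_sq[symmetric, OF i gen_mem(2)[OF ii(1) gen_mem(1)[OF i v]]])
   also have "A i (bx i (A i ?v)) = bx (i+1) ?v - A i ?v + bc i (bc (i+1) (A i ?v))"
    using A_x[OF i gen_mem(1)[OF i v]] A_sq[OF i v] by simp
   also have "bc i (bc (i+1) (A i ?v)) = A i (bc (i+1) (bc i ?v))"
    using A_c[OF i ii(2) v] A_c[OF i ii(1) gen_mem(3)[OF ii(1) v]] by simp
   also have "A i (bx (i+1) ?v - A i ?v + A i (bc (i+1) (bc i ?v))) = A i (bx (i+1) ?v) - ?v + bc (i+1) (bc i ?v)"
    using A_sq[OF i v] A_sq[OF i gen_mem(3)[OF ii(2) gen_mem(3)[OF ii(1) v]]] by (simp add: clin_simps[OF b_lin])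
   finally have "bx j (A i ?v) - A i (bx (tr i j) ?v) = bc (i+1) (bc i ?v) - ?v" using 2 by (simp add: algebra_simps)
   thus ?thesis using vD ii c_D by (simp only: sub_diff[OF D_sub])
  next
   case 3
   thus ?thesis using A_x_far[OF i j 3 v] by (simp add: transpose_def sub_0)
  qed
 qed
 moreover have "A i (bx (tr i j) ?v - op w (emb (aN (Gx (pw w (tr i j))) n))) : D (length (i # w))"
  using A_D[OF Cons.IH[OF w ii(3) n] i] by simp
 ultimately have "bx j (A i ?v) - A i (bx (tr i j) ?v) + A i (bx (tr i j) ?v - op w (emb (aN (Gx (pw w (tr i j))) n))) : D (length (i # w))"
  by (rule sub_add[OF D_sub])
 thus ?case by (simp add: clin_simps[OF b_lin])
qed

lemma x_D: "v : D l ==> j : {1..d} ==> bx j v : D l"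
proof (rule D_into[OF _ b_lin D_sub])
 fix w n assume j: "j : {1..d}" and w: "good w" "length w < l" and n: "n : VN"
 have "bx j (op w (emb n)) - op w (emb (aN (Gx (pw w j)) n)) : D l"
  using x_op[OF w(1) j n] D_mono[of "length w" l] w(2) by auto
 moreover have "op w (emb (aN (Gx (pw w j)) n)) : D l"
  by (rule op_D[OF w(1) HN.x_mem[OF pw_in[OF w(1) j] n] w(2)])
 ultimately show "bx j (op w (emb n)) : D l" using sub_add[OF D_sub] by fastforce
qed

lemma D_exhaust: "v : U ==> \<exists>l. v : D (Suc l)"
proof -
 let ?W = "\<Union>l. D l"
 have "?W = U"
 proof (rule gen)
  have m: "u + v : ?W" if "u : D l" "v : D l'" for u v l l'
  proof -
   have "u : D (max l l')" "v : D (max l l')" using that D_mono[of l "max l l'"] D_mono[of l' "max l l'"] by auto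
   thus ?thesis using sub_add[OF D_sub] by blast
  qed
  show "subsp ?W"
  proof (rule cvec.subspaceI)
   show "0 : ?W" using sub_0[OF D_sub] by blast
   show "x + y : ?W" if "x : ?W" "y : ?W" for x y using that m by (elim UN_E) auto
   show "cscale c x : ?W" if "x : ?W" for c x using that by (auto intro: sub_scale[OF D_sub])
  qed
  show "?W \<subseteq> U" using D_U by blast
  have "emb n : D 1" if "n : VN" for n using op_D[of "[]" n 1] that by simp
  thus "emb ` VN \<subseteq> ?W" by blast
  show "b g v : ?W" if "g : gens d" "v : ?W" for g v
  proof -
   obtain l where l: "v : D l" using \<open>v : ?W\<close> by blast
   from \<open>g : gens d\<close> show ?thesis using A_D[OF l] c_D[OF l] x_D[OF l] unfolding gens_def by blast
  qed
 qed
 moreover assume "v : U"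
 ultimately obtain l where "v : D l" by blast
 thus ?thesis using D_mono[of l "Suc l"] by auto
qed

definition e1 :: "nat \<times> int => 'a vec => 'a vec" where
 "e1 pc v = bx (fst pc) (bx (fst pc) v) - cscale (of_int (q (snd pc))) v"

definition PL :: "(nat \<times> int) list" where
 "PL = filter (%(p, c). c ~= zs ! (p - 1)) (List.product [1..<Suc d] zs)"

definition EE :: "'a vec => 'a vec" where "EE = foldr e1 PL"

lemma set_PL: "(p, c) : set PL \<longleftrightarrow> p : {1..d} & c : set zs & c ~= zs ! (p - 1)"
 by (auto simp: PL_def)

lemma clin_e1: "clin (e1 pc)"
 unfolding e1_def[abs_def] by (intro clin_minus clin_comp[OF b_lin b_lin] clin_cscale clin_id)

lemma clin_EE: "clin EE"
 unfolding EE_def by (intro clin_foldr clin_e1)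

lemma emb_0: "emb 0 = 0"
 using emb_scale[of 0 0] sub_0[OF HN.V] by simp

lemma x_sq_N: "p : {1..d} ==> n : VN ==> aN (Gx p) (aN (Gx p) n) = cscale (of_int (q (zs ! (p - 1)))) n"
 using HN.x_sq[of p n] kap_sq[OF nonneg, of p] by simp

lemma op_scale: "n : VN ==> op w (emb (cscale z n)) = cscale z (op w (emb n))"
 by (induction w) (simp_all add: emb_scale clin_scale[OF b_lin])

lemma e1_op:
 assumes w: "good w" and p: "p : {1..d}" and n: "n : VN"
 shows "e1 (p, c) (op w (emb n)) - cscale (of_int (q (zs ! (pw w p - 1)) - q c)) (op w (emb n)) : D (length w)"
proof -
 have m: "aN (Gx (pw w p)) n : VN" by (rule HN.x_mem[OF pw_in[OF w p] n])
 have "bx p (bx p (op w (emb n)) - op w (emb (aN (Gx (pw w p)) n))) : D (length w)" by (rule x_D[OF x_op[OF w p n] p])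
 from sub_add[OF D_sub this x_op[OF w p m]]
 have "bx p (bx p (op w (emb n))) - cscale (of_int (q (zs ! (pw w p - 1)))) (op w (emb n)) : D (length w)"
  by (simp add: clin_simps[OF b_lin] x_sq_N[OF pw_in[OF w p] n] op_scale[OF n])
 thus ?thesis by (simp add: e1_def cvec.scale_left_diff_distrib)
qed

lemma e1_D: "v : D l ==> p : {1..d} ==> e1 (p, c) v : D l"
 unfolding e1_def fst_conv by (intro sub_diff[OF D_sub] sub_scale[OF D_sub] x_D)

lemma foldr_e1_D: "set pcs \<subseteq> set PL ==> v : D l ==> foldr e1 pcs v : D l"
proof (induction pcs)
 case (Cons pc pcs)
 thus ?case using e1_D[of "foldr e1 pcs v" l "fst pc" "snd pc"] set_PL[of "fst pc" "snd pc"] by auto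
qed simp

text \<open>The strands of one row never cross in a good word.\<close>

lemma good_order:
 "good w ==> 1 \<le> p ==> p < p' ==> p' \<le> d ==> rr w p = rr w p' ==> pw w p < pw w p'"
proof (induction w arbitrary: p p')
 case (Cons i w)
 have g: "i : {1..<d}" "good w" "rr w i < rr w (i+1)" using Cons.prems(1) by (auto simp: good_Cons simp del: good.simps)
 have e: "rr w (tr i p) = rr w (tr i p')" using Cons.prems(5) by (simp add: rr_def)
 have "tr i p < tr i p'"
 proof (rule ccontr)
  assume "~ tr i p < tr i p'"
  hence "p = i & p' = i + 1" using Cons.prems(3) by (auto simp: transpose_def split: if_splits)
  thus False using e g(3) by simp
 qed
 moreover have "1 \<le> tr i p" "tr i p' \<le> d" using g(1) Cons.prems(2-4) by (auto simp: transpose_def)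
 ultimately show ?case using Cons.IH[OF g(2) _ _ _ e] by simp
qed simp

lemma good_id:
 assumes w: "good w" "w ~= []"
 shows "\<exists>p\<in>{1..d}. zs ! (pw w p - 1) ~= zs ! (p - 1)"
proof (rule ccontr)
 assume no: "~ ?thesis"
 have "pw w = id"
 proof (rule row_order_rigid[OF pw_permutes[OF w(1)], where r=r and z="%p. zs ! (p - 1)"])
  show "pw w p < pw w p'" if "1 \<le> p" "p < p'" "p' \<le> d" "r (pw w p) = r (pw w p')" for p p'
   using good_order[OF w(1) that(1-3)] that(4) by (simp add: rr_def)
  show "zs ! (pw w p - 1) = zs ! (p - 1)" if "p : {1..d}" for p using no that by blast
 qed (fact r_mono r_inj r_last)+
 hence rr: "rr w p = r p" for p by (simp add: rr_def)
 obtain i v where v: "w = i # v" using w(2) by (cases w) auto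
 have i: "i : {1..<d}" "rr v i < rr v (i+1)" using w(1) unfolding v good_Cons by auto
 hence "rr w i > rr w (i+1)" unfolding v rr_Cons by simp
 thus False using r_mono[of i "i+1"] i(1) unfolding rr by auto
qed

lemma EE_op:
 assumes w: "good w" "w ~= []" and n: "n : VN" shows "EE (op w (emb n)) : D (length w)"
proof -
 obtain p where p: "p : {1..d}" "zs ! (pw w p - 1) ~= zs ! (p - 1)" using good_id[OF w] by blast
 have "zs ! (pw w p - 1) : set zs" using pw_in[OF w(1) p(1)] len_zs by (intro nth_mem) auto
 hence pc: "(p, zs ! (pw w p - 1)) : set PL" using p by (simp add: set_PL)
 have key: "foldr e1 pcs (op w (emb n)) : {v. \<exists>z. v - cscale z (op w (emb n)) : D (length w)}
  & ((p, zs ! (pw w p - 1)) : set pcs --> foldr e1 pcs (op w (emb n)) : D (length w))" if "set pcs \<subseteq> set PL" for pcs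
  using that
 proof (induction pcs)
  case Nil
  show ?case using sub_0[OF D_sub] by (auto intro!: exI[of _ 1])
 next
  case (Cons a pcs)
  obtain p' c where a: "a = (p', c)" "p' : {1..d}" using Cons.prems set_PL by (cases a) auto
  let ?u = "op w (emb n)" and ?f = "foldr e1 pcs (op w (emb n))"
  obtain z where z: "?f - cscale z ?u : D (length w)" using Cons by auto
  let ?y = "of_int (q (zs ! (pw w p' - 1)) - q c)"
  have "e1 a (?f - cscale z ?u) + cscale z (e1 a ?u - cscale ?y ?u) : D (length w)"
   unfolding a(1) using e1_D[OF z a(2)] e1_op[OF w(1) a(2) n]
   by (intro sub_add[OF D_sub] sub_scale[OF D_sub])
  hence e: "e1 a ?f - cscale (z * ?y) ?u : D (length w)"
   by (simp add: clin_simps[OF clin_e1] cvec.scale_right_diff_distrib)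
  moreover have "e1 a ?f : D (length w)" if "(p, zs ! (pw w p - 1)) : set (a # pcs)"
  proof (cases "a = (p, zs ! (pw w p - 1))")
   case True
   thus ?thesis using e a by simp
  next
   case False
   hence "?f : D (length w)" using Cons that by auto
   thus ?thesis unfolding a(1) by (rule e1_D[OF _ a(2)])
  qed
  ultimately show ?case by auto
 qed
 show ?thesis using key[of PL] pc by (simp add: EE_def)
qed

lemma EE_D: "v : D (Suc (Suc l)) ==> EE v : D (Suc l)"
proof (rule D_into[OF _ clin_EE D_sub])
 fix w n assume w: "good w" "length w < Suc (Suc l)" and n: "n : VN"
 show "EE (op w (emb n)) : D (Suc l)"
 proof (cases "w = [] \<or> length w < Suc l")
  case True
  hence "op w (emb n) : D (Suc l)" by (intro op_D[OF w(1) n]) auto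
  thus ?thesis unfolding EE_def by (rule foldr_e1_D[OF order_refl])
 next
  case False
  thus ?thesis using EE_op[OF w(1) _ n] w(2) by (metis less_antisym)
 qed
qed

lemma EE_N: "\<exists>C. C ~= 0 & (\<forall>n\<in>VN. EE (emb n) = cscale C (emb n))"
proof -
 have "\<exists>C. C ~= 0 & (\<forall>n\<in>VN. foldr e1 pcs (emb n) = cscale C (emb n))" if "set pcs \<subseteq> set PL" for pcs
  using that
 proof (induction pcs)
  case Nil thus ?case by (intro exI[of _ 1]) simp
 next
  case (Cons a pcs)
  obtain p c where a: "a = (p, c)" "p : {1..d}" "c : set zs" "c ~= zs ! (p - 1)"
   using Cons.prems set_PL by (cases a) auto
  obtain C where C: "C ~= 0" "!!n. n : VN ==> foldr e1 pcs (emb n) = cscale C (emb n)" using Cons by auto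
  obtain k where k: "k < length zs" "zs ! k = c" using a(3) by (metis in_set_conv_nth)
  have "0 \<le> c" using nonneg[of "Suc k"] k len_zs by simp
  hence ne: "q (zs ! (p - 1)) - q c ~= 0" using q_inj nonneg[OF a(2)] a(4) by simp
  have e: "e1 a (emb n) = cscale (of_int (q (zs ! (p - 1)) - q c)) (emb n)" if "n : VN" for n
   using e1_op[of "[]" p n c] that a by (simp add: D_def)
  show ?case
   by (rule exI[of _ "C * of_int (q (zs ! (p - 1)) - q c)"])
     (use C e ne in "simp add: clin_scale[OF clin_e1] del: of_int_diff")
 qed
 from this[of PL] show ?thesis by (simp add: EE_def)
qed

lemma D_one: "D (Suc 0) = emb ` VN"
proof -
 have "subsp (emb ` VN)"
 proof (rule cvec.subspaceI)
  show "0 : emb ` VN" using emb_0 sub_0[OF HN.V] by force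
 next
  fix x y assume "x : emb ` VN" "y : emb ` VN"
  thus "x + y : emb ` VN" using emb_add sub_add[OF HN.V] by (metis (no_types, lifting) imageE imageI)
 next
  fix c x assume "x : emb ` VN"
  thus "cscale c x : emb ` VN" using emb_scale sub_scale[OF HN.V] by (metis (no_types, lifting) imageE imageI)
 qed
 moreover have "(\<Union>w\<in>{w. good w & length w < Suc 0}. XX w) = emb ` VN" by (auto simp: XX_def)
 ultimately show ?thesis by (simp add: D_def)
qed

definition stable :: "'a vec set => bool" where
 "stable W \<longleftrightarrow> subsp W & W \<subseteq> U & (\<forall>g\<in>gens d. \<forall>v\<in>W. b g v : W) & (\<forall>v\<in>W. sg v : W)"

lemma proper_meets:
 assumes W: "stable W" "W ~= U" and n: "n : VN" "emb n : W"
 shows "n = 0"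
proof (rule ccontr)
 assume "n ~= 0"
 note s = W(1)[unfolded stable_def]
 let ?T = "{n \<in> VN. emb n : W}"
 have bw: "b g v : W" if "g : bgens B d" "v : W" for g v
  using that s HN.B by (auto simp: bgens_def gens_def agens_def)
 have "HN.gsub ?T"
  unfolding HN.gsub_def HN.asub_def
 proof (intro conjI ballI cvec.subspaceI)
  show "0 : ?T" using sub_0[OF HN.V] emb_0 s sub_0 by auto
  show "x + y : ?T" if "x : ?T" "y : ?T" for x y
   using that emb_add s sub_add sub_add[OF HN.V] by auto
  show "cscale c x : ?T" if "x : ?T" for x c
   using that emb_scale s sub_scale sub_scale[OF HN.V] by auto
  show "aN (Gx i) v : ?T" "aN (Gc i) v : ?T" if "i : {1..d}" "v : ?T" for i v
   using that HN.x_mem HN.c_mem bw[of "Gx i" "emb v"] bw[of "Gc i" "emb v"] emb_act[of "Gx i" v] emb_act[of "Gc i" v]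
   by (auto simp: bgens_def agens_def)
  show "sgo par v : ?T" if "v : ?T" for v
   using that s emb_sg[of v] HN.sg_mem by auto
 qed auto
 moreover have "?T ~= {0}" using n \<open>n ~= 0\<close> by auto
 ultimately have "?T = VN" using VN_simple unfolding HN.asimple_def by blast
 hence "emb ` VN \<subseteq> W" by blast
 hence "W = U" using gen[of W] s by blast
 thus False using W(2) by simp
qed

theorem proper_sum:
 assumes W: "stable W" "W ~= U" "stable W'" "W' ~= U"
 shows "{u + w | u w. u : W & w : W'} ~= U"
proof
 assume eq: "{u + w | u w. u : W & w : W'} = U"
 obtain n where n: "n : VN" "n ~= 0" using VN_simple sub_0[OF HN.V] unfolding HN.asimple_def by blast
 have EW: "EE v : Y" if "stable Y" "v : Y" for Y v
 proof -
  have "e1 pc v : Y" if "pc : set PL" "v : Y" for pc v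
   using that \<open>stable Y\<close> set_PL[of "fst pc" "snd pc"] unfolding e1_def stable_def gens_def
   by (intro sub_diff sub_scale) auto
  hence "set pcs \<subseteq> set PL ==> foldr e1 pcs v : Y" for pcs using that by (induction pcs) auto
  thus ?thesis by (simp add: EE_def)
 qed
 have kill: "(EE ^^ l) v = 0" if Y: "stable Y" "Y ~= U" and v: "v : Y" "v : D (Suc l)" for Y v l
  using v
 proof (induction l arbitrary: v)
  case 0
  then obtain m where "m : VN" "v = emb m" unfolding D_one by blast
  thus ?case using proper_meets[OF Y, of m] 0(1) emb_0 by auto
 next
  case (Suc l)
  thus ?case using EW[OF Y(1) Suc.prems(1)] EE_D[OF Suc.prems(2)] by (simp add: funpow_swap1)
 qed
 obtain u w where uw: "emb n = u + w" "u : W" "w : W'" using eq emb_mem[OF n(1)] by blast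
 have "u : U" "w : U" using uw W by (auto simp: stable_def)
 then obtain l l' where "u : D (Suc l)" "w : D (Suc l')" using D_exhaust by blast
 hence l: "u : D (Suc (max l l'))" "w : D (Suc (max l l'))"
  using D_mono[of "Suc l" "Suc (max l l')"] D_mono[of "Suc l'" "Suc (max l l')"] by auto
 have EEl: "clin (EE ^^ k)" for k by (induction k) (auto simp: clin_id id_def intro!: clin_comp[OF clin_EE] simp: comp_def)
 obtain C where C: "C ~= 0" "!!n. n : VN ==> EE (emb n) = cscale C (emb n)" using EE_N by blast
 have "(EE ^^ k) (emb n) = cscale (C ^ k) (emb n)" for k
  by (induction k) (simp_all add: clin_scale[OF clin_EE] C(2)[OF n(1)] mult.commute)
 hence "cscale (C ^ max l l') (emb n) = (EE ^^ max l l') (u + w)" using uw(1) by metis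
 also have "\<dots> = 0" using kill[OF W(1,2) uw(2) l(1)] kill[OF W(3,4) uw(3) l(2)] by (simp add: clin_add[OF EEl])
 finally have "emb n = 0" using C(1) by simp
 hence "emb n : W" using W(1) sub_0[of W] by (simp add: stable_def)
 thus False using proper_meets[OF W(1,2) n(1)] n(2) by simp
qed

end

section \<open>Quotients of modules\<close>

text \<open>The set-theoretic operations of \<^const>\<open>quot\<close> on cosets.\<close>

lemma quot_ops:
 fixes M :: "'m smod" (structure)
 assumes M: "Module.module complex_ring M" and R: "submodule R complex_ring M"
 shows "carrier (quot M R) = (%x. R +> x) ` carrier M"
  and "\<zero>\<^bsub>quot M R\<^esub> = R" "homog (quot M R) t = (%x. R +> x) ` homog M t"
  and "x : carrier M ==> y : carrier M ==> (R +> x) \<oplus>\<^bsub>quot M R\<^esub> (R +> y) = R +> (x \<oplus> y)"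
  and "x : carrier M ==> z \<odot>\<^bsub>quot M R\<^esub> (R +> x) = R +> (z \<odot> x)"
  and "(!!x y. x : carrier M ==> y : carrier M ==> act M g (x \<oplus> y) = act M g x \<oplus> act M g y) ==>
     (!!x. x : carrier M ==> act M g x : carrier M) ==> (!!x. x : R ==> act M g x : R) ==>
     x : carrier M ==> act (quot M R) g (R +> x) = R +> act M g x"
  and "x : carrier M ==> R +> x = R \<longleftrightarrow> x : R"
proof -
 interpret M: module complex_ring M by (rule M)
 have sg: "subgroup R (add_monoid M)" using R by (simp add: submodule_def)
 have ad: "additive_subgroup R M" using sg by (simp add: additive_subgroup_def)
 interpret R: abelian_subgroup R M by (rule abelian_subgroupI3[OF ad M.abelian_group_axioms])
 have Rc: "R \<subseteq> carrier M" by (rule R.a_subset)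
 have abs: "R +> (h \<oplus> x) = R +> x" if "h : R" "x : carrier M" for h x
  using M.a_repr_independence[OF M.a_rcosI[OF that(1) Rc that(2)] that(2) sg] by simp
 have un: "(\<Union>y\<in>R +> x. R +> f y) = R +> f x"
  if x: "x : carrier M" and f: "!!x y. x : carrier M ==> y : carrier M ==> f (x \<oplus> y) = f x \<oplus> f y"
   "!!x. x : carrier M ==> f x : carrier M" "!!x. x : R ==> f x : R" for f x
 proof -
  have "R +> f y = R +> f x" if y: "y : R +> x" for y
  proof -
   obtain h where h: "h : R" "y = h \<oplus> x" using y by (auto simp: a_r_coset_def')
   show ?thesis unfolding h(2) using f x h(1) Rc abs by auto
  qed
  thus ?thesis using R.a_rcos_self[OF x] by blast
 qed
 show "carrier (quot M R) = (%x. R +> x) ` carrier M" by (auto simp: quot_def A_RCOSETS_def')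
 show "\<zero>\<^bsub>quot M R\<^esub> = R" "homog (quot M R) t = (%x. R +> x) ` homog M t" by (simp_all add: quot_def)
 show "(R +> x) \<oplus>\<^bsub>quot M R\<^esub> (R +> y) = R +> (x \<oplus> y)" if "x : carrier M" "y : carrier M"
  using R.a_rcos_sum[OF that] by (simp add: quot_def)
 show "z \<odot>\<^bsub>quot M R\<^esub> (R +> x) = R +> (z \<odot> x)" if "x : carrier M"
  using un[OF that, of "%x. z \<odot> x"] submodule.smult_closed[OF R] by (simp add: quot_def M.smult_r_distr)
 show "act (quot M R) g (R +> x) = R +> act M g x"
  if "!!x y. x : carrier M ==> y : carrier M ==> act M g (x \<oplus> y) = act M g x \<oplus> act M g y"
   "!!x. x : carrier M ==> act M g x : carrier M" "!!x. x : R ==> act M g x : R" "x : carrier M"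
  using un[OF that(4), of "act M g"] that(1-3) by (simp add: quot_def)
 show "R +> x = R \<longleftrightarrow> x : R" if "x : carrier M"
  using M.a_coset_join1[OF _ that sg] M.a_coset_join2[OF that sg] by blast
qed

text \<open>A module presented as the image of a space of vectors on which the parity is a linear involution.\<close>

locale pres =
 fixes G :: "gen set" and U :: "'a vec set" and sg :: "'a vec => 'a vec" and b :: "gen => 'a vec => 'a vec"
  and M :: "'m smod" (structure) and p :: "'a vec => 'm"
 assumes U: "subsp U" and b_lin: "!!g. clin (b g)" and sg_lin: "clin sg"
  and b_mem: "!!g v. g : G ==> v : U ==> b g v : U"
  and sg_mem: "!!v. v : U ==> sg v : U" and sg_sg: "!!v. v : U ==> sg (sg v) = v"
  and p_surj: "p ` U = carrier M" and p_zero: "p 0 = \<zero>"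
  and p_add: "!!u v. u : U ==> v : U ==> p (u + v) = p u \<oplus> p v"
  and p_scale: "!!z u. u : U ==> p (cscale z u) = z \<odot> p u"
  and p_act: "!!g u. g : G ==> u : U ==> p (b g u) = act M g (p u)"
  and p_sg: "!!u. u : U ==> p u = \<zero> ==> p (sg u) = \<zero>"
  and p_homog: "!!t. homog M t = p ` {u \<in> U. sg u = (if t then - u else u)}"
begin

lemmas U_closed = sub_0[OF U] sub_add[OF U] sub_scale[OF U] sub_neg[OF U] sub_diff[OF U]

lemma p_in: "u : U ==> p u : carrier M"
 using p_surj by blast

lemma p_ex: "x : carrier M ==> \<exists>u\<in>U. x = p u"
 using p_surj by blast

lemma module_M: "Module.module complex_ring M"
proof (rule moduleI)
 show "abelian_group M"
 proof (rule abelian_groupI)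
  show "x \<oplus> y : carrier M" if "x : carrier M" "y : carrier M" for x y
   using p_ex[OF that(1)] p_ex[OF that(2)] p_in p_add U_closed by metis
  show "\<zero> : carrier M" using p_in[OF U_closed(1)] p_zero by simp
  show "x \<oplus> y \<oplus> z = x \<oplus> (y \<oplus> z)" if "x : carrier M" "y : carrier M" "z : carrier M" for x y z
   using p_ex[OF that(1)] p_ex[OF that(2)] p_ex[OF that(3)] by (auto simp flip: p_add simp: U_closed add.assoc)
  show "x \<oplus> y = y \<oplus> x" if "x : carrier M" "y : carrier M" for x y
   using p_ex[OF that(1)] p_ex[OF that(2)] by (auto simp flip: p_add simp: add.commute)
  show "\<zero> \<oplus> x = x" if "x : carrier M" for x
   using p_ex[OF that] p_add[OF U_closed(1)] p_zero by auto
  show "\<exists>y\<in>carrier M. y \<oplus> x = \<zero>" if x: "x : carrier M" for x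
  proof -
   obtain u where u: "u : U" "x = p u" using p_ex[OF x] by blast
   have "p (- u) \<oplus> x = \<zero>" unfolding u(2) using p_add[of "- u" u] u(1) U_closed p_zero by simp
   thus ?thesis using p_in[of "- u"] u(1) U_closed by blast
  qed
 qed
 show "\<one>\<^bsub>complex_ring\<^esub> \<odot> x = x" if "x : carrier M" for x
  using p_ex[OF that] by (auto simp flip: p_scale)
 show "a \<odot> x : carrier M" if "x : carrier M" for a x
  using p_ex[OF that] p_in[OF U_closed(3)] p_scale by auto
 show "(a \<oplus>\<^bsub>complex_ring\<^esub> c) \<odot> x = a \<odot> x \<oplus> c \<odot> x" if "x : carrier M" for a c x
  using p_ex[OF that] by (auto simp flip: p_scale p_add simp: U_closed cvec.scale_left_distrib)
 show "a \<odot> (x \<oplus> y) = a \<odot> x \<oplus> a \<odot> y" if "x : carrier M" "y : carrier M" for a x y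
  using p_ex[OF that(1)] p_ex[OF that(2)] by (auto simp flip: p_scale p_add simp: U_closed cvec.scale_right_distrib)
 show "(a \<otimes>\<^bsub>complex_ring\<^esub> c) \<odot> x = a \<odot> (c \<odot> x)" if "x : carrier M" for a c x
  using p_ex[OF that] by (auto simp flip: p_scale simp: U_closed)
qed (rule cring_complex_ring)

sublocale M: Module.module complex_ring M by (rule module_M)

definition ker :: "'a vec set" where "ker = {u \<in> U. p u = \<zero>}"

definition stab :: "'a vec set => bool" where
 "stab W \<longleftrightarrow> subsp W & W \<subseteq> U & (\<forall>g\<in>G. \<forall>v\<in>W. b g v : W) & (\<forall>v\<in>W. sg v : W)"

lemma p_neg: "u : U ==> p (- u) = \<ominus> p u"
 using p_add[of "- u" u] U_closed p_zero by (intro M.minus_equality[symmetric]) (auto intro: p_in)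

lemma p_eq_iff: "u : U ==> v : U ==> p u = p v \<longleftrightarrow> u - v : ker"
proof -
 assume u: "u : U" "v : U"
 have m: "u - v : U" "- v : U" using u U_closed by auto
 have "p u = p v \<oplus> p (u - v)" "p (u - v) = p u \<oplus> p (- v)" "p v \<oplus> p (- v) = \<zero>"
  using p_add[OF u(2) m(1)] p_add[OF u(1) m(2)] p_add[OF u(2) m(2)] p_zero by simp_all
 thus ?thesis using m(1) M.r_zero[OF p_in[OF u(2)]] by (auto simp: ker_def)
qed

lemma pre_sub:
 assumes "submodule Z complex_ring M" shows "subsp {u \<in> U. p u : Z}"
proof -
 have "\<zero> : Z" using assms subgroup.one_closed[of Z "add_monoid M"] by (simp add: submodule_def)
 thus ?thesis using M.submoduleE[OF assms] U_closed p_zero p_add p_scale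
  by (intro cvec.subspaceI) auto
qed

lemma submod_stab:
 assumes Z: "submod G M Z" shows "stab {u \<in> U. p u : Z}" "p ` {u \<in> U. p u : Z} = Z" "ker \<subseteq> {u \<in> U. p u : Z}"
proof -
 have s: "submodule Z complex_ring M" "!!g v. g : G ==> v : Z ==> act M g v : Z"
  and gr: "!!v. v : Z ==> \<exists>v0\<in>Z \<inter> homog M False. \<exists>v1\<in>Z \<inter> homog M True. v = v0 \<oplus> v1"
  using Z by (auto simp: submod_def ungraded_submod_def)
 note c = pre_sub[OF s(1)]
 have YM: "Z \<subseteq> carrier M" using M.submoduleE(1)[OF s(1)] .
 show "p ` {u \<in> U. p u : Z} = Z" using YM p_ex by blast
 show k: "ker \<subseteq> {u \<in> U. p u : Z}" using sub_0[OF c] p_zero by (auto simp: ker_def)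
 have "p (sg u) : Z" if u: "u : U" "p u : Z" for u
 proof -
  obtain v0 v1 where v: "v0 : Z" "v0 : homog M False" "v1 : Z" "v1 : homog M True" "p u = v0 \<oplus> v1" using gr[OF u(2)] by auto
  obtain u0 where u0: "u0 : U" "sg u0 = u0" "v0 = p u0" using v(2) unfolding p_homog by auto
  obtain u1 where u1: "u1 : U" "sg u1 = - u1" "v1 = p u1" using v(4) unfolding p_homog by auto
  have "u - (u0 + u1) : ker" using v(5) u(1) u0 u1 U_closed p_eq_iff[of u "u0 + u1"] by (simp add: p_add)
  hence "p (sg (u - (u0 + u1))) = \<zero>" using p_sg by (auto simp: ker_def)
  moreover have "sg (u - (u0 + u1)) = sg u - (u0 - u1)" using u0(2) u1(2) by (simp add: clin_simps[OF sg_lin])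
  moreover have "sg u - (u0 - u1) : U" by (intro U_closed(5) sg_mem u(1) u0(1) u1(1))
  ultimately have "sg u - (u0 - u1) : ker" by (simp add: ker_def)
  hence "p (sg u) = p (u0 - u1)" using p_eq_iff[OF sg_mem[OF u(1)] U_closed(5)[OF u0(1) u1(1)]] by simp
  moreover have "u0 - u1 : {u \<in> U. p u : Z}" using u0 u1 v by (intro sub_diff[OF c]) auto
  ultimately show ?thesis by simp
 qed
 thus "stab {u \<in> U. p u : Z}" unfolding stab_def using c s(2) b_mem sg_mem p_act by auto
qed

lemma stab_submod:
 assumes W: "stab W" shows "submod G M (p ` W)"
proof -
 have s: "subsp W" "W \<subseteq> U" "!!g v. g : G ==> v : W ==> b g v : W" "!!v. v : W ==> sg v : W"
  using W by (auto simp: stab_def)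
 note cl = sub_0[OF s(1)] sub_add[OF s(1)] sub_scale[OF s(1)] sub_neg[OF s(1)] sub_diff[OF s(1)]
 have WU: "w : U" if "w : W" for w using s(2) that by blast
 have "submodule (p ` W) complex_ring M"
 proof (rule M.submoduleI)
  show "p ` W \<subseteq> carrier M" using WU p_in by blast
  show "\<zero> : p ` W" using cl(1) p_zero by (metis imageI)
  show "\<ominus> a : p ` W" if "a : p ` W" for a using that cl(4) by (auto simp flip: p_neg[OF WU])
  show "a \<oplus> c : p ` W" if "a : p ` W" "c : p ` W" for a c
   using that cl(2) by (auto simp flip: p_add[OF WU WU])
  show "a \<odot> c : p ` W" if "c : p ` W" for a c
   using that cl(3) by (auto simp flip: p_scale[OF WU])
 qed
 moreover have "act M g v : p ` W" if "g : G" "v : p ` W" for g v using that s(3) by (auto simp flip: p_act[OF _ WU])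
 moreover have "\<exists>v0\<in>p ` W \<inter> homog M False. \<exists>v1\<in>p ` W \<inter> homog M True. v = v0 \<oplus> v1" if v: "v : p ` W" for v
 proof -
  obtain u where u: "u : W" "v = p u" using v by blast
  define u0 u1 where "u0 = cscale (1/2) (u + sg u)" and "u1 = cscale (1/2) (u - sg u)"
  have m: "u0 : W" "u1 : W" unfolding u0_def u1_def using u s(4) cl by auto
  have h: "sg u0 = u0" "sg u1 = - u1" unfolding u0_def u1_def using sg_sg[OF WU[OF u(1)]]
   by (simp_all add: clin_simps[OF sg_lin] add.commute cvec.scale_right_diff_distrib)
  have "u = u0 + u1" unfolding u0_def u1_def by (rule poly_mapping_eqI) (simp add: lookup_add lookup_minus field_simps)
  thus ?thesis using m h u(2) p_add[of u0 u1] WU unfolding p_homog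
   by (intro bexI[of _ "p u0"] bexI[of _ "p u1"]) auto
 qed
 ultimately show ?thesis by (auto simp: submod_def ungraded_submod_def)
qed

lemma simple_iff: "simple G M \<longleftrightarrow> ker ~= U & (\<forall>W. stab W --> ker \<subseteq> W --> W = ker \<or> W = U)"
proof -
 have full: "{u \<in> U. p u : p ` W} = W" if "stab W" "ker \<subseteq> W" for W
 proof -
  have W: "subsp W" "W \<subseteq> U" using that by (auto simp: stab_def)
  have "u : W" if u: "u : U" "w : W" "p u = p w" for u w
  proof -
   have "u - w : W" using p_eq_iff[of u w] u W(2) \<open>ker \<subseteq> W\<close> by blast
   from sub_add[OF W(1) this u(2)] show ?thesis by simp
  qed
  thus ?thesis using W(2) by blast
 qed
 have k: "ker = U \<longleftrightarrow> carrier M = {\<zero>}"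
 proof
  assume "ker = U"
  hence "p u = \<zero>" if "u : U" for u using that unfolding ker_def by blast
  thus "carrier M = {\<zero>}" using U_closed(1) unfolding p_surj[symmetric] by force
 next
  assume "carrier M = {\<zero>}"
  thus "ker = U" unfolding p_surj[symmetric] ker_def by blast
 qed
 have 1: "p ` W = {\<zero>} \<longleftrightarrow> W = ker" "p ` W = carrier M \<longleftrightarrow> W = U" if "stab W" "ker \<subseteq> W" for W
 proof -
  have W: "W \<subseteq> U" "0 : W" using that sub_0 by (auto simp: stab_def)
  show "p ` W = {\<zero>} \<longleftrightarrow> W = ker" using W p_zero that(2) by (auto simp: ker_def)
  show "p ` W = carrier M \<longleftrightarrow> W = U" using full[OF that] p_surj p_in by blast
 qed
 show ?thesis
  unfolding simple_def k[symmetric]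
 proof (intro conj_cong refl iffI allI impI)
  fix W assume *: "\<forall>Z. submod G M Z --> Z = {\<zero>} \<or> Z = carrier M" "stab W" "ker \<subseteq> W"
  thus "W = ker \<or> W = U" using stab_submod[OF *(2)] 1[OF *(2,3)] by blast
 next
  fix Z assume *: "\<forall>W. stab W --> ker \<subseteq> W --> W = ker \<or> W = U" "submod G M Z"
  note Z = submod_stab[OF *(2)]
  show "Z = {\<zero>} \<or> Z = carrier M" using *(1) Z 1[OF Z(1,3)] by metis
 qed
qed

lemma quot_pres:
 assumes R: "submod G M R"
 shows "pres G U sg b (quot M R) (%u. R +> p u)" "pres.ker U (quot M R) (%u. R +> p u) = {u \<in> U. p u : R}"
proof -
 have Rs: "submodule R complex_ring M" using R by (simp add: submod_def ungraded_submod_def)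
 note q = quot_ops[OF module_M Rs]
 have act: "act (quot M R) g (R +> x) = R +> act M g x" if g: "g : G" and x: "x : carrier M" for g x
 proof (rule q(6)[OF _ _ _ x])
  show "act M g (x \<oplus> y) = act M g x \<oplus> act M g y" if "x : carrier M" "y : carrier M" for x y
   using p_ex[OF that(1)] p_ex[OF that(2)] g
   by (auto simp flip: p_add p_act simp: U_closed clin_add[OF b_lin] b_mem)
  show "act M g x : carrier M" if "x : carrier M" for x
   using p_ex[OF that] p_in[OF b_mem[OF g]] p_act[OF g] by auto
  show "act M g x : R" if "x : R" for x using R g that by (auto simp: submod_def ungraded_submod_def)
 qed
 have k: "R +> p u = R \<longleftrightarrow> p u : R" if "u : U" for u using q(7)[OF p_in[OF that]] .
 show *: "pres G U sg b (quot M R) (%u. R +> p u)"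
 proof
  show "(%u. R +> p u) ` U = carrier (quot M R)" unfolding q(1) p_surj[symmetric] by (rule image_image[symmetric])
  show "R +> p 0 = \<zero>\<^bsub>quot M R\<^esub>"
   using subgroup.one_closed[of R "add_monoid M"] Rs k[OF U_closed(1)] unfolding q(2) by (simp add: submodule_def p_zero)
  show "R +> p (sg u) = \<zero>\<^bsub>quot M R\<^esub>" if "u : U" "R +> p u = \<zero>\<^bsub>quot M R\<^esub>" for u
   using that submod_stab(1)[OF R] k sg_mem unfolding q(2) stab_def by blast
  show "homog (quot M R) t = (%u. R +> p u) ` {u \<in> U. sg u = (if t then - u else u)}" for t
   unfolding q(3) p_homog by (rule image_image)
 qed (use q(4,5) act p_in in "auto simp: U b_lin sg_lin b_mem sg_mem sg_sg p_add p_scale p_act")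
 show "pres.ker U (quot M R) (%u. R +> p u) = {u \<in> U. p u : R}"
  unfolding pres.ker_def[OF *] q(2) using k by blast
qed

text \<open>Two quotients of \<open>U\<close> with the same kernel are isomorphic.\<close>

lemma transport:
 assumes G: "G = gens d" and rels: "!!r u. r : rels d ==> u : U ==> vact b r u = 0" and S: "HC_ops d S par a"
  and b_sg: "!!g u. g : G ==> u : U ==> sg (b g u) = (if gpar g then - b g (sg u) else b g (sg u))"
  and psi: "clin psi" "psi ` U = S" "!!u. u : U ==> psi u = 0 \<longleftrightarrow> p u = \<zero>"
  and psi_act: "!!g u. g : G ==> u : U ==> psi (b g u) = (if t & gpar g then - a g (psi u) else a g (psi u))"
  and psi_sg: "!!u. u : U ==> sgo par (psi u) = (if t then - psi (sg u) else psi (sg u))"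
 shows "HC_supermodule d M & (\<exists>f. is_iso (gens d) t M (vmod S par a) f)"
proof -
 interpret S: HC_ops d S par a by (rule S)
 have pe: "p u = p v \<longleftrightarrow> psi u = psi v" if "u : U" "v : U" for u v
  using p_eq_iff[OF that] psi(3)[OF U_closed(5)[OF that]] U_closed(5)[OF that] by (auto simp: ker_def clin_diff[OF psi(1)])
 define f where "f x = psi (SOME u. u : U & x = p u)" for x
 have f: "f (p u) = psi u" if "u : U" for u
 proof -
  have w: "(SOME v. v : U & p u = p v) : U & p u = p (SOME v. v : U & p u = p v)"
   by (rule someI[where P="%v. v : U & p u = p v"]) (use that in simp)
  show ?thesis unfolding f_def by (rule pe[OF that, THEN iffD1, symmetric]) (use w in blast)+
 qed
 have SV: "psi u : S" if "u : U" for u using psi(2) that by blast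
 have inj: "x = y" if "x : carrier M" "y : carrier M" "f x = f y" for x y
  using p_ex[OF that(1)] p_ex[OF that(2)] f pe that(3) by auto
 have fadd: "f (x \<oplus> y) = f x + f y" if "x : carrier M" "y : carrier M" for x y
  using p_ex[OF that(1)] p_ex[OF that(2)] by (auto simp: f U_closed clin_add[OF psi(1)] simp flip: p_add)
 have fh: "f v : S & sgo par (f v) = (if s ~= t then - f v else f v)" if "v : homog M s" for v s
 proof -
  obtain u where "u : U" "sg u = (if s then - u else u)" "v = p u" using \<open>v : homog M s\<close> unfolding p_homog by auto
  thus ?thesis using psi_sg[of u] f SV by (auto simp: clin_neg[OF psi(1)])
 qed
 have hc: "v : carrier M" if "v : homog M s" for v s using that p_in unfolding p_homog by auto
 have iso: "is_iso (gens d) t M (vmod S par a) f"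
  unfolding is_iso_def is_hom_def operator_def
 proof (intro conjI allI ballI)
  show "f : carrier M \<rightarrow> carrier (vmod S par a)" using f SV by (auto simp flip: p_surj)
  show "f (z \<odot> x) = z \<odot>\<^bsub>vmod S par a\<^esub> f x" if "x : carrier M" for x z
   using p_ex[OF that] by (auto simp: f U_closed clin_scale[OF psi(1)] simp flip: p_scale)
  show "f (act M g v) = (if t & gpar g then - 1 else 1) \<odot>\<^bsub>vmod S par a\<^esub> act (vmod S par a) g (f v)" if "g : gens d" "v : carrier M" for g v
   using p_ex[OF that(2)] that(1) G by (auto simp: f b_mem psi_act cscale_m1 simp flip: p_act)
  show "bij_betw f (carrier M) (carrier (vmod S par a))"
  proof (rule bij_betw_imageI)
   show "inj_on f (carrier M)" by (rule inj_onI) (rule inj)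
   have "f ` carrier M = (%u. f (p u)) ` U" by (simp add: p_surj[symmetric] image_image)
   also have "\<dots> = S" using f psi(2) by simp
   finally show "f ` carrier M = carrier (vmod S par a)" by simp
  qed
 qed (use fadd fh in auto)
 have "HC_supermodule d M"
  unfolding HC_supermodule_def superspace_def
 proof (intro conjI allI ballI module_M)
  show "submodule (homog M s) complex_ring M" for s
  proof (rule M.submoduleI)
   show "homog M s \<subseteq> carrier M" using hc by blast
   show "\<zero> : homog M s" unfolding p_homog using U_closed(1) p_zero clin_0[OF sg_lin] by (auto intro!: image_eqI[of _ _ 0])
   fix x assume "x : homog M s"
   then obtain u where u: "u : U" "sg u = (if s then - u else u)" "x = p u" unfolding p_homog by auto
   show "\<ominus> x : homog M s" unfolding p_homog u(3) p_neg[OF u(1), symmetric] using u U_closed by (auto simp: clin_neg[OF sg_lin])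
   show "z \<odot> x : homog M s" for z unfolding p_homog u(3) p_scale[OF u(1), symmetric] using u U_closed by (auto simp: clin_scale[OF sg_lin])
   fix y assume "y : homog M s"
   then obtain v where v: "v : U" "sg v = (if s then - v else v)" "y = p v" unfolding p_homog by auto
   show "x \<oplus> y : homog M s" unfolding p_homog u(3) v(3) p_add[OF u(1) v(1), symmetric]
    using u v U_closed by (auto simp: clin_add[OF sg_lin])
  qed
  fix v assume v: "v : carrier M"
  have sub: "submod G M (carrier M)" using stab_submod[of U] U b_mem sg_mem p_surj by (simp add: stab_def)
  obtain v0 v1 where v01: "v0 : homog M False" "v1 : homog M True" "v = v0 \<oplus> v1"
   using sub v unfolding submod_def by blast
  let ?s = "%x. cscale (if t then - 1 else 1) (sgo par (f x))"
  have sp: "f w0 = cscale (1/2) (f v + ?s v)" "f w1 = cscale (1/2) (f v - ?s v)"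
   if w: "w0 : homog M False" "w1 : homog M True" "v = w0 \<oplus> w1" for w0 w1
  proof -
   have e: "f v = f w0 + f w1" "?s v = f w0 - f w1"
    using fadd[OF hc[OF w(1)] hc[OF w(2)]] fh[OF w(1)] fh[OF w(2)] w(3) by (auto simp: clin_add[OF clin_sgo] cscale_m1)
   show "f w0 = cscale (1/2) (f v + ?s v)" "f w1 = cscale (1/2) (f v - ?s v)"
    unfolding e(2) unfolding e(1) by (rule poly_mapping_eqI, simp add: lookup_add lookup_minus)+
  qed
  show "\<exists>!w. fst w : homog M False & snd w : homog M True & v = fst w \<oplus> snd w"
  proof (rule ex1I[of _ "(v0, v1)"])
   fix w assume w: "fst w : homog M False & snd w : homog M True & v = fst w \<oplus> snd w"
   have "f (fst w) = f v0" "f (snd w) = f v1" using sp[OF v01] sp[of "fst w" "snd w"] w by simp_all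
   hence "fst w = v0" "snd w = v1" using inj hc w v01 by blast+
   thus "w = (v0, v1)" by auto
  qed (use v01 in simp)
 next
  fix g assume g: "g : gens d"
  show "operator (gpar g) M M (act M g)"
   unfolding operator_def
  proof (intro conjI allI ballI)
   show "act M g : carrier M \<rightarrow> carrier M"
    using p_in[OF b_mem] p_act g G by (auto simp flip: p_surj)
   show "act M g (x \<oplus> y) = act M g x \<oplus> act M g y" if "x : carrier M" "y : carrier M" for x y
    using p_ex[OF that(1)] p_ex[OF that(2)] g G by (auto simp flip: p_add p_act simp: U_closed clin_add[OF b_lin] b_mem)
   show "act M g (z \<odot> x) = z \<odot> act M g x" if "x : carrier M" for x z
    using p_ex[OF that] g G by (auto simp flip: p_scale p_act simp: U_closed clin_scale[OF b_lin] b_mem)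
   fix s v assume "v : homog M s"
   then obtain u where u: "u : U" "sg u = (if s then - u else u)" "v = p u" unfolding p_homog by auto
   have "sg (b g u) = (if s ~= gpar g then - b g u else b g u)" using b_sg[of g u] g G u(1,2) by (auto simp: clin_neg[OF b_lin])
   thus "act M g v : homog M (s ~= gpar g)" unfolding p_homog u(3) using p_act[of g u] b_mem[of g u] g G u(1)
    by (intro image_eqI[of _ _ "b g u"]) auto
  qed
 next
  fix r v assume r: "r : rels d" and "v : carrier M"
  then obtain u where u: "u : U" "v = p u" using p_ex by blast
  have wa: "foldr b gl u : U & p (foldr b gl u) = foldr (act M) gl (p u)" if "set gl \<subseteq> G" for gl
   using that by (induction gl) (auto simp: u b_mem p_act)
  have rf: "r : fal d" using r rels_fal by blast
  have fs: "finsum M (%w. p (g w)) B = p (sum g B)" if "finite B" "!!w. w : B ==> g w : U" for g and B :: "gword set"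
   using that by (induction B rule: finite_induct) (auto simp: p_zero p_in p_add sub_sum[OF U])
  have "alg_act M r v = (\<Oplus>w\<in>keys r. p (cscale (lk r w) (foldr b (letters w) u)))"
   unfolding alg_act_def word_act_def u(2)
   by (rule M.finsum_cong') (use rf wa G in "auto simp: fal_iff p_scale intro!: M.smult_closed", (metis p_in)+)
  also have "\<dots> = p (vact b r u)"
   unfolding vact_def lin_def by (rule fs) (use rf wa G in "auto simp: fal_iff intro!: U_closed")
  finally have e: "alg_act M r v = p (vact b r u)" .
  show "alg_act M r v = \<zero>" unfolding e rels[OF r u(1)] by (rule p_zero)
 qed
 thus ?thesis using iso by blast
qed

end

section \<open>The algebra as a quotient of the free algebra\<close>

lemma ideal_rel_ideal: "ideal (rel_ideal d) (free_alg d)"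
 unfolding rel_ideal_def by (rule ring.genideal_ideal[OF ring_free_alg rels_fal])

lemma HC_elem_ops:
 assumes "f : fal d" "g : fal d"
 shows "HC_elem d f \<oplus>\<^bsub>HC d\<^esub> HC_elem d g = HC_elem d (f + g)" "HC_elem d f \<otimes>\<^bsub>HC d\<^esub> HC_elem d g = HC_elem d (f * g)"
 using assms ring_hom_add[OF ideal.rcos_ring_hom[OF ideal_rel_ideal[of d]], of f g]
  ring_hom_mult[OF ideal.rcos_ring_hom[OF ideal_rel_ideal[of d]], of f g]
 by (simp_all add: HC_elem_def HC_def)

lemma carrier_HC: "carrier (HC d) = HC_elem d ` fal d"
 by (auto simp: HC_def FactRing_def HC_elem_def A_RCOSETS_def')

lemma HC_elem_eq:
 assumes "f : fal d" "g : fal d" shows "HC_elem d f = HC_elem d g \<longleftrightarrow> f - g : rel_ideal d"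
proof -
 interpret R: ring "free_alg d" by (rule ring_free_alg)
 interpret I: ideal "rel_ideal d" "free_alg d" by (rule ideal_rel_ideal)
 show ?thesis
 proof
  assume "HC_elem d f = HC_elem d g"
  hence "f : HC_elem d g" using I.a_rcos_self[OF assms(1)] by (simp add: HC_elem_def)
  thus "f - g : rel_ideal d" by (auto simp: HC_elem_def a_r_coset_def')
 next
  assume *: "f - g : rel_ideal d"
  have "(f - g) \<oplus>\<^bsub>free_alg d\<^esub> g : HC_elem d g"
   unfolding HC_elem_def using * I.a_subset assms(2) by (rule R.a_rcosI)
  hence "HC_elem d g = HC_elem d f"
   using R.a_repr_independence[of "(f - g) \<oplus>\<^bsub>free_alg d\<^esub> g" "rel_ideal d" g] assms(2) I.a_subgroup by (simp add: HC_elem_def)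
  thus "HC_elem d f = HC_elem d g" ..
 qed
qed

lemma rel_ideal_least:
 assumes "J \<subseteq> fal d" "subsp J" "rels d \<subseteq> J"
  and "!!f g. f : J ==> g : fal d ==> f * g : J & g * f : J"
 shows "rel_ideal d \<subseteq> J"
 unfolding rel_ideal_def
proof (rule ring.genideal_minimal[OF ring_free_alg])
 interpret R: ring "free_alg d" by (rule ring_free_alg)
 have neg: "inv\<^bsub>add_monoid (free_alg d)\<^esub> x = - x" if "x : J" for x
 proof -
  have "\<ominus>\<^bsub>free_alg d\<^esub> x = - x" using that assms(1) by (intro R.minus_equality) (auto simp: fal_closed)
  thus ?thesis by (simp add: a_inv_def)
 qed
 show "ideal J (free_alg d)"
  by (intro idealI ring_free_alg R.a_group group.subgroupI)
    (use assms sub_0[OF assms(2)] sub_add[OF assms(2)] sub_neg[OF assms(2)] R.a_group neg in auto)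
qed (rule assms(3))

lemma HC_ops_ideal:
 assumes "HC_ops d S par a" "f : rel_ideal d" "v : S" shows "vact a f v = 0"
proof -
 interpret HC_ops d S par a by (rule assms(1))
 have "rel_ideal d \<subseteq> {f \<in> fal d. \<forall>v\<in>S. vact a f v = 0}"
 proof (rule rel_ideal_least)
  show "subsp {f \<in> fal d. \<forall>v\<in>S. vact a f v = 0}"
   by (rule cvec.subspaceI) (auto simp: fal_closed vact_lin)
 qed (use rels_fal rels vact_stable[OF V a_mem] in "auto simp: vact_mult[OF a_lin] fal_mult clin_0[OF clin_vact[OF a_lin]]")
 thus ?thesis using assms(2,3) by blast
qed

definition wpar :: "gword => bool" where
 "wpar w \<longleftrightarrow> odd (length (filter gpar (letters w)))"

lemma sgo_mult: "sgo wpar (f * g) = sgo wpar f * sgo wpar g"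
proof -
 have wp: "wpar (v + w) \<longleftrightarrow> wpar v ~= wpar w" for v w by (auto simp: wpar_def plus_gword_def)
 have b: "sgo wpar (bas w * g) = sgo wpar (bas w) * sgo wpar g" for w
  by (rule clin_eqI[where f="%g. sgo wpar (bas w * g)"])
    (auto intro!: clin_comp[OF clin_sgo clin_times_right] clin_comp[OF clin_times_right clin_sgo]
     clin_uminus[OF clin_comp[OF clin_times_right clin_sgo]]
     simp: mult_single wp cscale_m1)
 show ?thesis
  by (rule clin_eqI[where f="%f. sgo wpar (f * g)"])
    (use b in "auto intro!: clin_comp[OF clin_sgo clin_times_left] clin_comp[OF clin_times_left clin_sgo]")
qed

lemma sgo_gens: "sgo wpar (gs i) = gs i" "sgo wpar (gx i) = gx i" "sgo wpar (gc i) = - gc i" "sgo wpar 1 = 1"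
proof -
 have "sgo wpar (bas (Word [])) = bas (Word [])" by (simp add: wpar_def)
 thus "sgo wpar 1 = 1" by (metis single_one zero_gword_def)
qed (simp_all add: gs_def gx_def gc_def wpar_def cscale_m1)

lemma sgo_rels: "f : rels d ==> sgo wpar f = f \<or> sgo wpar f = - f"
 unfolding rels_def
 by (elim UnE CollectE exE conjE) (simp_all add: clin_simps[OF clin_sgo] sgo_mult sgo_gens)

lemma sgo_fal: "sgo wpar f : fal d \<longleftrightarrow> f : fal d"
proof -
 have "keys (sgo wpar f) = keys f" by (auto simp: in_keys_iff)
 thus ?thesis by (simp add: fal_iff)
qed

lemma sgo_rel_ideal: "f : rel_ideal d ==> sgo wpar f : rel_ideal d"
proof -
 interpret R: ring "free_alg d" by (rule ring_free_alg)
 interpret I: ideal "rel_ideal d" "free_alg d" by (rule ideal_rel_ideal)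
 have add: "x + y : rel_ideal d" if "x : rel_ideal d" "y : rel_ideal d" for x y using I.a_closed[OF that] by simp
 have mult: "x * y : rel_ideal d & y * x : rel_ideal d" if "x : rel_ideal d" "y : fal d" for x y
  using I.I_r_closed[OF that] I.I_l_closed[OF that] by simp
 have scale: "cscale c x : rel_ideal d" if "x : rel_ideal d" for c x
  using mult[OF that, of "cscale c 1"] by (simp add: fal_one fal_closed cscale_mult_right)
 have rl: "r : rel_ideal d" if "r : rels d" for r using R.genideal_self[OF rels_fal] that by (auto simp: rel_ideal_def)
 have "rel_ideal d \<subseteq> {f \<in> fal d. sgo wpar f : rel_ideal d}"
 proof (rule rel_ideal_least)
  show "subsp {f \<in> fal d. sgo wpar f : rel_ideal d}"
   using I.zero_closed by (intro cvec.subspaceI) (auto simp: fal_closed clin_simps[OF clin_sgo] add scale)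
  show "rels d \<subseteq> {f \<in> fal d. sgo wpar f : rel_ideal d}"
   using rels_fal sgo_rels rl scale[of _ "-1"] by (fastforce simp: cscale_m1)
 qed (use mult in "auto simp: fal_mult sgo_mult sgo_fal")
 moreover assume "f : rel_ideal d"
 ultimately show ?thesis by blast
qed

lemma HC_homog_eq: "HC_homog d t = HC_elem d ` {f \<in> fal d. sgo wpar f = (if t then - f else f)}"
 unfolding HC_homog_def homog_iff_sgo[symmetric] wpar_def by simp

lemma HC_ops_sgo:
 assumes "HC_ops d S par a" "f : fal d" "v : S"
 shows "sgo par (vact a f v) = vact a (sgo wpar f) (sgo par v)"
proof -
 interpret HC_ops d S par a by (rule assms(1))
 have w: "foldr a gl v : S & sgo par (foldr a gl v) = cscale (if odd (length (filter gpar gl)) then -1 else 1) (foldr a gl (sgo par v))"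
  if "set gl \<subseteq> gens d" for gl
  using that by (induction gl) (auto simp: assms(3) a_mem a_sg clin_simps[OF a_lin] cscale_m1)
 show ?thesis
  by (rule clin_eqI[where f="%f. sgo par (vact a f v)"])
    (use w assms(2) in "auto intro!: clin_comp[OF clin_sgo clin_vact_alg] clin_comp[OF clin_vact_alg clin_sgo]
     simp: vact_bas wpar_def fal_iff clin_simps[OF clin_vact_alg]")
qed

section \<open>The induced module\<close>

lemma idempotent_with_kernel:
 assumes R: "subsp R"
 shows "\<exists>f :: 'a vec => 'a vec. clin f & (\<forall>v. f v - v : R) & (\<forall>v. f v = 0 \<longleftrightarrow> v : R)"
proof -
 obtain B where B: "B \<subseteq> R" "cvec.independent B" "R \<subseteq> cvec.span B" using cvec.maximal_independent_subset[of R] by blast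
 define E where "E = cvec.extend_basis B"
 have E: "B \<subseteq> E" "cvec.independent E" "cvec.span E = UNIV"
  unfolding E_def using cvec.extend_basis_superset[OF B(2)] cvec.independent_extend_basis[OF B(2)] cvec.span_extend_basis[OF B(2)] by auto
 obtain f where f: "Vector_Spaces.linear cscale cscale f" "\<forall>x\<in>E. f x = (if x : B then 0 else x)"
  using cpair.linear_independent_extend[OF E(2), of "%x. if x : B then 0 else x"] by blast
 have c: "clin f" using f(1) by (intro clinI) (simp_all add: cpair.linear_add cpair.linear_scale)
 have d: "f v - v : R" for v
 proof (rule clin_span_mem[where f="%v. f v - v" and B=E])
  show "clin (%v. f v - v)" by (rule clin_minus[OF c clin_id])
  show "f x - x : R" if "x : E" for x using f(2) that B(1) sub_0[OF R] sub_neg[OF R] by auto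
 qed (use E(3) R in auto)
 have "f v = 0" if "v : R" for v
 proof -
  have "f v : {0}"
   by (rule clin_span_mem[where B=B, OF _ c]) (use B(1,3) E(1) f(2) that in "auto simp: cvec.subspace_single_0")
  thus ?thesis by simp
 qed
 moreover have "v : R" if "f v = 0" for v using d[of v] that sub_neg[OF R, of "- v"] by simp
 ultimately show ?thesis using c d by blast
qed

locale induced_setup =
 fixes d :: nat and G :: "gen set" and VN :: "'b vec set" and par :: "'b => bool" and aN :: "gen => 'b vec => 'b vec"
 assumes VN: "subsp VN" and G: "G \<subseteq> gens d" and aN_mem: "!!g m. g : G ==> m : VN ==> aN g m : VN"
  and sgN_mem: "!!m. m : VN ==> sgo par m : VN"
  and sgN_act: "!!g m. g : G ==> m : VN ==> sgo par (aN g m) = (if gpar g then - aN g (sgo par m) else aN g (sgo par m))"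
begin

abbreviation N where "N \<equiv> vmod VN par aN"

definition e :: "falg => 'b vec => (falg set \<times> 'b vec) vec" where
 "e f m = bas (HC_elem d f, m)"

definition F where "F = cvec.span {e f m | f m. f : fal d & m : VN}"
definition R0 where "R0 = induced_rel d G N"

lemmas VNc = sub_0[OF VN] sub_add[OF VN] sub_scale[OF VN] sub_neg[OF VN]

lemma F_sub: "subsp F" and R0_sub: "subsp R0"
 by (simp_all add: F_def R0_def induced_rel_def)

lemma F_eq: "carrier (induced_free d N) = F"
 unfolding induced_free_def F_def e_def by (simp add: carrier_HC) (rule arg_cong[where f=cvec.span], blast)

lemma e_F: "f : fal d ==> m : VN ==> e f m : F"
 unfolding F_def by (auto intro: cvec.span_base)

lemma F_into: "v : F ==> clin \<Phi> ==> subsp Z ==> (!!f m. f : fal d ==> m : VN ==> \<Phi> (e f m) : Z) ==> \<Phi> v : Z"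
 unfolding F_def by (erule clin_span_mem) auto

lemma HC_scale_elem: "f : fal d ==> HC_scale d c (HC_elem d f) = HC_elem d (cscale c f)"
 by (simp add: HC_scale_def HC_elem_ops fal_one fal_closed cscale_mult_left)

lemma HC_gen_elem: "g : gens d ==> f : fal d ==> HC_gen d g \<otimes>\<^bsub>HC d\<^esub> HC_elem d f = HC_elem d (bas (Word [g]) * f)"
 "g : gens d ==> f : fal d ==> HC_elem d f \<otimes>\<^bsub>HC d\<^esub> HC_gen d g = HC_elem d (f * bas (Word [g]))"
 by (simp_all add: HC_gen_def HC_elem_ops fal_gens)

definition gen_rels :: "(falg set \<times> 'b vec) vec set" where
 "gen_rels = {e (f + f') m - e f m - e f' m | f f' m. f : fal d & f' : fal d & m : VN}
  \<union> {e f (m + m') - e f m - e f m' | f m m'. f : fal d & m : VN & m' : VN}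
  \<union> {e (cscale z f) m - cscale z (e f m) | z f m. f : fal d & m : VN}
  \<union> {e f (cscale z m) - cscale z (e f m) | z f m. f : fal d & m : VN}
  \<union> {e (f * bas (Word [g])) m - e f (aN g m) | g f m. g : G & f : fal d & m : VN}"

lemma R0_eq: "R0 = cvec.span gen_rels"
proof -
 have g: "g : gens d" if "g : G" for g using G that by blast
 have 2: "{P h h' m | h h' m. h : HC_elem d ` fal d & h' : HC_elem d ` fal d & m : VN}
   = {P (HC_elem d f) (HC_elem d f') m | f f' m. f : fal d & f' : fal d & m : VN}"
  for P :: "falg set => falg set => 'b vec => (falg set \<times> 'b vec) vec" by blast
 have 1: "{P z h m | z h m. h : HC_elem d ` fal d & m : VN} = {P z (HC_elem d f) m | z f m. f : fal d & m : VN}"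
  for P :: "complex => falg set => 'b vec => (falg set \<times> 'b vec) vec" by blast
 have 0: "{P g h m | g h m. g : G & h : HC_elem d ` fal d & m : VN} = {P g (HC_elem d f) m | g f m. g : G & f : fal d & m : VN}"
  for P :: "gen => falg set => 'b vec => (falg set \<times> 'b vec) vec" by blast
 have "{bas (h \<oplus>\<^bsub>HC d\<^esub> h', m) - bas (h, m) - bas (h', m) | h h' m. h : carrier (HC d) & h' : carrier (HC d) & m : carrier N}
   = {e (f + f') m - e f m - e f' m | f f' m. f : fal d & f' : fal d & m : VN}"
  unfolding carrier_HC e_def vmod_simps 2 by (intro Collect_cong ex_cong1 rev_conj_cong refl) (simp add: HC_elem_ops)
 moreover have "{bas (h, m \<oplus>\<^bsub>N\<^esub> m') - bas (h, m) - bas (h, m') | h m m'. h : carrier (HC d) & m : carrier N & m' : carrier N}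
   = {e f (m + m') - e f m - e f m' | f m m'. f : fal d & m : VN & m' : VN}"
  unfolding carrier_HC e_def by auto
 moreover have "{bas (HC_scale d z h, m) - cscale z (bas (h, m)) | z h m. h : carrier (HC d) & m : carrier N}
   = {e (cscale z f) m - cscale z (e f m) | z f m. f : fal d & m : VN}"
  unfolding carrier_HC e_def vmod_simps 1 by (intro Collect_cong ex_cong1 rev_conj_cong refl) (simp add: HC_scale_elem)
 moreover have "{bas (h, z \<odot>\<^bsub>N\<^esub> m) - cscale z (bas (h, m)) | z h m. h : carrier (HC d) & m : carrier N}
   = {e f (cscale z m) - cscale z (e f m) | z f m. f : fal d & m : VN}"
  unfolding carrier_HC e_def by auto
 moreover have "{bas (h \<otimes>\<^bsub>HC d\<^esub> HC_gen d g, m) - bas (h, act N g m) | g h m. g : G & h : carrier (HC d) & m : carrier N}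
   = {e (f * bas (Word [g])) m - e f (aN g m) | g f m. g : G & f : fal d & m : VN}"
  unfolding carrier_HC e_def vmod_simps 0 by (intro Collect_cong ex_cong1 rev_conj_cong refl) (simp add: HC_gen_elem g)
 ultimately show ?thesis unfolding R0_def induced_rel_def gen_rels_def by (simp only:)
qed

lemma R0_into:
 assumes "v : R0" "clin \<Phi>" "subsp Z"
  and "!!f f' m. f : fal d ==> f' : fal d ==> m : VN ==> \<Phi> (e (f + f') m) - \<Phi> (e f m) - \<Phi> (e f' m) : Z"
  and "!!f m m'. f : fal d ==> m : VN ==> m' : VN ==> \<Phi> (e f (m + m')) - \<Phi> (e f m) - \<Phi> (e f m') : Z"
  and "!!z f m. f : fal d ==> m : VN ==> \<Phi> (e (cscale z f) m) - cscale z (\<Phi> (e f m)) : Z"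
  and "!!z f m. f : fal d ==> m : VN ==> \<Phi> (e f (cscale z m)) - cscale z (\<Phi> (e f m)) : Z"
  and "!!g f m. g : G ==> f : fal d ==> m : VN ==> \<Phi> (e (f * bas (Word [g])) m) - \<Phi> (e f (aN g m)) : Z"
 shows "\<Phi> v : Z"
 by (rule clin_span_mem[OF assms(1)[unfolded R0_eq] assms(2,3)])
   (use assms(4-8) in "auto simp: gen_rels_def clin_simps[OF assms(2)]")

lemma R0_rel:
 "f : fal d ==> f' : fal d ==> m : VN ==> e (f + f') m - e f m - e f' m : R0"
 "f : fal d ==> m : VN ==> m' : VN ==> e f (m + m') - e f m - e f m' : R0"
 "f : fal d ==> m : VN ==> e (cscale z f) m - cscale z (e f m) : R0"
 "f : fal d ==> m : VN ==> e f (cscale z m) - cscale z (e f m) : R0"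
 "g : G ==> f : fal d ==> m : VN ==> e (f * bas (Word [g])) m - e f (aN g m) : R0"
 unfolding R0_eq gen_rels_def
 by (rule cvec.span_base, (((rule UnI2)?, intro CollectI exI conjI, rule refl, assumption+) | rule UnI1)+)+

lemma fal_gen_mult: "g : gens d ==> f : fal d ==> f * bas (Word [g]) : fal d" "g : gens d ==> f : fal d ==> bas (Word [g]) * f : fal d"
 by (simp_all add: fal_mult fal_gens)

lemma R0_F: "R0 \<subseteq> F"
proof
 fix v assume "v : R0"
 thus "v : F"
  by (rule R0_into[OF _ clin_id F_sub])
    (use G in "(intro sub_diff[OF F_sub] sub_scale[OF F_sub] e_F fal_closed fal_gen_mult VNc aN_mem; blast)+")
qed

definition LF :: "gen => (falg set \<times> 'b vec) vec => (falg set \<times> 'b vec) vec" where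
 "LF g = lin (%(h, m). bas (HC_gen d g \<otimes>\<^bsub>HC d\<^esub> h, m))"

definition rep :: "falg set => falg" where
 "rep h = (SOME f. f : fal d & h = HC_elem d f)"

lemma rep: "f : fal d ==> rep (HC_elem d f) : fal d & rep (HC_elem d f) - f : rel_ideal d"
proof -
 assume f: "f : fal d"
 have "rep (HC_elem d f) : fal d & HC_elem d f = HC_elem d (rep (HC_elem d f))"
  unfolding rep_def by (rule someI[where P="%g. g : fal d & HC_elem d f = HC_elem d g"]) (use f in simp)
 thus ?thesis using HC_elem_eq f by metis
qed

definition sF :: "(falg set \<times> 'b vec) vec => (falg set \<times> 'b vec) vec" where
 "sF = lin (%(h, m). bas (HC_elem d (sgo wpar (rep h)), sgo par m))"

lemma LF_e: "g : gens d ==> f : fal d ==> LF g (e f m) = e (bas (Word [g]) * f) m"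
 by (simp add: LF_def e_def HC_gen_elem)

lemma sF_e: "f : fal d ==> sF (e f m) = e (sgo wpar f) (sgo par m)"
proof -
 assume f: "f : fal d"
 have "sgo wpar (rep (HC_elem d f)) - sgo wpar f : rel_ideal d"
  using sgo_rel_ideal[of "rep (HC_elem d f) - f" d] rep[OF f] by (simp add: clin_diff[OF clin_sgo])
 hence "HC_elem d (sgo wpar (rep (HC_elem d f))) = HC_elem d (sgo wpar f)"
  using HC_elem_eq[of "sgo wpar (rep (HC_elem d f))" d "sgo wpar f"] rep[OF f] f by (simp add: sgo_fal)
 thus ?thesis by (simp add: sF_def e_def)
qed

lemma clin_LF: "clin (LF g)" and clin_sF: "clin sF"
 by (simp_all add: LF_def sF_def)

lemma LF_R0: "g : gens d ==> v : R0 ==> LF g v : R0"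
 by (rule R0_into[OF _ clin_LF R0_sub])
   (use G in "auto simp: LF_e fal_closed fal_mult fal_gens distrib_left cscale_mult_right mult.assoc[symmetric] subset_iff intro: R0_rel")

lemma sF_R0: "v : R0 ==> sF v : R0"
proof (rule R0_into[OF _ clin_sF R0_sub])
 fix g f m assume g: "g : G" and f: "f : fal d" and m: "m : VN"
 have gg: "g : gens d" using G g by blast
 have fg: "f * bas (Word [g]) : fal d" using f gg by (simp add: fal_mult fal_gens)
 have L: "sF (e (f * bas (Word [g])) m) = e (if gpar g then - (sgo wpar f * bas (Word [g])) else sgo wpar f * bas (Word [g])) (sgo par m)"
  unfolding sF_e[OF fg] by (simp add: sgo_mult wpar_def cscale_m1)
 note r = R0_rel(5)[OF g sgo_fal[THEN iffD2, OF f] sgN_mem[OF m]]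
 have n1: "e (- h) m' + e h m' : R0" "e h (- m') + e h m' : R0" if "h : fal d" "m' : VN" for h m'
  using R0_rel(3,4)[OF that, of "-1"] by (simp_all add: cscale_m1)
 show "sF (e (f * bas (Word [g])) m) - sF (e f (aN g m)) : R0"
 proof (cases "gpar g")
  case False
  thus ?thesis using r by (simp add: L sF_e[OF f] sgN_act[OF g m])
 next
  case True
  let ?h = "sgo wpar f * bas (Word [g])" and ?m = "sgo par m"
  have "(e (- ?h) ?m + e ?h ?m) - (e ?h ?m - e (sgo wpar f) (aN g ?m)) - (e (sgo wpar f) (- aN g ?m) + e (sgo wpar f) (aN g ?m)) : R0"
   by (rule sub_diff[OF R0_sub sub_diff[OF R0_sub n1(1) r] n1(2)])
     (use g f gg m in "auto simp: fal_mult fal_gens sgo_fal sgN_mem aN_mem")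
  thus ?thesis using True by (simp add: L sF_e[OF f] sgN_act[OF g m])
 qed
qed (use R0_rel in "auto simp: sF_e fal_closed VNc clin_simps[OF clin_sgo] sgo_fal sgN_mem")

definition f0 :: "(falg set \<times> 'b vec) vec => (falg set \<times> 'b vec) vec" where
 "f0 = (SOME f. clin f & (\<forall>v. f v - v : R0) & (\<forall>v. f v = 0 \<longleftrightarrow> v : R0))"

lemma f0: "clin f0" "f0 v - v : R0" "f0 v = 0 \<longleftrightarrow> v : R0"
proof -
 have "clin f0 & (\<forall>v. f0 v - v : R0) & (\<forall>v. f0 v = 0 \<longleftrightarrow> v : R0)"
  unfolding f0_def using someI_ex[OF idempotent_with_kernel[OF R0_sub]] .
 thus "clin f0" "f0 v - v : R0" "f0 v = 0 \<longleftrightarrow> v : R0" by auto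
qed

lemma f0_eq: "v - w : R0 ==> f0 v = f0 w"
 using f0(3)[of "v - w"] by (simp add: clin_diff[OF f0(1)])

definition U where "U = f0 ` F"
definition b where "b g v = f0 (LF g v)"
definition sg where "sg v = f0 (sF v)"
definition beta where "beta f m = f0 (e f m)"

lemma U_sub: "subsp U"
 unfolding U_def by (rule clin_image_subspace[OF f0(1) F_sub])

lemma U_F: "U \<subseteq> F"
proof -
 have "f0 v : F" if "v : F" for v using sub_add[OF F_sub subsetD[OF R0_F f0(2)[of v]] that] by simp
 thus ?thesis by (auto simp: U_def)
qed

lemma f0_U: "u : U ==> f0 u = u"
 using f0_eq[OF f0(2)] by (auto simp: U_def)

lemma beta_U: "f : fal d ==> m : VN ==> beta f m : U"
 unfolding beta_def U_def using e_F by blast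

lemma U_into:
 assumes "u : U" "clin \<Phi>" "subsp Z" "!!f m. f : fal d ==> m : VN ==> \<Phi> (beta f m) : Z" shows "\<Phi> u : Z"
proof -
 obtain v where v: "v : F" "u = f0 v" using assms(1) by (auto simp: U_def)
 show ?thesis unfolding v(2) using F_into[OF v(1) clin_comp[OF assms(2) f0(1)] assms(3)] assms(4) by (simp add: beta_def)
qed

lemma U_eqI:
 assumes "u : U" "clin \<Phi>" "clin \<Psi>" "!!f m. f : fal d ==> m : VN ==> \<Phi> (beta f m) = \<Psi> (beta f m)" shows "\<Phi> u = \<Psi> u"
 using U_into[OF assms(1) clin_minus[OF assms(2,3)] cvec.subspace_single_0] assms(4) by simp

lemma beta_rel:
 "f : fal d ==> f' : fal d ==> m : VN ==> beta (f + f') m = beta f m + beta f' m"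
 "f : fal d ==> m : VN ==> m' : VN ==> beta f (m + m') = beta f m + beta f m'"
 "f : fal d ==> m : VN ==> beta (cscale z f) m = cscale z (beta f m)"
 "f : fal d ==> m : VN ==> beta f (cscale z m) = cscale z (beta f m)"
 "g : G ==> f : fal d ==> m : VN ==> beta (f * bas (Word [g])) m = beta f (aN g m)"
 using R0_rel[THEN f0(3)[THEN iffD2]] by (simp_all add: beta_def clin_simps[OF f0(1)] algebra_simps)

lemma b_beta: "g : gens d ==> f : fal d ==> b g (beta f m) = beta (bas (Word [g]) * f) m"
proof -
 assume g: "g : gens d" and f: "f : fal d"
 have "LF g (beta f m) - LF g (e f m) : R0" using LF_R0[OF g f0(2)] by (simp add: beta_def clin_diff[OF clin_LF])
 thus ?thesis using f0_eq LF_e[OF g f] by (simp add: b_def beta_def)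
qed

lemma sg_beta: "f : fal d ==> sg (beta f m) = beta (sgo wpar f) (sgo par m)"
proof -
 assume f: "f : fal d"
 have "sF (beta f m) - sF (e f m) : R0" using sF_R0[OF f0(2)] by (simp add: beta_def clin_diff[OF clin_sF])
 thus ?thesis using f0_eq sF_e[OF f] by (simp add: sg_def beta_def)
qed

lemma clin_b: "clin (b g)" and clin_sg: "clin sg"
 unfolding b_def[abs_def] sg_def[abs_def] by (intro clin_comp[OF f0(1)] clin_LF clin_sF)+

lemma b_U: "g : gens d ==> u : U ==> b g u : U"
 by (erule U_into[OF _ clin_b U_sub]) (auto simp: b_beta fal_mult fal_gens intro!: beta_U)

lemma sg_U: "u : U ==> sg u : U"
 by (erule U_into[OF _ clin_sg U_sub]) (auto simp: sg_beta sgo_fal sgN_mem intro!: beta_U)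

lemma sg_sg: "u : U ==> sg (sg u) = u"
 by (erule U_eqI[OF _ clin_comp[OF clin_sg clin_sg] clin_id]) (simp add: sg_beta sgo_fal)

lemma b_sg: "g : gens d ==> u : U ==> sg (b g u) = (if gpar g then - b g (sg u) else b g (sg u))"
proof (rule U_eqI[where \<Phi>="%u. sg (b g u)"])
 show "clin (%u. if gpar g then - b g (sg u) else b g (sg u))"
  using clin_comp[OF clin_b clin_sg] clin_uminus by (cases "gpar g") auto
 fix f m assume g: "g : gens d" and f: "f : fal d" and m: "m : VN"
 have h: "bas (Word [g]) * sgo wpar f : fal d" using g f by (simp add: fal_gen_mult sgo_fal)
 show "sg (b g (beta f m)) = (if gpar g then - b g (sg (beta f m)) else b g (sg (beta f m)))"
  using beta_rel(3)[OF h sgN_mem[OF m], of "-1"] g f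
  by (simp add: b_beta sg_beta fal_gen_mult sgo_fal sgo_mult wpar_def cscale_m1)
qed (auto intro: clin_comp[OF clin_sg clin_b])

lemma vact_beta: "r : fal d ==> f : fal d ==> m : VN ==> vact b r (beta f m) = beta (r * f) m"
proof -
 assume r: "r : fal d" and f: "f : fal d" and m: "m : VN"
 have w: "foldr b gl (beta f m) = beta (bas (Word gl) * f) m & bas (Word gl) * f : fal d" if "set gl \<subseteq> gens d" for gl
  using that
 proof (induction gl)
  case Nil
  have "bas (Word []) = (1 :: falg)" by (metis single_one zero_gword_def)
  thus ?case using f by simp
 next
  case (Cons g gl)
  have "bas (Word (g # gl)) = bas (Word [g]) * bas (Word gl)" by (simp add: mult_single plus_gword_def)
  thus ?case using Cons by (simp add: b_beta mult.assoc fal_mult fal_gens)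
 qed
 let ?B = "bas ` {w. set (letters w) \<subseteq> gens d}"
 have "r : {r \<in> fal d. vact b r (beta f m) = beta (r * f) m}"
 proof (rule clin_span_mem[where f="%r. r" and B="?B", OF _ clin_id])
  show "subsp {r \<in> fal d. vact b r (beta f m) = beta (r * f) m}"
  proof (rule cvec.subspaceI)
   have "beta 0 m = 0" using beta_rel(3)[OF f m, of 0] by simp
   thus "0 : {r \<in> fal d. vact b r (beta f m) = beta (r * f) m}" by (simp add: fal_closed vact_lin)
  qed (auto simp: vact_lin fal_closed distrib_right cscale_mult_left beta_rel(1,3) fal_mult f m)
  show "x : {r \<in> fal d. vact b r (beta f m) = beta (r * f) m}" if x: "x : ?B" for x
  proof -
   obtain v where v: "x = bas v" "set (letters v) \<subseteq> gens d" using x by auto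
   thus ?thesis using w[OF v(2)] by (simp add: vact_bas fal_iff)
  qed
 qed (use r in "simp add: fal_span")
 thus ?thesis by simp
qed

lemma vact_rel: "r : rels d ==> u : U ==> vact b r u = 0"
proof (rule U_eqI[OF _ clin_vact[OF clin_b] clin_zero])
 interpret R: ring "free_alg d" by (rule ring_free_alg)
 interpret I: ideal "rel_ideal d" "free_alg d" by (rule ideal_rel_ideal)
 fix f m assume r: "r : rels d" and f: "f : fal d" and m: "m : VN"
 have rf: "r : fal d" using r rels_fal by blast
 have "r : rel_ideal d" using R.genideal_self[OF rels_fal] r by (auto simp: rel_ideal_def)
 hence "r * f : rel_ideal d" using I.I_r_closed[of r f] f by simp
 hence "HC_elem d (r * f) = HC_elem d 0" using HC_elem_eq[of "r * f" d 0] rf f by (simp add: fal_mult fal_closed)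
 hence "beta (r * f) m = beta 0 m" by (simp add: beta_def e_def)
 also have "\<dots> = 0" using beta_rel(3)[OF f m, of 0] by simp
 finally show "vact b r (beta f m) = 0" using vact_beta[OF rf f m] by simp
qed

lemma generated:
 assumes W: "subsp W" "W \<subseteq> U" "beta 1 ` VN \<subseteq> W" "!!g v. g : gens d ==> v : W ==> b g v : W"
 shows "W = U"
proof -
 have "beta f m : W" if "f : fal d" "m : VN" for f m
 proof -
  have "vact b f (beta 1 m) : W" by (rule vact_stable[OF W(1,4) that(1)]) (use W(3) that in auto)
  thus ?thesis using vact_beta[OF that(1) fal_one that(2)] by simp
 qed
 hence "u : W" if "u : U" for u using U_into[OF that clin_id W(1)] by blast
 thus ?thesis using W(2) by blast
qed

lemma homog_image: "f0 ` homog (induced_free d N) t = {u \<in> U. sg u = (if t then - u else u)}"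
proof
 let ?H = "homog (induced_free d N) t"
 let ?D = "%p s. {f \<in> p. sgo wpar f = (if s then - f else f)}"
 have H: "?H = cvec.span {e f m | f m p. f : fal d & sgo wpar f = (if p then - f else f) & m : VN & sgo par m = (if p ~= t then - m else m)}"
  unfolding induced_free_def e_def HC_homog_eq by simp (rule arg_cong[where f=cvec.span], blast)
 have Es: "subsp {u \<in> U. sg u = (if t then - u else u)}"
  by (rule cvec.subspaceI) (use sub_0[OF U_sub] sub_add[OF U_sub] sub_scale[OF U_sub] in
   \<open>auto simp: clin_simps[OF clin_sg]\<close>)
 have neg: "beta (- f) m = - beta f m" "beta f (- m) = - beta f m" if "f : fal d" "m : VN" for f m
  using beta_rel(3,4)[OF that, of "-1"] by (simp_all add: cscale_m1)
 show "f0 ` ?H \<subseteq> {u \<in> U. sg u = (if t then - u else u)}"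
 proof clarify
  fix v assume "v : ?H"
  hence "f0 v : {u \<in> U. sg u = (if t then - u else u)}"
   unfolding H
  proof (rule clin_span_mem[OF _ f0(1) Es])
   fix x assume "x : {e f m | f m p. f : fal d & sgo wpar f = (if p then - f else f) & m : VN & sgo par m = (if p ~= t then - m else m)}"
   then obtain f m p where x: "x = e f m" "f : fal d" "sgo wpar f = (if p then - f else f)" "m : VN" "sgo par m = (if p ~= t then - m else m)" by auto
   have "sg (beta f m) = (if t then - beta f m else beta f m)"
    unfolding sg_beta[OF x(2)] x(3,5) using neg[OF x(2,4)] neg[of "- f" m] neg[of f "- m"] x(2,4) VNc
    by (auto simp: fal_closed)
   thus "f0 x : {u \<in> U. sg u = (if t then - u else u)}" unfolding x(1) using beta_U[OF x(2,4)] by (simp add: beta_def)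
  qed
  thus "f0 v : U & sg (f0 v) = (if t then - f0 v else f0 v)" by simp
 qed
 show "{u \<in> U. sg u = (if t then - u else u)} \<subseteq> f0 ` ?H"
 proof clarify
  fix u assume u: "u : U" "sg u = (if t then - u else u)"
  let ?z = "if t then - 1 else 1 :: complex"
  have Hs: "subsp (f0 ` ?H)" by (rule clin_image_subspace[OF f0(1)]) (simp add: H)
  have c: "clin (%u. u + cscale ?z (sg u))" by (intro clin_plus clin_id clin_cscale clin_sg)
  have "u + cscale ?z (sg u) : f0 ` ?H"
  proof (rule U_into[OF u(1) c Hs])
   fix f m assume f: "f : fal d" and m: "m : VN"
   define fe fo me mo where "fe = cscale (1/2) (f + sgo wpar f)" and "fo = cscale (1/2) (f - sgo wpar f)"
    and "me = cscale (1/2) (m + sgo par m)" and "mo = cscale (1/2) (m - sgo par m)"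
   have fm: "fe : fal d" "fo : fal d" "me : VN" "mo : VN"
    unfolding fe_def fo_def me_def mo_def using f m sgN_mem[OF m] VNc sub_diff[OF VN] by (auto simp: fal_closed sgo_fal)
   have eq: "f = fe + fo" "m = me + mo" unfolding fe_def fo_def me_def mo_def
    by (rule poly_mapping_eqI, simp add: lookup_add lookup_minus field_simps)+
   have s: "sgo wpar fe = fe" "sgo wpar fo = - fo" "sgo par me = me" "sgo par mo = - mo"
    unfolding fe_def fo_def me_def mo_def by (rule poly_mapping_eqI, simp add: lookup_add lookup_minus)+
   have mem: "beta f' m' : f0 ` ?H" if "f' : fal d" "m' : VN" "sgo wpar f' = (if p then - f' else f')" "sgo par m' = (if p ~= t then - m' else m')" for f' m' p
    unfolding beta_def H using that by (intro imageI cvec.span_base) blast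
   have "beta f m = beta fe me + beta fe mo + (beta fo me + beta fo mo)"
    unfolding eq using fm by (simp add: beta_rel(1,2) VNc)
   moreover have "sg (beta f m) = beta fe me - beta fe mo - (beta fo me - beta fo mo)"
   proof -
    have sf: "sgo wpar f = fe + - fo" by (subst eq(1)) (simp add: clin_simps[OF clin_sgo] s)
    have sm: "sgo par m = me + - mo" by (subst eq(2)) (simp add: clin_simps[OF clin_sgo] s)
    have "sg (beta f m) = beta (fe + - fo) (me + - mo)"  unfolding sg_beta[OF f] sf sm ..
    also have "\<dots> = beta fe me + beta fe (- mo) + (beta (- fo) me + beta (- fo) (- mo))"
     using fm by (simp only: beta_rel(1,2) VNc fal_closed) (simp only: ac_simps)
    finally show ?thesis using fm by (simp add: neg VNc fal_closed)
   qed
   ultimately have "beta f m + cscale ?z (sg (beta f m)) =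
     (if t then cscale 2 (beta fe mo) + cscale 2 (beta fo me) else cscale 2 (beta fe me) + cscale 2 (beta fo mo))"
    by (auto intro!: poly_mapping_eqI simp: lookup_add lookup_minus)
   moreover have "beta fe (if t then mo else me) : f0 ` ?H" "beta fo (if t then me else mo) : f0 ` ?H"
    using mem[of fe "if t then mo else me" False] mem[of fo "if t then me else mo" True] fm s by auto
   ultimately show "beta f m + cscale ?z (sg (beta f m)) : f0 ` ?H"
    using sub_add[OF Hs sub_scale[OF Hs] sub_scale[OF Hs]] by (auto split: if_splits)
  qed
  moreover have "u + cscale ?z (sg u) = cscale 2 u" using u(2) by (intro poly_mapping_eqI) (auto simp: lookup_add)
  ultimately have "cscale (1/2) (cscale 2 u) : f0 ` ?H" using sub_scale[OF Hs] by metis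
  thus "u : f0 ` ?H" by simp
 qed
qed

definition pq where "pq u = R0 +>\<^bsub>induced_free d N\<^esub> u"

lemma module_F: "Module.module complex_ring (induced_free d N)"
 by (rule module_vec[OF F_sub F_eq]) (simp_all add: induced_free_def)

lemma R0_submodule: "submodule R0 complex_ring (induced_free d N)"
proof -
 have "submodule R0 complex_ring (induced_free d N) \<longleftrightarrow> R0 \<subseteq> F & subsp R0"
  by (rule submodule_vec[OF F_sub F_eq]) (simp_all add: induced_free_def)
 thus ?thesis using R0_F R0_sub by simp
qed

lemma pres_induced: "pres (gens d) U sg b (induced d G N) pq" "pres.ker U (induced d G N) pq = {0}"
proof -
 note q = quot_ops[OF module_F R0_submodule]
 have ops: "add (induced_free d N) = (+)" "smult (induced_free d N) = cscale" "act (induced_free d N) = LF"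
  by (auto simp: induced_free_def LF_def fun_eq_iff)
 have ind: "induced d G N = quot (induced_free d N) R0" by (simp add: induced_def R0_def)
 have m0: "R0 +>\<^bsub>induced_free d N\<^esub> x = pq x" for x by (simp add: pq_def)
 have LF_F: "LF g v : F" if "g : gens d" "v : F" for g v
  by (rule F_into[OF that(2) clin_LF F_sub]) (use that(1) in "auto simp: LF_e fal_mult fal_gens intro!: e_F")
 have act: "act (induced d G N) g (pq x) = pq (LF g x)" if "g : gens d" "x : F" for g x
  using q(6)[of g x] that LF_F LF_R0 unfolding ind m0 F_eq ops by (simp add: clin_add[OF clin_LF])
 have pf: "pq (f0 v) = pq v" if "v : F" for v
 proof -
  have "pq ((f0 v - v) + v) = pq (f0 v - v) \<oplus>\<^bsub>induced d G N\<^esub> pq v"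
   using q(4)[of "f0 v - v" v] subsetD[OF R0_F f0(2)] that unfolding ind m0 F_eq ops by simp
  also have "pq (f0 v - v) = pq 0"
   using q(7)[of "f0 v - v"] q(7)[of 0] f0(2) R0_F sub_0[OF R0_sub] sub_0[OF F_sub] unfolding m0 F_eq by blast
  also have "pq 0 \<oplus>\<^bsub>induced d G N\<^esub> pq v = pq v"
   using q(4)[of 0 v] sub_0[OF F_sub] that unfolding ind m0 F_eq ops by simp
  finally show ?thesis by simp
 qed
 have UF: "u : F" if "u : U" for u using U_F that by blast
 have k: "pq u = R0 \<longleftrightarrow> u = 0" if "u : U" for u
  using q(7)[of u] UF[OF that] f0(3)[of u] f0_U[OF that] unfolding m0 F_eq by simp
 show *: "pres (gens d) U sg b (induced d G N) pq"
 proof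
  show "pq ` U = carrier (induced d G N)" unfolding ind q(1) F_eq m0 U_def image_image using pf by (intro image_cong) auto
  show "pq 0 = \<zero>\<^bsub>induced d G N\<^esub>" unfolding ind q(2) using k[OF sub_0[OF U_sub]] by simp
  show "pq (u + v) = pq u \<oplus>\<^bsub>induced d G N\<^esub> pq v" if "u : U" "v : U" for u v
   using q(4)[of u v] UF[OF that(1)] UF[OF that(2)] unfolding ind m0 F_eq ops by simp
  show "pq (cscale z u) = z \<odot>\<^bsub>induced d G N\<^esub> pq u" if "u : U" for u z
   using q(5)[of u z] UF[OF that] unfolding ind m0 F_eq ops by simp
  show "pq (b g u) = act (induced d G N) g (pq u)" if "g : gens d" "u : U" for g u
   using act[OF that(1) UF[OF that(2)]] pf[OF LF_F[OF that(1) UF[OF that(2)]]] by (simp add: b_def)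
  show "pq (sg u) = \<zero>\<^bsub>induced d G N\<^esub>" if "u : U" "pq u = \<zero>\<^bsub>induced d G N\<^esub>" for u
   using that k[of u] k[OF sub_0[OF U_sub]] unfolding ind q(2) by (simp add: clin_0[OF clin_sg])
  show "homog (induced d G N) t = pq ` {u \<in> U. sg u = (if t then - u else u)}" for t
  proof -
   have "v : F" if "v : homog (induced_free d N) t" for v
   proof -
    have "homog (induced_free d N) t \<subseteq> carrier (induced_free d N)"
     unfolding induced_free_def HC_homog_eq by (simp add: carrier_HC) (rule cvec.span_mono, blast)
    thus ?thesis using that F_eq by blast
   qed
   thus ?thesis unfolding homog_image[symmetric] ind q(3) m0 image_image using pf by (intro image_cong) auto
  qed
 qed (auto simp: U_sub clin_b clin_sg b_U sg_U sg_sg)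
 show "pres.ker U (induced d G N) pq = {0}"
  unfolding pres.ker_def[OF *] unfolding ind q(2) using k sub_0[OF U_sub] by auto
qed

text \<open>Frobenius reciprocity.\<close>

lemma frobenius:
 assumes S: "HC_ops d S par' a" and gam: "!!m. m : VN ==> gam m : S"
  "!!m m'. m : VN ==> m' : VN ==> gam (m + m') = gam m + gam m'"
  "!!z m. m : VN ==> gam (cscale z m) = cscale z (gam m)"
  "!!g m. g : G ==> m : VN ==> gam (aN g m) = a g (gam m)"
  "!!m. m : VN ==> sgo par' (gam m) = (if t then - gam (sgo par m) else gam (sgo par m))"
 shows "\<exists>psi. clin psi & (\<forall>u\<in>U. psi u : S) & (\<forall>g\<in>gens d. \<forall>u\<in>U. psi (b g u) = a g (psi u))
  & (\<forall>u\<in>U. sgo par' (psi u) = (if t then - psi (sg u) else psi (sg u))) & (\<forall>m\<in>VN. psi (beta 1 m) = gam m)"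
proof -
 interpret S: HC_ops d S par' a by (rule S)
 define psi where "psi = lin (%(h, m). vact a (rep h) (gam m))"
 have c: "clin psi" by (simp add: psi_def)
 have e: "psi (e f m) = vact a f (gam m)" if "f : fal d" "m : VN" for f m
  using HC_ops_ideal[OF S _ gam(1)[OF that(2)], of "rep (HC_elem d f) - f"] rep[OF that(1)]
  by (simp add: psi_def e_def vact_lin)
 have "psi v : {0}" if "v : R0" for v
  by (rule R0_into[OF that c])
    (use G in "auto simp: e gam vact_lin clin_simps[OF clin_vact[OF S.a_lin]] vact_mult[OF S.a_lin] vact_bas fal_closed fal_mult fal_gens VNc aN_mem subset_iff cvec.subspace_single_0")
 hence beta: "psi (beta f m) = vact a f (gam m)" if "f : fal d" "m : VN" for f m
 proof -
  have "psi (f0 (e f m) - e f m) = 0" using f0(2) \<open>!!v. v : R0 ==> psi v : {0}\<close> by blast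
  thus ?thesis using e[OF that] by (simp add: beta_def clin_diff[OF c])
 qed
 show ?thesis
 proof (intro exI[of _ psi] conjI ballI c)
  show "psi u : S" if "u : U" for u
   by (rule U_into[OF that c S.V]) (auto simp: beta intro!: vact_stable[OF S.V S.a_mem] gam(1))
  show "psi (b g u) = a g (psi u)" if "g : gens d" "u : U" for g u
   by (rule U_eqI[OF that(2) clin_comp[OF c clin_b] clin_comp[OF S.a_lin c]])
     (use that(1) in "auto simp: b_beta beta fal_mult fal_gens vact_mult[OF S.a_lin] vact_bas")
  show "sgo par' (psi u) = (if t then - psi (sg u) else psi (sg u))" if "u : U" for u
  proof (rule U_eqI[OF that clin_comp[OF clin_sgo c]])
   show "clin (%u. if t then - psi (sg u) else psi (sg u))" using clin_comp[OF c clin_sg] clin_uminus by (cases t) auto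
  qed (auto simp: beta sg_beta HC_ops_sgo[OF S] gam(1,5) sgo_fal sgN_mem clin_neg[OF clin_vact[OF S.a_lin]])
  show "psi (beta 1 m) = gam m" if "m : VN" for m using beta[OF fal_one that] by (simp add: vact_one)
 qed
qed

end

section \<open>The isomorphism\<close>

lemma em_inj: "em M a = em M b ==> a = b"
proof -
 have r: "lin (%(J, M'). bas J) (em M a) = a" for a
  by (rule clin_eqI[where f="%a. lin (%(J, M'). bas J) (em M a)" and g="%a. a"])
    (auto intro!: clin_comp[OF clin_lin clin_tens_left])
 assume "em M a = em M b"
 thus "a = b" using r by metis
qed

context skewK
begin

lemma block_not_std: "i : block_index blens ==> ~ std (swap i L0)"
proof
 assume i: "i : block_index blens" and s: "std (swap i L0)"
 have ii: "i : {1..<n}" "rw i = rw (i+1)" using i block_rw by auto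
 have p: "i : {1..n}" "i + 1 : {1..n}" using ii by auto
 obtain z where z: "bl ! (i - 1) = bx (rw i) z" "row (rw i) z" using row_bl[OF p(1)] by auto
 obtain z' where z': "bl ! i = bx (rw i) z'" "row (rw i) z'" using row_bl[OF p(2)] ii(2) by auto
 have L: "L0 (bx (rw i) z) = i" "L0 (bx (rw i) z') = i + 1"
  using L_lbl[OF std_L0 p(1)] L_lbl[OF std_L0 p(2)] lbl_L0[OF p(1)] lbl_L0[OF p(2)] z z' by auto
 have "lex (bl ! (i - 1)) (bl ! i)" using lex_bl[of "i - 1" i] ii(1) length_bl by auto
 hence "z < z'" unfolding z(1) z'(1) by (simp add: lex_def bx_def)
 hence "swap i L0 (bx (rw i) z) < swap i L0 (bx (rw i) z')" by (rule std_row_raw[OF s z(2) z'(2)])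
 thus False using L by (simp add: swap_def)
qed

text \<open>The restriction of \<open>H\<close> contains the module over the block subalgebra from which \<open>M(\<lambda>,\<mu>)\<close> is
  induced.\<close>

lemma block_embedding:
 fixes V :: "rowb list vec set"
 assumes bm: "bmod V (sgo listpar) (%i. aN (Gx i)) (%i. aN (Gc i)) n (%i. kap (contents segs ! (i - 1)))
   (%i. aN (Gs i)) (block_index blens)"
  and as: "wmod.asimple V (sgo listpar) (%i. aN (Gx i)) (%i. aN (Gc i)) n"
 shows "\<exists>gam t. (\<forall>m\<in>V. gam m : S) & (\<forall>m\<in>V. \<forall>m'\<in>V. gam (m + m') = gam m + gam m')
  & (\<forall>m\<in>V. \<forall>z. gam (cscale z m) = cscale z (gam m))
  & (\<forall>g\<in>bgens (block_index blens) n. \<forall>m\<in>V. gam (aN g m) = hat_act lam mu g (gam m))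
  & (\<forall>m\<in>V. sgo hpar (gam m) = (if t then - gam (sgo listpar m) else gam (sgo listpar m)))
  & (\<exists>m\<in>V. gam m ~= 0)"
proof -
 let ?c = "%i. aN (Gc i)"
 define k where "k i = kap (contents segs ! (i - 1))" for i
 interpret HN: bmod V "sgo listpar" "%i. aN (Gx i)" ?c n k "%i. aN (Gs i)" "block_index blens"
  unfolding k_def[abs_def] by (rule bm)
 interpret St: wmod "clsp n" "sgo clpar" "std_x k" "%i. lin (cl_c i)" n k by (rule std_wmod)
 define K' where "K' = {a \<in> clsp n. em L0 a : KM L0}"
 have K'_sub: "subsp K'" unfolding K'_def by (rule clin_vimage_subspace[OF clin_tens_left KM_sub subspace_clsp])
 have K'_KM: "KM L0 = em L0 ` K'" using KM_em[OF std_L0] by (auto simp: K'_def)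
 have kk: "kc i L0 = k i" if "i : {1..n}" for i using cn_lbl[OF that] by (simp add: kp_kap k_def cn_def)
 have ex: "em L0 (std_x k i a) = hx i (em L0 a)" if "i : {1..n}" for i a
  unfolding hx_em kk[OF that] std_x_def by (rule clin_scale[OF clin_tens_left])
 have ec: "em L0 (lin (cl_c i) a) = hat_c i (em L0 a)" for i a by (rule hat_c_em[symmetric])
 have K'_cl: "std_x k i a : K'" "lin (cl_c i) a : K'" if "i : {1..n}" "a : K'" for i a
  using that KM_closed(1,2)[OF std_L0, of "em L0 a" i] St.x_mem[OF that(1)] St.c_mem[OF that(1)] ex[OF that(1)] ec
  by (simp_all only: K'_def mem_Collect_eq)
 have K'_sg: "sgo clpar a : K'" if "a : K'" for a
  using that KM_closed(3)[OF std_L0, of "em L0 a"] St.sg_mem by (simp add: K'_def sgo_em)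
 have gs: "St.gsub K'" unfolding St.gsub_def St.asub_def using K'_sub K'_cl K'_sg by (auto simp: K'_def)
 interpret KK: wmod K' "sgo clpar" "std_x k" "%i. lin (cl_c i)" n k by (rule St.gsub_wmod[OF gs])
 have KM0: "KM L0 ~= {0}"
 proof -
  obtain v where "v : K" "v ~= 0" using K_props(6) sub_0[OF K_props(1)] by blast
  thus ?thesis using tau_inj[OF std_L0] unfolding KM_def by blast
 qed
 have em0: "em L0 a = 0 \<longleftrightarrow> a = 0" for a using em_inj[where M=L0 and b=0] clin_0[OF clin_tens_left] by auto
 have Kas: "KK.asimple"
  unfolding KK.asimple_def
 proof (intro conjI allI impI)
  show "K' ~= {0}" using KM0 unfolding K'_KM by (auto simp: em0)
  fix W assume "KK.gsub W"
  hence W: "subsp W" "W \<subseteq> K'" "!!i v. i : {1..n} ==> v : W ==> std_x k i v : W"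
   "!!i v. i : {1..n} ==> v : W ==> lin (cl_c i) v : W" "!!v. v : W ==> sgo clpar v : W"
   by (auto simp: KK.gsub_def KK.asub_def)
  have "em L0 ` W = {0} \<or> em L0 ` W = KM L0"
  proof (rule KM_simple[OF std_L0 clin_image_subspace[OF clin_tens_left W(1)]])
   show "em L0 ` W \<subseteq> KM L0" using W(2) K'_KM by blast
   show "hat_c j v : em L0 ` W" if "j : {1..n}" "v : em L0 ` W" for j v
    using that W(4) by (auto simp: hat_c_em simp del: tens_bas)
   show "hx j v : em L0 ` W" if "j : {1..n}" "v : em L0 ` W" for j v
   proof -
    obtain a where a: "a : W" "v = em L0 a" using \<open>v : em L0 ` W\<close> by blast
    show ?thesis unfolding a(2) ex[OF that(1), symmetric] using W(3)[OF that(1) a(1)] by blast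
   qed
   show "sgo hpar v : em L0 ` W" if "v : em L0 ` W" for v using that W(5) by (auto simp: sgo_em simp del: tens_bas)
  qed
  thus "W = {0} \<or> W = K'"
  proof
   assume "em L0 ` W = {0}"
   hence "W \<subseteq> {0}" using em0 by blast
   thus ?thesis using sub_0[OF W(1)] by blast
  next
   assume "em L0 ` W = KM L0"
   hence "K' \<subseteq> W" unfolding K'_KM using em_inj by blast
   thus ?thesis using W(2) by blast
  qed
 qed
 obtain u where u: "HN.hw u" "HN.homo u" "bij_betw (eta ?c u) K' V"
  using HN.simple_iso_std[OF as Kas gs] by blast
 have uV: "u : V" using u(1) by (simp add: HN.hw_def)
 define gam where "gam m = em L0 (the_inv_into K' (eta ?c u) m)" for m
 have gam: "gam (eta ?c u a) = em L0 a" if "a : K'" for a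
  unfolding gam_def using the_inv_into_f_f[OF bij_betw_imp_inj_on[OF u(3)] that] by simp
 have Vex: "\<exists>a\<in>K'. m = eta ?c u a" if "m : V" for m using that u(3) by (auto simp: bij_betw_def)
 have add: "gam (m + m') = gam m + gam m'" if "m : V" "m' : V" for m m'
  using Vex[OF that(1)] Vex[OF that(2)] gam sub_add[OF K'_sub]
  by (auto simp flip: clin_add[OF clin_eta] simp: clin_add[OF clin_tens_left])
 have scale: "gam (cscale z m) = cscale z (gam m)" if "m : V" for z m
  using Vex[OF that] gam sub_scale[OF K'_sub]
  by (auto simp flip: clin_scale[OF clin_eta] simp: clin_scale[OF clin_tens_left])
 have diff: "gam (m - m') = gam m - gam m'" if "m : V" "m' : V" for m m'
  using add[of "m - m'" m'] that sub_diff[OF HN.V] by (simp add: algebra_simps)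
 have K'c: "a : clsp n" if "a : K'" for a using that by (simp add: K'_def)
 have c: "gam (aN (Gc j) m) = hat_c j (gam m)" if "j : {1..n}" and m: "m : V" for j m
 proof -
  obtain a where a: "a : K'" "m = eta ?c u a" using Vex[OF m] by blast
  show ?thesis unfolding a(2) HN.eta_c[OF uV K'c[OF a(1)] that(1), symmetric] gam[OF a(1)] gam[OF K'_cl(2)[OF that(1) a(1)]] ec ..
 qed
 have x: "gam (aN (Gx j) m) = hx j (gam m)" if "j : {1..n}" and m: "m : V" for j m
 proof -
  obtain a where a: "a : K'" "m = eta ?c u a" using Vex[OF m] by blast
  have "aN (Gx j) m = eta ?c u (std_x k j a)"
   unfolding a(2) HN.x_eta[OF u(1) K'c[OF a(1)] that(1)] std_x_def clin_scale[OF clin_eta] ..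
  thus ?thesis unfolding a(2) gam[OF a(1)] using gam[OF K'_cl(1)[OF that(1) a(1)]] ex[OF that(1)] by simp
 qed
 have s: "gam (aN (Gs i) m) = hs i (gam m)" if i: "i : block_index blens" and m: "m : V" for i m
 proof -
  have ii: "i : {1..<n}" "i : {1..n}" "i + 1 : {1..n}" using i block_rw by auto
  obtain a where a: "a : K'" "m = eta ?c u a" using Vex[OF m] by blast
  have "yy i L0 = 0" using yy_std[OF std_L0 ii(1)] block_not_std[OF i] by simp
  hence "hs i (gam m) = cscale (1 / (k (i+1) * k (i+1) - k i * k i)) (Bo i (gam m))"
   unfolding a(2) gam[OF a(1)] hs_formula[OF std_L0 ii(1) K'c[OF a(1)]] kk[OF ii(2)] kk[OF ii(3)] by simp
  also have "Bo i (gam m) = gam (aN (Gx i) m + aN (Gx (i+1)) m - aN (Gc i) (aN (Gc (i+1)) (aN (Gx i) m - aN (Gx (i+1)) m)))"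
   using m ii(2,3) HN.x_mem HN.c_mem sub_diff[OF HN.V] sub_add[OF HN.V]
   by (simp only: Bo_def add diff c x)
  also have "cscale (1 / (k (i+1) * k (i+1) - k i * k i)) \<dots> = gam (aN (Gs i) m)"
   unfolding HN.s_formula[OF i m]
   using m ii(2,3) HN.x_mem HN.c_mem sub_diff[OF HN.V] sub_add[OF HN.V]
   by (intro scale[symmetric]) simp
  finally show ?thesis by simp
 qed
 have sg: "gam (sgo listpar m) = (if sgo listpar u ~= u then - sgo hpar (gam m) else sgo hpar (gam m))" if m: "m : V" for m
 proof -
  obtain a where a: "a : K'" "m = eta ?c u a" using Vex[OF m] by blast
  have "sgo listpar m = eta ?c (sgo listpar u) (sgo clpar a)" unfolding a(2) by (rule HN.sg_eta[OF uV K'c[OF a(1)]])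
  also have "\<dots> = (if sgo listpar u ~= u then - eta ?c u (sgo clpar a) else eta ?c u (sgo clpar a))"
  proof (cases "sgo listpar u = u")
   case False
   hence "sgo listpar u = - u" using u(2) by (simp add: HN.homo_def)
   thus ?thesis using False clin_neg[OF clin_eta_vec[where a="sgo clpar a" and c="?c"]] HN.c_lin by simp
  qed simp
  finally have e: "sgo listpar m = (if sgo listpar u ~= u then - eta ?c u (sgo clpar a) else eta ?c u (sgo clpar a))" .
  have "gam (- eta ?c u (sgo clpar a)) = - em L0 (sgo clpar a)"
   using gam[OF sub_neg[OF K'_sub K'_sg[OF a(1)]]] by (simp only: clin_neg[OF clin_eta] clin_neg[OF clin_tens_left])
  thus ?thesis unfolding e using gam[OF K'_sg[OF a(1)]] gam[OF a(1)] a(2) by (simp add: sgo_em del: tens_bas)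
 qed
 have mem: "gam m : S" if "m : V" for m
  using Vex[OF that] gam KM_S[OF std_L0] K'_KM by auto
 have ne: "\<exists>m\<in>V. gam m ~= 0"
 proof -
  obtain a where a: "a : K'" "a ~= 0" using Kas sub_0[OF K'_sub] unfolding KK.asimple_def by blast
  thus ?thesis using gam[OF a(1)] em0 u(3) by (metis bij_betwE)
 qed
 show ?thesis
  by (rule exI[of _ gam], rule exI[of _ "sgo listpar u ~= u"])
    (use mem add scale c x s sg ne in "auto simp: bgens_def agens_def simp del: hat_act.simps(2,3)")
qed

theorem L_module_iso_H_module:
 assumes N: "is_Phi_product segs N"
 shows "HC_isomorphic n (L_module lam mu N) (H_module lam mu K)"
proof -
 have nn: "0 \<le> fst s" if "s : set segs" for s using that segs_nth by (auto simp: in_set_conv_nth)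
 obtain V aN where V: "N = vmod V listpar aN" "bmodule (block_index blens) (contents segs) V listpar aN"
  "simple (block_gens blens) N" using is_Phi_product_bmodule[OF N nn] unfolding seg_lens_segs by blast
 let ?B = "block_index blens" and ?G = "block_gens blens"
 have len: "length (contents segs) = n" using length_contents[of segs] by (simp add: seg_lens_segs n_blens)
 have G: "?G = bgens ?B n" using block_gens_eq[of blens] by (simp add: n_blens)
 have bm: "bmod V (sgo listpar) (%i. aN (Gx i)) (%i. aN (Gc i)) n (%i. kap (contents segs ! (i - 1))) (%i. aN (Gs i)) ?B"
  using V(2) by (simp add: bmodule_def len)
 interpret HN: bmod V "sgo listpar" "%i. aN (Gx i)" "%i. aN (Gc i)" n "%i. kap (contents segs ! (i - 1))" "%i. aN (Gs i)" ?B
  by (rule bm)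
 have as: "HN.asimple" using simple_bmodule(1)[OF V(2)] V(1,3) by (simp add: len G)
 obtain gam t where gam: "!!m. m : V ==> gam m : S" "!!m m'. m : V ==> m' : V ==> gam (m + m') = gam m + gam m'"
  "!!z m. m : V ==> gam (cscale z m) = cscale z (gam m)"
  "!!g m. g : ?G ==> m : V ==> gam (aN g m) = hat_act lam mu g (gam m)"
  "!!m. m : V ==> sgo hpar (gam m) = (if t then - gam (sgo listpar m) else gam (sgo listpar m))"
  and gam0: "\<exists>m\<in>V. gam m ~= 0"
  using block_embedding[OF bm as] unfolding G by blast
 interpret I: induced_setup n ?G V listpar aN
 proof
  show "?G \<subseteq> gens n" unfolding G bgens_def gens_def agens_def using HN.B by auto
  show "aN g m : V" if "g : ?G" "m : V" for g m
   using that HN.x_mem HN.c_mem HN.s_mem unfolding G bgens_def agens_def by auto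
  show "sgo listpar (aN g m) = (if gpar g then - aN g (sgo listpar m) else aN g (sgo listpar m))" if "g : ?G" "m : V" for g m
   using that HN.x_sg HN.c_sg HN.s_sg unfolding G bgens_def agens_def by auto
 qed (auto simp: HN.V HN.sg_mem)
 obtain psi where psi: "clin psi" "!!u. u : I.U ==> psi u : S" "!!g u. g : gens n ==> u : I.U ==> psi (I.b g u) = hat_act lam mu g (psi u)"
  "!!u. u : I.U ==> sgo hpar (psi u) = (if t then - psi (I.sg u) else psi (I.sg u))" "!!m. m : V ==> psi (I.beta 1 m) = gam m"
  using I.frobenius[OF S_HC_ops gam] by blast
 interpret D: ind V listpar aN n "contents segs" ?B I.U I.sg I.b "I.beta 1" rw
 proof unfold_locales
  show "I.b g (I.beta 1 m) = I.beta 1 (aN g m)" if "g : bgens ?B n" "m : V" for g m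
  proof -
   have g: "g : ?G" "g : gens n" using that G I.G by auto
   show ?thesis using I.b_beta[OF g(2) fal_one] I.beta_rel(5)[OF g(1) fal_one that(2)] by simp
  qed
  show "\<exists>e\<in>{p..n}. rw e = rw p & (\<forall>p'\<in>{p..n}. contents segs ! (p' - 1) = contents segs ! (e - 1) --> p' = e)"
   if "p : {1..n}" for p using row_end[OF that] by (simp add: cn_def)
  show "p = p'" if "p : {1..n}" "p' : {1..n}" "rw p = rw p'" "contents segs ! (p - 1) = contents segs ! (p' - 1)" for p p'
   using rw_cn_inj that by (simp add: cn_def)
  show "0 \<le> contents segs ! (p - 1)" if "p : {1..n}" for p
   using cn_lbl[OF that] content_nonneg[OF lbl_Bx[OF std_L0 that]] by (simp add: cn_def)
  show "HN.asimple" by (rule as)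
 qed (use I.beta_rel I.sg_beta I.generated I.U_sub I.clin_b I.clin_sg I.b_U I.vact_rel I.beta_U fal_one sgo_gens(4) block_rw rw_mono len in auto)
 define Q1 where "Q1 = M_module lam mu N"
 have Q1: "Q1 = Defs.induced n ?G (vmod V listpar aN)"
  by (simp add: Q1_def M_module_def Let_def n_blens V(1) flip: blens_def)
 interpret p: pres "gens n" I.U I.sg I.b Q1 I.pq unfolding Q1 by (rule I.pres_induced(1))
 have pk: "p.ker = {0}" using I.pres_induced(2) unfolding Q1 .
 note Usub = I.U_sub
 have stab: "p.stab W \<longleftrightarrow> D.stable W" for W by (simp add: p.stab_def D.stable_def)
 define W0 where "W0 = {u \<in> I.U. psi u = 0}"
 have W0s: "subsp W0"
  using clin_vimage_subspace[OF psi(1) cvec.subspace_single_0 Usub] by (simp add: W0_def)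
 have W0: "p.stab W0"
  unfolding p.stab_def
 proof (intro conjI ballI W0s)
  show "I.b g v : W0" if "g : gens n" "v : W0" for g v
   using that psi(3) I.b_U clin_0[OF clin_hat_act] by (simp add: W0_def del: hat_act.simps)
  show "I.sg v : W0" if "v : W0" for v
  proof -
   have v: "v : I.U" "psi v = 0" using that by (auto simp: W0_def)
   have "(if t then - psi (I.sg v) else psi (I.sg v)) = 0"
    unfolding psi(4)[OF v(1), symmetric] v(2) by (rule clin_0[OF clin_sgo])
   thus ?thesis using I.sg_U[OF v(1)] by (simp add: W0_def split: if_splits)
  qed
 qed (auto simp: W0_def)
 have img: "submod (gens n) (vmod S hpar (hat_act lam mu)) (psi ` W)" if "p.stab W" for W
 proof -
  have W: "subsp W" "W \<subseteq> I.U" "!!g v. g : gens n ==> v : W ==> I.b g v : W" "!!v. v : W ==> I.sg v : W"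
   using that by (auto simp: p.stab_def)
  have i: "subsp (psi ` W)" by (rule clin_image_subspace[OF psi(1) W(1)])
  show ?thesis unfolding submod_vmod[OF S_sub]
  proof (intro conjI ballI i)
   show "psi ` W \<subseteq> S" using W(2) psi(2) by blast
   show "hat_act lam mu g v : psi ` W" if "g : gens n" "v : psi ` W" for g v
   proof -
    obtain w where w: "w : W" "v = psi w" using \<open>v : psi ` W\<close> by blast
    show ?thesis unfolding w(2) psi(3)[OF that(1) subsetD[OF W(2) w(1)], symmetric] using W(3)[OF that(1) w(1)] by blast
   qed
   show "sgo hpar v : psi ` W" if "v : psi ` W" for v
   proof -
    obtain w where w: "w : W" "v = psi w" using \<open>v : psi ` W\<close> by blast
    have "psi (I.sg w) : psi ` W" using W(4)[OF w(1)] by blast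
    thus ?thesis unfolding w(2) psi(4)[OF subsetD[OF W(2) w(1)]] using sub_neg[OF i] by simp
   qed
  qed
 qed
 have dich: "psi ` W = {0} \<or> psi ` W = S" if "p.stab W" for W using S_simple[OF img[OF that]] by blast
 have Ust: "p.stab I.U" using Usub I.b_U I.sg_U by (simp add: p.stab_def)
 have surj: "psi ` I.U = S"
 proof -
  obtain m where "m : V" "gam m ~= 0" using gam0 by blast
  hence "psi (I.beta 1 m) ~= 0" "I.beta 1 m : I.U" using psi(5) I.beta_U[OF fal_one] by auto
  thus ?thesis using dich[OF Ust] by blast
 qed
 have W0U: "W0 ~= I.U"
 proof
  assume "W0 = I.U"
  hence "psi ` I.U = {0}" using sub_0[OF Usub] clin_0[OF psi(1)] by (force simp: W0_def)
  moreover obtain m where "m : V" "gam m ~= 0" using gam0 by blast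
  ultimately show False using gam(1) surj by blast
 qed
 have maximal: "W = W0 \<or> W = I.U" if W: "p.stab W" "W0 \<subseteq> W" for W
  using dich[OF W(1)]
 proof
  assume "psi ` W = {0}"
  hence "W \<subseteq> W0" using W(1) by (auto simp: W0_def p.stab_def)
  thus ?thesis using W(2) by blast
 next
  assume eq: "psi ` W = S"
  have Ws: "subsp W" "W \<subseteq> I.U" using W(1) by (auto simp: p.stab_def)
  have "u : W" if u: "u : I.U" for u
  proof -
   obtain w where w: "w : W" "psi u = psi w" using psi(2)[OF u] eq by (metis imageE)
   have "u - w : W0" using w u Ws(2) sub_diff[OF Usub] by (auto simp: W0_def clin_diff[OF psi(1)])
   thus ?thesis using W(2) w(1) sub_add[OF Ws(1), of "u - w" w] by auto
  qed
  thus ?thesis using Ws(2) by blast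
 qed
 define R where "R = I.pq ` W0"
 have pinj: "u = v" if "u : I.U" "v : I.U" "I.pq u = I.pq v" for u v
  using p.p_eq_iff[OF that(1,2)] that(3) pk by simp
 have Rs: "submod (gens n) Q1 R" unfolding R_def by (rule p.stab_submod[OF W0])
 have Rk: "{u \<in> I.U. I.pq u : R} = W0" using pinj unfolding R_def W0_def by blast
 interpret r: pres "gens n" I.U I.sg I.b "quot Q1 R" "%u. R +>\<^bsub>Q1\<^esub> I.pq u" by (rule p.quot_pres(1)[OF Rs])
 have rk: "r.ker = W0" using p.quot_pres(2)[OF Rs] Rk by simp
 have Rsimple: "simple (gens n) (quot Q1 R)"
  unfolding r.simple_iff rk using W0U maximal by blast
 have unique: "R' = R" if R': "submod (gens n) Q1 R' & simple (gens n) (quot Q1 R')" for R'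
 proof -
  define W where "W = {u \<in> I.U. I.pq u : R'}"
  note W = p.submod_stab[OF conjunct1[OF R'], folded W_def]
  interpret r': pres "gens n" I.U I.sg I.b "quot Q1 R'" "%u. R' +>\<^bsub>Q1\<^esub> I.pq u" by (rule p.quot_pres(1)[OF conjunct1[OF R']])
  have k: "r'.ker = W" using p.quot_pres(2)[OF conjunct1[OF R']] by (simp add: W_def)
  have m: "W ~= I.U" "!!X. p.stab X ==> W \<subseteq> X ==> X = W \<or> X = I.U"
   using conjunct2[OF R'] unfolding r'.simple_iff k by blast+
  let ?X = "{u + w | u w. u : W & w : W0}"
  have s: "subsp W" "W \<subseteq> I.U" "!!g v. g : gens n ==> v : W ==> I.b g v : W" "!!v. v : W ==> I.sg v : W"
   using W(1) by (auto simp: p.stab_def)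
  have s0: "W0 \<subseteq> I.U" "!!g v. g : gens n ==> v : W0 ==> I.b g v : W0" "!!v. v : W0 ==> I.sg v : W0"
   using W0 by (auto simp: p.stab_def)
  have X: "p.stab ?X"
   unfolding p.stab_def
  proof (intro conjI ballI cvec.subspace_sums s(1) W0s)
   show "?X \<subseteq> I.U" using s(2) s0(1) sub_add[OF Usub] by blast
   show "I.b g v : ?X" if "g : gens n" "v : ?X" for g v
    using that s(3) s0(2) by (auto simp: clin_add[OF I.clin_b]) blast
   show "I.sg v : ?X" if "v : ?X" for v using that s(4) s0(3) by (auto simp: clin_add[OF I.clin_sg]) blast
  qed
  have in1: "W \<subseteq> ?X" using sub_0[OF W0s] by (force intro: exI[of _ 0])
  have in2: "W0 \<subseteq> ?X" using sub_0[OF s(1)] by (force intro: exI[of _ 0])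
  have "?X ~= I.U" using D.proper_sum W(1) m(1) W0 W0U unfolding stab by blast
  hence "W0 \<subseteq> W" using m(2)[OF X in1] in2 by blast
  hence "W = W0" using maximal[OF W(1)] m(1) by blast
  thus "R' = R" using W(2) by (simp add: R_def)
 qed
 have L: "L_module lam mu N = quot Q1 R"
 proof -
  have "(THE R. submod (gens n) Q1 R & simple (gens n) (quot Q1 R)) = R"
   by (rule the_equality, rule conjI[OF Rs Rsimple], rule unique)
  thus ?thesis unfolding L_module_def simple_quotient_def Q1_def[symmetric] blens_def[symmetric] n_blens[symmetric] by simp
 qed
 define psi' where "psi' = (if t then (%u. sgo hpar (psi u)) else psi)"
 interpret HS: HC_ops n S hpar "hat_act lam mu" by (rule S_HC_ops)
 have "HC_supermodule n (quot Q1 R) & (\<exists>f. is_iso (gens n) t (quot Q1 R) (vmod S hpar (hat_act lam mu)) f)"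
 proof (rule r.transport[OF refl I.vact_rel S_HC_ops I.b_sg, where psi=psi'])
  show "clin psi'" unfolding psi'_def using psi(1) clin_comp[OF clin_sgo psi(1)] by simp
  show "psi' ` I.U = S"
  proof (cases t)
   case True
   have "sgo hpar ` S = S" using HS.sg_mem by (auto intro!: image_eqI[of _ "sgo hpar", OF sgo_sgo[symmetric]])
   thus ?thesis using surj True by (simp add: psi'_def image_image[symmetric])
  qed (simp add: psi'_def surj)
  show "psi' u = 0 \<longleftrightarrow> R +>\<^bsub>Q1\<^esub> I.pq u = \<zero>\<^bsub>quot Q1 R\<^esub>" if "u : I.U" for u
  proof -
   have "sgo hpar v = 0 \<longleftrightarrow> v = 0" for v using sgo_sgo[of hpar v] clin_0[OF clin_sgo] by metis
   hence "psi' u = 0 \<longleftrightarrow> u : W0" using that by (auto simp: psi'_def W0_def)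
   also have "\<dots> \<longleftrightarrow> u : r.ker" using rk by simp
   finally show ?thesis using that by (simp add: r.ker_def)
  qed
  show "psi' (I.b g u) = (if t & gpar g then - hat_act lam mu g (psi' u) else hat_act lam mu g (psi' u))" if "g : gens n" "u : I.U" for g u
   using psi(3)[OF that] HS.a_sg[OF that(1) psi(2)[OF that(2)]] by (simp add: psi'_def del: hat_act.simps)
  show "sgo hpar (psi' u) = (if t then - psi' (I.sg u) else psi' (I.sg u))" if "u : I.U" for u
  proof (cases t)
   case True
   have "sgo hpar (psi u) = - psi (I.sg u)" using psi(4)[OF that] True by simp
   hence "psi u = - sgo hpar (psi (I.sg u))" by (metis sgo_sgo clin_neg[OF clin_sgo])
   thus ?thesis using True by (simp add: psi'_def)
  qed (use psi(4)[OF that] in "simp add: psi'_def")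
 qed
 thus ?thesis unfolding HC_isomorphic_def L H_module_eq using HS.HC_supermodule by blast
qed

end

theorem corollary5p1p4:
  fixes lam mu :: "nat list" and d :: nat
    and N :: "rowb list vec smod" and L :: filling and K :: "hatb vec set"
  assumes "shifted_skew_shape lam mu"
    and "d = card (boxes lam mu)"
    and "is_Phi_product (segments lam mu) N"
    and "standard lam mu L"
    and "simple_submod (agens d) (hatH lam mu) K"
    and "K \<subseteq> Cl_v d L"
  shows "HC_isomorphic d (L_module lam mu N) (H_module lam mu K)"
proof -
  interpret skewK lam mu L K
    using assms by unfold_locales auto
  show ?thesis unfolding assms(2) by (rule L_module_iso_H_module) (use assms(3) in \<open>simp add: segs_def\<close>)
qed

end
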